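(* Let $M$ be a closed manifold with a filtration $0\subseteq\mathcal F^1\subseteq\cdots\subseteq\mathcal F^N=\mathcal X(M)$ by finitely generated $C^\infty(M,\mathbb R)$-modules of vector fields satisfying $[\mathcal F^i,\mathcal F^j]\subseteq\mathcal F^{i+j}$ for $i+j\le N$. If $x\in M$ and $\xi\in\mathcal T^*\mathcal F_x$, then the coadjoint orbit $Ad^*(\mathcal{G}r(\mathcal F)_x)\cdot\xi\subseteq\mathfrak{gr}(\mathcal F)_x^*$ has dimension $\le 2\dim(M)$.
   Context: $\mathcal X(M)$ is the module of vector fields on $M$, and $\mathcal F^0:=0$. For $x\in M$ let $I_x\subseteq C^\infty(M,\mathbb R)$ be the ideal of functions vanishing at $x$ and $\mathfrak{gr}(\mathcal F)_x=\bigoplus_{i=1}^N \mathcal F^i/(\mathcal F^{i-1}+I_x\mathcal F^i)$, a graded nilpotent Lie algebra with bracket $[[X]_x,[Y]_x]=[[X,Y]]_x$ (class in degree $i+j$) for $X\in\mathcal F^i$, $Y\in\mathcal F^j$ (zero if $i+j>N$). $\mathcal{G}r(\mathcal F)_x$ is the simply connected Lie group integrating it (same space, Baker–Campbell–Hausdorff product), and $Ad^*$ is its coadjoint action on $\mathfrak{gr}(\mathcal F)_x^*$. **Characteristic set.** Let $\mathfrak{gr}(\mathcal F)^*=\bigsqcup_{x\in M}\mathfrak{gr}(\mathcal F)_x^*$ and $\mathfrak a\mathcal F^*=T^*M\times\,]0,1]\ \sqcup\ \mathfrak{gr}(\mathcal F)^*\times\{0\}$, with the weakest topology such that the projection to $M\times[0,1]$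 is continuous and, for every $i\in\{1,\dots,N\}$ and $X\in\mathcal F^i$, the function $(\xi,x,t)\mapsto t^i\xi(X(x))$ for $t>0$, $(\xi,x,0)\mapsto \xi([X]_x)$ is continuous, where $[X]_x\in \mathcal F^i/(\mathcal F^{i-1}+I_x\mathcal F^i)\subseteq\mathfrak{gr}(\mathcal F)_x$. Define $\mathcal T^*\mathcal F=\{\xi\in\mathfrak{gr}(\mathcal F)^*:(\xi,0)\in\overline{T^*M\times\,]0,1]}\}$ and $\mathcal T^*\mathcal F_x=\mathcal T^*\mathcal F\cap\mathfrak{gr}(\mathcal F)_x^*$. *)

theory Defs
  imports "HOL-Analysis.Analysis" "HOL-Algebra.FiniteProduct"
begin

definition partial_deriv :: "nat \<Rightarrow> ((nat \<Rightarrow> real) \<Rightarrow> real) \<Rightarrow> (nat \<Rightarrow> real) \<Rightarrow> real" where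
  "partial_deriv i f x = deriv (\<lambda>t. f (x(i := t))) (x i)"

definition iterated_partial :: "nat list \<Rightarrow> ((nat \<Rightarrow> real) \<Rightarrow> real) \<Rightarrow> (nat \<Rightarrow> real) \<Rightarrow> real" where
  "iterated_partial is f = foldr partial_deriv is f"

text \<open>All partial derivatives of all orders exist and are continuous on the open set \<open>V\<close>.\<close>

definition smooth_on :: "nat \<Rightarrow> (nat \<Rightarrow> real) set \<Rightarrow> ((nat \<Rightarrow> real) \<Rightarrow> real) \<Rightarrow> bool" where
  "smooth_on n V f \<longleftrightarrow> openin (Euclidean_space n) V \<and>
     (\<forall>is. set is \<subseteq> {..<n} \<longrightarrow>
        continuous_map (subtopology (Euclidean_space n) V) euclideanreal (iterated_partial is f) \<and>
        (\<forall>i<n. \<forall>x\<in>V. (\<lambda>t. iterated_partial is f (x(i := t))) differentiable (at (x i))))"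

text \<open>The dimension is a natural number (possibly 0), and charts take values in
  \<open>Euclidean_space n\<close>. The atlas need not be maximal.\<close>

record 'a manifold =
  mtop :: "'a topology"
  mdim :: nat
  matlas :: "('a set \<times> ('a \<Rightarrow> nat \<Rightarrow> real)) set"

abbreviation mpoints :: "'a manifold \<Rightarrow> 'a set" where
  "mpoints M \<equiv> topspace (mtop M)"

definition smooth_manifold :: "'a manifold \<Rightarrow> bool" where
  "smooth_manifold M \<longleftrightarrow>
     Hausdorff_space (mtop M) \<and> second_countable (mtop M) \<and>
     (\<Union>(U, \<phi>)\<in>matlas M. U) = mpoints M \<and>
     (\<forall>(U, \<phi>)\<in>matlas M.
        openin (mtop M) U \<and> openin (Euclidean_space (mdim M)) (\<phi> ` U) \<and>
        homeomorphic_map (subtopology (mtop M) U)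
          (subtopology (Euclidean_space (mdim M)) (\<phi> ` U)) \<phi>) \<and>
     (\<forall>(U, \<phi>)\<in>matlas M. \<forall>(V, \<psi>)\<in>matlas M. \<forall>i<mdim M.
        smooth_on (mdim M) (\<phi> ` (U \<inter> V)) (\<lambda>y. \<psi> (inv_into U \<phi> y) i))"

definition closed_manifold :: "'a manifold \<Rightarrow> bool" where
  "closed_manifold M \<longleftrightarrow> smooth_manifold M \<and> compact_space (mtop M)"

text \<open>Functions on \<open>M\<close>, and linear maps defined on a space of functions, are made total by the
  value 0 outside their domain, so that equality of maps is equality on the domain.\<close>

definition C_infinity :: "'a manifold \<Rightarrow> ('a \<Rightarrow> real) set" where
  "C_infinity M = {f. (\<forall>p. p \<notin> mpoints M \<longrightarrow> f p = 0) \<and>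
     (\<forall>(U, \<phi>)\<in>matlas M. smooth_on (mdim M) (\<phi> ` U) (\<lambda>y. f (inv_into U \<phi> y)))}"

definition linear_functionals :: "('b \<Rightarrow> real) set \<Rightarrow> (('b \<Rightarrow> real) \<Rightarrow> real) set" where
  "linear_functionals S = {h. (\<forall>u. u \<notin> S \<longrightarrow> h u = 0) \<and>
     (\<forall>u\<in>S. \<forall>v\<in>S. \<forall>a b. h (\<lambda>z. a * u z + b * v z) = a * h u + b * h v)}"

text \<open>Tangent vectors at \<open>p\<close> are the derivations of the algebra of smooth functions at \<open>p\<close>.\<close>

definition tangent_space :: "'a manifold \<Rightarrow> 'a \<Rightarrow> (('a \<Rightarrow> real) \<Rightarrow> real) set" where
  "tangent_space M p = {v \<in> linear_functionals (C_infinity M).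
     \<forall>f\<in>C_infinity M. \<forall>g\<in>C_infinity M. v (\<lambda>q. f q * g q) = v f * g p + f p * v g}"

definition cotangent_space :: "'a manifold \<Rightarrow> 'a \<Rightarrow> ((('a \<Rightarrow> real) \<Rightarrow> real) \<Rightarrow> real) set" where
  "cotangent_space M p = linear_functionals (tangent_space M p)"

type_synonym 'a vfield = "('a \<Rightarrow> real) \<Rightarrow> 'a \<Rightarrow> real"

definition vf_at :: "'a vfield \<Rightarrow> 'a \<Rightarrow> ('a \<Rightarrow> real) \<Rightarrow> real" where
  "vf_at X p = (\<lambda>f. X f p)"

definition vector_fields :: "'a manifold \<Rightarrow> 'a vfield set" where
  "vector_fields M = {X. (\<forall>p\<in>mpoints M. vf_at X p \<in> tangent_space M p) \<and>
     (\<forall>f\<in>C_infinity M. X f \<in> C_infinity M) \<and>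
     (\<forall>f. f \<notin> C_infinity M \<longrightarrow> X f = (\<lambda>p. 0))}"

definition vf_zero :: "'a vfield" where
  "vf_zero = (\<lambda>f p. 0)"

definition vf_add :: "'a vfield \<Rightarrow> 'a vfield \<Rightarrow> 'a vfield" where
  "vf_add X Y = (\<lambda>f p. X f p + Y f p)"

definition vf_diff :: "'a vfield \<Rightarrow> 'a vfield \<Rightarrow> 'a vfield" where
  "vf_diff X Y = (\<lambda>f p. X f p - Y f p)"

definition vf_scale :: "real \<Rightarrow> 'a vfield \<Rightarrow> 'a vfield" where
  "vf_scale c X = (\<lambda>f p. c * X f p)"

definition vf_bracket :: "'a vfield \<Rightarrow> 'a vfield \<Rightarrow> 'a vfield" where
  "vf_bracket X Y = (\<lambda>f p. X (Y f) p - Y (X f) p)"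

definition finitely_generated_module :: "'a manifold \<Rightarrow> 'a vfield set \<Rightarrow> bool" where
  "finitely_generated_module M E \<longleftrightarrow> (\<exists>B. finite B \<and> B \<subseteq> vector_fields M \<and>
     E = {(\<lambda>f p. \<Sum>Z\<in>B. g Z p * Z f p) | g. \<forall>Z\<in>B. g Z \<in> C_infinity M})"

definition filtration :: "'a manifold \<Rightarrow> nat \<Rightarrow> (nat \<Rightarrow> 'a vfield set) \<Rightarrow> bool" where
  "filtration M N F \<longleftrightarrow> 1 \<le> N \<and> F 0 = {vf_zero} \<and> F N = vector_fields M \<and>
     (\<forall>i\<in>{1..N}. finitely_generated_module M (F i)) \<and>
     (\<forall>i<N. F i \<subseteq> F (Suc i)) \<and>
     (\<forall>i\<ge>1. \<forall>j\<ge>1. i + j \<le> N \<longrightarrow> (\<forall>X\<in>F i. \<forall>Y\<in>F j. vf_bracket X Y \<in> F (i + j)))"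

record 'v lie_algebra = "'v partial_object" +
  lzero :: 'v
  ladd :: "'v \<Rightarrow> 'v \<Rightarrow> 'v"
  lscale :: "real \<Rightarrow> 'v \<Rightarrow> 'v"
  lbracket :: "'v \<Rightarrow> 'v \<Rightarrow> 'v"

definition lsum :: "'v lie_algebra \<Rightarrow> ('i \<Rightarrow> 'v) \<Rightarrow> 'i set \<Rightarrow> 'v" where
  "lsum L = finprod \<lparr>carrier = carrier L, mult = ladd L, one = lzero L\<rparr>"

definition lie_dual :: "'v lie_algebra \<Rightarrow> ('v \<Rightarrow> real) set" where
  "lie_dual L = {\<xi>. (\<forall>u. u \<notin> carrier L \<longrightarrow> \<xi> u = 0) \<and>
     (\<forall>u\<in>carrier L. \<forall>v\<in>carrier L. \<forall>a b.
        \<xi> (ladd L (lscale L a u) (lscale L b v)) = a * \<xi> u + b * \<xi> v)}"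

text \<open>Right-nested brackets \<open>[w\<^sub>1,[w\<^sub>2,\<dots>,[w\<^sub>m\<^sub>-\<^sub>1,w\<^sub>m]]]\<close>; the value on the empty word is
  never used.\<close>

fun nested_bracket :: "'v lie_algebra \<Rightarrow> 'v list \<Rightarrow> 'v" where
  "nested_bracket L [] = lzero L"
| "nested_bracket L [v] = v"
| "nested_bracket L (v # w) = lbracket L v (nested_bracket L w)"

text \<open>The Baker-Campbell-Hausdorff product in Dynkin's form
  \<open>\<Sum> (-1)\<^sup>n\<^sup>-\<^sup>1/n \<cdot> [x\<^bsup>r1\<^esup> y\<^bsup>s1\<^esup> \<dots> x\<^bsup>rn\<^esup> y\<^bsup>sn\<^esup>] / (\<Sum>(r\<^sub>i + s\<^sub>i) \<cdot> \<Prod> r\<^sub>i! s\<^sub>i!)\<close>,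
  the sum being over all nonempty lists of pairs \<open>(r\<^sub>i, s\<^sub>i) \<noteq> (0, 0)\<close>. In a Lie algebra in which
  all brackets of more than \<open>N\<close> elements vanish only the terms of total degree at most \<open>N\<close>
  contribute.\<close>

definition dynkin_indices :: "nat \<Rightarrow> (nat \<times> nat) list set" where
  "dynkin_indices N = {ps. ps \<noteq> [] \<and> (\<forall>(r, s)\<in>set ps. 0 < r + s) \<and>
     (\<Sum>(r, s)\<leftarrow>ps. r + s) \<le> N}"

definition dynkin_coeff :: "(nat \<times> nat) list \<Rightarrow> real" where
  "dynkin_coeff ps = (-1) ^ (length ps - 1) / real (length ps) /
     (real (\<Sum>(r, s)\<leftarrow>ps. r + s) * (\<Prod>(r, s)\<leftarrow>ps. fact r * fact s))"

definition dynkin_word :: "'v \<Rightarrow> 'v \<Rightarrow> (nat \<times> nat) list \<Rightarrow> 'v list" where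
  "dynkin_word x y ps = concat (map (\<lambda>(r, s). replicate r x @ replicate s y) ps)"

definition bch :: "'v lie_algebra \<Rightarrow> nat \<Rightarrow> 'v \<Rightarrow> 'v \<Rightarrow> 'v" where
  "bch L N x y = lsum L
     (\<lambda>ps. lscale L (dynkin_coeff ps) (nested_bracket L (dynkin_word x y ps))) (dynkin_indices N)"

definition bch_group :: "'v lie_algebra \<Rightarrow> nat \<Rightarrow> 'v monoid" where
  "bch_group L N = \<lparr>carrier = carrier L, mult = bch L N, one = lzero L\<rparr>"

text \<open>The coadjoint action is \<open>Ad\<^sup>* g \<xi> = \<xi> \<circ> Ad (g\<^sup>-\<^sup>1)\<close>, where \<open>Ad (g\<^sup>-\<^sup>1) Y\<close> is the velocity at
  \<open>t = 0\<close> of the curve \<open>g\<^sup>-\<^sup>1 (t Y) g\<close>; here \<open>t Y\<close> is the one-parameter subgroup of \<open>Y\<close>, as the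
  exponential map of the group is the identity. By linearity \<open>\<xi>\<close> may be applied before
  differentiating.\<close>

definition coadjoint :: "'v lie_algebra \<Rightarrow> nat \<Rightarrow> 'v \<Rightarrow> ('v \<Rightarrow> real) \<Rightarrow> 'v \<Rightarrow> real" where
  "coadjoint L N g \<xi> = (\<lambda>Y. if Y \<in> carrier L
     then deriv (\<lambda>t. \<xi> ((m_inv (bch_group L N) g \<otimes>\<^bsub>bch_group L N\<^esub> lscale L t Y)
                          \<otimes>\<^bsub>bch_group L N\<^esub> g)) 0
     else 0)"

definition coadjoint_orbit :: "'v lie_algebra \<Rightarrow> nat \<Rightarrow> ('v \<Rightarrow> real) \<Rightarrow> ('v \<Rightarrow> real) set" where
  "coadjoint_orbit L N \<xi> = (\<lambda>g. coadjoint L N g \<xi>) ` carrier (bch_group L N)"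

text \<open>\<open>S\<close> carries the structure of a (second countable) smooth \<open>k\<close>-manifold whose inclusion into
  the dual of the finite-dimensional Lie algebra \<open>L\<close> is an immersion: read in a chart, the inclusion
  has smooth coordinates \<open>\<xi> \<mapsto> \<xi> Y\<close>, and its \<open>k\<close> partial derivatives are linearly independent.
  By second countability, \<open>k\<close> is determined by \<open>S\<close> when \<open>S\<close> is nonempty.\<close>

definition immersed_submanifold :: "'v lie_algebra \<Rightarrow> ('v \<Rightarrow> real) set \<Rightarrow> nat \<Rightarrow> bool" where
  "immersed_submanifold L S k \<longleftrightarrow> S \<subseteq> lie_dual L \<and>
     (\<exists>Q. smooth_manifold Q \<and> mpoints Q = S \<and> mdim Q = k \<and>
       (\<forall>(U, \<phi>)\<in>matlas Q.
          (\<forall>Y\<in>carrier L. smooth_on k (\<phi> ` U) (\<lambda>y. inv_into U \<phi> y Y)) \<and>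
          (\<forall>y\<in>\<phi> ` U. \<forall>c.
             (\<forall>Y\<in>carrier L. (\<Sum>i<k. c i * partial_deriv i (\<lambda>z. inv_into U \<phi> z Y) y) = 0)
             \<longrightarrow> (\<forall>i<k. c i = 0))))"

definition vanishing_ideal :: "'a manifold \<Rightarrow> 'a \<Rightarrow> ('a \<Rightarrow> real) set" where
  "vanishing_ideal M x = {f \<in> C_infinity M. f x = 0}"

definition ideal_times_module :: "('a \<Rightarrow> real) set \<Rightarrow> 'a vfield set \<Rightarrow> 'a vfield set" where
  "ideal_times_module I E = {(\<lambda>f p. \<Sum>k<m. g k p * Z k f p) | (m :: nat) g Z.
     \<forall>k<m. g k \<in> I \<and> Z k \<in> E}"

definition gr_denominator ::
  "'a manifold \<Rightarrow> (nat \<Rightarrow> 'a vfield set) \<Rightarrow> 'a \<Rightarrow> nat \<Rightarrow> 'a vfield set" where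
  "gr_denominator M F x i =
     {vf_add Y Z | Y Z. Y \<in> F (i - 1) \<and> Z \<in> ideal_times_module (vanishing_ideal M x) (F i)}"

definition gr_coset ::
  "'a manifold \<Rightarrow> (nat \<Rightarrow> 'a vfield set) \<Rightarrow> 'a \<Rightarrow> nat \<Rightarrow> 'a vfield \<Rightarrow> 'a vfield set" where
  "gr_coset M F x i X = {Y \<in> F i. vf_diff Y X \<in> gr_denominator M F x i}"

text \<open>An element of the direct sum is a family of cosets indexed by \<open>{1..N}\<close>. The operations are
  defined through representatives: each union below is over sets that all coincide, as the coset
  does not depend on the representatives. The degree \<open>k\<close> part of the bracket is the sum of the
  \<open>[X\<^sub>i, Y\<^sub>j]\<close> with \<open>i + j = k\<close>.\<close>

type_synonym 'a gr_vector = "nat \<Rightarrow> 'a vfield set"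

definition gr_lie ::
  "'a manifold \<Rightarrow> nat \<Rightarrow> (nat \<Rightarrow> 'a vfield set) \<Rightarrow> 'a \<Rightarrow> 'a gr_vector lie_algebra" where
  "gr_lie M N F x = \<lparr>
     carrier = PiE {1..N} (\<lambda>i. gr_coset M F x i ` F i),
     lzero = (\<lambda>i\<in>{1..N}. gr_coset M F x i vf_zero),
     ladd = (\<lambda>u v. \<lambda>i\<in>{1..N}. \<Union>X\<in>u i. \<Union>Y\<in>v i. gr_coset M F x i (vf_add X Y)),
     lscale = (\<lambda>c u. \<lambda>i\<in>{1..N}. \<Union>X\<in>u i. gr_coset M F x i (vf_scale c X)),
     lbracket = (\<lambda>u v. \<lambda>k\<in>{1..N}. \<Union>X\<in>Pi {1..N} u. \<Union>Y\<in>Pi {1..N} v.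
        gr_coset M F x k (\<lambda>f p. \<Sum>i\<in>{1..<k}. vf_bracket (X i) (Y (k - i)) f p))\<rparr>"

definition gr_class ::
  "'a manifold \<Rightarrow> nat \<Rightarrow> (nat \<Rightarrow> 'a vfield set) \<Rightarrow> 'a \<Rightarrow> nat \<Rightarrow> 'a vfield \<Rightarrow> 'a gr_vector" where
  "gr_class M N F x i X =
     (\<lambda>k\<in>{1..N}. gr_coset M F x k (if k = i then X else vf_zero))"

text \<open>\<open>Cotangent x \<xi> t\<close> is the point \<open>(\<xi>, x, t)\<close> with \<open>t > 0\<close>, and \<open>Graded x \<xi>\<close> the point
  \<open>(\<xi>, x, 0)\<close>.\<close>

datatype 'a adiabatic_point =
    Cotangent 'a "(('a \<Rightarrow> real) \<Rightarrow> real) \<Rightarrow> real" real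
  | Graded 'a "'a gr_vector \<Rightarrow> real"

definition cotangent_part :: "'a manifold \<Rightarrow> 'a adiabatic_point set" where
  "cotangent_part M =
     {Cotangent x \<xi> t | x \<xi> t. x \<in> mpoints M \<and> \<xi> \<in> cotangent_space M x \<and> t \<in> {0<..1}}"

definition graded_part ::
  "'a manifold \<Rightarrow> nat \<Rightarrow> (nat \<Rightarrow> 'a vfield set) \<Rightarrow> 'a adiabatic_point set" where
  "graded_part M N F =
     {Graded x \<xi> | x \<xi>. x \<in> mpoints M \<and> \<xi> \<in> lie_dual (gr_lie M N F x)}"

fun base_projection :: "'a adiabatic_point \<Rightarrow> 'a \<times> real" where
  "base_projection (Cotangent x \<xi> t) = (x, t)"
| "base_projection (Graded x \<xi>) = (x, 0)"

fun evaluation :: "'a manifold \<Rightarrow> nat \<Rightarrow> (nat \<Rightarrow> 'a vfield set) \<Rightarrow> nat \<Rightarrow> 'a vfield \<Rightarrow>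
    'a adiabatic_point \<Rightarrow> real" where
  "evaluation M N F i X (Cotangent x \<xi> t) = t ^ i * \<xi> (vf_at X x)"
| "evaluation M N F i X (Graded x \<xi>) = \<xi> (gr_class M N F x i X)"

definition adiabatic_topology ::
  "'a manifold \<Rightarrow> nat \<Rightarrow> (nat \<Rightarrow> 'a vfield set) \<Rightarrow> 'a adiabatic_point topology" where
  "adiabatic_topology M N F = (let A = cotangent_part M \<union> graded_part M N F in
     topology_generated_by
       ({{z \<in> A. base_projection z \<in> W} | W.
           openin (prod_topology (mtop M) (top_of_set {0..1})) W} \<union>
        {{z \<in> A. evaluation M N F i X z \<in> W} | i X W.
           i \<in> {1..N} \<and> X \<in> F i \<and> open W}))"

definition characteristic_set ::
  "'a manifold \<Rightarrow> nat \<Rightarrow> (nat \<Rightarrow> 'a vfield set) \<Rightarrow> 'a \<Rightarrow> ('a gr_vector \<Rightarrow> real) set" where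
  "characteristic_set M N F x = {\<xi> \<in> lie_dual (gr_lie M N F x).
     Graded x \<xi> \<in> adiabatic_topology M N F closure_of cotangent_part M}"

end

theory Submission
  imports Defs "HOL-Library.Function_Algebras" "HOL-Computational_Algebra.Formal_Power_Series"
    "HOL-Computational_Algebra.Polynomial"
begin

text \<open>For a covector \<open>\<eta>\<close> at \<open>p\<close> the form \<open>(X, Y) \<mapsto> \<eta> ([X, Y] p)\<close> vanishes whenever \<open>X\<close> and \<open>Y\<close>
  both vanish at \<open>p\<close>, so its rank is at most twice the dimension of \<open>M\<close>. A characteristic \<open>\<xi>\<close> is a
  limit of such covectors, evaluated on the dilated fields \<open>\<Sum> t\<^sup>i X\<^sub>i\<close>. As nonsingularity of a matrix
  is an open condition, the form \<open>\<xi> [u, v]\<close> on the graded Lie algebra has no larger rank, and this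
  rank is the dimension of the tangent space of the orbit at \<open>\<xi>\<close>.

  That the orbit is an immersed submanifold is seen in a faithful nilpotent representation: there the
  Dynkin series becomes the product of exponentials, and in a basis adapted to the grading the
  coadjoint action is unitriangular and polynomial along one-parameter subgroups. Orbits of such
  actions have a global polynomial chart.\<close>

text \<open>This is an identity between truncated sums. Products of more than \<open>N\<close>
  represented elements vanish; ad a is a difference of two commuting multiplications, so its powers
  vanish from \<open>2 * N + 1\<close> on, and the derivative of exp, which divides by ad a, costs
  one term more: hence \<open>2 * N + 2\<close>.

  At t > 0 the form pairs dilated fields in all degrees, while the graded bracket drops degrees
  above \<open>N\<close>. The surplus brackets lie in \<open>F N\<close>, so t^N times their values
  stays bounded near \<xi>, and the remaining power of t removes them in the limit.

  Of the 2 dim M conditions behind the rank bound, half make a combination of fields vanish at the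
  point; the others make it pair to zero with fields whose values span the remaining values there.
  That a field annihilating dim M suitable functions at a point vanishes there rests on Hadamard's
  lemma, since tangent vectors are abstract derivations.\<close>

unbundle no vec_syntax
unbundle fps_syntax

section \<open>Functions of finite smoothness on Euclidean space\<close>

abbreviation (input) ESp :: "nat \<Rightarrow> (nat \<Rightarrow> real) set" where
  "ESp n \<equiv> {x. \<forall>i\<ge>n. x i = 0}"

lemma Euclidean_space_top: "Euclidean_space n = top_of_set (ESp n)"
  by (simp add: Euclidean_space_def euclidean_product_topology)

text \<open>Recursion on the order of differentiability, instead of words of partial derivatives,
  turns the sum, product and chain rules into one-step inductions. The innermost derivative is
  peeled off first, which is why words are split at their end.\<close>

primrec ck :: "nat \<Rightarrow> (nat \<Rightarrow> real) set \<Rightarrow> nat \<Rightarrow> ((nat \<Rightarrow> real) \<Rightarrow> real) \<Rightarrow> bool" where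
  "ck n V 0 f \<longleftrightarrow> continuous_on V f"
| "ck n V (Suc k) f \<longleftrightarrow> continuous_on V f \<and>
     (\<forall>i<n. \<forall>x\<in>V. (\<lambda>t. f (x(i := t))) differentiable (at (x i))) \<and>
     (\<forall>i<n. ck n V k (partial_deriv i f))"

lemma ck_continuous: "ck n V k f \<Longrightarrow> continuous_on V f"
  by (cases k) auto

lemma ck_mono: "ck n V (Suc k) f \<Longrightarrow> ck n V k f"
  by (induction k arbitrary: f) auto

lemma ck_subset: "ck n V k f \<Longrightarrow> W \<subseteq> V \<Longrightarrow> ck n W k f"
  by (induction k arbitrary: f) (auto intro: continuous_on_subset)

lemma iterated_partial_snoc: "iterated_partial (is @ [i]) f = iterated_partial is (partial_deriv i f)"
  by (simp add: iterated_partial_def)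

lemma iterated_partial_Nil: "iterated_partial [] f = f"
  by (simp add: iterated_partial_def)

lemma continuous_map_Euclidean_subspace:
  assumes "openin (Euclidean_space n) V"
  shows "continuous_map (subtopology (Euclidean_space n) V) euclideanreal f \<longleftrightarrow> continuous_on V f"
proof -
  have "V \<subseteq> ESp n"
    using openin_subset[OF assms] by (simp add: topspace_Euclidean_space)
  then have "subtopology (Euclidean_space n) V = top_of_set V"
    by (simp add: Euclidean_space_top subtopology_subtopology Int_absorb1)
  then show ?thesis by simp
qed

lemma smooth_on_iff_ck: "smooth_on n V f \<longleftrightarrow> openin (Euclidean_space n) V \<and> (\<forall>k. ck n V k f)"
proof (intro iffI conjI allI)
  fix k assume "smooth_on n V f"
  then show "ck n V k f"
  proof (induction k arbitrary: f)
    case 0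
    then have "continuous_map (subtopology (Euclidean_space n) V) euclideanreal (iterated_partial [] f)"
      "openin (Euclidean_space n) V" unfolding smooth_on_def by auto
    then show ?case using continuous_map_Euclidean_subspace by (simp add: iterated_partial_Nil)
  next
    case (Suc k)
    have o: "openin (Euclidean_space n) V" using Suc by (simp add: smooth_on_def)
    have 1: "set is \<subseteq> {..<n} \<Longrightarrow> continuous_on V (iterated_partial is f)"
       "set is \<subseteq> {..<n} \<Longrightarrow> i < n \<Longrightarrow> x \<in> V \<Longrightarrow> (\<lambda>t. iterated_partial is f (x(i := t))) differentiable (at (x i))"
      for "is" i x
      using Suc.prems o continuous_map_Euclidean_subspace unfolding smooth_on_def by auto
    have "smooth_on n V (partial_deriv i f)" if "i < n" for i
      unfolding smooth_on_def
    proof (intro conjI allI impI ballI o)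
      fix "is" j x assume "is": "set is \<subseteq> {..<n}"
      then have s: "set (is @ [i]) \<subseteq> {..<n}" using that by auto
      show "continuous_map (subtopology (Euclidean_space n) V) euclideanreal (iterated_partial is (partial_deriv i f))"
        using 1(1)[OF s] unfolding continuous_map_Euclidean_subspace[OF o] iterated_partial_snoc .
      assume "j < n" "x \<in> V"
      from 1(2)[OF s this] show "(\<lambda>t. iterated_partial is (partial_deriv i f) (x(j := t))) differentiable (at (x j))"
        unfolding iterated_partial_snoc .
    qed
    then have "\<forall>i<n. ck n V k (partial_deriv i f)" using Suc.IH by blast
    moreover have "continuous_on V f" using 1(1)[of "[]"] by (simp add: iterated_partial_Nil)
    moreover have "\<forall>i<n. \<forall>x\<in>V. (\<lambda>t. f (x(i := t))) differentiable (at (x i))"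
      using 1(2)[of "[]"] unfolding iterated_partial_Nil by simp
    ultimately show ?case unfolding ck.simps by blast
  qed
next
  assume *: "openin (Euclidean_space n) V \<and> (\<forall>k. ck n V k f)"
  have "continuous_on V (iterated_partial is f) \<and>
        (\<forall>i<n. \<forall>x\<in>V. (\<lambda>t. iterated_partial is f (x(i := t))) differentiable (at (x i)))"
    if "set is \<subseteq> {..<n}" "\<forall>k. ck n V k f" for "is"
    using that
  proof (induction "is" arbitrary: f rule: rev_induct)
    case Nil
    have "ck n V (Suc 0) f" using Nil(2) by blast
    then show ?case unfolding iterated_partial_Nil ck.simps by blast
  next
    case (snoc i "is")
    have "ck n V k (partial_deriv i f)" for k
      using snoc(2) spec[OF snoc(3), of "Suc k"] by auto
    then show ?case unfolding iterated_partial_snoc using snoc by auto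
  qed
  then show "smooth_on n V f" unfolding smooth_on_def
    using * continuous_map_Euclidean_subspace by auto
qed (simp add: smooth_on_def)

section \<open>Partial derivatives on open sets and closure of \<open>ck\<close> under
  arithmetic\<close>

lemma continuous_on_update: "continuous_on UNIV (\<lambda>t::real. (x::nat \<Rightarrow> real)(i := t))"
proof (rule continuous_on_coordinatewise_then_product)
  fix j show "continuous_on UNIV (\<lambda>t. (x(i := t)) j)"
    by (cases "j = i") auto
qed

lemma eventually_update:
  assumes V: "openin (Euclidean_space n) V" and x: "x \<in> V" and i: "i < n"
  shows "eventually (\<lambda>t. x(i := t) \<in> V) (nhds (x i))"
proof -
  obtain U where U: "open U" "V = ESp n \<inter> U"
    using V unfolding Euclidean_space_top openin_open by auto
  have "open ((\<lambda>t. x(i := t)) -` U)"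
    using continuous_on_update U(1) by (simp add: continuous_on_open_vimage)
  moreover have "x i \<in> (\<lambda>t. x(i := t)) -` U" using x U by simp
  ultimately have "eventually (\<lambda>t. x(i := t) \<in> U) (nhds (x i))"
    unfolding eventually_nhds by blast
  moreover have "x(i := t) \<in> ESp n" for t using x U i by auto
  ultimately show ?thesis unfolding U(2) by simp
qed

lemma partial_deriv_eqI:
  assumes "((\<lambda>t. f (x(i := t))) has_field_derivative D) (at (x i))"
  shows "partial_deriv i f x = D"
  unfolding partial_deriv_def using assms by (rule DERIV_imp_deriv)

lemma partial_deriv_works:
  assumes "(\<lambda>t. f (x(i := t))) differentiable (at (x i))"
  shows "((\<lambda>t. f (x(i := t))) has_field_derivative partial_deriv i f x) (at (x i))"
  unfolding partial_deriv_def using assms DERIV_deriv_iff_real_differentiable by blast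

lemma ck_partial:
  assumes "ck n V (Suc k) f" "i < n" "x \<in> V"
  shows "((\<lambda>t. f (x(i := t))) has_field_derivative partial_deriv i f x) (at (x i))"
  using assms by (intro partial_deriv_works) auto

text \<open>A short coordinate segment through a point of the open set \<open>V\<close> remains in
  \<open>V\<close>, so agreement on \<open>V\<close> passes to the partial derivatives
  there.\<close>

lemma ck_cong:
  assumes V: "openin (Euclidean_space n) V"
  shows "ck n V k f \<Longrightarrow> (\<And>x. x \<in> V \<Longrightarrow> f x = g x) \<Longrightarrow> ck n V k g"
proof (induction k arbitrary: f g)
  case 0
  then show ?case by (simp cong: continuous_on_cong)
next
  case (Suc k)
  have d: "((\<lambda>t. g (x(i := t))) has_field_derivative partial_deriv i f x) (at (x i))"
    if "i < n" "x \<in> V" for i x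
  proof -
    have "eventually (\<lambda>t. f (x(i := t)) = g (x(i := t))) (nhds (x i))"
      using eventually_update[OF V that(2,1)] by eventually_elim (use Suc in auto)
    from DERIV_cong_ev[OF refl this refl] show ?thesis
      using ck_partial[OF Suc.prems(1) that] by (rule iffD1)
  qed
  have "ck n V k (partial_deriv i g)" if "i < n" for i
  proof (rule Suc.IH)
    show "ck n V k (partial_deriv i f)" using Suc.prems(1) that by auto
    show "partial_deriv i f x = partial_deriv i g x" if "x \<in> V" for x
      using partial_deriv_eqI[of g x i] d[OF \<open>i < n\<close> that] by simp
  qed
  moreover have "continuous_on V g" using ck_continuous[OF Suc.prems(1)] Suc.prems(2)
    by (simp cong: continuous_on_cong)
  moreover have "(\<lambda>t. g (x(i := t))) differentiable (at (x i))" if "i < n" "x \<in> V" for i x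
    using d[OF that] real_differentiable_def by blast
  ultimately show ?case by auto
qed

lemma ck_SucI:
  assumes V: "openin (Euclidean_space n) V" and "continuous_on V f"
    and "\<And>i x. i < n \<Longrightarrow> x \<in> V \<Longrightarrow> ((\<lambda>t. f (x(i := t))) has_field_derivative f' i x) (at (x i))"
    and "\<And>i. i < n \<Longrightarrow> ck n V k (f' i)"
  shows "ck n V (Suc k) f"
proof -
  have "ck n V k (partial_deriv i f)" if "i < n" for i
    using assms(4)[OF that] by (rule ck_cong[OF V]) (use assms(3) that partial_deriv_eqI in force)
  then show ?thesis using assms by (auto simp: real_differentiable_def)
qed

lemma ck_const: "openin (Euclidean_space n) V \<Longrightarrow> ck n V k (\<lambda>x. c)"
proof (induction k arbitrary: c)
  case (Suc k)
  then show ?case by (intro ck_SucI[where f' = "\<lambda>_ _. 0"]) auto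
qed simp

lemma ck_coord: "openin (Euclidean_space n) V \<Longrightarrow> ck n V k (\<lambda>x. x j)"
proof (induction k)
  case 0 then show ?case by (auto intro: continuous_on_product_coordinates continuous_on_subset)
next
  case (Suc k)
  show ?case
  proof (rule ck_SucI[OF Suc(2), where f' = "\<lambda>i _. if i = j then 1 else 0"])
    show "continuous_on V (\<lambda>x. x j)"
      by (auto intro: continuous_on_product_coordinates continuous_on_subset)
    show "((\<lambda>t. (x(i := t)) j) has_field_derivative (if i = j then 1 else 0)) (at (x i))" for i x
      by (cases "i = j") auto
    show "ck n V k (\<lambda>_. if i = j then 1 else 0)" for i using ck_const[OF Suc(2)] .
  qed
qed

lemma ck_add:
  assumes V: "openin (Euclidean_space n) V"
  shows "ck n V k f \<Longrightarrow> ck n V k g \<Longrightarrow> ck n V k (\<lambda>x. f x + g x)"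
proof (induction k arbitrary: f g)
  case 0 then show ?case by (auto intro: continuous_intros)
next
  case (Suc k)
  show ?case
  proof (rule ck_SucI[OF V, where f' = "\<lambda>i x. partial_deriv i f x + partial_deriv i g x"])
    show "continuous_on V (\<lambda>x. f x + g x)" using Suc.prems by (auto intro: continuous_intros)
    show "((\<lambda>t. f (x(i := t)) + g (x(i := t))) has_field_derivative partial_deriv i f x + partial_deriv i g x) (at (x i))"
      if "i < n" "x \<in> V" for i x
      by (intro DERIV_add ck_partial[OF Suc.prems(1) that] ck_partial[OF Suc.prems(2) that])
    show "ck n V k (\<lambda>x. partial_deriv i f x + partial_deriv i g x)" if "i < n" for i
      using Suc that by auto
  qed
qed

lemma ck_mult:
  assumes V: "openin (Euclidean_space n) V"
  shows "ck n V k f \<Longrightarrow> ck n V k g \<Longrightarrow> ck n V k (\<lambda>x. f x * g x)"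
proof (induction k arbitrary: f g)
  case 0 then show ?case by (auto intro: continuous_intros)
next
  case (Suc k)
  show ?case
  proof (rule ck_SucI[OF V, where f' = "\<lambda>i x. partial_deriv i f x * g x + partial_deriv i g x * f x"])
    show "continuous_on V (\<lambda>x. f x * g x)" using Suc.prems by (auto intro: continuous_intros)
    show "((\<lambda>t. f (x(i := t)) * g (x(i := t))) has_field_derivative partial_deriv i f x * g x + partial_deriv i g x * f x) (at (x i))"
      if "i < n" "x \<in> V" for i x
      using DERIV_mult[OF ck_partial[OF Suc.prems(1) that] ck_partial[OF Suc.prems(2) that]]
      unfolding fun_upd_triv .
    show "ck n V k (\<lambda>x. partial_deriv i f x * g x + partial_deriv i g x * f x)" if "i < n" for i
      using Suc that ck_mono[OF Suc.prems(1)] ck_mono[OF Suc.prems(2)] by (auto intro!: ck_add[OF V])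
  qed
qed

lemma ck_sum:
  assumes "openin (Euclidean_space n) V"
  shows "(\<And>i. i \<in> I \<Longrightarrow> ck n V k (f i)) \<Longrightarrow> ck n V k (\<lambda>x. \<Sum>i\<in>I. f i x)"
  by (induction I rule: infinite_finite_induct) (auto intro: ck_const[OF assms] ck_add[OF assms])

lemma ck_prod:
  assumes "openin (Euclidean_space n) V"
  shows "(\<And>i. i \<in> I \<Longrightarrow> ck n V k (f i)) \<Longrightarrow> ck n V k (\<lambda>x. \<Prod>i\<in>I. f i x)"
  by (induction I rule: infinite_finite_induct) (auto intro: ck_const[OF assms] ck_mult[OF assms])

lemma ck_diff:
  assumes "openin (Euclidean_space n) V" "ck n V k f" "ck n V k g"
  shows "ck n V k (\<lambda>x. f x - g x)"
  using ck_add[OF assms(1,2) ck_mult[OF assms(1) ck_const[OF assms(1), of _ "-1"] assms(3)]] by simp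

lemma ck_poly:
  assumes V: "openin (Euclidean_space n) V" and f: "ck n V k f"
  shows "ck n V k (\<lambda>x. poly p (f x))"
proof (induction p)
  case (pCons a p)
  then show ?case unfolding poly_pCons by (intro ck_add[OF V] ck_const[OF V] ck_mult[OF V] f)
qed (simp add: ck_const[OF V])

lemma ck_Un:
  assumes "openin (Euclidean_space n) V" "openin (Euclidean_space n) W"
  shows "ck n V k f \<Longrightarrow> ck n W k f \<Longrightarrow> ck n (V \<union> W) k f"
proof (induction k arbitrary: f)
  have c: "continuous_on (V \<union> W) f" if "continuous_on V f" "continuous_on W f" for f
  proof (rule continuous_on_Un_local_open)
    have "V \<union> W \<subseteq> ESp n"
      using assms openin_subset unfolding Euclidean_space_top by fastforce
    then show "openin (top_of_set (V \<union> W)) V" "openin (top_of_set (V \<union> W)) W"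
      using assms unfolding Euclidean_space_top by (auto intro: openin_subset_trans)
  qed fact+
  {
    case 0
    then show ?case using c by simp
  next
    case (Suc k)
    then show ?case using c by auto
  }
qed

text \<open>Points of \<open>ESp n\<close> differ only in their first \<open>n\<close> coordinates,
  so a basic open set of the infinite product contains a sup-norm ball in them.\<close>

lemma open_box:
  assumes V: "openin (Euclidean_space n) V" and p: "p \<in> V"
  shows "\<exists>d>0. \<forall>y\<in>ESp n. (\<forall>i<n. \<bar>y i - p i\<bar> < d) \<longrightarrow> y \<in> V"
proof -
  obtain U where U: "open U" "V = ESp n \<inter> U"
    using V unfolding Euclidean_space_top openin_open by auto
  have pU: "p \<in> U" and pE: "p \<in> ESp n" using p U by auto
  have "openin (product_topology (\<lambda>i. euclidean) UNIV) U"
    unfolding euclidean_product_topology open_openin[symmetric] by (rule U(1))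
  from product_topology_open_contains_basis[OF this pU]
  have "\<exists>X. p \<in> PiE UNIV X \<and> (\<forall>i. open (X i)) \<and> finite {i. X i \<noteq> UNIV} \<and> PiE UNIV X \<subseteq> U"
    by simp
  then obtain X where X: "p \<in> PiE UNIV X" "\<And>i. open (X i)" "PiE UNIV X \<subseteq> U" by blast
  have "\<forall>i. \<exists>d>0. \<forall>t. \<bar>t - p i\<bar> < d \<longrightarrow> t \<in> X i"
  proof
    fix i
    have "p i \<in> X i" using X(1) by auto
    then show "\<exists>d>0. \<forall>t. \<bar>t - p i\<bar> < d \<longrightarrow> t \<in> X i"
      using X(2)[of i] by (auto simp: open_dist dist_real_def)
  qed
  then obtain d where d: "\<And>i. d i > 0" "\<And>i t. \<bar>t - p i\<bar> < d i \<Longrightarrow> t \<in> X i" by metis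
  define m where "m = Min (insert 1 (d ` {..<n}))"
  have m: "m > 0" "\<And>i. i < n \<Longrightarrow> m \<le> d i" unfolding m_def using d by (auto simp: Min_gr_iff)
  show ?thesis
  proof (intro exI[of _ m] conjI ballI impI)
    fix y assume y: "y \<in> ESp n" "\<forall>i<n. \<bar>y i - p i\<bar> < m"
    have "y i \<in> X i" for i
    proof (cases "i < n")
      case True then show ?thesis using d(2) y(2) m(2) by force
    next
      case False
      then have "y i = p i" using y(1) pE by simp
      then show ?thesis using X(1) by auto
    qed
    then show "y \<in> V" using X(3) U(2) y(1) by auto
  qed (rule m)
qed

text \<open>The intermediate point is located only by its distance from \<open>a\<close>, which
  treats both orders of the end points, and their equality, alike.\<close>

lemma mean_value_segment:
  fixes f :: "real \<Rightarrow> real"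
  assumes "\<And>s. \<bar>s - a\<bar> \<le> \<bar>b - a\<bar> \<Longrightarrow> (f has_field_derivative f' s) (at s)"
  shows "\<exists>s. \<bar>s - a\<bar> \<le> \<bar>b - a\<bar> \<and> f b - f a = (b - a) * f' s"
proof (cases a b rule: linorder_cases)
  case less
  then obtain z where "a < z" "z < b" "f b - f a = (b - a) * f' z"
    using MVT2[of a b f f'] assms by auto
  then show ?thesis by (intro exI[of _ z]) auto
next
  case greater
  then obtain z where "b < z" "z < a" "f a - f b = (a - b) * f' z"
    using MVT2[of b a f f'] assms by auto
  then show ?thesis by (intro exI[of _ z]) (auto simp: algebra_simps)
qed auto

section \<open>Coordinatewise convergence and the chain rule\<close>

lemma tendsto_fun:
  fixes c :: "'b \<Rightarrow> nat \<Rightarrow> real"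
  assumes "\<And>i. ((\<lambda>t. c t i) \<longlongrightarrow> p i) F"
  shows "(c \<longlongrightarrow> p) F"
  unfolding tendsto_def
proof (intro allI impI)
  fix U :: "(nat \<Rightarrow> real) set" assume U: "open U" "p \<in> U"
  have "openin (product_topology (\<lambda>i. euclidean) UNIV) U"
    unfolding euclidean_product_topology open_openin[symmetric] by (rule U(1))
  from product_topology_open_contains_basis[OF this U(2)]
  have "\<exists>X. p \<in> PiE UNIV X \<and> (\<forall>i. open (X i)) \<and> finite {i. X i \<noteq> UNIV} \<and> PiE UNIV X \<subseteq> U"
    by simp
  then obtain X where X: "p \<in> PiE UNIV X" "\<And>i. open (X i)" "finite {i. X i \<noteq> UNIV}" "PiE UNIV X \<subseteq> U"
    by blast
  have "eventually (\<lambda>t. \<forall>i\<in>{i. X i \<noteq> UNIV}. c t i \<in> X i) F"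
    using X(1,2) assms by (intro eventually_ball_finite X(3)) (auto simp: tendsto_def)
  then show "eventually (\<lambda>t. c t \<in> U) F"
  proof eventually_elim
    case (elim t)
    then have "c t i \<in> X i" for i by (cases "X i = UNIV") auto
    then show ?case using X(4) by (auto simp: PiE_iff)
  qed
qed

text \<open>Only continuous partial derivatives are given, so the increment is telescoped: the point
  moves to \<open>c t\<close> one coordinate at a time, and the mean value theorem handles each
  move.\<close>

lemma chain_rule_ck:
  assumes V: "openin (Euclidean_space n) V" and f: "ck n V 1 f"
    and c: "eventually (\<lambda>t. c t \<in> ESp n) (at t0)" and c0: "c t0 \<in> V"
    and c': "\<And>j. j < n \<Longrightarrow> ((\<lambda>t. c t j) has_field_derivative c' j) (at t0)"
  shows "((\<lambda>t. f (c t)) has_field_derivative (\<Sum>j<n. partial_deriv j f (c t0) * c' j)) (at t0)"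
proof -
  define p where "p = c t0"
  \<comment> \<open>\<open>m j t\<close> has already moved its first \<open>j\<close> coordinates to
    the curve; the others are still those of \<open>p\<close>.\<close>
  define m where "m = (\<lambda>j t i. if i < j then c t i else p i)"
  have pV: "p \<in> V" using c0 by (simp add: p_def)
  have pE: "p \<in> ESp n" using pV openin_subset[OF V] by (auto simp: topspace_Euclidean_space)
  obtain d where d: "d > 0" "\<And>y. y \<in> ESp n \<Longrightarrow> (\<And>i. i < n \<Longrightarrow> \<bar>y i - p i\<bar> < d) \<Longrightarrow> y \<in> V"
    using open_box[OF V pV] by blast
  have cj: "((\<lambda>t. c t j) \<longlongrightarrow> p j) (at t0)" if "j < n" for j
    using DERIV_isCont[OF c'[OF that]] by (simp add: isCont_def p_def)
  have "eventually (\<lambda>t. \<forall>j\<in>{..<n}. \<bar>c t j - p j\<bar> < d) (at t0)"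
    using cj d(1) by (intro eventually_ball_finite) (auto simp: tendsto_iff dist_real_def)
  then have near: "eventually (\<lambda>t. c t \<in> ESp n \<and> (\<forall>j<n. \<bar>c t j - p j\<bar> < d)) (at t0)"
    using c by eventually_elim auto
  have step: "((\<lambda>t. f (m (Suc j) t) - f (m j t)) has_field_derivative partial_deriv j f p * c' j) (at t0)"
    if j: "j < n" for j
  proof -
    have mS: "m (Suc j) t = (m j t)(j := c t j)" for t
      unfolding m_def by (auto simp: fun_eq_iff less_Suc_eq)
    have mj: "m j t = (m j t)(j := p j)" for t
      unfolding m_def by (auto simp: fun_eq_iff)
    have inV: "(m j t)(j := s) \<in> V"
      if t: "c t \<in> ESp n \<and> (\<forall>j<n. \<bar>c t j - p j\<bar> < d)" and s: "\<bar>s - p j\<bar> \<le> \<bar>c t j - p j\<bar>" for t s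
    proof (rule d(2))
      show "(m j t)(j := s) \<in> ESp n" using t pE j unfolding m_def by auto
      show "\<bar>((m j t)(j := s)) i - p i\<bar> < d" if "i < n" for i
        using t s d(1) that j unfolding m_def by (cases "i = j") (auto intro: le_less_trans)
    qed
    have "\<exists>s. (c t \<in> ESp n \<and> (\<forall>j<n. \<bar>c t j - p j\<bar> < d)) \<longrightarrow> \<bar>s - p j\<bar> \<le> \<bar>c t j - p j\<bar> \<and>
       f (m (Suc j) t) - f (m j t) = (c t j - p j) * partial_deriv j f ((m j t)(j := s))" for t
    proof (cases "c t \<in> ESp n \<and> (\<forall>j<n. \<bar>c t j - p j\<bar> < d)")
      case True
      have der: "((\<lambda>s. f ((m j t)(j := s))) has_field_derivative partial_deriv j f ((m j t)(j := s))) (at s)"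
        if "\<bar>s - p j\<bar> \<le> \<bar>c t j - p j\<bar>" for s
        using ck_partial[OF f[unfolded One_nat_def] j inV[OF True that]] by simp
      from mean_value_segment[of "p j" "c t j", OF der]
      have "\<exists>s. \<bar>s - p j\<bar> \<le> \<bar>c t j - p j\<bar> \<and>
         f (m (Suc j) t) - f (m j t) = (c t j - p j) * partial_deriv j f ((m j t)(j := s))"
        unfolding mS mj[of t, symmetric] .
      then show ?thesis by blast
    qed auto
    then have "\<forall>t. \<exists>s. (c t \<in> ESp n \<and> (\<forall>j<n. \<bar>c t j - p j\<bar> < d)) \<longrightarrow> \<bar>s - p j\<bar> \<le> \<bar>c t j - p j\<bar> \<and>
       f (m (Suc j) t) - f (m j t) = (c t j - p j) * partial_deriv j f ((m j t)(j := s))" ..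
    from choice[OF this] obtain s where s0: "\<forall>t. (c t \<in> ESp n \<and> (\<forall>j<n. \<bar>c t j - p j\<bar> < d)) \<longrightarrow> \<bar>s t - p j\<bar> \<le> \<bar>c t j - p j\<bar> \<and>
       f (m (Suc j) t) - f (m j t) = (c t j - p j) * partial_deriv j f ((m j t)(j := s t))" ..
    have s: "\<bar>s t - p j\<bar> \<le> \<bar>c t j - p j\<bar>"
       "f (m (Suc j) t) - f (m j t) = (c t j - p j) * partial_deriv j f ((m j t)(j := s t))"
      if "c t \<in> ESp n \<and> (\<forall>j<n. \<bar>c t j - p j\<bar> < d)" for t
      using mp[OF spec[OF s0] that] by (rule conjunct1, rule conjunct2)
    have "((\<lambda>t. s t - p j) \<longlongrightarrow> 0) (at t0)"
    proof (rule Lim_null_comparison)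
      show "eventually (\<lambda>t. norm (s t - p j) \<le> \<bar>c t j - p j\<bar>) (at t0)"
        using near by eventually_elim (simp add: s(1))
      show "((\<lambda>t. \<bar>c t j - p j\<bar>) \<longlongrightarrow> 0) (at t0)"
        using tendsto_rabs[OF tendsto_diff[OF cj[OF j] tendsto_const[of "p j"]]] by simp
    qed
    from tendsto_add[OF this tendsto_const[of "p j"]] have st: "(s \<longlongrightarrow> p j) (at t0)" by simp
    have z: "((\<lambda>t. (m j t)(j := s t)) \<longlongrightarrow> p) (at t0)"
    proof (rule tendsto_fun)
      fix i show "((\<lambda>t. ((m j t)(j := s t)) i) \<longlongrightarrow> p i) (at t0)"
        using st cj[of i] j by (cases "i = j"; cases "i < j") (auto simp: m_def)
    qed
    have "((\<lambda>t. partial_deriv j f ((m j t)(j := s t))) \<longlongrightarrow> partial_deriv j f p) (at t0)"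
    proof (rule continuous_on_tendsto_compose[OF _ z pV])
      show "continuous_on V (partial_deriv j f)" using f j by simp
      show "eventually (\<lambda>t. (m j t)(j := s t) \<in> V) (at t0)"
        using near by eventually_elim (rule inV, assumption, rule s(1))
    qed
    moreover have "((\<lambda>t. (c t j - p j) / (t - t0)) \<longlongrightarrow> c' j) (at t0)"
      using c'[OF j] unfolding has_field_derivative_iff p_def .
    ultimately have lim: "((\<lambda>t. partial_deriv j f ((m j t)(j := s t)) * ((c t j - p j) / (t - t0)))
        \<longlongrightarrow> partial_deriv j f p * c' j) (at t0)"
      by (rule tendsto_mult)
    have m0: "m i t0 = p" for i unfolding m_def p_def by auto
    have ev: "eventually (\<lambda>t. partial_deriv j f ((m j t)(j := s t)) * ((c t j - p j) / (t - t0))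
         = (f (m (Suc j) t) - f (m j t) - (f (m (Suc j) t0) - f (m j t0))) / (t - t0)) (at t0)"
      using near by eventually_elim (simp add: m0 s(2))
    show ?thesis
      unfolding has_field_derivative_iff using tendsto_cong[OF ev] lim by simp
  qed
  have "((\<lambda>t. f (m j t)) has_field_derivative (\<Sum>i<j. partial_deriv i f p * c' i)) (at t0)"
    if "j \<le> n" for j
    using that
  proof (induction j)
    case 0
    then show ?case by (simp add: m_def)
  next
    case (Suc j)
    then have "((\<lambda>t. f (m j t) + (f (m (Suc j) t) - f (m j t))) has_field_derivative
       (\<Sum>i<j. partial_deriv i f p * c' i) + partial_deriv j f p * c' j) (at t0)"
      by (intro DERIV_add step) auto
    then show ?case by simp
  qed
  from this[of n] have D: "((\<lambda>t. f (m n t)) has_field_derivative (\<Sum>i<n. partial_deriv i f p * c' i)) (at t0)"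
    by simp
  have mn: "m n t = c t" if "c t \<in> ESp n" for t
    using that pE unfolding m_def by (auto simp: fun_eq_iff)
  have "eventually (\<lambda>t. f (m n t) = f (c t)) (at t0)"
    using c by (rule eventually_mono) (simp only: mn)
  moreover have "m n t0 = c t0" by (auto simp: m_def p_def fun_eq_iff)
  ultimately have "eventually (\<lambda>t. f (m n t) = f (c t)) (nhds t0)"
    by (simp add: eventually_nhds_conv_at)
  from DERIV_cong_ev[OF refl this refl] D show ?thesis unfolding p_def by (rule iffD1)
qed

lemma ck_compose:
  assumes V: "openin (Euclidean_space n) V" and W: "openin (Euclidean_space m) W"
    and \<Psi>: "\<And>y. y \<in> W \<Longrightarrow> \<Psi> y \<in> V"
  shows "ck n V k f \<Longrightarrow> (\<And>j. j < n \<Longrightarrow> ck m W k (\<lambda>y. \<Psi> y j)) \<Longrightarrow> ck m W k (\<lambda>y. f (\<Psi> y))"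
proof (induction k arbitrary: f)
  have VE: "V \<subseteq> ESp n" using openin_subset[OF V] by (simp add: topspace_Euclidean_space)
  have c: "continuous_on W (\<lambda>y. f (\<Psi> y))"
    if "continuous_on V f" and *: "\<And>j. j < n \<Longrightarrow> continuous_on W (\<lambda>y. \<Psi> y j)" for f
  proof (rule continuous_on_compose2[OF that(1)])
    show "continuous_on W \<Psi>"
    proof (rule continuous_on_coordinatewise_then_product)
      fix j show "continuous_on W (\<lambda>y. \<Psi> y j)"
      proof (cases "j < n")
        case False
        then have "\<And>y. y \<in> W \<Longrightarrow> \<Psi> y j = 0" using \<Psi> VE by force
        then show ?thesis by (simp cong: continuous_on_cong)
      qed (rule *)
    qed
  qed (use \<Psi> in auto)
  {
    case 0
    then show ?case using c by simp
  next
    case (Suc k)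
    have "\<forall>i<n. continuous_on V (partial_deriv i f)" using Suc.prems(1) ck_continuous by auto
    then have f1: "ck n V 1 f" using Suc.prems(1) by simp
    show ?case
    proof (rule ck_SucI[OF W, where f' = "\<lambda>i y. \<Sum>j<n. partial_deriv j f (\<Psi> y) * partial_deriv i (\<lambda>y. \<Psi> y j) y"])
      show "continuous_on W (\<lambda>y. f (\<Psi> y))"
        by (rule c[OF ck_continuous[OF Suc.prems(1)] ck_continuous[OF Suc.prems(2)]])
      show "((\<lambda>t. f (\<Psi> (y(i := t)))) has_field_derivative
          (\<Sum>j<n. partial_deriv j f (\<Psi> y) * partial_deriv i (\<lambda>y. \<Psi> y j) y)) (at (y i))"
        if "i < m" "y \<in> W" for i y
      proof -
        have ev: "eventually (\<lambda>t. \<Psi> (y(i := t)) \<in> ESp n) (at (y i))"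
          unfolding eventually_at_filter using eventually_update[OF W that(2,1)]
          by eventually_elim (use VE \<Psi> in blast)
        have "((\<lambda>t. \<Psi> (y(i := t)) j) has_field_derivative partial_deriv i (\<lambda>y. \<Psi> y j) y) (at (y i))" if "j < n" for j
          using ck_partial[OF Suc.prems(2)[OF that] \<open>i < m\<close> \<open>y \<in> W\<close>] .
        from chain_rule_ck[OF V f1 ev _ this] show ?thesis using \<Psi>[OF that(2)] unfolding fun_upd_triv .
      qed
      show "ck m W k (\<lambda>y. \<Sum>j<n. partial_deriv j f (\<Psi> y) * partial_deriv i (\<lambda>y. \<Psi> y j) y)"
        if "i < m" for i
      proof (intro ck_sum[OF W] ck_mult[OF W])
        fix j assume "j \<in> {..<n}"
        then show "ck m W k (\<lambda>y. partial_deriv j f (\<Psi> y))"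
          using Suc.prems(1) by (intro Suc.IH[OF _ ck_mono[OF Suc.prems(2)]]) auto
        show "ck m W k (partial_deriv i (\<lambda>y. \<Psi> y j))"
          using Suc.prems(2)[of j] \<open>j \<in> {..<n}\<close> that by auto
      qed
    qed
  }
qed

section \<open>Bump functions and Hadamard's lemma\<close>

text \<open>The polynomial factor closes the family under differentiation: in the variable u = 1/x,
  the derivative replaces P by u^2 (P - P'). Smoothness of the flat function exp (-1/x) is then an
  induction over all P at once.\<close>

definition bfun :: "real poly \<Rightarrow> real \<Rightarrow> real" where
  "bfun P x = (if x > 0 then poly P (1 / x) * exp (- (1 / x)) else 0)"

lemma poly_div_exp_tendsto_0: "((\<lambda>u::real. poly p u / exp u) \<longlongrightarrow> 0) at_top"
proof -
  have "((\<lambda>u::real. \<Sum>i\<le>degree p. coeff p i * (u ^ i / exp u)) \<longlongrightarrow> (\<Sum>i\<le>degree p. coeff p i * 0)) at_top"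
    by (intro tendsto_sum tendsto_mult tendsto_const tendsto_power_div_exp_0)
  then show ?thesis by (simp add: poly_altdef sum_divide_distrib)
qed

lemma bfun_deriv: "(bfun P has_field_derivative bfun ([:0, 0, 1:] * (P - pderiv P)) x) (at x)"
proof (cases x "0::real" rule: linorder_cases)
  case less
  have "eventually (\<lambda>y. bfun P y = 0) (nhds x)"
    using eventually_nhds_in_open[of "{..<0}" x] less by (auto simp: bfun_def elim!: eventually_mono)
  from DERIV_cong_ev[OF refl this refl] have "(bfun P has_field_derivative 0) (at x)"
    by (rule iffD2) simp
  then show ?thesis using less by (simp add: bfun_def)
next
  case greater
  let ?h = "\<lambda>y. poly P (1 / y) * exp (- (1 / y))"
  have "eventually (\<lambda>y. bfun P y = ?h y) (nhds x)"
    using eventually_nhds_in_open[of "{0<..}" x] greater by (auto simp: bfun_def elim!: eventually_mono)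
  note ev = DERIV_cong_ev[OF refl this refl]
  have 1: "((\<lambda>y. 1 / y) has_field_derivative - (1 / x\<^sup>2)) (at x)"
    using greater by (auto intro!: derivative_eq_intros simp: power2_eq_square)
  have 2: "((\<lambda>y. poly P (1 / y)) has_field_derivative poly (pderiv P) (1 / x) * - (1 / x\<^sup>2)) (at x)"
    by (rule DERIV_chain2[OF poly_DERIV 1])
  have 3: "((\<lambda>y. exp (- (1 / y))) has_field_derivative exp (- (1 / x)) * - (- (1 / x\<^sup>2))) (at x)"
    by (rule DERIV_chain2[OF DERIV_exp DERIV_minus[OF 1]])
  have "(?h has_field_derivative bfun ([:0, 0, 1:] * (P - pderiv P)) x) (at x)"
    using DERIV_mult[OF 2 3] greater by (simp add: bfun_def algebra_simps power2_eq_square)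
  then show ?thesis by (rule iffD2[OF ev])
next
  case equal
  have "((\<lambda>y. bfun P y / y) \<longlongrightarrow> 0) (at 0)"
  proof (rule filterlim_split_at)
    have "eventually (\<lambda>y. bfun P y / y = 0) (at_left 0)"
      by (auto simp: bfun_def eventually_at_filter)
    then show "((\<lambda>y. bfun P y / y) \<longlongrightarrow> 0) (at_left 0)"
      by (rule tendsto_eventually)
    \<comment> \<open>With u = 1/y the difference quotient at 0 is u P(u) / exp u, and u tends to
      infinity.\<close>
    have "((\<lambda>y. poly ([:0, 1:] * P) (inverse y) / exp (inverse y)) \<longlongrightarrow> 0) (at_right 0)"
      by (rule filterlim_compose[OF poly_div_exp_tendsto_0 filterlim_inverse_at_top_right])
    moreover have "eventually (\<lambda>y. poly ([:0, 1:] * P) (inverse y) / exp (inverse y) = bfun P y / y) (at_right 0)"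
      by (auto simp: bfun_def eventually_at_filter exp_minus field_simps)
    ultimately show "((\<lambda>y. bfun P y / y) \<longlongrightarrow> 0) (at_right 0)"
      by (rule Lim_transform_eventually)
  qed
  moreover have "bfun Q 0 = 0" for Q by (simp add: bfun_def)
  ultimately show ?thesis unfolding has_field_derivative_iff equal by simp
qed

lemma ck_bfun:
  assumes V: "openin (Euclidean_space n) V"
  shows "ck n V k f \<Longrightarrow> ck n V k (\<lambda>x. bfun P (f x))"
proof (induction k arbitrary: P)
  have c: "continuous_on V (\<lambda>x. bfun P (f x))" if "continuous_on V f" for P
  proof (rule continuous_on_compose2[OF _ that])
    show "continuous_on UNIV (bfun P)"
      unfolding continuous_on_eq_continuous_at[OF open_UNIV] using DERIV_isCont[OF bfun_deriv] by blast
  qed auto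
  {
    case 0 then show ?case using c by simp
  next
    case (Suc k)
    let ?Q = "[:0, 0, 1:] * (P - pderiv P)"
    show ?case
    proof (rule ck_SucI[OF V, where f' = "\<lambda>i x. bfun ?Q (f x) * partial_deriv i f x"])
      show "continuous_on V (\<lambda>x. bfun P (f x))" using c ck_continuous[OF Suc.prems] .
      show "((\<lambda>t. bfun P (f (x(i := t)))) has_field_derivative bfun ?Q (f x) * partial_deriv i f x) (at (x i))"
        if "i < n" "x \<in> V" for i x
        using DERIV_chain2[OF bfun_deriv[of P "f (x(i := x i))"] ck_partial[OF Suc.prems that]]
        unfolding fun_upd_triv .
      show "ck n V k (\<lambda>x. bfun ?Q (f x) * partial_deriv i f x)" if "i < n" for i
        using Suc.prems that by (intro ck_mult[OF V] Suc.IH ck_mono[OF Suc.prems]) auto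
    qed
  }
qed

section \<open>Cubes, homotheties and integrals depending on a parameter\<close>

definition cube :: "nat \<Rightarrow> (nat \<Rightarrow> real) \<Rightarrow> real \<Rightarrow> (nat \<Rightarrow> real) set" where
  "cube n a r = {y \<in> ESp n. \<forall>i<n. \<bar>y i - a i\<bar> < r}"

lemma openin_cube: "openin (Euclidean_space n) (cube n a r)"
proof -
  have "open (\<Inter>i\<in>{..<n}. {y::nat \<Rightarrow> real. \<bar>y i - a i\<bar> < r})"
    by (intro open_INT finite_lessThan ballI open_Collect_less continuous_intros continuous_on_product_coordinates)
  moreover have "cube n a r = ESp n \<inter> (\<Inter>i\<in>{..<n}. {y::nat \<Rightarrow> real. \<bar>y i - a i\<bar> < r})"
    unfolding cube_def by auto
  ultimately show ?thesis unfolding Euclidean_space_top openin_open by blast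
qed

definition homothety :: "(nat \<Rightarrow> real) \<Rightarrow> real \<Rightarrow> (nat \<Rightarrow> real) \<Rightarrow> nat \<Rightarrow> real" where
  "homothety a s y = (\<lambda>i. a i + s * (y i - a i))"

lemma homothety_cube:
  assumes "a \<in> ESp n" "y \<in> cube n a r" "s \<in> {0..1}"
  shows "homothety a s y \<in> cube n a r"
proof -
  have "\<bar>s * (y i - a i)\<bar> < r" if "i < n" for i
  proof -
    have "\<bar>s * (y i - a i)\<bar> \<le> 1 * \<bar>y i - a i\<bar>"
      unfolding abs_mult using assms(3) by (intro mult_right_mono) auto
    then show ?thesis using assms(2) that unfolding cube_def by fastforce
  qed
  then show ?thesis using assms unfolding cube_def homothety_def by auto
qed

lemma continuous_on_homothety: "continuous_on S (\<lambda>(y, s). homothety a s y)"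
  unfolding case_prod_beta
proof (rule continuous_on_coordinatewise_then_product)
  fix i
  have "continuous_on S (\<lambda>p. fst p i)"
    by (rule continuous_on_compose2[OF continuous_on_product_coordinates continuous_on_fst[OF continuous_on_id]]) auto
  then show "continuous_on S (\<lambda>p. homothety a (snd p) (fst p) i)"
    unfolding homothety_def by (intro continuous_intros)
qed

lemma continuous_on_homothety_integrand:
  assumes "a \<in> ESp n" "continuous_on (cube n a r) F"
  shows "continuous_on (cube n a r \<times> {0..1}) (\<lambda>(y, s). s ^ j * F (homothety a s y))"
proof -
  have "continuous_on (cube n a r \<times> {0..1}) (\<lambda>p. F (case p of (y, s) \<Rightarrow> homothety a s y))"
    by (rule continuous_on_compose2[OF assms(2) continuous_on_homothety])
       (use homothety_cube[OF assms(1)] in auto)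
  then have "continuous_on (cube n a r \<times> {0..1}) (\<lambda>p. snd p ^ j * F (case p of (y, s) \<Rightarrow> homothety a s y))"
    by (intro continuous_intros)
  then show ?thesis by (simp add: case_prod_beta)
qed

text \<open>Differentiation under the integral produces a factor \<open>s\<close> from the
  homothety, so the induction has to carry all weights \<open>s ^ j\<close>.\<close>

lemma ck_integral:
  assumes a: "a \<in> ESp n"
  shows "ck n (cube n a r) k F \<Longrightarrow> ck n (cube n a r) k (\<lambda>y. integral {0..1} (\<lambda>s. s ^ j * F (homothety a s y)))"
proof (induction k arbitrary: F j)
  have c: "continuous_on (cube n a r) (\<lambda>y. integral {0..1} (\<lambda>s. s ^ j * F (homothety a s y)))"
    if "continuous_on (cube n a r) F" for F j
    using integral_continuous_on_param[of "cube n a r" 0 1 "\<lambda>y s. s ^ j * F (homothety a s y)"]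
      continuous_on_homothety_integrand[OF a that] by simp
  {
    case 0
    then show ?case using c by simp
  next
    case (Suc k)
    show ?case
    proof (rule ck_SucI[OF openin_cube, where f' = "\<lambda>i y. integral {0..1} (\<lambda>s. s ^ Suc j * partial_deriv i F (homothety a s y))"])
      show "continuous_on (cube n a r) (\<lambda>y. integral {0..1} (\<lambda>s. s ^ j * F (homothety a s y)))"
        using c ck_continuous[OF Suc.prems] .
      show "ck n (cube n a r) k (\<lambda>y. integral {0..1} (\<lambda>s. s ^ Suc j * partial_deriv i F (homothety a s y)))"
        if "i < n" for i
        using Suc.prems that by (intro Suc.IH) auto
      fix i y assume i: "i < n" and y: "y \<in> cube n a r"
      \<comment> \<open>The coordinate line through \<open>y\<close> stays in the cube over this
        interval. Being open, it lets the derivative within \<open>U\<close> count as the full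
        derivative at \<open>y i\<close>.\<close>
      define U where "U = {a i - r<..<a i + r}"
      have yU: "y(i := t) \<in> cube n a r" if "t \<in> U" for t
        using that y i unfolding cube_def U_def by (auto simp: abs_less_iff)
      have yi: "y i \<in> U" using y i unfolding cube_def U_def by (auto simp: abs_less_iff)
      have slice: "continuous_on (U \<times> {0..1}) (\<lambda>(t, s). s ^ l * G (homothety a s (y(i := t))))"
        if "continuous_on (cube n a r) G" for G l
      proof -
        have u: "continuous_on (U \<times> {0..1}) (\<lambda>p. (y(i := fst p), snd p :: real))"
        proof (intro continuous_on_Pair continuous_on_snd continuous_on_id)
          show "continuous_on (U \<times> {0..1}) (\<lambda>p. y(i := fst p))"
            by (rule continuous_on_compose2[OF continuous_on_update continuous_on_fst[OF continuous_on_id]]) auto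
        qed
        have "continuous_on (U \<times> {0..1}) (\<lambda>p. (\<lambda>(y, s). s ^ l * G (homothety a s y)) (y(i := fst p), snd p))"
          by (rule continuous_on_compose2[OF continuous_on_homothety_integrand[OF a that] u]) (use yU in auto)
        then show ?thesis by (simp add: case_prod_beta)
      qed
      have dF: "continuous_on (cube n a r) (partial_deriv i F)" using Suc.prems i ck_continuous by auto
      have "((\<lambda>t. integral (cbox 0 1) (\<lambda>s. s ^ j * F (homothety a s (y(i := t))))) has_field_derivative
          integral (cbox 0 1) (\<lambda>s. s ^ Suc j * partial_deriv i F (homothety a s (y(i := y i))))) (at (y i) within U)"
      proof (rule leibniz_rule_field_derivative[where fx = "\<lambda>t s. s ^ Suc j * partial_deriv i F (homothety a s (y(i := t)))"])
        show "continuous_on (U \<times> cbox 0 1) (\<lambda>(t, s). s ^ Suc j * partial_deriv i F (homothety a s (y(i := t))))"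
          using slice[OF dF, of "Suc j"] by simp
        show "convex U" unfolding U_def by (rule convex_real_interval)
        show "(\<lambda>s. s ^ j * F (homothety a s (y(i := t)))) integrable_on cbox 0 1" if "t \<in> U" for t
        proof -
          have "continuous_on {0..1} (\<lambda>s. (\<lambda>(t, s). s ^ j * F (homothety a s (y(i := t)))) (t, s))"
            by (rule continuous_on_compose2[OF slice[OF ck_continuous[OF Suc.prems], of j]])
               (use that in \<open>auto intro: continuous_intros\<close>)
          then show ?thesis by (simp add: integrable_continuous_interval)
        qed
        fix t s :: real assume t: "t \<in> U" and s: "s \<in> cbox 0 1"
        let ?x = "homothety a s (y(i := t))"
        have x: "?x \<in> cube n a r" using homothety_cube[OF a yU[OF t]] s by simp
        have xi: "?x i = a i + s * (t - a i)" by (simp add: homothety_def)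
        have upd: "homothety a s (y(i := \<tau>)) = ?x(i := a i + s * (\<tau> - a i))" for \<tau>
          by (auto simp: homothety_def fun_eq_iff)
        have "((\<lambda>\<tau>. F (?x(i := \<tau>))) has_field_derivative partial_deriv i F ?x) (at (a i + s * (t - a i)))"
          using ck_partial[OF Suc.prems i x] unfolding xi .
        then have "((\<lambda>\<tau>. F (?x(i := a i + s * (\<tau> - a i)))) has_field_derivative partial_deriv i F ?x * s) (at t)"
          by (rule DERIV_chain2) (auto intro!: derivative_eq_intros)
        then have "((\<lambda>\<tau>. s ^ j * F (homothety a s (y(i := \<tau>)))) has_field_derivative s ^ j * (partial_deriv i F ?x * s)) (at t)"
          unfolding upd[symmetric] by (rule DERIV_cmult)
        moreover have "s ^ j * (partial_deriv i F ?x * s) = s ^ Suc j * partial_deriv i F ?x" by simp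
        ultimately show "((\<lambda>\<tau>. s ^ j * F (homothety a s (y(i := \<tau>)))) has_field_derivative
            s ^ Suc j * partial_deriv i F ?x) (at t within U)"
          using has_field_derivative_at_within by metis
      qed (rule yi)
      then show "((\<lambda>t. integral {0..1} (\<lambda>s. s ^ j * F (homothety a s (y(i := t))))) has_field_derivative
          integral {0..1} (\<lambda>s. s ^ Suc j * partial_deriv i F (homothety a s y))) (at (y i))"
        using at_within_open[OF yi] unfolding U_def by (simp del: power_Suc)
    qed
  }
qed

text \<open>The difference \<open>f y - f a\<close> is the integral of the derivative of
  \<open>f\<close> along the segment from \<open>a\<close> to \<open>y\<close>; each
  \<open>g i\<close> is a partial derivative averaged over that segment.\<close>

lemma hadamard:
  assumes a: "a \<in> ESp n" and f: "\<And>k. ck n (cube n a r) k f"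
  shows "\<exists>g. (\<forall>i<n. \<forall>k. ck n (cube n a r) k (g i)) \<and>
           (\<forall>y\<in>cube n a r. f y = f a + (\<Sum>i<n. (y i - a i) * g i y))"
proof (intro exI conjI allI impI ballI)
  let ?g = "\<lambda>i y. integral {0..1} (\<lambda>s. s ^ 0 * partial_deriv i f (homothety a s y))"
  fix i k assume "i < n"
  then show "ck n (cube n a r) k (?g i)"
    using f[of "Suc k"] by (intro ck_integral[OF a]) auto
next
  let ?g = "\<lambda>i y. integral {0..1} (\<lambda>s. s ^ 0 * partial_deriv i f (homothety a s y))"
  fix y assume y: "y \<in> cube n a r"
  have yE: "y \<in> ESp n" using y by (simp add: cube_def)
  have D: "((\<lambda>s. f (homothety a s y)) has_field_derivative (\<Sum>i<n. partial_deriv i f (homothety a s y) * (y i - a i))) (at s)"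
    if "s \<in> {0..1}" for s
  proof (rule chain_rule_ck[OF openin_cube f])
    show "homothety a s y \<in> cube n a r" using homothety_cube[OF a y that] .
    show "eventually (\<lambda>s. homothety a s y \<in> ESp n) (at s)"
      using a yE by (auto simp: homothety_def)
    show "((\<lambda>s. homothety a s y j) has_field_derivative y j - a j) (at s)" for j
      unfolding homothety_def by (auto intro!: derivative_eq_intros)
  qed
  have "((\<lambda>s. \<Sum>i<n. partial_deriv i f (homothety a s y) * (y i - a i)) has_integral
      f (homothety a 1 y) - f (homothety a 0 y)) {0..1}"
  proof (rule fundamental_theorem_of_calculus)
    fix s :: real assume "s \<in> {0..1}"
    from has_field_derivative_at_within[OF D[OF this]]
    show "((\<lambda>s. f (homothety a s y)) has_vector_derivative
        (\<Sum>i<n. partial_deriv i f (homothety a s y) * (y i - a i))) (at s within {0..1})"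
      by (rule has_real_derivative_iff_has_vector_derivative[THEN iffD1])
  qed simp
  moreover have "((\<lambda>s. \<Sum>i<n. partial_deriv i f (homothety a s y) * (y i - a i)) has_integral
      (\<Sum>i<n. ?g i y * (y i - a i))) {0..1}"
  proof (intro has_integral_sum has_integral_mult_left finite_lessThan)
    fix i assume i: "i \<in> {..<n}"
    have "continuous_on (cube n a r) (partial_deriv i f)" using f[of 1] i by auto
    note continuous_on_homothety_integrand[OF a this, of 0]
    then have "continuous_on {0..1} (\<lambda>s. (\<lambda>(y, s). s ^ 0 * partial_deriv i f (homothety a s y)) (y, s))"
      by (rule continuous_on_compose2) (use y in \<open>auto intro: continuous_intros\<close>)
    then show "((\<lambda>s. partial_deriv i f (homothety a s y)) has_integral ?g i y) {0..1}"
      by (simp add: integrable_continuous_interval integrable_integral)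
  qed
  ultimately have "f (homothety a 1 y) - f (homothety a 0 y) = (\<Sum>i<n. ?g i y * (y i - a i))"
    by (rule has_integral_unique)
  moreover have "homothety a 1 y = y" "homothety a 0 y = a" by (auto simp: homothety_def)
  ultimately show "f y = f a + (\<Sum>i<n. (y i - a i) * ?g i y)" by (simp add: mult.commute)
qed

section \<open>Orbits of unitriangular groups\<close>

text \<open>This passes from the integer powers of a group element to its whole one-parameter
  subgroup.\<close>

lemma poly_nat_eqI:
  fixes p q :: "real poly"
  assumes "\<And>m::nat. poly p (real m) = poly q (real m)"
  shows "p = q"
proof (rule ccontr)
  assume "p \<noteq> q"
  then have "finite {x. poly (p - q) x = 0}" by (intro poly_roots_finite) simp
  moreover have "range real \<subseteq> {x. poly (p - q) x = 0}" using assms by auto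
  ultimately have "finite (range real)" using finite_subset by blast
  then show False using finite_imageD[of real UNIV] by (simp add: inj_on_def)
qed

text \<open>\<open>pw g\<close> is the one-parameter subgroup through \<open>g\<close>. Group laws
  are required only for the effect on the coordinates below \<open>n\<close>, because
  \<open>act\<close> describes the action through coordinates and says nothing controlled beyond
  them.\<close>

locale unitriangular_action =
  fixes G :: "'g set" and n :: nat
    and act :: "'g \<Rightarrow> (nat \<Rightarrow> real) \<Rightarrow> nat \<Rightarrow> real" and pw :: "'g \<Rightarrow> real \<Rightarrow> 'g"
    and m :: "'g \<Rightarrow> nat \<Rightarrow> nat \<Rightarrow> real"
  assumes tri: "\<And>g w b. g \<in> G \<Longrightarrow> b < n \<Longrightarrow> act g w b = w b + (\<Sum>a<b. m g b a * w a)"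
    and mult: "\<And>g h. g \<in> G \<Longrightarrow> h \<in> G \<Longrightarrow> \<exists>k\<in>G. \<forall>w. \<forall>b<n. act k w b = act g (act h w) b"
    and inverse: "\<And>g. g \<in> G \<Longrightarrow> \<exists>h\<in>G. \<forall>w. \<forall>b<n. act h (act g w) b = w b \<and> act g (act h w) b = w b"
    and pw: "\<And>g s. g \<in> G \<Longrightarrow> pw g s \<in> G"
      "\<And>g s t w b. g \<in> G \<Longrightarrow> b < n \<Longrightarrow> act (pw g (s + t)) w b = act (pw g s) (act (pw g t) w) b"
      "\<And>g w b. g \<in> G \<Longrightarrow> b < n \<Longrightarrow> act (pw g 1) w b = act g w b"
      "\<And>g w b. g \<in> G \<Longrightarrow> b < n \<Longrightarrow> act (pw g 0) w b = w b"
      "\<And>g b a. g \<in> G \<Longrightarrow> b < n \<Longrightarrow> a < b \<Longrightarrow> \<exists>p. \<forall>s. m (pw g s) b a = poly p s"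
begin

definition agree :: "nat \<Rightarrow> (nat \<Rightarrow> real) \<Rightarrow> (nat \<Rightarrow> real) \<Rightarrow> bool" where
  "agree j w w' \<longleftrightarrow> (\<forall>b<j. w b = w' b)"

lemma agree_refl: "agree j w w"
  by (simp add: agree_def)
lemma agree_sym: "agree j w w' \<Longrightarrow> agree j w' w"
  by (simp add: agree_def)
lemma agree_trans: "agree j w w' \<Longrightarrow> agree j w' w'' \<Longrightarrow> agree j w w''"
  by (simp add: agree_def)
lemma agree_mono: "agree j w w' \<Longrightarrow> i \<le> j \<Longrightarrow> agree i w w'"
  by (simp add: agree_def)
lemma agree_Suc: "agree (Suc j) w w' \<longleftrightarrow> agree j w w' \<and> w j = w' j"
  by (auto simp: agree_def less_Suc_eq)

text \<open>By unitriangularity the increment of coordinate \<open>j\<close> is a function of the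
  lower coordinates alone: on vectors with the same lower part, \<open>g\<close> translates
  it.\<close>

lemma act_shift: "g \<in> G \<Longrightarrow> j < n \<Longrightarrow> agree j w w' \<Longrightarrow> act g w j - w j = act g w' j - w' j"
  by (simp add: tri agree_def)

lemma act_agree: "g \<in> G \<Longrightarrow> j \<le> n \<Longrightarrow> agree j w w' \<Longrightarrow> agree j (act g w) (act g w')"
  by (simp add: tri agree_def)

text \<open>The offset \<open>i\<close> makes each letter read its own entry of the same parameter
  vector \<open>y\<close>.\<close>

primrec word_act :: "nat \<Rightarrow> 'g list \<Rightarrow> (nat \<Rightarrow> real) \<Rightarrow> (nat \<Rightarrow> real) \<Rightarrow> nat \<Rightarrow> real" where
  "word_act i [] = (\<lambda>y w. w)"
| "word_act i (g # gs) = (\<lambda>y w. act (pw g (y i)) (word_act (Suc i) gs y w))"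

lemma word_act_snoc: "word_act i (gs @ [g]) y w = word_act i gs y (act (pw g (y (i + length gs))) w)"
  by (induction gs arbitrary: i) auto

lemma word_act_local:
  "(\<And>j. j < i + length gs \<Longrightarrow> y j = y' j) \<Longrightarrow> word_act i gs y w = word_act i gs y' w"
proof (induction gs arbitrary: i)
  case (Cons g gs)
  have "word_act (Suc i) gs y w = word_act (Suc i) gs y' w" using Cons by auto
  moreover have "y i = y' i" using Cons.prems by simp
  ultimately show ?case by simp
qed simp

lemma word_act_agree:
  "set gs \<subseteq> G \<Longrightarrow> j \<le> n \<Longrightarrow> agree j w w' \<Longrightarrow> agree j (word_act i gs y w) (word_act i gs y w')"
  by (induction gs arbitrary: i) (auto intro!: act_agree pw)

lemma word_act_shift:
  "set gs \<subseteq> G \<Longrightarrow> j < n \<Longrightarrow> agree j w w' \<Longrightarrow> word_act i gs y w j - w j = word_act i gs y w' j - w' j"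
proof (induction gs arbitrary: i)
  case (Cons g gs)
  have "agree j (word_act (Suc i) gs y w) (word_act (Suc i) gs y w')"
    using Cons.prems by (intro word_act_agree) auto
  from act_shift[OF _ Cons.prems(2) this, of "pw g (y i)"]
  have "word_act i (g # gs) y w j - word_act (Suc i) gs y w j = word_act i (g # gs) y w' j - word_act (Suc i) gs y w' j"
    using Cons.prems pw(1) by simp
  moreover have "word_act (Suc i) gs y w j - w j = word_act (Suc i) gs y w' j - w' j"
    using Cons by auto
  ultimately show ?case by linarith
qed simp

lemma word_act_in:
  assumes "g0 \<in> G" "set gs \<subseteq> G"
  shows "\<exists>u\<in>G. \<forall>w. agree n (act u w) (word_act i gs y w)"
  using assms(2)
proof (induction gs arbitrary: i)
  case Nil
  \<comment> \<open>The empty word needs a group element acting as the identity; \<open>g0\<close>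
    times its inverse is one.\<close>
  obtain h where h: "h \<in> G" "\<forall>w. \<forall>b<n. act h (act g0 w) b = w b \<and> act g0 (act h w) b = w b"
    using inverse[OF assms(1)] by blast
  obtain k where "k \<in> G" "\<forall>w. \<forall>b<n. act k w b = act g0 (act h w) b" using mult[OF assms(1) h(1)] by blast
  then show ?case using h by (intro bexI[of _ k]) (auto simp: agree_def)
next
  case (Cons g gs)
  obtain u where u: "u \<in> G" "\<And>w. agree n (act u w) (word_act (Suc i) gs y w)"
    using Cons.IH[of "Suc i"] Cons.prems by auto
  have pg: "pw g (y i) \<in> G" using Cons.prems pw(1) by simp
  obtain k where k: "k \<in> G" "\<And>w. \<forall>b<n. act k w b = act (pw g (y i)) (act u w) b"
    using mult[OF pg u(1)] by blast
  have "agree n (act k w) (word_act i (g # gs) y w)" for w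
  proof -
    have "agree n (act k w) (act (pw g (y i)) (act u w))" using k by (simp add: agree_def)
    then show ?thesis using agree_trans act_agree[OF pg le_refl u(2)] by simp
  qed
  then show ?case using k(1) by blast
qed

lemma ck_word_act:
  assumes V: "openin (Euclidean_space k) V"
  shows "set gs \<subseteq> G \<Longrightarrow> b < n \<Longrightarrow> ck k V K (\<lambda>y. word_act i gs y w b)"
proof (induction gs arbitrary: i b)
  case Nil
  then show ?case using ck_const[OF V] by simp
next
  case (Cons g gs)
  have IH: "ck k V K (\<lambda>y. word_act (Suc i) gs y w a)" if "a < n" for a
    using Cons.IH[of a "Suc i"] Cons.prems(1) that by simp
  have g: "g \<in> G" using Cons.prems by simp
  have m: "ck k V K (\<lambda>y. m (pw g (y i)) b a)" if ab: "a < b" for a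
  proof -
    obtain p where "\<And>s. m (pw g s) b a = poly p s" using pw(5)[OF g Cons.prems(2) ab] by blast
    then show ?thesis using ck_poly[OF V ck_coord[OF V]] by simp
  qed
  have "ck k V K (\<lambda>y. word_act (Suc i) gs y w b + (\<Sum>a<b. m (pw g (y i)) b a * word_act (Suc i) gs y w a))"
    using Cons.prems(2) by (intro ck_add[OF V] ck_sum[OF V] ck_mult[OF V] IH m) auto
  then show ?case using tri[OF pw(1)[OF g] Cons.prems(2)] by simp
qed

lemma pw_poly:
  assumes g: "g \<in> G" and b: "b < n"
  shows "\<exists>p. \<forall>s. act (pw g s) w b = poly p s"
proof -
  have "\<forall>a\<in>{..<b}. \<exists>p. \<forall>s. m (pw g s) b a = poly p s" using pw(5)[OF g b] by simp
  then obtain P where P: "\<And>a s. a < b \<Longrightarrow> m (pw g s) b a = poly (P a) s"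
    unfolding bchoice_iff by auto
  have "act (pw g s) w b = poly ([:w b:] + (\<Sum>a<b. smult (w a) (P a))) s" for s
    using tri[OF pw(1)[OF g] b] by (simp add: poly_sum P mult.commute)
  then show ?thesis by blast
qed

text \<open>Integer powers of \<open>g\<close> fix these coordinates because \<open>g\<close> does,
  and a polynomial in \<open>s\<close> that is constant on the naturals is constant.\<close>

lemma pw_stabilizer:
  assumes g: "g \<in> G" and j: "j \<le> n" and st: "agree j (act g v) v"
  shows "agree j (act (pw g s) v) v"
proof -
  have nat: "agree j (act (pw g (real k)) v) v" for k
  proof (induction k)
    case 0
    then show ?case using pw(4)[OF g] j by (simp add: agree_def)
  next
    case (Suc k)
    have "agree j (act (pw g (real (Suc k))) v) (act (pw g (real k)) (act (pw g 1) v))"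
      using pw(2)[OF g, of _ "real k" 1 v] j by (simp add: agree_def add.commute)
    moreover have "agree j (act (pw g 1) v) v"
      using pw(3)[OF g] st j by (simp add: agree_def)
    then have "agree j (act (pw g (real k)) (act (pw g 1) v)) (act (pw g (real k)) v)"
      by (rule act_agree[OF pw(1)[OF g] j])
    ultimately show ?case using Suc agree_trans by blast
  qed
  show ?thesis unfolding agree_def
  proof (intro allI impI)
    fix b assume b: "b < j"
    obtain p where p: "\<And>s. act (pw g s) v b = poly p s" using pw_poly[OF g, of b v] b j by auto
    have "p = [:v b:]"
      by (rule poly_nat_eqI) (use nat b in \<open>simp add: agree_def flip: p\<close>)
    then show "act (pw g s) v b = v b" using p by simp
  qed
qed

text \<open>The displacement of coordinate \<open>j\<close> is additive in \<open>s\<close>, since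
  the lower coordinates stay fixed; a polynomial that is additive on the naturals is linear.\<close>

lemma pw_linear:
  assumes g: "g \<in> G" and j: "j < n" and st: "agree j (act g v) v"
  shows "act (pw g s) v j = v j + s * (act g v j - v j)"
proof -
  define q where "q = (\<lambda>s. act (pw g s) v j - v j)"
  have add: "q (s + t) = q s + q t" for s t
  proof -
    have "act (pw g s) (act (pw g t) v) j - act (pw g t) v j = act (pw g s) v j - v j"
      using pw_stabilizer[OF g _ st, of t] j by (intro act_shift[OF pw(1)[OF g]]) auto
    then show ?thesis unfolding q_def using pw(2)[OF g j] by simp
  qed
  have nat: "q (real k) = real k * q 1" for k
  proof (induction k)
    case 0
    then show ?case using pw(4)[OF g j] by (simp add: q_def)
  next
    case (Suc k)
    then show ?case using add[of "real k" 1] by (simp add: algebra_simps)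
  qed
  obtain p where p: "\<And>s. act (pw g s) v j = poly p s" using pw_poly[OF g j] by blast
  have "p = [:v j, q 1:]"
    by (rule poly_nat_eqI) (use nat in \<open>simp add: q_def algebra_simps flip: p\<close>)
  then have "act (pw g s) v j = v j + s * q 1" using p by simp
  then show ?thesis using pw(3)[OF g j] by (simp add: q_def)
qed

lemma partial_deriv_independent:
  assumes "\<And>t. f (y(k := t)) = f y"
  shows "partial_deriv k f y = 0"
  unfolding partial_deriv_def assms by simp

text \<open>The orbit is seen through its first \<open>j\<close> coordinates, which is what the
  induction runs on. The three clauses after membership are surjectivity, injectivity and
  immersivity of the parametrisation.\<close>

definition orbit_chart :: "(nat \<Rightarrow> real) \<Rightarrow> nat \<Rightarrow> 'g list \<Rightarrow> bool" where
  "orbit_chart v j gs \<longleftrightarrow> set gs \<subseteq> G \<and>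
    (\<forall>h\<in>G. \<exists>y\<in>ESp (length gs). agree j (act h v) (word_act 0 gs y v)) \<and>
    (\<forall>y\<in>ESp (length gs). \<forall>y'\<in>ESp (length gs). agree j (word_act 0 gs y v) (word_act 0 gs y' v) \<longrightarrow> y = y') \<and>
    (\<forall>y c. (\<forall>b<j. (\<Sum>i<length gs. c i * partial_deriv i (\<lambda>y. word_act 0 gs y v b) y) = 0) \<longrightarrow>
       (\<forall>i<length gs. c i = 0))"

text \<open>Chevalley--Rosenlicht: orbits of unipotent groups are parametrised coordinate by coordinate.
  If the stabiliser of the first \<open>j\<close> coordinates moves coordinate \<open>j\<close>, a one-parameter subgroup of it
  sweeps that coordinate bijectively, since it acts on it by translations.\<close>

lemma orbit_parametrization:
  assumes g0: "g0 \<in> G"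
  shows "j \<le> n \<Longrightarrow> \<exists>gs. orbit_chart v j gs"
proof (induction j)
  case 0
  show ?case by (rule exI[of _ "[]"]) (auto simp: orbit_chart_def agree_def fun_eq_iff)
next
  case (Suc j)
  then have j: "j < n" "j \<le> n" by auto
  obtain gs where oc: "orbit_chart v j gs" using Suc.IH[OF j(2)] by blast
  have gs: "set gs \<subseteq> G"
    and ex: "\<And>h. h \<in> G \<Longrightarrow> \<exists>y\<in>ESp (length gs). agree j (act h v) (word_act 0 gs y v)"
    and uniq: "\<And>y y'. y \<in> ESp (length gs) \<Longrightarrow> y' \<in> ESp (length gs) \<Longrightarrow>
      agree j (word_act 0 gs y v) (word_act 0 gs y' v) \<Longrightarrow> y = y'"
    using oc unfolding orbit_chart_def by (elim conjE, blast)+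
  have imm0: "\<forall>y c. (\<forall>b<j. (\<Sum>i<length gs. c i * partial_deriv i (\<lambda>y. word_act 0 gs y v b) y) = 0) \<longrightarrow>
       (\<forall>i<length gs. c i = 0)"
    using oc unfolding orbit_chart_def by (elim conjE)
  have imm: "\<forall>i<length gs. c i = 0"
    if "\<And>b. b < j \<Longrightarrow> (\<Sum>i<length gs. c i * partial_deriv i (\<lambda>y. word_act 0 gs y v b) y) = 0" for y c
    using imm0[THEN spec[of _ y], THEN spec[of _ c]] that by simp
  show ?case
  proof (cases "\<exists>g\<in>G. agree j (act g v) v \<and> act g v j \<noteq> v j")
    case False
    show ?thesis
      unfolding orbit_chart_def
    proof (intro exI[of _ gs] conjI gs ballI impI allI)
      fix h assume h: "h \<in> G"
      obtain y where y: "y \<in> ESp (length gs)" "agree j (act h v) (word_act 0 gs y v)" using ex[OF h] by blast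
      \<comment> \<open>\<open>u\<close> acts as the word and \<open>u'\<close> undoes it. Then
        \<open>k\<close>, acting as \<open>u'\<close> after \<open>h\<close>, stabilises the first
        \<open>j\<close> coordinates of \<open>v\<close>, hence by the case assumption also
        coordinate \<open>j\<close>; applying \<open>u\<close> again gives the claim for
        \<open>h\<close>.\<close>
      obtain u where u: "u \<in> G" "\<And>w. agree n (act u w) (word_act 0 gs y w)"
        using word_act_in[OF g0 gs, of 0 y] by blast
      obtain u' where u': "u' \<in> G" "\<And>w b. b < n \<Longrightarrow> act u' (act u w) b = w b" "\<And>w b. b < n \<Longrightarrow> act u (act u' w) b = w b"
        using inverse[OF u(1)] by blast
      obtain k where k: "k \<in> G" "\<And>w b. b < n \<Longrightarrow> act k w b = act u' (act h w) b" using mult[OF u'(1) h] by blast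
      have "agree j (act h v) (act u v)"
        using agree_trans[OF y(2) agree_sym[OF agree_mono[OF u(2) j(2)]]] .
      from act_agree[OF u'(1) j(2) this] have "agree j (act k v) v"
        using k(2) u'(2) j by (simp add: agree_def)
      then have "agree (Suc j) (act k v) v" using False k(1) by (auto simp: agree_Suc)
      from act_agree[OF u(1) Suc.prems this]
      have A: "agree (Suc j) (act u (act k v)) (act u v)" .
      have "agree n (act k v) (act u' (act h v))" using k(2) by (simp add: agree_def)
      from act_agree[OF u(1) le_refl this] have B: "agree n (act u (act k v)) (act h v)"
        using u'(3) by (simp add: agree_def)
      have "agree (Suc j) (act h v) (act u v)"
        by (rule agree_trans[OF agree_sym[OF agree_mono[OF B Suc.prems]] A])
      from agree_trans[OF this agree_mono[OF u(2) Suc.prems]]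
      have "agree (Suc j) (act h v) (word_act 0 gs y v)" .
      then show "\<exists>y\<in>ESp (length gs). agree (Suc j) (act h v) (word_act 0 gs y v)" using y(1) by blast
    next
      fix y y' assume "y \<in> ESp (length gs)" "y' \<in> ESp (length gs)"
        "agree (Suc j) (word_act 0 gs y v) (word_act 0 gs y' v)"
      then show "y = y'" using uniq by (simp add: agree_Suc)
    next
      fix y c i
      assume *: "\<forall>b<Suc j. (\<Sum>i<length gs. c i * partial_deriv i (\<lambda>y. word_act 0 gs y v b) y) = 0" and i: "i < length gs"
      have "\<forall>i<length gs. c i = 0" by (rule imm[where c = c and y = y]) (use * in simp)
      then show "c i = 0" using i by blast
    qed
  next
    case True
    then obtain g where g: "g \<in> G" and st: "agree j (act g v) v" and mv: "act g v j \<noteq> v j" by blast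
    define e where "e = act g v j - v j"
    have e: "e \<noteq> 0" using mv by (simp add: e_def)
    let ?k = "length gs"
    let ?gs = "gs @ [g]"
    \<comment> \<open>The new letter fixes the first \<open>j\<close> coordinates of
      \<open>v\<close>, so it affects the old chart only by translating coordinate \<open>j\<close>
      by its parameter times \<open>e\<close>.\<close>
    have below: "word_act 0 ?gs y v b = word_act 0 gs y v b" if "b < j" for y b
      using word_act_agree[OF gs j(2) pw_stabilizer[OF g j(2) st], of 0 y "y ?k"] that
      by (simp add: word_act_snoc agree_def)
    have at_j: "word_act 0 ?gs y v j = word_act 0 gs y v j + y ?k * e" for y
      using word_act_shift[OF gs j(1) pw_stabilizer[OF g j(2) st], of 0 y "y ?k"] pw_linear[OF g j(1) st, of "y ?k"]
      by (simp add: word_act_snoc e_def)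
    have indep: "word_act 0 gs (y(?k := t)) v = word_act 0 gs y v" for y t
      by (rule word_act_local) simp
    show ?thesis
      unfolding orbit_chart_def
    proof (intro exI[of _ ?gs] conjI ballI impI allI)
      show "set ?gs \<subseteq> G" using gs g by simp
      fix h assume h: "h \<in> G"
      obtain y where y: "y \<in> ESp ?k" "agree j (act h v) (word_act 0 gs y v)" using ex[OF h] by blast
      define y' where "y' = y(?k := (act h v j - word_act 0 gs y v j) / e)"
      have "y' \<in> ESp (length ?gs)" using y(1) by (simp add: y'_def)
      moreover have "agree (Suc j) (act h v) (word_act 0 ?gs y' v)"
        using y(2) e unfolding agree_Suc at_j unfolding agree_def
        by (simp add: below) (simp add: y'_def indep)
      ultimately show "\<exists>y\<in>ESp (length ?gs). agree (Suc j) (act h v) (word_act 0 ?gs y v)" by blast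
    next
      fix y y' assume y: "y \<in> ESp (length ?gs)" "y' \<in> ESp (length ?gs)"
        and ag: "agree (Suc j) (word_act 0 ?gs y v) (word_act 0 ?gs y' v)"
      have "y(?k := 0) = y'(?k := 0)"
      proof (rule uniq)
        show "y(?k := 0) \<in> ESp ?k" "y'(?k := 0) \<in> ESp ?k"
          using y by (auto simp: Suc_le_eq)
        show "agree j (word_act 0 gs (y(?k := 0)) v) (word_act 0 gs (y'(?k := 0)) v)"
          using ag unfolding indep agree_Suc unfolding agree_def by (simp add: below)
      qed
      then have 1: "y i = y' i" if "i \<noteq> ?k" for i using that by (metis fun_upd_other)
      have "word_act 0 gs y v = word_act 0 gs y' v" by (rule word_act_local) (use 1 in simp)
      then have "y ?k * e = y' ?k * e" using ag unfolding agree_Suc at_j by simp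
      then have "y ?k = y' ?k" using e by simp
      then show "y = y'" using 1 by (metis ext)
    next
      fix y c i
      assume *: "\<forall>b<Suc j. (\<Sum>i<length ?gs. c i * partial_deriv i (\<lambda>y. word_act 0 ?gs y v b) y) = 0"
        and i: "i < length ?gs"
      \<comment> \<open>The Jacobian is block triangular: the new column vanishes in the old rows
        and has the non-zero entry \<open>e\<close> in row \<open>j\<close>.\<close>
      have 0: "partial_deriv ?k (\<lambda>y. word_act 0 gs y v b) y = 0" for b
        by (rule partial_deriv_independent) (simp add: indep)
      have c: "\<forall>i<?k. c i = 0"
      proof (rule imm[where c = c and y = y])
        fix b assume b: "b < j"
        then show "(\<Sum>i<?k. c i * partial_deriv i (\<lambda>y. word_act 0 gs y v b) y) = 0"
          using *[rule_format, of b] 0[of b] by (simp add: below)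
      qed
      have "partial_deriv ?k (\<lambda>y. word_act 0 ?gs y v j) y = e"
      proof (rule partial_deriv_eqI)
        show "((\<lambda>t. word_act 0 ?gs (y(?k := t)) v j) has_field_derivative e) (at (y ?k))"
          unfolding at_j indep by (auto intro!: derivative_eq_intros)
      qed
      then have "c ?k * e = 0" using *[rule_format, of j] c by simp
      then have "c ?k = 0" using e by simp
      then show "c i = 0" using c i by (auto simp: less_Suc_eq)
    qed
  qed
qed

end

section \<open>Endomorphisms of real vector spaces\<close>

text \<open>Vector fields, families of them and coordinate sequences are all functions; with the
  pointwise structure, \<open>span\<close> and \<open>subspace\<close> apply to each of
  them.\<close>

instantiation "fun" :: (type, real_vector) real_vector
begin

definition "scaleR c f = (\<lambda>x. c *\<^sub>R f x)" for f :: "'a \<Rightarrow> 'b"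

instance
  by standard (auto simp: scaleR_fun_def fun_eq_iff algebra_simps)

end

lemma scaleR_apply [simp]: "(c *\<^sub>R f) x = c *\<^sub>R f x"
  by (simp add: scaleR_fun_def)

lemma minus_fun_apply' [simp]: "(f - g) x = f x - g x"
  by (simp add: fun_diff_def)

lemma uminus_fun_apply' [simp]: "(- f) x = - f x"
  by (simp add: fun_Compl_def)

lemma zero_fun_apply' [simp]: "0 x = 0"
  by (simp add: zero_fun_def)

lemma sum_fun_apply: "(\<Sum>i\<in>I. f i) x = (\<Sum>i\<in>I. f i x)"
  by (induction I rule: infinite_finite_induct) auto

text \<open>As a type of class \<open>real_algebra_1\<close> the operators admit the power series
  calculus below, including operators on an algebra such as ad. The class
  \<open>zero_neq_one\<close> provides a non-zero vector, so that 0 and 1 differ as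
  operators.\<close>

typedef (overloaded) ('v :: "{real_vector, zero_neq_one}") endo = "{f :: 'v \<Rightarrow> 'v. linear f}"
  morphisms app Endo
  by (auto intro: exI[of _ "\<lambda>x. x"] linear_ident)

setup_lifting type_definition_endo

instantiation endo :: ("{real_vector, zero_neq_one}") real_algebra_1
begin

lift_definition zero_endo :: "'a endo" is "\<lambda>x. 0" by (auto intro: linearI)
lift_definition one_endo :: "'a endo" is "\<lambda>x. x" by (auto intro: linearI)
lift_definition plus_endo :: "'a endo \<Rightarrow> 'a endo \<Rightarrow> 'a endo" is "\<lambda>f g x. f x + g x"
  by (rule linear_compose_add)
lift_definition minus_endo :: "'a endo \<Rightarrow> 'a endo \<Rightarrow> 'a endo" is "\<lambda>f g x. f x - g x"
  by (rule linear_compose_sub)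
lift_definition uminus_endo :: "'a endo \<Rightarrow> 'a endo" is "\<lambda>f x. - f x"
  by (rule linear_compose_neg)
lift_definition times_endo :: "'a endo \<Rightarrow> 'a endo \<Rightarrow> 'a endo" is "\<lambda>f g x. f (g x)"
  using linear_compose unfolding o_def by auto
lift_definition scaleR_endo :: "real \<Rightarrow> 'a endo \<Rightarrow> 'a endo" is "\<lambda>c f x. c *\<^sub>R f x"
  by (rule linear_compose_scale_right)

instance
proof
  show "(0 :: 'a endo) \<noteq> 1"
    by transfer (metis zero_neq_one)
qed (transfer; auto simp: fun_eq_iff algebra_simps linear_add linear_scale)+

end

lemma linear_app [simp]: "linear (app f)"
  using app by auto

lemma app_simps [simp]:
  "app 0 v = 0" "app 1 v = v" "app (f + g) v = app f v + app g v"
  "app (f - g) v = app f v - app g v" "app (- f) v = - app f v"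
  "app (f * g) v = app f (app g v)" "app (c *\<^sub>R f) v = c *\<^sub>R app f v"
  by (transfer; simp)+

lemma app_linear [simp]:
  "app f (v + w) = app f v + app f w" "app f (v - w) = app f v - app f w"
  "app f (c *\<^sub>R v) = c *\<^sub>R app f v" "app f 0 = 0" "app f (- v) = - app f v"
  by (simp_all add: linear_add linear_diff linear_scale linear_0 linear_neg)

lemma app_sum: "app (\<Sum>i\<in>I. f i) v = (\<Sum>i\<in>I. app (f i) v)"
  by (induction I rule: infinite_finite_induct) auto

lemma app_sum_right: "app f (\<Sum>i\<in>I. v i) = (\<Sum>i\<in>I. app f (v i))"
  by (simp add: linear_sum)

lemma endo_eqI: "(\<And>v. app f v = app g v) \<Longrightarrow> f = g"
  by transfer auto

lemma app_Endo: "linear f \<Longrightarrow> app (Endo f) v = f v"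
  by (simp add: Endo_inverse)

section \<open>Functional calculus for nilpotent elements\<close>

text \<open>When \<open>a ^ K = 0\<close> this truncated evaluation is an algebra homomorphism from
  power series and respects composition.\<close>

definition fc :: "nat \<Rightarrow> real fps \<Rightarrow> 'a::real_algebra_1 \<Rightarrow> 'a" where
  "fc K f a = (\<Sum>n<K. fps_nth f n *\<^sub>R a ^ n)"

lemma power_eq_0_mono: "a ^ K = 0 \<Longrightarrow> K \<le> n \<Longrightarrow> a ^ n = (0 :: 'a :: real_algebra_1)"
  by (metis le_add_diff_inverse mult_zero_left power_add)

lemma fc_add: "fc K (f + g) a = fc K f a + fc K g a"
  by (simp add: fc_def scaleR_add_left sum.distrib)

lemma fc_diff: "fc K (f - g) a = fc K f a - fc K g a"
  by (simp add: fc_def scaleR_diff_left sum_subtractf)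

lemma fc_one: "K > 0 \<Longrightarrow> fc K 1 a = 1"
proof -
  assume "K > 0"
  have "fc K 1 a = (\<Sum>n<K. if n = 0 then 1 else 0)"
    unfolding fc_def by (intro sum.cong) auto
  then show ?thesis using \<open>K > 0\<close> by simp
qed

lemma fc_X: "K > 1 \<Longrightarrow> fc K fps_X a = a"
proof -
  assume "K > 1"
  have "fc K fps_X a = (\<Sum>n<K. if n = 1 then a else 0)"
    unfolding fc_def by (intro sum.cong) (auto simp: fps_X_def)
  then show ?thesis using \<open>K > 1\<close> by simp
qed

text \<open>Nilpotency removes the terms with \<open>i + j \<ge> K\<close> from the square of index
  pairs and leaves the triangle of the Cauchy product.\<close>

lemma fc_mult:
  assumes "a ^ K = 0"
  shows "fc K (f * g) a = fc K f a * fc K g a"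
proof -
  let ?h = "\<lambda>i j. (f $ i * g $ j) *\<^sub>R a ^ (i + j)"
  have "fc K f a * fc K g a = (\<Sum>i<K. \<Sum>j<K. ?h i j)"
    unfolding fc_def sum_product by (simp add: power_add mult.commute)
  also have "\<dots> = (\<Sum>(i,j)\<in>{..<K} \<times> {..<K}. ?h i j)"
    by (simp add: sum.cartesian_product)
  also have "\<dots> = (\<Sum>(i,j)\<in>{(i,j). i + j < K}. ?h i j)"
    by (rule sum.mono_neutral_right) (auto, metis not_less power_eq_0_mono[OF assms])
  also have "\<dots> = (\<Sum>k<K. \<Sum>i\<le>k. ?h i (k - i))"
    by (rule sum.triangle_reindex)
  also have "\<dots> = fc K (f * g) a"
    unfolding fc_def fps_mult_nth atLeast0AtMost scaleR_left.sum by simp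
  finally show ?thesis by simp
qed

lemma fc_power: "a ^ K = 0 \<Longrightarrow> K > 0 \<Longrightarrow> fc K (f ^ n) a = fc K f a ^ n"
  by (induction n) (auto simp: fc_one fc_mult)

lemma fc_compose:
  assumes a: "a ^ K = 0" and K: "K > 0" and g: "fps_nth g 0 = 0"
  shows "fc K (f oo g) a = fc K f (fc K g a)"
proof -
  have z: "(g ^ i) $ m = 0" if "m < i" for i m
    using startsby_zero_power_prefix[OF g] that by simp
  have "fc K (f oo g) a = (\<Sum>m<K. \<Sum>i\<le>m. (f $ i * (g ^ i) $ m) *\<^sub>R a ^ m)"
    unfolding fc_def fps_compose_nth scaleR_left.sum atLeast0AtMost by simp
  also have "\<dots> = (\<Sum>m<K. \<Sum>i<K. (f $ i * (g ^ i) $ m) *\<^sub>R a ^ m)"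
    by (intro sum.cong refl sum.mono_neutral_left) (auto simp: z)
  also have "\<dots> = (\<Sum>i<K. \<Sum>m<K. (f $ i * (g ^ i) $ m) *\<^sub>R a ^ m)"
    by (rule sum.swap)
  also have "\<dots> = (\<Sum>i<K. (f $ i) *\<^sub>R fc K (g ^ i) a)"
    by (simp add: fc_def scaleR_sum_right)
  finally show ?thesis
    by (simp add: fc_def[of K f] fc_power[OF a K])
qed

lemma fc_larger:
  assumes "a ^ K = 0" "K \<le> L"
  shows "fc L f a = fc K f a"
  unfolding fc_def using assms by (intro sum.mono_neutral_right) (auto simp: power_eq_0_mono)

abbreviation fexp :: "nat \<Rightarrow> 'a::real_algebra_1 \<Rightarrow> 'a" where
  "fexp K \<equiv> fc K (fps_exp 1)"

lemma fexp_def': "fexp K a = (\<Sum>n<K. (1 / fact n) *\<^sub>R a ^ n)"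
  by (simp add: fc_def)

lemma exp_compose_ln: "fps_exp (1::real) oo fps_ln 1 = 1 + fps_X"
proof -
  have 1: "fps_nth (fps_exp (1::real) - 1) 0 = 0" "fps_nth (fps_exp (1::real) - 1) 1 \<noteq> 0" by simp_all
  have "(fps_exp 1 - 1) oo fps_inv (fps_exp (1::real) - 1) = fps_X"
    using fps_inv_right[OF 1] .
  then have "(fps_exp 1 - 1) oo fps_ln (1::real) = fps_X"
    by (simp add: fps_ln_fps_exp_inv)
  then show ?thesis
    by (simp add: fps_compose_sub_distrib algebra_simps)
qed

lemma ln_compose_exp: "fps_ln 1 oo (fps_exp 1 - 1) = (fps_X :: real fps)"
proof -
  have 1: "fps_nth (fps_exp (1::real) - 1) 0 = 0" "fps_nth (fps_exp (1::real) - 1) 1 \<noteq> 0" by simp_all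
  show ?thesis using fps_inv[OF 1] by (simp add: fps_ln_fps_exp_inv)
qed

text \<open>The series of (exp z - 1) / z.\<close>

definition fps_phi :: "real fps" where "fps_phi = Abs_fps (\<lambda>n. 1 / fact (Suc n))"

text \<open>The series of ln (1 + z) / z.\<close>

definition fps_lnq :: "real fps" where "fps_lnq = Abs_fps (\<lambda>n. (-1) ^ n / real (Suc n))"

text \<open>With w = exp z - 1 the product is (z / w) (w / z). It inverts the factor that the
  derivative of exp contributes.\<close>

lemma phi_lnq: "(fps_lnq oo (fps_exp 1 - 1)) * fps_phi = 1"
proof -
  let ?e = "fps_exp (1::real) - 1"
  have e0: "?e $ 0 = 0" by simp
  have 1: "?e = fps_X * fps_phi"
  proof (rule fps_ext)
    fix n show "?e $ n = (fps_X * fps_phi) $ n"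
      by (cases n) (simp_all add: fps_phi_def field_simps del: fact_Suc)
  qed
  have 2: "fps_ln 1 = fps_X * fps_lnq"
    by (rule fps_ext) (auto simp: fps_lnq_def fps_ln_nth)
  have "fps_X = (fps_X * fps_lnq) oo ?e"
    using ln_compose_exp unfolding 2 by simp
  also have "\<dots> = ?e * (fps_lnq oo ?e)"
    by (simp add: fps_compose_mult_distrib[OF e0])
  also have "\<dots> = fps_X * (fps_phi * (fps_lnq oo ?e))"
    by (subst 1) (simp add: mult.assoc)
  finally have "fps_X * 1 = fps_X * (fps_phi * (fps_lnq oo ?e))" by simp
  then show ?thesis by (subst (asm) mult_left_cancel) (auto simp: mult.commute)
qed

lemma commuting_power: "b * c = c * b \<Longrightarrow> b ^ n * c = c * (b ^ n :: 'a :: real_algebra_1)"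
  by (rule power_commuting_commutes)

lemma commuting_binomial:
  fixes b c :: "'a::real_algebra_1"
  assumes bc: "b * c = c * b"
  shows "(b + c) ^ n = (\<Sum>k\<le>n. real (n choose k) *\<^sub>R (b ^ k * c ^ (n - k)))"
proof (induction n)
  case (Suc n)
  have 1: "b * (\<Sum>k\<le>n. real (n choose k) *\<^sub>R (b ^ k * c ^ (n - k)))
    = (\<Sum>k\<le>n. real (n choose k) *\<^sub>R (b ^ Suc k * c ^ (Suc n - Suc k)))"
    by (simp add: sum_distrib_left mult.assoc)
  have 2: "c * (b ^ k * c ^ (n - k)) = b ^ k * c ^ (Suc n - k)" if "k \<le> n" for k
  proof -
    have "c * (b ^ k * c ^ (n - k)) = b ^ k * (c * c ^ (n - k))"
      unfolding mult.assoc[symmetric] commuting_power[OF bc] ..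
    then show ?thesis by (simp add: Suc_diff_le[OF that])
  qed
  have 3: "c * (\<Sum>k\<le>n. real (n choose k) *\<^sub>R (b ^ k * c ^ (n - k)))
    = (\<Sum>k\<le>n. real (n choose k) *\<^sub>R (b ^ k * c ^ (Suc n - k)))"
    unfolding sum_distrib_left by (intro sum.cong) (auto simp: 2)
  also have "\<dots> = (\<Sum>k\<le>Suc n. real (n choose k) *\<^sub>R (b ^ k * c ^ (Suc n - k)))"
    by simp
  also have "\<dots> = c ^ Suc n + (\<Sum>k\<le>n. real (n choose Suc k) *\<^sub>R (b ^ Suc k * c ^ (Suc n - Suc k)))"
    by (subst sum.atMost_Suc_shift) simp
  finally have "(b + c) ^ Suc n = c ^ Suc n +
     (\<Sum>k\<le>n. real (Suc n choose Suc k) *\<^sub>R (b ^ Suc k * c ^ (Suc n - Suc k)))"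
    using 1 unfolding power_Suc[of "b + c"] Suc distrib_right
    by (simp add: scaleR_add_left sum.distrib del: power_Suc)
  also have "\<dots> = (\<Sum>k\<le>Suc n. real (Suc n choose k) *\<^sub>R (b ^ k * c ^ (Suc n - k)))"
    by (subst sum.atMost_Suc_shift) simp
  finally show ?case .
qed simp

text \<open>The product of truncated sums runs over a square, the exponential of the sum over a
  triangle; the mixed monomials in between have to vanish. Nilpotency of \<open>b\<close> and
  \<open>c\<close> separately with index \<open>K\<close> would not give this.\<close>

lemma fexp_add:
  fixes b c :: "'a::real_algebra_1"
  assumes bc: "b * c = c * b" and z: "\<And>i j. K \<le> i + j \<Longrightarrow> b ^ i * c ^ j = 0"
  shows "fexp K (b + c) = fexp K b * fexp K c"
proof -
  let ?h = "\<lambda>i j. (1 / fact i * (1 / fact j)) *\<^sub>R (b ^ i * c ^ j)"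
  have "fexp K b * fexp K c = (\<Sum>i<K. \<Sum>j<K. ?h i j)"
    unfolding fexp_def' sum_product by (simp add: mult.commute)
  also have "\<dots> = (\<Sum>(i,j)\<in>{..<K} \<times> {..<K}. ?h i j)"
    by (simp add: sum.cartesian_product)
  also have "\<dots> = (\<Sum>(i,j)\<in>{(i,j). i + j < K}. ?h i j)"
    by (rule sum.mono_neutral_right) (auto, metis not_less z)
  also have "\<dots> = (\<Sum>k<K. \<Sum>i\<le>k. ?h i (k - i))"
    by (rule sum.triangle_reindex)
  also have "\<dots> = (\<Sum>k<K. (1 / fact k) *\<^sub>R (b + c) ^ k)"
  proof (intro sum.cong refl)
    fix k
    have "(1 / fact i * (1 / fact (k - i))) *\<^sub>R (b ^ i * c ^ (k - i))
       = (1 / fact k) *\<^sub>R (real (k choose i) *\<^sub>R (b ^ i * c ^ (k - i)))" if "i \<le> k" for i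
      using that by (simp add: binomial_fact)
    then show "(\<Sum>i\<le>k. ?h i (k - i)) = (1 / fact k) *\<^sub>R (b + c) ^ k"
      by (simp add: commuting_binomial[OF bc] scaleR_sum_right del: scaleR_scaleR)
  qed
  finally show ?thesis by (simp add: fexp_def')
qed

section \<open>Dynkin's formula in a graded algebra\<close>

lemma commuting_powers: "b * c = c * b \<Longrightarrow> b ^ m * c ^ j = c ^ j * (b ^ m :: 'a :: real_algebra_1)"
  by (metis commuting_power)

text \<open>This is ((b + c)^n - c^n) / b for commuting variables, written without division. It is
  applied with b = ad a and c the right multiplication by a, so that b + c is the left
  multiplication.\<close>

definition dquot :: "'a::real_algebra_1 \<Rightarrow> 'a \<Rightarrow> nat \<Rightarrow> 'a" where
  "dquot b c n = (\<Sum>m<n. real (n choose Suc m) *\<^sub>R (b ^ m * c ^ (n - Suc m)))"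

lemma dquot_0 [simp]: "dquot b c 0 = 0"
  by (simp add: dquot_def)

lemma dquot_Suc:
  assumes bc: "b * c = c * b"
  shows "dquot b c (Suc n) = (b + c) * dquot b c n + c ^ n"
proof -
  have 1: "b * dquot b c n = (\<Sum>m<n. real (n choose Suc m) *\<^sub>R (b ^ Suc m * c ^ (n - Suc m)))"
    by (simp add: dquot_def sum_distrib_left mult.assoc)
  have 2: "c * (b ^ m * c ^ (n - Suc m)) = b ^ m * c ^ (n - m)" if "m < n" for m
  proof -
    have "c * (b ^ m * c ^ (n - Suc m)) = b ^ m * (c * c ^ (n - Suc m))"
      unfolding mult.assoc[symmetric] commuting_power[OF bc] ..
    also have "c * c ^ (n - Suc m) = c ^ (n - m)"
      using that by (metis Suc_diff_Suc power_Suc)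
    finally show ?thesis .
  qed
  have 3: "c * dquot b c n = (\<Sum>m<n. real (n choose Suc m) *\<^sub>R (b ^ m * c ^ (n - m)))"
    unfolding dquot_def sum_distrib_left by (intro sum.cong) (auto simp: 2)
  have "dquot b c (Suc n) = (\<Sum>m<Suc n. real (n choose m) *\<^sub>R (b ^ m * c ^ (n - m)))
      + (\<Sum>m<Suc n. real (n choose Suc m) *\<^sub>R (b ^ m * c ^ (n - m)))"
    unfolding dquot_def by (simp add: scaleR_add_left sum.distrib[symmetric] del: sum.lessThan_Suc)
  also have "(\<Sum>m<Suc n. real (n choose m) *\<^sub>R (b ^ m * c ^ (n - m))) = c ^ n + b * dquot b c n"
    unfolding 1 by (subst sum.lessThan_Suc_shift) simp
  also have "(\<Sum>m<Suc n. real (n choose Suc m) *\<^sub>R (b ^ m * c ^ (n - m))) = c * dquot b c n"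
    unfolding 3 by simp
  finally show ?thesis by (simp add: algebra_simps)
qed

text \<open>The identity (exp (b + c) - exp c) / b = exp c (exp b - 1) / b. Division by
  \<open>b\<close> lowers the degree by one, hence \<open>Suc M\<close> terms against vanishing from
  degree \<open>M\<close>.\<close>

lemma sum_dquot:
  fixes b c :: "'a::real_algebra_1"
  assumes bc: "b * c = c * b" and z: "\<And>i j. M \<le> i + j \<Longrightarrow> b ^ i * c ^ j = 0"
  shows "(\<Sum>n<Suc M. (1 / fact n) *\<^sub>R dquot b c n) = fexp (Suc M) c * fc (Suc M) fps_phi b"
proof -
  let ?h = "\<lambda>i j. (1 / fact (Suc i) * (1 / fact j)) *\<^sub>R (b ^ i * c ^ j)"
  have "fexp (Suc M) c * fc (Suc M) fps_phi b
      = (\<Sum>j<Suc M. \<Sum>i<Suc M. (1 / fact j * (1 / fact (Suc i))) *\<^sub>R (c ^ j * b ^ i))"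
    unfolding fexp_def' sum_product fc_def fps_phi_def by (simp add: mult.commute del: sum.lessThan_Suc fact_Suc)
  also have "\<dots> = (\<Sum>i<Suc M. \<Sum>j<Suc M. ?h i j)"
    by (subst sum.swap) (simp only: commuting_powers[OF bc] mult.commute)
  also have "\<dots> = (\<Sum>(i,j)\<in>{..<Suc M} \<times> {..<Suc M}. ?h i j)"
    by (simp only: sum.cartesian_product)
  also have "\<dots> = (\<Sum>(i,j)\<in>{(i,j). i + j < M}. ?h i j)"
    by (rule sum.mono_neutral_right) (auto simp del: fact_Suc, metis not_less z)
  also have "\<dots> = (\<Sum>k<M. \<Sum>i\<le>k. ?h i (k - i))"
    by (rule sum.triangle_reindex)
  also have "\<dots> = (\<Sum>k<M. (1 / fact (Suc k)) *\<^sub>R dquot b c (Suc k))"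
  proof (intro sum.cong refl)
    fix k
    have "(1 / fact (Suc i) * (1 / fact (k - i))) *\<^sub>R (b ^ i * c ^ (k - i))
       = (1 / fact (Suc k)) *\<^sub>R (real (Suc k choose Suc i) *\<^sub>R (b ^ i * c ^ (Suc k - Suc i)))" if "i \<le> k" for i
      using that by (simp add: binomial_fact del: fact_Suc binomial_Suc_Suc)
    then show "(\<Sum>i\<le>k. ?h i (k - i)) = (1 / fact (Suc k)) *\<^sub>R dquot b c (Suc k)"
      unfolding dquot_def lessThan_Suc_atMost scaleR_sum_right by (intro sum.cong) auto
  qed
  also have "\<dots> = (\<Sum>n<Suc M. (1 / fact n) *\<^sub>R dquot b c n)"
    by (subst sum.lessThan_Suc_shift) simp
  finally show ?thesis by simp
qed

section \<open>Commutators, multiplication operators and the derivative of the exponential\<close>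

definition comm :: "'a::ring \<Rightarrow> 'a \<Rightarrow> 'a" where "comm a b = a * b - b * a"

lemma comm_self [simp]: "comm a a = 0" "comm a 0 = 0"
  by (simp_all add: comm_def)

definition adE :: "'a::real_algebra_1 \<Rightarrow> 'a endo" where "adE a = Endo (comm a)"
definition lE :: "'a::real_algebra_1 \<Rightarrow> 'a endo" where "lE a = Endo (\<lambda>w. a * w)"
definition rE :: "'a::real_algebra_1 \<Rightarrow> 'a endo" where "rE a = Endo (\<lambda>w. w * a)"

lemma app_adE [simp]: "app (adE a) w = comm a w"
  unfolding adE_def by (subst app_Endo) (auto intro!: linearI simp: comm_def algebra_simps)
lemma app_lE [simp]: "app (lE a) w = a * w"
  unfolding lE_def by (subst app_Endo) (auto intro!: linearI simp: algebra_simps)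
lemma app_rE [simp]: "app (rE a) w = w * a"
  unfolding rE_def by (subst app_Endo) (auto intro!: linearI simp: algebra_simps)

lemma lE_adE: "lE a = adE a + rE a"
  by (rule endo_eqI) (simp add: comm_def)
lemma adE_lE: "adE a = lE a + - rE a"
  by (rule endo_eqI) (simp add: comm_def)
lemma lE_rE: "lE a * - rE a = - rE a * lE a"
  by (rule endo_eqI) (simp add: mult.assoc)
lemma adE_rE: "adE a * rE a = rE a * adE a"
  by (rule endo_eqI) (simp add: comm_def algebra_simps)

lemma app_lE_power: "app (lE a ^ n) w = a ^ n * w"
  by (induction n) (auto simp: mult.assoc)
lemma app_rE_power: "app (rE a ^ n) w = w * a ^ n"
  by (induction n arbitrary: w) (auto simp: mult.assoc power_commutes)

lemma app_fc_lE: "app (fc K f (lE a)) w = fc K f a * w"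
  by (simp add: fc_def app_sum app_lE_power sum_distrib_right)
lemma app_fc_rE: "app (fc K f (rE a)) w = w * fc K f a"
  by (simp add: fc_def app_sum app_rE_power sum_distrib_left)

text \<open>Expanded in the commuting left and right multiplications, every monomial of total degree
  \<open>2 * N + 1\<close> contains one of them to a power above \<open>N\<close>.\<close>

lemma adE_rE_nilpotent:
  assumes a: "\<And>n. n > N \<Longrightarrow> a ^ n = 0" and ij: "2 * N + 1 \<le> i + j"
  shows "adE a ^ i * rE a ^ j = 0"
proof -
  have l: "lE a ^ n = 0" if "n > N" for n
    by (rule endo_eqI) (simp add: app_lE_power a that)
  have r: "rE a ^ n = 0" if "n > N" for n
    by (rule endo_eqI) (simp add: app_rE_power a that)
  have "lE a ^ k * (- rE a) ^ (i - k) * rE a ^ j = 0" if "k \<le> i" for k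
  proof -
    have "k > N \<or> i - k + j > N" using ij that by linarith
    then have "lE a ^ k * rE a ^ (i - k + j) = 0" using l r by auto
    then show ?thesis
      by (subst power_minus) (simp add: mult.assoc power_add endo_eqI flip: minus_one_power_iff
          | cases "even (i - k)"; simp add: mult.assoc power_add)+
  qed
  then show ?thesis
    unfolding adE_lE commuting_binomial[OF lE_rE] sum_distrib_right by (intro sum.neutral) auto
qed

text \<open>Left multiplication is the sum of the commuting operators ad a and right multiplication;
  exponentiating this sum gives the conjugation formula.\<close>

lemma fexp_conj:
  assumes a: "\<And>n. n > N \<Longrightarrow> a ^ n = 0"
  shows "fexp (2 * N + 2) a * w = app (fexp (2 * N + 2) (adE a)) w * fexp (2 * N + 2) a"
proof -
  have "app (fexp (2 * N + 2) (lE a)) w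
     = app (fexp (2 * N + 2) (rE a) * fexp (2 * N + 2) (adE a)) w"
    unfolding lE_adE add.commute[of "adE a"]
    by (subst fexp_add) (auto simp: adE_rE commuting_powers[OF adE_rE[symmetric]] intro!: adE_rE_nilpotent[OF a])
  then show ?thesis by (simp add: app_fc_lE app_fc_rE)
qed

lemma comm_derivation: "comm t (a * b) = comm t a * b + a * comm t b"
  by (simp add: comm_def algebra_simps)

lemma comm_add: "comm t (a + b) = comm t a + comm t b"
  by (simp add: comm_def algebra_simps)

lemma comm_scale: "comm t (c *\<^sub>R a) = c *\<^sub>R comm t (a :: 'a :: real_algebra)"
  by (simp add: comm_def algebra_simps)

lemma comm_sum: "comm t (\<Sum>i\<in>I. f i) = (\<Sum>i\<in>I. comm t (f i))"
  by (simp add: comm_def sum_distrib_left sum_distrib_right sum_subtractf)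

text \<open>The Leibniz rule gives the sum of L^i R^j over i + j = n - 1, that is (L^n - R^n) / (L -
  R), where L - R = ad a.\<close>

lemma comm_power: "comm t (a ^ n) = app (dquot (adE a) (rE a) n) (comm t a)"
proof (induction n)
  case 0
  then show ?case by (simp add: comm_def)
next
  case (Suc n)
  have "app (dquot (adE a) (rE a) (Suc n)) (comm t a) = a * comm t (a ^ n) + comm t a * a ^ n"
    unfolding dquot_Suc[OF adE_rE] lE_adE[symmetric] by (simp add: Suc app_rE_power)
  then show ?case by (simp add: comm_derivation)
qed

text \<open>The derivative of the exponential map, for the inner derivation \<open>comm t\<close>:
  its logarithmic derivative is (exp (ad a) - 1) / ad a applied to the derivative of
  \<open>a\<close>.\<close>

lemma comm_fexp:
  assumes a: "\<And>n. n > N \<Longrightarrow> a ^ n = 0"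
  shows "comm t (fexp (2 * N + 2) a) = app (fc (2 * N + 2) fps_phi (adE a)) (comm t a) * fexp (2 * N + 2) a"
proof -
  have S: "2 * N + 2 = Suc (2 * N + 1)" by simp
  have "comm t (fexp (2 * N + 2) a) = app (\<Sum>n<2 * N + 2. (1 / fact n) *\<^sub>R dquot (adE a) (rE a) n) (comm t a)"
    by (simp add: fexp_def' comm_sum comm_scale comm_power app_sum del: sum.lessThan_Suc)
  also have "\<dots> = app (fexp (2 * N + 2) (rE a) * fc (2 * N + 2) fps_phi (adE a)) (comm t a)"
    unfolding S by (subst sum_dquot) (auto simp: adE_rE intro!: adE_rE_nilpotent[OF a])
  finally show ?thesis by (simp add: app_fc_rE)
qed

fun nest :: "'a::ring list \<Rightarrow> 'a" where
  "nest [] = 0"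
| "nest [v] = v"
| "nest (v # w) = comm v (nest w)"

lemma nest_Cons: "w \<noteq> [] \<Longrightarrow> nest (v # w) = comm v (nest w)"
  by (cases w) auto

lemma nest_replicate_append: "w \<noteq> [] \<Longrightarrow> nest (replicate r a @ w) = app (adE a ^ r) (nest w)"
  by (induction r) (auto simp: nest_Cons)

lemma nest_replicate: "nest (replicate n a) = (if n = 1 then a else 0)"
proof (cases n)
  case (Suc m)
  have "nest (replicate (Suc (Suc k)) a) = 0" for k
    by (induction k) auto
  then show ?thesis using Suc by (cases m) auto
qed simp

section \<open>The Dynkin series in an algebra with a degree operator\<close>

abbreviation total_degree :: "(nat \<times> nat) list \<Rightarrow> nat" where
  "total_degree ps \<equiv> \<Sum>(r, s)\<leftarrow>ps. r + s"

abbreviation fact_prod :: "(nat \<times> nat) list \<Rightarrow> real" where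
  "fact_prod ps \<equiv> \<Prod>(r, s)\<leftarrow>ps. fact r * fact s"

lemma length_dynkin_word: "length (dynkin_word x y ps) = total_degree ps"
proof (induction ps)
  case (Cons p ps)
  then show ?case by (cases p) (simp add: dynkin_word_def)
qed (simp add: dynkin_word_def)

lemma set_dynkin_word: "set (dynkin_word x y ps) \<subseteq> {x, y}"
proof
  fix v assume "v \<in> set (dynkin_word x y ps)"
  then obtain p where "v \<in> set (replicate (fst p) x @ replicate (snd p) y)"
    unfolding dynkin_word_def set_concat set_map case_prod_beta by blast
  then show "v \<in> {x, y}"
    unfolding set_append Un_iff in_set_replicate by blast
qed

lemma dynkin_word_Cons: "dynkin_word x y ((r, s) # ps) = replicate r x @ replicate s y @ dynkin_word x y ps"
  by (simp add: dynkin_word_def)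

lemma total_degree_bound: "(\<forall>(r, s)\<in>set ps. 0 < r + s) \<Longrightarrow>
   length ps \<le> total_degree ps \<and> (\<forall>q\<in>set ps. fst q \<le> total_degree ps \<and> snd q \<le> total_degree ps)"
proof (induction ps)
  case (Cons p ps)
  obtain r s where p: "p = (r, s)" by (cases p)
  have IH: "length ps \<le> total_degree ps"
    "\<And>q. q \<in> set ps \<Longrightarrow> fst q \<le> total_degree ps" "\<And>q. q \<in> set ps \<Longrightarrow> snd q \<le> total_degree ps"
    using Cons by auto
  have "total_degree (p # ps) = r + s + total_degree ps" "r + s > 0"
    using Cons.prems p by auto
  with IH show ?case by (auto simp: p intro: trans_le_add2)
qed simp

text \<open>Here \<open>t\<close> is a degree operator, \<open>E = exp x exp y\<close> and \<open>A = log E\<close>. Computing the derivation \<open>comm t\<close>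
  of \<open>E\<close> in two ways gives \<open>comm t A = comm t Z\<close> for the Dynkin series \<open>Z\<close>; the derivation is injective on
  elements without constant term, so \<open>A = Z\<close>.\<close>

locale dynkin_setup =
  fixes x y t :: "'a::real_algebra_1" and N :: nat
  assumes tx: "comm t x = x" and ty: "comm t y = y"
    and words: "\<And>w. set w \<subseteq> {x, y} \<Longrightarrow> N < length w \<Longrightarrow> prod_list w = 0"
begin

text \<open>The filtration by word length in the subalgebra generated by \<open>x\<close> and
  \<open>y\<close>. \<open>J 1\<close> consists of the elements without constant term, and
  \<open>J k\<close> is zero for \<open>k > N\<close>.\<close>

definition J :: "nat \<Rightarrow> 'a set" where
  "J k = span {prod_list w | w. set w \<subseteq> {x, y} \<and> k \<le> length w}"

lemma J_sub: "subspace (J k)"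
  unfolding J_def by simp

lemma J_word: "set w \<subseteq> {x, y} \<Longrightarrow> k \<le> length w \<Longrightarrow> prod_list w \<in> J k"
  unfolding J_def by (intro span_base) auto

lemma J_induct [consumes 1, case_names zero step]:
  assumes "a \<in> J k" "P 0"
    "\<And>c w b. set w \<subseteq> {x, y} \<Longrightarrow> k \<le> length w \<Longrightarrow> P b \<Longrightarrow> P (c *\<^sub>R prod_list w + b)"
  shows "P a"
  using assms(1) unfolding J_def
  by (rule span_induct_alt) (use assms(2,3) in auto)

lemma J_add: "a \<in> J k \<Longrightarrow> b \<in> J k \<Longrightarrow> a + b \<in> J k"
  by (rule subspace_add[OF J_sub])
lemma J_diff: "a \<in> J k \<Longrightarrow> b \<in> J k \<Longrightarrow> a - b \<in> J k"
  by (rule subspace_diff[OF J_sub])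
lemma J_scale: "a \<in> J k \<Longrightarrow> c *\<^sub>R a \<in> J k"
  by (rule subspace_scale[OF J_sub])
lemma J_0: "0 \<in> J k"
  by (rule subspace_0[OF J_sub])
lemma J_sum: "(\<And>i. i \<in> I \<Longrightarrow> f i \<in> J k) \<Longrightarrow> sum f I \<in> J k"
  by (rule subspace_sum[OF J_sub])

lemma J_mult:
  assumes "a \<in> J i" "b \<in> J j"
  shows "a * b \<in> J (i + j)"
  using assms(1)
proof (induction rule: J_induct)
  case (step c w a)
  have "prod_list w * b \<in> J (i + j)"
    using assms(2)
  proof (induction rule: J_induct)
    case (step d v b)
    have "prod_list w * prod_list v \<in> J (i + j)"
      using J_word[of "w @ v" "i + j"] step \<open>set w \<subseteq> {x, y}\<close> \<open>i \<le> length w\<close> by auto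
    then show ?case using step by (auto simp: distrib_left intro!: J_add J_scale)
  qed (auto simp: J_0)
  then show ?case using step by (auto simp: distrib_right intro!: J_add J_scale)
qed (auto simp: J_0)

lemma J_eq_0: "a \<in> J k \<Longrightarrow> N < k \<Longrightarrow> a = 0"
  by (induction rule: J_induct) (auto simp: words)

lemma J_mono: "a \<in> J j \<Longrightarrow> i \<le> j \<Longrightarrow> a \<in> J i"
  by (induction rule: J_induct) (auto simp: J_0 intro!: J_add J_scale J_word)

lemma J_1: "1 \<in> J 0"
  using J_word[of "[]" 0] by simp

lemma J_power: "a \<in> J 1 \<Longrightarrow> a ^ n \<in> J n"
proof (induction n)
  case (Suc n)
  then show ?case using J_mult[of a 1 "a ^ n" n] by simp
qed (simp add: J_1)

lemma J_nil: "a \<in> J 1 \<Longrightarrow> n > N \<Longrightarrow> a ^ n = 0"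
  using J_power J_eq_0 by blast

lemma xJ: "x \<in> J 1" and yJ: "y \<in> J 1"
  using J_word[of "[x]" 1] J_word[of "[y]" 1] by auto

lemma J_fc: "a \<in> J 1 \<Longrightarrow> f $ 0 = 0 \<Longrightarrow> fc K f a \<in> J 1"
  unfolding fc_def
proof (intro J_sum)
  fix n assume "a \<in> J 1" "f $ 0 = 0"
  then show "(f $ n) *\<^sub>R a ^ n \<in> J 1"
    by (cases n) (auto simp: J_0 simp del: power_Suc intro!: J_scale intro: J_mono[OF J_power])
qed

lemma J_comm: "a \<in> J i \<Longrightarrow> b \<in> J j \<Longrightarrow> comm a b \<in> J (i + j)"
  unfolding comm_def using J_mult[of a i b j] J_mult[of b j a i] by (auto simp: add.commute intro: J_diff)

lemma J_nest: "set w \<subseteq> {x, y} \<Longrightarrow> w \<noteq> [] \<Longrightarrow> nest w \<in> J (length w)"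
proof (induction w rule: nest.induct)
  case (3 v u w)
  then show ?case using J_comm[of v 1 "nest (u # w)" "length (u # w)"] xJ yJ by auto
qed (use xJ yJ in auto)

lemma comm_t_nest: "set w \<subseteq> {x, y} \<Longrightarrow> w \<noteq> [] \<Longrightarrow> comm t (nest w) = real (length w) *\<^sub>R nest w"
proof (induction w rule: nest.induct)
  case (3 v u w)
  let ?n = "nest (u # w)"
  have "comm t (comm v ?n) = comm (comm t v) ?n + comm v (comm t ?n)"
    by (simp add: comm_def algebra_simps)
  also have "comm t v = v" using 3 tx ty by auto
  also have "comm t ?n = real (length (u # w)) *\<^sub>R ?n" using 3 by simp
  finally show ?case by (simp add: comm_scale comm_add scaleR_add_left scaleR_2)
qed (use tx ty in auto)

lemma comm_t_word: "set w \<subseteq> {x, y} \<Longrightarrow> comm t (prod_list w) = real (length w) *\<^sub>R prod_list w"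
proof (induction w)
  case (Cons v w)
  have "comm t v = v" using Cons tx ty by auto
  then show ?case using Cons by (simp add: comm_derivation algebra_simps)
qed (simp add: comm_def)

text \<open>On \<open>J 1\<close> the derivation \<open>comm t\<close> is annihilated by \<open>\<Prod>m=1..N. (comm t - m)\<close>, so \<open>0\<close> is not an
  eigenvalue.\<close>

lemma comm_t_inj:
  assumes a: "a \<in> J 1" and 0: "comm t a = 0"
  shows "a = 0"
proof -
  define p where "p = (\<lambda>b. foldr (\<lambda>m b. comm t b - real m *\<^sub>R b) [1..<Suc N] b)"
  have p_add: "foldr (\<lambda>m b. comm t b - real m *\<^sub>R b) ms (c *\<^sub>R b + d)
     = c *\<^sub>R foldr (\<lambda>m b. comm t b - real m *\<^sub>R b) ms b + foldr (\<lambda>m b. comm t b - real m *\<^sub>R b) ms d"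
    for ms c b d
    by (induction ms) (auto simp: comm_add comm_scale algebra_simps)
  have eig: "foldr (\<lambda>m b. comm t b - real m *\<^sub>R b) ms b = (\<Prod>m\<leftarrow>ms. r - real m) *\<^sub>R b"
    if "comm t b = r *\<^sub>R b" for ms b r
    by (induction ms) (auto simp: comm_scale that algebra_simps)
  have "p a = 0" using a
  proof (induction rule: J_induct)
    case zero
    then show ?case using eig[of 0 0] by (simp add: p_def comm_def)
  next
    case (step c w b)
    have "p (prod_list w) = 0"
    proof (cases "length w > N")
      case True
      then show ?thesis using step words eig[of 0 0] by (simp add: p_def comm_def)
    next
      case False
      then have "(\<Prod>m\<leftarrow>[1..<Suc N]. real (length w) - real m) = 0"
        using step unfolding prod_list_zero_iff by (auto simp del: upt_Suc)
      then show ?thesis unfolding p_def using eig[OF comm_t_word[OF step(1)]] by simp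
    qed
    then show ?case using step p_add unfolding p_def by simp
  qed
  moreover have "p a = (\<Prod>m\<leftarrow>[1..<Suc N]. 0 - real m) *\<^sub>R a"
    unfolding p_def by (rule eig) (simp add: 0)
  moreover have "(\<Prod>m\<leftarrow>[1..<Suc N]. 0 - real m) \<noteq> 0"
    unfolding prod_list_zero_iff by (auto simp del: upt_Suc)
  ultimately show ?thesis by simp
qed

definition "K = 2 * N + 2"

lemma K_bounds: "N < K" "0 < K" "Suc 0 < K"
  by (simp_all add: K_def)

definition "E = fexp K x * fexp K y"
definition "A = fc K (fps_ln 1) (E - 1)"

lemma fexp_J: "a \<in> J 1 \<Longrightarrow> fexp K a - 1 \<in> J 1"
proof -
  assume a: "a \<in> J 1"
  have "fexp K a - 1 = fc K (fps_exp 1 - 1) a" by (simp add: fc_diff fc_one K_bounds)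
  then show ?thesis using J_fc[OF a, of "fps_exp 1 - 1" K] by simp
qed

lemma E_J: "E - 1 \<in> J 1"
proof -
  have "E - 1 = (fexp K x - 1) * (fexp K y - 1) + (fexp K x - 1) + (fexp K y - 1)"
    by (simp add: E_def algebra_simps)
  moreover have "(fexp K x - 1) * (fexp K y - 1) \<in> J 1"
    using J_mult[OF fexp_J[OF xJ] fexp_J[OF yJ]] J_mono[of _ "1 + 1" 1] by simp
  ultimately show ?thesis using fexp_J[OF xJ] fexp_J[OF yJ] J_add by presburger
qed

lemma A_J: "A \<in> J 1"
  unfolding A_def by (rule J_fc[OF E_J]) simp

lemma fexp_A: "fexp K A = E"
proof -
  have "(E - 1) ^ K = 0" using J_nil[OF E_J K_bounds(1)] .
  then have "fexp K A = fc K (fps_exp 1 oo fps_ln 1) (E - 1)"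
    unfolding A_def by (subst fc_compose) (auto simp: K_bounds)
  then show ?thesis unfolding exp_compose_ln fc_add by (simp add: fc_one fc_X K_bounds)
qed

lemma fexp_minus: "a \<in> J 1 \<Longrightarrow> fexp K a * fexp K (- a) = 1"
proof -
  assume a: "a \<in> J 1"
  have "fexp K a * fexp K (- a) = fexp K (a + - a)"
  proof (rule fexp_add[symmetric])
    fix i j :: nat assume "K \<le> i + j"
    then have "a ^ (i + j) = 0" using J_nil[OF a, of "i + j"] K_bounds(1) by linarith
    then show "a ^ i * (- a) ^ j = 0" by (subst power_minus) (cases "even j"; simp flip: power_add)
  qed simp
  also have "\<dots> = 1"
    using fc_larger[of 0 1 K "fps_exp 1"] K_bounds by (simp add: fc_def)
  finally show ?thesis .
qed

lemma E_cancel: "v * E = w * E \<Longrightarrow> v = w"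
proof -
  assume "v * E = w * E"
  then have "v * E * (fexp K (- y) * fexp K (- x)) = w * E * (fexp K (- y) * fexp K (- x))" by simp
  moreover have "E * (fexp K (- y) * fexp K (- x)) = 1"
    using fexp_minus[OF xJ] fexp_minus[OF yJ] unfolding E_def by (metis mult.assoc mult.right_neutral)
  ultimately show ?thesis by (simp add: mult.assoc)
qed

text \<open>\<open>C\<close> is conjugation by \<open>E\<close>, and \<open>V\<close> is the
  logarithmic derivative of \<open>E\<close>: it satisfies \<open>comm t E = V * E\<close>.\<close>

definition "C = fexp K (adE x) * fexp K (adE y)"
definition "V = x + app (fexp K (adE x)) y"

text \<open>Conjugation by \<open>E\<close> is computed twice, once from \<open>E\<close> = exp
  \<open>A\<close> and once from its two factors.\<close>

lemma exp_adA: "fexp K (adE A) = C"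
proof (rule endo_eqI)
  fix w
  have "app (fexp K (adE A)) w * E = E * w"
    using fexp_conj[of N A w, folded K_def] J_nil[OF A_J] by (simp only: fexp_A)
  also have "\<dots> = fexp K x * (app (fexp K (adE y)) w * fexp K y)"
    using fexp_conj[of N y w, folded K_def] J_nil[OF yJ] by (simp only: E_def mult.assoc)
  also have "\<dots> = app C w * E"
    using fexp_conj[of N x "app (fexp K (adE y)) w", folded K_def] J_nil[OF xJ]
    by (simp only: E_def C_def mult.assoc[symmetric] app_simps)
  finally show "app (fexp K (adE A)) w = app C w" by (rule E_cancel)
qed

lemma app_fc_kernel:
  assumes "app T v = 0" "L > 0"
  shows "app (fc L f T) v = (f $ 0) *\<^sub>R v"
proof -
  have "app (T ^ n) v = (if n = 0 then v else 0)" for n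
    by (induction n) (auto simp: assms(1))
  then have "app (fc L f T) v = (\<Sum>n<L. if n = 0 then (f $ 0) *\<^sub>R v else 0)"
    unfolding fc_def app_sum by (intro sum.cong) auto
  then show ?thesis using assms(2) by simp
qed

text \<open>Here \<open>comm t a = a\<close> is killed by ad a, so only the constant term 1 of
  \<open>fps_phi\<close> acts.\<close>

lemma comm_t_fexp: "comm t a = a \<Longrightarrow> a \<in> J 1 \<Longrightarrow> comm t (fexp K a) = a * fexp K a"
  using comm_fexp[of N a t, folded K_def] J_nil[of a] K_bounds by (simp add: app_fc_kernel fps_phi_def)

lemma comm_t_E: "comm t E = V * E"
proof -
  have "comm t E = x * E + fexp K x * (y * fexp K y)"
    by (simp add: E_def comm_derivation comm_t_fexp[OF tx xJ] comm_t_fexp[OF ty yJ] mult.assoc)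
  also have "fexp K x * (y * fexp K y) = app (fexp K (adE x)) y * E"
    using fexp_conj[of N x y, folded K_def] J_nil[OF xJ] by (simp only: E_def mult.assoc[symmetric])
  finally show ?thesis by (simp add: V_def distrib_right)
qed

lemma adE_A_nil: "adE A ^ K = 0"
  using adE_rE_nilpotent[of N A K 0] J_nil[OF A_J] by (simp add: K_def)

text \<open>Comparing the two logarithmic derivatives of exp \<open>A\<close> gives \<phi>(ad
  \<open>A\<close>) (comm t \<open>A\<close>) = \<open>V\<close>, and \<open>phi_lnq\<close> inverts
  \<phi>(ad \<open>A\<close>) as a series in exp (ad \<open>A\<close>) - 1 =
  \<open>C - 1\<close>.\<close>

lemma comm_t_A: "comm t A = app (fc K fps_lnq (C - 1)) V"
proof -
  have "app (fc K fps_phi (adE A)) (comm t A) * E = V * E"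
    using comm_fexp[of N A t, folded K_def] J_nil[OF A_J] comm_t_E by (simp only: fexp_A)
  then have 1: "app (fc K fps_phi (adE A)) (comm t A) = V" by (rule E_cancel)
  have 2: "fc K (fps_exp 1 - 1) (adE A) = C - 1"
    by (simp add: fc_diff exp_adA fc_one K_bounds)
  have "fc K fps_lnq (C - 1) * fc K fps_phi (adE A)
     = fc K ((fps_lnq oo (fps_exp 1 - 1)) * fps_phi) (adE A)"
    unfolding 2[symmetric] by (simp add: fc_mult[OF adE_A_nil] fc_compose[OF adE_A_nil] K_bounds)
  also have "\<dots> = 1" unfolding phi_lnq by (rule fc_one[OF K_bounds(2)])
  finally have "app (fc K fps_lnq (C - 1) * fc K fps_phi (adE A)) (comm t A) = comm t A" by simp
  then show ?thesis by (simp add: 1)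
qed

text \<open>A list in \<open>LL n\<close> is a choice of one term from each of \<open>n\<close>
  factors exp x exp y - 1, and \<open>beta n\<close> collects the corresponding nested brackets. It
  turns out that \<open>beta (Suc n)\<close> is \<open>(C - 1) ^ n\<close> applied to
  \<open>V\<close>. Entries are bounded by \<open>K\<close> only to keep the index sets
  finite.\<close>

definition "Box = {..<K} \<times> {..<K} - {(0, 0)}"
definition "LL n = {ps. set ps \<subseteq> Box \<and> length ps = n}"
definition "beta n = (\<Sum>ps\<in>LL n. (1 / fact_prod ps) *\<^sub>R nest (dynkin_word x y ps))"

lemma finite_box: "finite Box"
  by (simp add: Box_def)

lemma finite_LL: "finite (LL n)"
  unfolding LL_def using finite_lists_length_eq[OF finite_box] .

lemma fexp_minus_1: "C - 1 = (\<Sum>(r, s)\<in>Box. (1 / (fact r * fact s)) *\<^sub>R (adE x ^ r * adE y ^ s))"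
proof -
  have "C = (\<Sum>(r, s)\<in>{..<K} \<times> {..<K}. (1 / (fact r * fact s)) *\<^sub>R (adE x ^ r * adE y ^ s))"
    unfolding C_def fexp_def' sum_product sum.cartesian_product[symmetric]
    by (simp add: mult.commute)
  also have "\<dots> = 1 + (\<Sum>(r, s)\<in>Box. (1 / (fact r * fact s)) *\<^sub>R (adE x ^ r * adE y ^ s))"
    unfolding Box_def by (subst sum.remove[of _ "(0, 0)"]) (auto simp: K_bounds)
  finally show ?thesis by simp
qed

lemma nest_replicate2: "nest (replicate r x @ replicate s y)
   = (if s = 0 then if r = 1 then x else 0 else if s = 1 then app (adE x ^ r) y else 0)"
  by (cases s) (auto simp: nest_replicate nest_replicate_append simp del: replicate_Suc)

text \<open>A right-nested bracket ending in two equal letters is zero, so a single block survives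
  only as x alone or as (ad x)^r y; these terms sum to x + exp (ad x) y.\<close>

lemma beta_1: "beta (Suc 0) = V"
proof -
  let ?g = "\<lambda>r s. (1 / (fact r * fact s)) *\<^sub>R nest (replicate r x @ replicate s y)"
  have LL1: "LL (Suc 0) = (\<lambda>p. [p]) ` Box"
    unfolding LL_def by (auto simp: length_Suc_conv)
  have inner: "(\<Sum>s<K. ?g r s) = (if r = 1 then x else 0) + (1 / fact r) *\<^sub>R app (adE x ^ r) y" for r
  proof -
    have "(\<Sum>s<K. ?g r s) = (\<Sum>s\<in>{0, 1}. ?g r s)"
      using K_bounds by (intro sum.mono_neutral_right) (auto simp: nest_replicate2)
    then show ?thesis by (simp add: nest_replicate2)
  qed
  have "beta (Suc 0) = (\<Sum>(r, s)\<in>Box. ?g r s)"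
    unfolding beta_def LL1 by (subst sum.reindex) (auto simp: inj_on_def dynkin_word_def intro!: sum.cong)
  also have "\<dots> = (\<Sum>(r, s)\<in>{..<K} \<times> {..<K}. ?g r s)"
    unfolding Box_def by (rule sum.mono_neutral_left) auto
  also have "\<dots> = (\<Sum>r<K. \<Sum>s<K. ?g r s)"
    by (simp add: sum.cartesian_product)
  also have "\<dots> = V"
    unfolding inner sum.distrib V_def using K_bounds by (simp add: fexp_def' app_sum)
  finally show ?thesis .
qed

lemma dynkin_word_nonempty: "ps \<noteq> [] \<Longrightarrow> set ps \<subseteq> Box \<Longrightarrow> dynkin_word x y ps \<noteq> []"
proof (cases ps)
  case (Cons p qs)
  then show "ps \<noteq> [] \<Longrightarrow> set ps \<subseteq> Box \<Longrightarrow> dynkin_word x y ps \<noteq> []"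
    by (cases p) (auto simp: dynkin_word_def Box_def)
qed simp

text \<open>Putting the pair (r, s) in front of a non-empty word applies (ad x)^r (ad y)^s to its
  nested bracket, and these operators with their factorial weights sum to
  \<open>C - 1\<close>.\<close>

lemma beta_Suc: "n > 0 \<Longrightarrow> beta (Suc n) = app (C - 1) (beta n)"
proof -
  assume n: "n > 0"
  let ?w = "dynkin_word x y"
  have LLS: "LL (Suc n) = (\<lambda>(p, ps). p # ps) ` (Box \<times> LL n)"
    unfolding LL_def by (auto simp: length_Suc_conv image_iff)
  have "beta (Suc n) = (\<Sum>(p, ps)\<in>Box \<times> LL n. (1 / fact_prod (p # ps)) *\<^sub>R nest (?w (p # ps)))"
    unfolding beta_def LLS by (subst sum.reindex) (auto simp: inj_on_def intro!: sum.cong)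
  also have "\<dots> = (\<Sum>(p, ps)\<in>Box \<times> LL n. app (case p of (r, s) \<Rightarrow> (1 / (fact r * fact s)) *\<^sub>R (adE x ^ r * adE y ^ s))
      ((1 / fact_prod ps) *\<^sub>R nest (?w ps)))"
  proof (intro sum.cong refl, clarify)
    fix r s ps assume "ps \<in> LL n"
    then have "?w ps \<noteq> []" using n dynkin_word_nonempty by (auto simp: LL_def)
    then show "(1 / fact_prod ((r, s) # ps)) *\<^sub>R nest (?w ((r, s) # ps))
       = app ((1 / (fact r * fact s)) *\<^sub>R (adE x ^ r * adE y ^ s)) ((1 / fact_prod ps) *\<^sub>R nest (?w ps))"
      by (simp add: dynkin_word_Cons nest_replicate_append)
  qed
  also have "\<dots> = app (C - 1) (beta n)"
    unfolding sum.cartesian_product[symmetric] fexp_minus_1 app_sum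
    unfolding beta_def app_sum_right by (simp add: case_prod_beta)
  finally show ?thesis .
qed

lemma beta_power: "app ((C - 1) ^ n) V = beta (Suc n)"
  by (induction n) (simp_all add: beta_1 beta_Suc del: app_simps(4))

definition "Z = (\<Sum>ps\<in>dynkin_indices N. dynkin_coeff ps *\<^sub>R nest (dynkin_word x y ps))"

lemma dynkin_indices_iff:
  "ps \<in> dynkin_indices N \<longleftrightarrow> ps \<in> (\<Union>n<K. LL (Suc n)) \<and> total_degree ps \<le> N"
proof
  assume ps: "ps \<in> dynkin_indices N"
  then have 1: "\<forall>(r, s)\<in>set ps. 0 < r + s" "ps \<noteq> []" "total_degree ps \<le> N"
    by (auto simp: dynkin_indices_def)
  have "set ps \<subseteq> Box"
  proof
    fix q assume q: "q \<in> set ps"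
    then have "fst q \<le> N" "snd q \<le> N" "q \<noteq> (0, 0)"
      using total_degree_bound[OF 1(1)] 1(1,3) by fastforce+
    then show "q \<in> Box" unfolding Box_def using K_bounds(1) by (cases q) auto
  qed
  moreover have "length ps = Suc (length ps - 1)" "length ps - 1 < K"
    using 1 total_degree_bound[OF 1(1)] K_bounds(1) by (auto simp: Suc_le_eq)
  ultimately show "ps \<in> (\<Union>n<K. LL (Suc n)) \<and> total_degree ps \<le> N"
    using 1(3) unfolding LL_def by blast
next
  assume "ps \<in> (\<Union>n<K. LL (Suc n)) \<and> total_degree ps \<le> N"
  then show "ps \<in> dynkin_indices N"
    unfolding dynkin_indices_def LL_def Box_def by auto
qed

lemma dynkin_indices_word:
  assumes ps: "ps \<in> dynkin_indices N"
  shows "dynkin_word x y ps \<noteq> []"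
proof -
  obtain n where "ps \<in> LL (Suc n)" using ps dynkin_indices_iff by blast
  then show ?thesis by (intro dynkin_word_nonempty) (auto simp: LL_def)
qed

text \<open>The derivation multiplies a Dynkin term by its total degree and so cancels that
  denominator in \<open>dynkin_coeff\<close>. What is left is the series ln (1 + w) / w at w =
  \<open>C - 1\<close>, applied to \<open>V\<close>; terms of degree above \<open>N\<close>
  vanish.\<close>

lemma comm_t_Z: "comm t Z = comm t A"
proof -
  let ?w = "dynkin_word x y"
  let ?c = "\<lambda>ps. ((-1) ^ (length ps - 1) / real (length ps) / fact_prod ps)"
  let ?S = "\<Union>n<K. LL (Suc n)"
  have fin: "finite ?S" using finite_LL by auto
  have "comm t A = (\<Sum>n<K. \<Sum>ps\<in>LL (Suc n). ?c ps *\<^sub>R nest (?w ps))"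
    unfolding comm_t_A fc_def[of K fps_lnq] app_sum app_simps beta_power
    by (auto simp: beta_def scaleR_sum_right fps_lnq_def LL_def intro!: sum.cong)
  also have "\<dots> = (\<Sum>ps\<in>?S. ?c ps *\<^sub>R nest (?w ps))"
    using finite_LL by (subst sum.UNION_disjoint) (auto simp: LL_def)
  also have "\<dots> = (\<Sum>ps\<in>dynkin_indices N. ?c ps *\<^sub>R nest (?w ps))"
  proof (rule sum.mono_neutral_right[OF fin])
    show "dynkin_indices N \<subseteq> ?S" using dynkin_indices_iff by blast
    show "\<forall>ps\<in>?S - dynkin_indices N. ?c ps *\<^sub>R nest (?w ps) = 0"
    proof
      fix ps assume ps: "ps \<in> ?S - dynkin_indices N"
      then have "N < length (?w ps)" using dynkin_indices_iff[of ps] by (auto simp: length_dynkin_word)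
      then have "nest (?w ps) = 0"
        using J_eq_0[OF J_nest[OF set_dynkin_word]] by (metis length_greater_0_conv not_less_zero neq0_conv)
      then show "?c ps *\<^sub>R nest (?w ps) = 0" by simp
    qed
  qed
  also have "\<dots> = comm t Z"
    unfolding Z_def comm_sum
  proof (intro sum.cong refl)
    fix ps assume ps: "ps \<in> dynkin_indices N"
    then have ne: "?w ps \<noteq> []"
      by (rule dynkin_indices_word)
    then have "total_degree ps \<noteq> 0" unfolding length_dynkin_word[of x y, symmetric] by simp
    moreover have "comm t (nest (?w ps)) = real (total_degree ps) *\<^sub>R nest (?w ps)"
      using comm_t_nest[OF set_dynkin_word ne] unfolding length_dynkin_word .
    moreover have "dynkin_coeff ps = ?c ps / real (total_degree ps)"
      unfolding dynkin_coeff_def by (simp only: divide_divide_eq_left mult.commute mult.left_commute mult.assoc)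
    ultimately show "?c ps *\<^sub>R nest (?w ps) = comm t (dynkin_coeff ps *\<^sub>R nest (?w ps))"
      unfolding comm_scale by (simp only: scaleR_scaleR) simp
  qed
  finally show ?thesis ..
qed

lemma Z_J: "Z \<in> J 1"
  unfolding Z_def
proof (intro J_sum J_scale)
  fix ps assume "ps \<in> dynkin_indices N"
  then have ne: "dynkin_word x y ps \<noteq> []"
    by (rule dynkin_indices_word)
  then show "nest (dynkin_word x y ps) \<in> J 1"
    using J_mono[OF J_nest[OF set_dynkin_word ne], of 1] by (simp add: Suc_le_eq)
qed

theorem dynkin: "fexp K Z = fexp K x * fexp K y"
proof -
  have "Z - A = 0"
    using comm_t_inj[OF J_diff[OF Z_J A_J]] comm_t_Z by (simp add: comm_def algebra_simps)
  then show ?thesis using fexp_A by (simp add: E_def)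
qed

end

section \<open>The Baker--Campbell--Hausdorff group\<close>

text \<open>Sequences stand for power series in a parameter \<open>s\<close>: \<open>hat a\<close> is \<open>s a\<close> and \<open>euler\<close> is \<open>s d/ds\<close>, which
  provides the degree operator needed for Dynkin's formula.\<close>

definition hat :: "'v::{real_vector, zero_neq_one} endo \<Rightarrow> (nat \<Rightarrow> 'v) endo" where
  "hat a = Endo (\<lambda>h k. if k = 0 then 0 else app a (h (k - 1)))"

definition euler :: "(nat \<Rightarrow> 'v::{real_vector, zero_neq_one}) endo" where
  "euler = Endo (\<lambda>h k. real k *\<^sub>R h k)"

lemma app_hat: "app (hat a) h k = (if k = 0 then 0 else app a (h (k - 1)))"
proof -
  have "linear (\<lambda>h (k::nat). if k = 0 then 0 else app a (h (k - 1)))"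
    by (intro linearI) (auto simp: fun_eq_iff)
  then show ?thesis unfolding hat_def by (simp add: app_Endo)
qed

lemma app_euler: "app euler h k = real k *\<^sub>R h k"
proof -
  have "linear (\<lambda>(h :: nat \<Rightarrow> 'a) k. real k *\<^sub>R h k)"
    by (intro linearI) (auto simp: fun_eq_iff algebra_simps)
  then show ?thesis unfolding euler_def by (simp add: app_Endo)
qed

lemma comm_euler_hat: "comm euler (hat a) = hat a"
proof (rule endo_eqI, rule ext)
  fix h k show "app (comm euler (hat a)) h k = app (hat a) h k"
    by (cases k) (simp_all add: comm_def app_hat app_euler algebra_simps)
qed

lemma prod_list_hat:
  "app (prod_list (map hat w)) h k = (if k < length w then 0 else app (prod_list w) (h (k - length w)))"
  by (induction w arbitrary: k) (auto simp: app_hat)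

text \<open>Evaluation of the grading parameter at \<open>1\<close>: on sequences that are eventually constant the
  operator \<open>a\<close> eventually acts as \<open>b\<close>.\<close>

definition eventually_acts :: "(nat \<Rightarrow> 'v) endo \<Rightarrow> 'v::{real_vector, zero_neq_one} endo \<Rightarrow> bool" where
  "eventually_acts a b \<longleftrightarrow> (\<forall>h v. eventually (\<lambda>k. h k = v) sequentially \<longrightarrow>
     eventually (\<lambda>k. app a h k = app b v) sequentially)"

lemma eventually_acts_hat: "eventually_acts (hat a) a"
  unfolding eventually_acts_def
proof (intro allI impI)
  fix h and v :: 'a assume "eventually (\<lambda>k. h k = v) sequentially"
  then obtain m where m: "\<And>k. m \<le> k \<Longrightarrow> h k = v" unfolding eventually_sequentially by blast
  show "eventually (\<lambda>k. app (hat a) h k = app a v) sequentially"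
    unfolding eventually_sequentially
    by (rule exI[of _ "Suc m"]) (auto simp: app_hat m)
qed

lemma eventually_acts_basic:
  "eventually_acts 0 0" "eventually_acts 1 1"
  by (auto simp: eventually_acts_def)

lemma eventually_acts_add:
  assumes "eventually_acts a b" "eventually_acts a' b'"
  shows "eventually_acts (a + a') (b + b')"
  unfolding eventually_acts_def
proof (intro allI impI)
  fix h and v :: 'a assume "eventually (\<lambda>k. h k = v) sequentially"
  then have "eventually (\<lambda>k. app a h k = app b v) sequentially" "eventually (\<lambda>k. app a' h k = app b' v) sequentially"
    using assms by (auto simp: eventually_acts_def)
  then show "eventually (\<lambda>k. app (a + a') h k = app (b + b') v) sequentially"
    by eventually_elim simp
qed

lemma eventually_acts_scale:
  assumes "eventually_acts a b"
  shows "eventually_acts (c *\<^sub>R a) (c *\<^sub>R b)"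
  unfolding eventually_acts_def
proof (intro allI impI)
  fix h and v :: 'a assume "eventually (\<lambda>k. h k = v) sequentially"
  then have "eventually (\<lambda>k. app a h k = app b v) sequentially"
    using assms by (auto simp: eventually_acts_def)
  then show "eventually (\<lambda>k. app (c *\<^sub>R a) h k = app (c *\<^sub>R b) v) sequentially"
    by eventually_elim simp
qed

lemma eventually_acts_mult:
  "eventually_acts a b \<Longrightarrow> eventually_acts a' b' \<Longrightarrow> eventually_acts (a * a') (b * b')"
  by (auto simp: eventually_acts_def)

lemma eventually_acts_diff:
  "eventually_acts a b \<Longrightarrow> eventually_acts a' b' \<Longrightarrow> eventually_acts (a - a') (b - b')"
  using eventually_acts_add[OF _ eventually_acts_scale[of a' b' "-1"], of a b] by simp

lemma eventually_acts_sum: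
  "(\<And>i. i \<in> I \<Longrightarrow> eventually_acts (f i) (g i)) \<Longrightarrow> eventually_acts (sum f I) (sum g I)"
  by (induction I rule: infinite_finite_induct) (auto intro: eventually_acts_basic eventually_acts_add)

lemma eventually_acts_power: "eventually_acts a b \<Longrightarrow> eventually_acts (a ^ n) (b ^ n)"
  by (induction n) (auto intro: eventually_acts_basic eventually_acts_mult)

lemma eventually_acts_fc: "eventually_acts a b \<Longrightarrow> eventually_acts (fc K f a) (fc K f b)"
  unfolding fc_def by (intro eventually_acts_sum eventually_acts_scale eventually_acts_power)

lemma eventually_acts_nest: "eventually_acts (nest (map hat w)) (nest w)"
proof (induction w rule: nest.induct)
  case (3 v u w)
  then show ?case
    by (auto simp: comm_def intro!: eventually_acts_diff eventually_acts_mult eventually_acts_hat)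
qed (auto intro: eventually_acts_basic eventually_acts_hat)

text \<open>Constant sequences test both operators on every vector.\<close>

lemma eventually_acts_unique:
  assumes "eventually_acts a b" "eventually_acts a b'"
  shows "b = b'"
proof (rule endo_eqI)
  fix v :: 'a
  have "eventually (\<lambda>k. app a (\<lambda>_. v) k = app b v \<and> app a (\<lambda>_. v) k = app b' v) sequentially"
    using assms by (auto simp: eventually_acts_def intro!: eventually_conj)
  then obtain k where "app a (\<lambda>_. v) k = app b v \<and> app a (\<lambda>_. v) k = app b' v"
    using eventually_happens'[OF sequentially_bot] by blast
  then show "app b v = app b' v" by metis
qed

lemma map_dynkin_word: "map f (dynkin_word x y ps) = dynkin_word (f x) (f y) ps"
  unfolding dynkin_word_def map_concat map_map o_def case_prod_beta map_append map_replicate ..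

text \<open>The given algebra need not contain a degree operator for \<open>x\<close> and
  \<open>y\<close>. Their images under \<open>hat\<close> have one, namely \<open>euler\<close>; the
  identity proved there is then evaluated at parameter 1.\<close>

theorem dynkin_formula:
  fixes x y :: "'v::{real_vector, zero_neq_one} endo"
  assumes words: "\<And>w. set w \<subseteq> {x, y} \<Longrightarrow> N < length w \<Longrightarrow> prod_list w = 0"
  shows "fexp (2 * N + 2) (\<Sum>ps\<in>dynkin_indices N. dynkin_coeff ps *\<^sub>R nest (dynkin_word x y ps))
     = fexp (2 * N + 2) x * fexp (2 * N + 2) y"
proof -
  interpret dynkin_setup "hat x" "hat y" euler N
  proof
    fix ws assume ws: "set ws \<subseteq> {hat x, hat y}" "N < length ws"
    have "\<exists>w. ws = map hat w \<and> set w \<subseteq> {x, y}" using ws(1)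
    proof (induction ws)
      case (Cons a ws)
      then obtain w where "ws = map hat w" "set w \<subseteq> {x, y}" by auto
      moreover obtain b where "a = hat b" "b \<in> {x, y}" using Cons by auto
      ultimately show ?case by (intro exI[of _ "b # w"]) auto
    qed simp
    then obtain w where w: "ws = map hat w" "set w \<subseteq> {x, y}" by blast
    then have "prod_list w = 0" using words ws by simp
    then show "prod_list ws = 0"
      unfolding w(1) by (intro endo_eqI ext) (simp add: prod_list_hat)
  qed (auto simp: comm_euler_hat)
  have "eventually_acts Z (\<Sum>ps\<in>dynkin_indices N. dynkin_coeff ps *\<^sub>R nest (dynkin_word x y ps))"
    unfolding Z_def map_dynkin_word[symmetric]
    by (intro eventually_acts_sum eventually_acts_scale eventually_acts_nest)
  then have "eventually_acts (fexp K Z) (fexp K (\<Sum>ps\<in>dynkin_indices N. dynkin_coeff ps *\<^sub>R nest (dynkin_word x y ps)))"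
    by (rule eventually_acts_fc)
  moreover have "eventually_acts (fexp K Z) (fexp K x * fexp K y)"
    unfolding dynkin by (intro eventually_acts_mult eventually_acts_fc eventually_acts_hat)
  ultimately show ?thesis unfolding K_def by (rule eventually_acts_unique)
qed

lemma finite_dynkin_indices: "finite (dynkin_indices N)"
proof (rule finite_subset)
  show "finite {ps. set ps \<subseteq> {..N} \<times> {..N} \<and> length ps \<le> N}"
    by (rule finite_lists_length_le) simp
  show "dynkin_indices N \<subseteq> {ps. set ps \<subseteq> {..N} \<times> {..N} \<and> length ps \<le> N}"
  proof
    fix ps assume ps: "ps \<in> dynkin_indices N"
    then have 1: "\<forall>(r, s)\<in>set ps. 0 < r + s" "total_degree ps \<le> N"
      by (auto simp: dynkin_indices_def)
    have "set ps \<subseteq> {..N} \<times> {..N}"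
    proof
      fix q assume "q \<in> set ps"
      then have "fst q \<le> N" "snd q \<le> N"
        using total_degree_bound[OF 1(1)] 1(2) by fastforce+
      then show "q \<in> {..N} \<times> {..N}" by (cases q) auto
    qed
    then show "ps \<in> {ps. set ps \<subseteq> {..N} \<times> {..N} \<and> length ps \<le> N}"
      using total_degree_bound[OF 1(1)] 1(2) by auto
  qed
qed

section \<open>Transport of the group law and of the adjoint action through a representation\<close>

lemma scaleR_power_eq: "(c *\<^sub>R a) ^ n = (c ^ n) *\<^sub>R (a :: 'a :: real_algebra_1) ^ n"
  by (induction n) (simp_all add: mult.commute)

text \<open>Faithfulness imports the algebraic identities of \<open>L\<close>, and afterwards the
  group laws of \<open>bch\<close>, from an associative algebra of operators. The nilpotency clause
  concerns products of operators, which is what the truncated series require.\<close>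

locale lie_rep =
  fixes L :: "'g lie_algebra" and N :: nat and \<rho> :: "'g \<Rightarrow> 'v::{real_vector, zero_neq_one} endo"
  assumes closed: "lzero L \<in> carrier L"
      "\<And>u v. u \<in> carrier L \<Longrightarrow> v \<in> carrier L \<Longrightarrow> ladd L u v \<in> carrier L"
      "\<And>c u. u \<in> carrier L \<Longrightarrow> lscale L c u \<in> carrier L"
      "\<And>u v. u \<in> carrier L \<Longrightarrow> v \<in> carrier L \<Longrightarrow> lbracket L u v \<in> carrier L"
    and rep: "\<rho> (lzero L) = 0"
      "\<And>u v. u \<in> carrier L \<Longrightarrow> v \<in> carrier L \<Longrightarrow> \<rho> (ladd L u v) = \<rho> u + \<rho> v"
      "\<And>c u. u \<in> carrier L \<Longrightarrow> \<rho> (lscale L c u) = c *\<^sub>R \<rho> u"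
      "\<And>u v. u \<in> carrier L \<Longrightarrow> v \<in> carrier L \<Longrightarrow> \<rho> (lbracket L u v) = comm (\<rho> u) (\<rho> v)"
    and inj: "inj_on \<rho> (carrier L)"
    and nil: "\<And>w. set w \<subseteq> \<rho> ` carrier L \<Longrightarrow> N < length w \<Longrightarrow> prod_list w = 0"
begin

lemma rho_eqI: "u \<in> carrier L \<Longrightarrow> v \<in> carrier L \<Longrightarrow> \<rho> u = \<rho> v \<Longrightarrow> u = v"
  using inj by (auto simp: inj_on_def)

lemma additive_monoid: "comm_monoid \<lparr>carrier = carrier L, mult = ladd L, one = lzero L\<rparr>"
  by (rule comm_monoidI) (auto intro!: rho_eqI simp: closed rep algebra_simps)

lemma lsum: "finite I \<Longrightarrow> (\<And>i. i \<in> I \<Longrightarrow> f i \<in> carrier L) \<Longrightarrow>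
   lsum L f I \<in> carrier L \<and> \<rho> (lsum L f I) = (\<Sum>i\<in>I. \<rho> (f i))"
proof (induction I rule: finite_induct)
  interpret comm_monoid "\<lparr>carrier = carrier L, mult = ladd L, one = lzero L\<rparr>" by (rule additive_monoid)
  case empty
  then show ?case by (simp add: lsum_def closed rep)
next
  interpret comm_monoid "\<lparr>carrier = carrier L, mult = ladd L, one = lzero L\<rparr>" by (rule additive_monoid)
  case (insert i I)
  have "lsum L f (insert i I) = ladd L (f i) (lsum L f I)"
    using finprod_insert[OF insert(1,2), of f] insert(4) by (auto simp: lsum_def)
  then show ?case using insert by (auto simp: closed rep)
qed

lemma nested: "w \<noteq> [] \<Longrightarrow> set w \<subseteq> carrier L \<Longrightarrow>
   nested_bracket L w \<in> carrier L \<and> \<rho> (nested_bracket L w) = nest (map \<rho> w)"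
proof (induction w rule: induct_list012)
  case (3 v u w)
  then show ?case by (auto simp: closed rep)
qed auto

lemma nested_dynkin:
  assumes "ps \<in> dynkin_indices N" "u \<in> carrier L" "v \<in> carrier L"
  shows "nested_bracket L (dynkin_word u v ps) \<in> carrier L"
    "\<rho> (nested_bracket L (dynkin_word u v ps)) = nest (dynkin_word (\<rho> u) (\<rho> v) ps)"
proof -
  have ps: "ps \<noteq> []" "\<forall>(r, s)\<in>set ps. 0 < r + s" using assms(1) by (auto simp: dynkin_indices_def)
  have "0 < length ps" using ps(1) by simp
  then have "0 < length (dynkin_word u v ps)"
    using total_degree_bound[OF ps(2)] unfolding length_dynkin_word by linarith
  then have ne: "dynkin_word u v ps \<noteq> []" by simp
  have s: "set (dynkin_word u v ps) \<subseteq> carrier L"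
    using set_dynkin_word[of u v ps] assms by auto
  show "nested_bracket L (dynkin_word u v ps) \<in> carrier L"
    "\<rho> (nested_bracket L (dynkin_word u v ps)) = nest (dynkin_word (\<rho> u) (\<rho> v) ps)"
    using nested[OF ne s] by (auto simp: map_dynkin_word)
qed

abbreviation "K \<equiv> Suc (Suc (2 * N))"

lemma bch_closed:
  assumes "u \<in> carrier L" "v \<in> carrier L"
  shows "bch L N u v \<in> carrier L"
    and bch_rep: "fexp K (\<rho> (bch L N u v)) = fexp K (\<rho> u) * fexp K (\<rho> v)"
proof -
  have 1: "bch L N u v \<in> carrier L \<and> \<rho> (bch L N u v) =
    (\<Sum>ps\<in>dynkin_indices N. \<rho> (lscale L (dynkin_coeff ps) (nested_bracket L (dynkin_word u v ps))))"
    unfolding bch_def by (rule lsum[OF finite_dynkin_indices]) (simp add: closed nested_dynkin assms)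
  then show "bch L N u v \<in> carrier L" by simp
  have "\<rho> (bch L N u v) = (\<Sum>ps\<in>dynkin_indices N. dynkin_coeff ps *\<^sub>R nest (dynkin_word (\<rho> u) (\<rho> v) ps))"
    using 1 by (simp add: rep nested_dynkin assms)
  moreover have "\<And>w. set w \<subseteq> {\<rho> u, \<rho> v} \<Longrightarrow> N < length w \<Longrightarrow> prod_list w = 0"
    by (rule nil) (use assms in auto)
  ultimately show "fexp K (\<rho> (bch L N u v)) = fexp K (\<rho> u) * fexp K (\<rho> v)"
    using dynkin_formula[of "\<rho> u" "\<rho> v" N] by simp
qed

lemma power_nil: "u \<in> carrier L \<Longrightarrow> N < n \<Longrightarrow> \<rho> u ^ n = 0"
  using nil[of "replicate n (\<rho> u)"] by simp

text \<open>The truncated logarithm recovers \<open>\<rho> u\<close> from its exponential, and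
  \<open>\<rho>\<close> is injective.\<close>

lemma fexp_inj:
  assumes "u \<in> carrier L" "v \<in> carrier L" "fexp K (\<rho> u) = fexp K (\<rho> v)"
  shows "u = v"
proof -
  have "fc K (fps_ln 1) (fexp K (\<rho> w) - 1) = \<rho> w" if w: "w \<in> carrier L" for w
  proof -
    have "fexp K (\<rho> w) - 1 = fc K (fps_exp 1 - 1) (\<rho> w)" by (simp add: fc_diff fc_one)
    then have "fc K (fps_ln 1) (fexp K (\<rho> w) - 1) = fc K (fps_ln 1 oo (fps_exp 1 - 1)) (\<rho> w)"
      using fc_compose[of "\<rho> w" K "fps_exp 1 - 1" "fps_ln 1"] power_nil[OF w, of K] by simp
    then show ?thesis by (simp add: ln_compose_exp fc_X)
  qed
  then show ?thesis using assms rho_eqI by metis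
qed

lemma fexp_0: "fexp K 0 = (1 :: 'v endo)"
  using fc_larger[of "0 :: 'v endo" 1 K "fps_exp 1"] by (simp add: fc_def)

lemma fexp_scale_add:
  assumes u: "u \<in> carrier L"
  shows "fexp K ((s + t) *\<^sub>R \<rho> u) = fexp K (s *\<^sub>R \<rho> u) * fexp K (t *\<^sub>R \<rho> u)"
proof -
  have "(s *\<^sub>R \<rho> u) ^ i * (t *\<^sub>R \<rho> u) ^ j = 0" if "K \<le> i + j" for i j
  proof -
    have "(s *\<^sub>R \<rho> u) ^ i * (t *\<^sub>R \<rho> u) ^ j = (s ^ i * t ^ j) *\<^sub>R (\<rho> u ^ (i + j))"
      unfolding scaleR_power_eq power_add by (simp add: mult.commute)
    then show ?thesis using power_nil[OF u, of "i + j"] that by simp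
  qed
  then show ?thesis unfolding scaleR_add_left by (intro fexp_add) auto
qed

lemma fexp_neg: "u \<in> carrier L \<Longrightarrow> fexp K (- \<rho> u) * fexp K (\<rho> u) = 1"
  "u \<in> carrier L \<Longrightarrow> fexp K (\<rho> u) * fexp K (- \<rho> u) = 1"
  using fexp_scale_add[of u "-1" 1] fexp_scale_add[of u 1 "-1"] fexp_0 by simp_all

text \<open>The injective map sending u to exp \<open>(\<rho> u)\<close> turns \<open>bch\<close>
  into multiplication, so each law is checked among operators.\<close>

lemma group: "group (bch_group L N)"
proof (rule groupI)
  fix u v w assume "u \<in> carrier (bch_group L N)" "v \<in> carrier (bch_group L N)" "w \<in> carrier (bch_group L N)"
  then show "u \<otimes>\<^bsub>bch_group L N\<^esub> v \<otimes>\<^bsub>bch_group L N\<^esub> w = u \<otimes>\<^bsub>bch_group L N\<^esub> (v \<otimes>\<^bsub>bch_group L N\<^esub> w)"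
    by (intro fexp_inj) (simp_all add: bch_group_def bch_closed bch_rep mult.assoc)
next
  fix u assume "u \<in> carrier (bch_group L N)"
  then have u: "u \<in> carrier L" by (simp add: bch_group_def)
  then show "\<one>\<^bsub>bch_group L N\<^esub> \<otimes>\<^bsub>bch_group L N\<^esub> u = u"
    by (intro fexp_inj) (simp_all add: bch_group_def bch_closed bch_rep closed rep fexp_0)
  have "bch L N (lscale L (-1) u) u = lzero L"
    by (intro fexp_inj) (simp_all add: bch_closed bch_rep closed rep fexp_0 u fexp_neg)
  then show "\<exists>y\<in>carrier (bch_group L N). y \<otimes>\<^bsub>bch_group L N\<^esub> u = \<one>\<^bsub>bch_group L N\<^esub>"
    using closed(3)[OF u] by (auto simp: bch_group_def)
qed (auto simp: bch_group_def bch_closed closed)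

lemma m_inv:
  assumes u: "u \<in> carrier L"
  shows "m_inv (bch_group L N) u = lscale L (-1) u"
proof (rule group.inv_equality[OF group])
  show "lscale L (-1) u \<otimes>\<^bsub>bch_group L N\<^esub> u = \<one>\<^bsub>bch_group L N\<^esub>"
    unfolding bch_group_def
    by (simp, intro fexp_inj) (simp_all add: bch_closed bch_rep closed rep fexp_0 u fexp_neg)
qed (use closed u in \<open>auto simp: bch_group_def\<close>)

lemma P_subspace: "subspace (\<rho> ` carrier L)"
  unfolding subspace_def
proof (intro conjI ballI allI)
  show "0 \<in> \<rho> ` carrier L" using closed rep by force
  fix a b assume "a \<in> \<rho> ` carrier L" "b \<in> \<rho> ` carrier L"
  then show "a + b \<in> \<rho> ` carrier L" using closed(2) rep(2) by (auto simp flip: rep(2))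
next
  fix c a assume "a \<in> \<rho> ` carrier L"
  then show "c *\<^sub>R a \<in> \<rho> ` carrier L" using closed(3) by (auto simp flip: rep(3))
qed

lemma P_ad_power: "u \<in> carrier L \<Longrightarrow> Y \<in> carrier L \<Longrightarrow> app (adE (\<rho> u) ^ n) (\<rho> Y) \<in> \<rho> ` carrier L"
proof (induction n)
  case (Suc n)
  then obtain Z where "Z \<in> carrier L" "app (adE (\<rho> u) ^ n) (\<rho> Y) = \<rho> Z" by auto
  then show ?case using Suc closed(4) by (auto simp flip: rep(4))
qed auto

text \<open>This is the adjoint operator of the inverse of \<open>g\<close>, in the convention of
  \<open>coadjoint\<close>.\<close>

definition Ad :: "'g \<Rightarrow> 'g \<Rightarrow> 'g" where
  "Ad g Y = inv_into (carrier L) \<rho> (fexp K (- \<rho> g) * \<rho> Y * fexp K (\<rho> g))"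

text \<open>As a series in ad \<open>(\<rho> g)\<close> the conjugate visibly stays in the image of
  \<open>carrier L\<close>, which is what \<open>Ad\<close> has to invert \<open>\<rho>\<close>
  on.\<close>

lemma conj_eq:
  assumes "g \<in> carrier L"
  shows "fexp K (- \<rho> g) * w * fexp K (\<rho> g) = (\<Sum>n<K. ((-1) ^ n / fact n) *\<^sub>R app (adE (\<rho> g) ^ n) w)"
proof -
  have n: "(- \<rho> g) ^ n = 0" if "n > N" for n
    using power_nil[OF assms that] by (subst power_minus) simp
  have "fexp K (- \<rho> g) * w * fexp K (\<rho> g) = app (fexp K (adE (- \<rho> g))) w"
    using fexp_conj[of N "- \<rho> g" w] n fexp_neg(1)[OF assms] by (simp add: mult.assoc)
  moreover have "adE (- \<rho> g) = - adE (\<rho> g)"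
    by (rule endo_eqI) (simp add: comm_def)
  moreover have "app ((- adE (\<rho> g)) ^ n) w = (-1) ^ n *\<^sub>R app (adE (\<rho> g) ^ n) w" for n
    by (subst power_minus) (cases "even n"; simp)
  ultimately show ?thesis by (simp only: fexp_def' app_sum app_simps) (simp add: mult.commute)
qed

lemma Ad:
  assumes "g \<in> carrier L" "Y \<in> carrier L"
  shows "Ad g Y \<in> carrier L" "\<rho> (Ad g Y) = fexp K (- \<rho> g) * \<rho> Y * fexp K (\<rho> g)"
proof -
  have "fexp K (- \<rho> g) * \<rho> Y * fexp K (\<rho> g) \<in> \<rho> ` carrier L"
    unfolding conj_eq[OF assms(1)]
    by (intro subspace_sum[OF P_subspace] subspace_scale[OF P_subspace] P_ad_power assms)
  then show "Ad g Y \<in> carrier L" "\<rho> (Ad g Y) = fexp K (- \<rho> g) * \<rho> Y * fexp K (\<rho> g)"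
    unfolding Ad_def by (auto intro: inv_into_into f_inv_into_f)
qed

lemma fexp_conjugate:
  assumes "b * c = (1 :: 'v endo)" "c * b = 1"
  shows "fexp K (b * a * c) = b * fexp K a * c"
proof -
  have "(b * a * c) ^ n = b * a ^ n * c" for n
  proof (induction n)
    case (Suc n)
    have "b * a * c * (b * a ^ n * c) = b * a * (c * b) * a ^ n * c" by (simp only: mult.assoc)
    then show ?case using Suc assms by (simp add: mult.assoc)
  qed (simp add: assms)
  then show ?thesis by (simp only: fexp_def' sum_distrib_left sum_distrib_right) simp
qed

text \<open>Conjugation commutes with the exponential, so the curve differentiated in
  \<open>coadjoint\<close> is a straight line through 0.\<close>

lemma conjugate_bch:
  assumes g: "g \<in> carrier L" and Y: "Y \<in> carrier L"
  shows "bch L N (bch L N (lscale L (-1) g) (lscale L s Y)) g = lscale L s (Ad g Y)"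
proof (rule fexp_inj)
  have "fexp K (\<rho> (lscale L s (Ad g Y))) = fexp K (fexp K (- \<rho> g) * (s *\<^sub>R \<rho> Y) * fexp K (\<rho> g))"
    by (simp add: rep Ad g Y)
  also have "\<dots> = fexp K (- \<rho> g) * fexp K (s *\<^sub>R \<rho> Y) * fexp K (\<rho> g)"
    by (rule fexp_conjugate) (use fexp_neg[OF g] in auto)
  finally show "fexp K (\<rho> (bch L N (bch L N (lscale L (-1) g) (lscale L s Y)) g)) = fexp K (\<rho> (lscale L s (Ad g Y)))"
    by (simp add: bch_rep bch_closed closed rep g Y)
qed (use g Y in \<open>auto intro!: bch_closed closed Ad\<close>)

lemma dual_scale:
  assumes "\<xi> \<in> lie_dual L" "Y \<in> carrier L"
  shows "\<xi> (lscale L s Y) = s * \<xi> Y"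
proof -
  have "ladd L (lscale L s Y) (lscale L 0 Y) = lscale L s Y"
    by (intro rho_eqI) (simp_all add: closed rep assms)
  moreover have "\<xi> (ladd L (lscale L s Y) (lscale L 0 Y)) = s * \<xi> Y + 0 * \<xi> Y"
    using assms unfolding lie_dual_def by blast
  ultimately show ?thesis by simp
qed

lemma coadjoint_Ad:
  assumes "\<xi> \<in> lie_dual L" "g \<in> carrier L"
  shows "coadjoint L N g \<xi> = (\<lambda>Y. if Y \<in> carrier L then \<xi> (Ad g Y) else 0)"
proof
  fix Y
  show "coadjoint L N g \<xi> Y = (if Y \<in> carrier L then \<xi> (Ad g Y) else 0)"
  proof (cases "Y \<in> carrier L")
    case True
    have "deriv (\<lambda>t. \<xi> (lscale L t (Ad g Y))) 0 = \<xi> (Ad g Y)"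
      unfolding dual_scale[OF assms(1) Ad(1)[OF assms(2) True]]
      by (intro DERIV_imp_deriv) (auto intro!: derivative_eq_intros)
    moreover have "m_inv (bch_group L N) g \<otimes>\<^bsub>bch_group L N\<^esub> lscale L t Y \<otimes>\<^bsub>bch_group L N\<^esub> g
        = lscale L t (Ad g Y)" for t
      using conjugate_bch[OF assms(2) True] by (simp add: m_inv assms) (simp add: bch_group_def)
    ultimately show ?thesis using True by (simp add: coadjoint_def)
  qed (simp add: coadjoint_def)
qed

end

section \<open>Tangent vectors and vector fields\<close>

lemma closed_box_compactin: "compactin (Euclidean_space n) {y \<in> ESp n. \<forall>i<n. \<bar>y i - a i\<bar> \<le> c}"
proof -
  let ?S = "\<lambda>i. if i < n then {a i - c..a i + c} else {0::real}"
  have eq: "{y \<in> ESp n. \<forall>i<n. \<bar>y i - a i\<bar> \<le> c} = PiE UNIV ?S"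
  proof (intro equalityI subsetI)
    fix y assume "y \<in> {y \<in> ESp n. \<forall>i<n. \<bar>y i - a i\<bar> \<le> c}"
    then have "y i \<in> ?S i" for i by (cases "i < n") (auto simp: abs_le_iff)
    then show "y \<in> PiE UNIV ?S" by blast
  next
    fix y assume "y \<in> PiE UNIV ?S"
    then have *: "y i \<in> ?S i" for i by blast
    have "y i = 0" if "i \<ge> n" for i using *[of i] that by auto
    moreover have "\<bar>y i - a i\<bar> \<le> c" if "i < n" for i using *[of i] that by (auto simp: abs_le_iff)
    ultimately show "y \<in> {y \<in> ESp n. \<forall>i<n. \<bar>y i - a i\<bar> \<le> c}" by blast
  qed
  have "compactin (product_topology (\<lambda>i. euclideanreal) UNIV) (PiE UNIV ?S)"
    unfolding compactin_PiE by auto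
  then show ?thesis
    unfolding Euclidean_space_def compactin_subtopology eq[symmetric] by auto
qed

locale smooth_mfd =
  fixes M :: "'a manifold"
  assumes smooth: "smooth_manifold M"
begin

abbreviation "d \<equiv> mdim M"

lemma chart:
  assumes "(U, \<phi>) \<in> matlas M"
  shows "openin (mtop M) U" "openin (Euclidean_space d) (\<phi> ` U)"
    "homeomorphic_map (subtopology (mtop M) U) (subtopology (Euclidean_space d) (\<phi> ` U)) \<phi>"
  using smooth assms unfolding smooth_manifold_def by auto

lemma chart_subset: "(U, \<phi>) \<in> matlas M \<Longrightarrow> U \<subseteq> mpoints M"
  using chart(1) openin_subset by blast

lemma chart_cover: "p \<in> mpoints M \<Longrightarrow> \<exists>U \<phi>. (U, \<phi>) \<in> matlas M \<and> p \<in> U"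
  using smooth unfolding smooth_manifold_def by fast

lemma chart_inj: "(U, \<phi>) \<in> matlas M \<Longrightarrow> inj_on \<phi> U"
  using homeomorphic_imp_injective_map[OF chart(3)] chart_subset
  by (simp add: topspace_subtopology Int_absorb1)

lemma chart_inv: "(U, \<phi>) \<in> matlas M \<Longrightarrow> p \<in> U \<Longrightarrow> inv_into U \<phi> (\<phi> p) = p"
  by (rule inv_into_f_f[OF chart_inj])

lemma chart_image_open:
  assumes c: "(U, \<phi>) \<in> matlas M" and W: "openin (mtop M) W" "W \<subseteq> U"
  shows "openin (Euclidean_space d) (\<phi> ` W)"
proof -
  have "openin (subtopology (mtop M) U) W"
    using W by (meson openin_open_subtopology chart(1)[OF c])
  then have "openin (subtopology (Euclidean_space d) (\<phi> ` U)) (\<phi> ` W)"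
    using homeomorphic_map_openness[OF chart(3)[OF c], of W] W chart_subset[OF c]
    by (simp add: topspace_subtopology)
  then show ?thesis using openin_open_subtopology[OF chart(2)[OF c]] by blast
qed

lemma chart_preimage_open:
  assumes c: "(U, \<phi>) \<in> matlas M" and Q: "openin (Euclidean_space d) Q"
  shows "openin (mtop M) {p \<in> U. \<phi> p \<in> Q}"
proof -
  have "continuous_map (subtopology (mtop M) U) (subtopology (Euclidean_space d) (\<phi> ` U)) \<phi>"
    using homeomorphic_imp_continuous_map[OF chart(3)[OF c]] .
  then have "continuous_map (subtopology (mtop M) U) (Euclidean_space d) \<phi>"
    by (simp add: continuous_map_in_subtopology)
  from openin_continuous_map_preimage[OF this Q]
  have "openin (subtopology (mtop M) U) {p \<in> topspace (subtopology (mtop M) U). \<phi> p \<in> Q}" .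
  moreover have "topspace (subtopology (mtop M) U) = U"
    using chart_subset[OF c] by auto
  ultimately have "openin (subtopology (mtop M) U) {p \<in> U. \<phi> p \<in> Q}" by (simp only:)
  then show ?thesis using openin_open_subtopology[OF chart(1)[OF c]] by blast
qed

lemma C_infinity_iff: "f \<in> C_infinity M \<longleftrightarrow> (\<forall>p. p \<notin> mpoints M \<longrightarrow> f p = 0) \<and>
    (\<forall>(U, \<phi>)\<in>matlas M. \<forall>k. ck d (\<phi> ` U) k (\<lambda>y. f (inv_into U \<phi> y)))"
proof -
  have "smooth_on d (\<phi> ` U) g \<longleftrightarrow> (\<forall>k. ck d (\<phi> ` U) k g)" if "(U, \<phi>) \<in> matlas M" for U \<phi> g
    using chart(2)[OF that] by (simp add: smooth_on_iff_ck)
  then show ?thesis unfolding C_infinity_def by blast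
qed

lemma C_infinity_outside: "f \<in> C_infinity M \<Longrightarrow> p \<notin> mpoints M \<Longrightarrow> f p = 0"
  by (simp add: C_infinity_iff)

lemma C_infinity_chart: "f \<in> C_infinity M \<Longrightarrow> (U, \<phi>) \<in> matlas M \<Longrightarrow> ck d (\<phi> ` U) k (\<lambda>y. f (inv_into U \<phi> y))"
  unfolding C_infinity_iff by blast

lemma C_infinityI: "(\<And>p. p \<notin> mpoints M \<Longrightarrow> f p = 0) \<Longrightarrow>
    (\<And>U \<phi> k. (U, \<phi>) \<in> matlas M \<Longrightarrow> ck d (\<phi> ` U) k (\<lambda>y. f (inv_into U \<phi> y))) \<Longrightarrow> f \<in> C_infinity M"
  unfolding C_infinity_iff by blast

lemma C_infinity_add: "f \<in> C_infinity M \<Longrightarrow> g \<in> C_infinity M \<Longrightarrow> (\<lambda>q. f q + g q) \<in> C_infinity M"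
  by (rule C_infinityI) (simp_all add: C_infinity_outside ck_add chart C_infinity_chart)

lemma C_infinity_mult: "f \<in> C_infinity M \<Longrightarrow> g \<in> C_infinity M \<Longrightarrow> (\<lambda>q. f q * g q) \<in> C_infinity M"
  by (rule C_infinityI) (simp_all add: C_infinity_outside ck_mult chart C_infinity_chart)

lemma C_infinity_scale: "f \<in> C_infinity M \<Longrightarrow> (\<lambda>q. c * f q) \<in> C_infinity M"
  by (rule C_infinityI) (simp_all add: C_infinity_outside ck_mult ck_const chart C_infinity_chart)

lemma C_infinity_lin: "f \<in> C_infinity M \<Longrightarrow> g \<in> C_infinity M \<Longrightarrow> (\<lambda>q. a * f q + b * g q) \<in> C_infinity M"
  using C_infinity_add[OF C_infinity_scale C_infinity_scale] .

lemma C_infinity_0: "(\<lambda>q. 0) \<in> C_infinity M"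
  by (rule C_infinityI) (simp_all add: ck_const chart)

lemma C_infinity_diff: "f \<in> C_infinity M \<Longrightarrow> g \<in> C_infinity M \<Longrightarrow> (\<lambda>q. f q - g q) \<in> C_infinity M"
  using C_infinity_lin[of f g 1 "-1"] by simp

lemma C_infinity_sum: "(\<And>i. i \<in> I \<Longrightarrow> f i \<in> C_infinity M) \<Longrightarrow> (\<lambda>q. \<Sum>i\<in>I. f i q) \<in> C_infinity M"
  by (induction I rule: infinite_finite_induct) (auto intro: C_infinity_0 C_infinity_add)

text \<open>Elements of \<open>C_infinity M\<close> are zero off \<open>M\<close>, so a constant has
  to be cut off there.\<close>

definition const_fun :: "real \<Rightarrow> 'a \<Rightarrow> real" where
  "const_fun c = (\<lambda>q. if q \<in> mpoints M then c else 0)"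

lemma C_infinity_const: "const_fun c \<in> C_infinity M"
proof (rule C_infinityI)
  fix U \<phi> k assume c: "(U, \<phi>) \<in> matlas M"
  have "inv_into U \<phi> y \<in> mpoints M" if "y \<in> \<phi> ` U" for y
    using chart_subset[OF c] inv_into_into[OF that] by blast
  then show "ck d (\<phi> ` U) k (\<lambda>y. const_fun c (inv_into U \<phi> y))" for c
    by (intro ck_cong[OF chart(2)[OF c] ck_const[OF chart(2)[OF c], of k c]]) (simp add: const_fun_def)
qed (simp add: const_fun_def)

text \<open>A smooth function on a cube inside a chart that vanishes off a smaller closed cube extends by
  zero: the closed cube is compact, hence its preimage is closed in \<open>M\<close>.\<close>

definition extend :: "'a set \<Rightarrow> ('a \<Rightarrow> nat \<Rightarrow> real) \<Rightarrow> (nat \<Rightarrow> real) set \<Rightarrow> ((nat \<Rightarrow> real) \<Rightarrow> real) \<Rightarrow> 'a \<Rightarrow> real" where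
  "extend U \<phi> Q G p = (if p \<in> U \<and> \<phi> p \<in> Q then G (\<phi> p) else 0)"

lemma extend_smooth:
  assumes c: "(U, \<phi>) \<in> matlas M" and Q: "cube d a r \<subseteq> \<phi> ` U" and cr: "c < r"
    and G: "\<And>k. ck d (cube d a r) k G"
    and z: "\<And>y i. y \<in> cube d a r \<Longrightarrow> i < d \<Longrightarrow> c < \<bar>y i - a i\<bar> \<Longrightarrow> G y = 0"
  shows "extend U \<phi> (cube d a r) G \<in> C_infinity M"
proof (rule C_infinityI)
  show "extend U \<phi> (cube d a r) G p = 0" if "p \<notin> mpoints M" for p
    using that chart_subset[OF c] unfolding extend_def by auto
  let ?h = "extend U \<phi> (cube d a r) G"
  define K where "K = {y \<in> ESp d. \<forall>i<d. \<bar>y i - a i\<bar> \<le> c}"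
  define KM where "KM = {p \<in> U. \<phi> p \<in> K}"
  define UQ where "UQ = {p \<in> U. \<phi> p \<in> cube d a r}"
  have KQ: "K \<subseteq> cube d a r" using cr unfolding K_def cube_def by force
  have UQ: "openin (mtop M) UQ" unfolding UQ_def by (rule chart_preimage_open[OF c openin_cube])
  have "closedin (mtop M) KM"
  proof (rule compactin_imp_closedin)
    show "Hausdorff_space (mtop M)" using smooth by (simp add: smooth_manifold_def)
    obtain g where g: "homeomorphic_maps (subtopology (mtop M) U) (subtopology (Euclidean_space d) (\<phi> ` U)) \<phi> g"
      using chart(3)[OF c] homeomorphic_map_maps by blast
    have gc: "continuous_map (subtopology (Euclidean_space d) (\<phi> ` U)) (subtopology (mtop M) U) g"
      and g1: "\<And>p. p \<in> U \<Longrightarrow> g (\<phi> p) = p"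
      using g chart_subset[OF c] unfolding homeomorphic_maps_def by (auto simp: topspace_subtopology)
    have "compactin (subtopology (Euclidean_space d) (\<phi> ` U)) K"
      using closed_box_compactin[of d a c] KQ Q unfolding compactin_subtopology K_def[symmetric] by blast
    then have "compactin (subtopology (mtop M) U) (g ` K)"
      using gc image_compactin by blast
    moreover have "g ` K = KM"
    proof
      show "g ` K \<subseteq> KM"
      proof
        fix p assume "p \<in> g ` K"
        then obtain y where y: "y \<in> K" "p = g y" by blast
        then obtain q where "q \<in> U" "y = \<phi> q" using KQ Q by blast
        then show "p \<in> KM" using y g1 unfolding KM_def by simp
      qed
      show "KM \<subseteq> g ` K" unfolding KM_def using g1 by force
    qed
    ultimately show "compactin (mtop M) KM" by (simp add: compactin_subtopology)
  qed
  then have KM: "openin (mtop M) (mpoints M - KM)" by (rule openin_diff[OF openin_topspace])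
  fix V \<psi> k assume v: "(V, \<psi>) \<in> matlas M"
  \<comment> \<open>On \<open>S1\<close> the function is \<open>G\<close> after a change of charts,
    on \<open>S2\<close> it is zero. The two open sets cover the chart because the closed cube
    \<open>K\<close> lies inside the open cube.\<close>
  define S1 where "S1 = \<psi> ` (V \<inter> UQ)"
  define S2 where "S2 = \<psi> ` (V \<inter> (mpoints M - KM))"
  have o1: "openin (Euclidean_space d) S1" unfolding S1_def
    by (intro chart_image_open[OF v] openin_Int chart(1)[OF v] UQ) auto
  have o2: "openin (Euclidean_space d) S2" unfolding S2_def
    by (intro chart_image_open[OF v] openin_Int chart(1)[OF v] KM) auto
  have "V = V \<inter> UQ \<union> V \<inter> (mpoints M - KM)"
    using chart_subset[OF v] KQ unfolding UQ_def KM_def by blast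
  then have S: "\<psi> ` V = S1 \<union> S2" unfolding S1_def S2_def by blast
  have 2: "ck d S2 k (\<lambda>y. ?h (inv_into V \<psi> y))"
  proof (rule ck_cong[OF o2 ck_const[OF o2, of k 0]])
    fix y assume "y \<in> S2"
    then obtain p where p: "p \<in> V" "p \<notin> KM" "y = \<psi> p" unfolding S2_def by blast
    have "?h p = 0"
    proof (cases "p \<in> U \<and> \<phi> p \<in> cube d a r")
      case True
      then have "\<phi> p \<notin> K" "\<phi> p \<in> ESp d" using p unfolding KM_def cube_def by auto
      then obtain i where "i < d" "\<not> \<bar>\<phi> p i - a i\<bar> \<le> c" unfolding K_def by blast
      then have "G (\<phi> p) = 0" using z[of "\<phi> p" i] True by simp
      then show ?thesis unfolding extend_def by simp
    qed (auto simp: extend_def)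
    then show "0 = ?h (inv_into V \<psi> y)" using p chart_inv[OF v] by simp
  qed
  have 1: "ck d S1 k (\<lambda>y. ?h (inv_into V \<psi> y))"
  proof (rule ck_cong[OF o1])
    show "ck d S1 k (\<lambda>y. G (\<phi> (inv_into V \<psi> y)))"
    proof (rule ck_compose[OF openin_cube o1 _ G])
      show "\<phi> (inv_into V \<psi> y) \<in> cube d a r" if "y \<in> S1" for y
        using that chart_inv[OF v] unfolding S1_def UQ_def by auto
      fix j assume "j < d"
      then have "smooth_on d (\<psi> ` (V \<inter> U)) (\<lambda>y. \<phi> (inv_into V \<psi> y) j)"
        using smooth v c unfolding smooth_manifold_def by blast
      then have "ck d (\<psi> ` (V \<inter> U)) k (\<lambda>y. \<phi> (inv_into V \<psi> y) j)"
        by (simp add: smooth_on_iff_ck)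
      then show "ck d S1 k (\<lambda>y. \<phi> (inv_into V \<psi> y) j)"
        by (rule ck_subset) (auto simp: S1_def UQ_def)
    qed
    fix y assume "y \<in> S1"
    then show "G (\<phi> (inv_into V \<psi> y)) = ?h (inv_into V \<psi> y)"
      using chart_inv[OF v] unfolding S1_def UQ_def by (auto simp: extend_def)
  qed
  show "ck d (\<psi> ` V) k (\<lambda>y. ?h (inv_into V \<psi> y))"
    unfolding S by (rule ck_Un[OF o1 o2 1 2])
qed

lemma tangent_linear:
  assumes "v \<in> tangent_space M p" "f \<in> C_infinity M" "g \<in> C_infinity M"
  shows "v (\<lambda>q. a * f q + b * g q) = a * v f + b * v g"
  using assms unfolding tangent_space_def linear_functionals_def by blast

lemma tangent_leibniz:
  assumes "v \<in> tangent_space M p" "f \<in> C_infinity M" "g \<in> C_infinity M"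
  shows "v (\<lambda>q. f q * g q) = v f * g p + f p * v g"
  using assms unfolding tangent_space_def by blast

lemma tangent_0: "v \<in> tangent_space M p \<Longrightarrow> v (\<lambda>q. 0) = 0"
  using tangent_linear[OF _ C_infinity_0 C_infinity_0, of v p 0 0] by simp

lemma tangent_sum:
  assumes "v \<in> tangent_space M p"
  shows "(\<And>i. i \<in> I \<Longrightarrow> f i \<in> C_infinity M) \<Longrightarrow> v (\<lambda>q. \<Sum>i\<in>I. f i q) = (\<Sum>i\<in>I. v (f i))"
proof (induction I rule: infinite_finite_induct)
  case (insert i I)
  then have "v (\<lambda>q. 1 * f i q + 1 * (\<Sum>i\<in>I. f i q)) = 1 * v (f i) + 1 * v (\<lambda>q. \<Sum>i\<in>I. f i q)"
    by (intro tangent_linear[OF assms] C_infinity_sum) auto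
  then show ?case using insert by simp
qed (simp_all add: tangent_0[OF assms])

lemma tangent_const:
  assumes v: "v \<in> tangent_space M p" and p: "p \<in> mpoints M"
  shows "v (const_fun c) = 0"
proof -
  have "(\<lambda>q. const_fun 1 q * const_fun 1 q) = const_fun 1"
    by (auto simp: const_fun_def fun_eq_iff)
  then have "v (const_fun 1) = 0"
    using tangent_leibniz[OF v C_infinity_const C_infinity_const, of 1 1] p by (simp add: const_fun_def)
  moreover have "(\<lambda>q. c * const_fun 1 q + 0 * const_fun 1 q) = const_fun c"
    by (auto simp: const_fun_def fun_eq_iff)
  ultimately show ?thesis
    using tangent_linear[OF v C_infinity_const C_infinity_const, of c 1 0 1] by simp
qed

text \<open>Hadamard's lemma writes f - f(p) locally as a sum of (y_i - a_i) g_i. Multiplying by the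
  square of a cutoff puts one cutoff on each factor, so both become global functions; each product
  is then killed by \<open>v\<close>, because \<open>v\<close> kills \<open>x i\<close> and
  \<open>x i\<close> vanishes at \<open>p\<close>.\<close>

theorem tangent_coordinates:
  assumes p: "p \<in> mpoints M"
  obtains x where "\<And>i. i < d \<Longrightarrow> x i \<in> C_infinity M"
    "\<And>v f. v \<in> tangent_space M p \<Longrightarrow> (\<And>i. i < d \<Longrightarrow> v (x i) = 0) \<Longrightarrow> f \<in> C_infinity M \<Longrightarrow> v f = 0"
proof -
  obtain U \<phi> where c: "(U, \<phi>) \<in> matlas M" and pU: "p \<in> U" using chart_cover[OF p] by blast
  define a where "a = \<phi> p"
  have aU: "a \<in> \<phi> ` U" using pU by (simp add: a_def)
  have aE: "a \<in> ESp d" using openin_subset[OF chart(2)[OF c]] aU by (auto simp: topspace_Euclidean_space)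
  obtain r where r: "r > 0" "\<forall>y\<in>ESp d. (\<forall>i<d. \<bar>y i - a i\<bar> < r) \<longrightarrow> y \<in> \<phi> ` U"
    using open_box[OF chart(2)[OF c] aU] by blast
  define Q where "Q = cube d a r"
  have QU: "Q \<subseteq> \<phi> ` U" using r(2) unfolding Q_def cube_def by blast
  have Qo: "openin (Euclidean_space d) Q" unfolding Q_def by (rule openin_cube)
  have aQ: "a \<in> Q" using aE r(1) by (simp add: Q_def cube_def)
  \<comment> \<open>A product of bumps that is non-zero at \<open>a\<close> and vanishes once some
    coordinate is farther than \<open>r / 2\<close>; the gap between \<open>r / 2\<close> and
    \<open>r\<close> is what \<open>extend_smooth\<close> asks for.\<close>
  define \<chi> where "\<chi> = (\<lambda>y. \<Prod>i<d. bfun 1 ((r / 2)\<^sup>2 - (y i - a i) * (y i - a i)))"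
  have \<chi>: "ck d Q k \<chi>" for k
    unfolding \<chi>_def by (intro ck_prod ck_bfun ck_diff ck_mult ck_const ck_coord Qo)
  have \<chi>0: "\<chi> y = 0" if "i < d" "r / 2 < \<bar>y i - a i\<bar>" for y i
  proof -
    have "(r / 2)\<^sup>2 < \<bar>y i - a i\<bar>\<^sup>2" using that r(1) by (intro power_strict_mono) auto
    then have "bfun 1 ((r / 2)\<^sup>2 - (y i - a i) * (y i - a i)) = 0"
      by (simp add: bfun_def power2_eq_square)
    then show ?thesis unfolding \<chi>_def using that(1) by (intro prod_zero) auto
  qed
  have \<chi>a: "\<chi> a \<noteq> 0" unfolding \<chi>_def using r(1) by (simp add: bfun_def)
  let ?e = "extend U \<phi> Q"
  have ext: "?e (\<lambda>y. \<chi> y * G y) \<in> C_infinity M" if "\<And>k. ck d Q k G" for G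
    unfolding Q_def
  proof (rule extend_smooth[OF c, of _ _ "r / 2"])
    show "cube d a r \<subseteq> \<phi> ` U" using QU unfolding Q_def .
    show "r / 2 < r" using r(1) by simp
    show "ck d (cube d a r) k (\<lambda>y. \<chi> y * G y)" for k
      using ck_mult[OF Qo \<chi> that] unfolding Q_def .
  qed (use \<chi>0 in auto)
  define x where "x = (\<lambda>i. ?e (\<lambda>y. \<chi> y * (y i - a i)))"
  have xC: "x i \<in> C_infinity M" for i
    unfolding x_def by (intro ext ck_diff ck_coord ck_const Qo)
  show thesis
  proof (rule that[OF xC])
    fix v f assume v: "v \<in> tangent_space M p" and vx: "\<And>i. i < d \<Longrightarrow> v (x i) = 0"
      and f: "f \<in> C_infinity M"
    have fQ: "ck d (cube d a r) k (\<lambda>y. f (inv_into U \<phi> y))" for k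
      using ck_subset[OF C_infinity_chart[OF f c]] QU unfolding Q_def by blast
    obtain g where g: "\<And>i k. i < d \<Longrightarrow> ck d Q k (g i)"
      "\<And>y. y \<in> Q \<Longrightarrow> f (inv_into U \<phi> y) = f (inv_into U \<phi> a) + (\<Sum>i<d. (y i - a i) * g i y)"
      using hadamard[OF aE fQ] unfolding Q_def by blast
    define \<gamma> where "\<gamma> = (\<lambda>i. ?e (\<lambda>y. \<chi> y * g i y))"
    have \<gamma>C: "\<gamma> i \<in> C_infinity M" if "i < d" for i
      unfolding \<gamma>_def by (intro ext g that)
    define \<eta> where "\<eta> = ?e (\<lambda>y. \<chi> y * 1)"
    have \<eta>C: "\<eta> \<in> C_infinity M" unfolding \<eta>_def by (intro ext ck_const Qo)
    define F where "F = (\<lambda>q. f q - const_fun (f p) q)"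
    have FC: "F \<in> C_infinity M" unfolding F_def by (intro C_infinity_diff f C_infinity_const)
    have Fp: "F p = 0" using p by (simp add: F_def const_fun_def)
    have \<eta>\<eta>: "(\<lambda>q. \<eta> q * \<eta> q) \<in> C_infinity M" by (intro C_infinity_mult \<eta>C)
    have id: "(\<lambda>q. \<eta> q * \<eta> q * F q) = (\<lambda>q. \<Sum>i<d. x i q * \<gamma> i q)"
    proof
      fix q show "\<eta> q * \<eta> q * F q = (\<Sum>i<d. x i q * \<gamma> i q)"
      proof (cases "q \<in> U \<and> \<phi> q \<in> Q")
        case True
        then have q: "q \<in> mpoints M" using chart_subset[OF c] by blast
        have "F q = (\<Sum>i<d. (\<phi> q i - a i) * g i (\<phi> q))"
          using g(2)[of "\<phi> q"] True chart_inv[OF c] pU q unfolding F_def const_fun_def a_def by simp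
        then show ?thesis using True
          unfolding \<eta>_def x_def \<gamma>_def extend_def by (simp add: sum_distrib_left algebra_simps)
      qed (auto simp: \<eta>_def x_def extend_def)
    qed
    have "v (\<lambda>q. \<eta> q * \<eta> q * F q) = \<eta> p * \<eta> p * v F"
      using tangent_leibniz[OF v \<eta>\<eta> FC] Fp by simp
    moreover have "v (\<lambda>q. \<Sum>i<d. x i q * \<gamma> i q) = (\<Sum>i<d. v (\<lambda>q. x i q * \<gamma> i q))"
      by (rule tangent_sum[OF v]) (auto intro: C_infinity_mult xC \<gamma>C)
    moreover have "v (\<lambda>q. x i q * \<gamma> i q) = 0" if "i < d" for i
      using tangent_leibniz[OF v xC \<gamma>C[OF that], of i] vx[OF that] by (simp add: x_def extend_def a_def)
    ultimately have "\<eta> p * \<eta> p * v F = 0" unfolding id by simp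
    moreover have "\<eta> p \<noteq> 0" using \<chi>a aQ pU by (simp add: \<eta>_def extend_def a_def)
    ultimately have "v F = 0" by simp
    moreover have "v F = v f"
      using tangent_linear[OF v f C_infinity_const, of 1 "-1" "f p"] tangent_const[OF v p]
      by (simp add: F_def)
    ultimately show "v f = 0" by simp
  qed
qed

section \<open>Vector fields as derivations, and their brackets\<close>

lemma vf_smooth: "X \<in> vector_fields M \<Longrightarrow> f \<in> C_infinity M \<Longrightarrow> X f \<in> C_infinity M"
  by (simp add: vector_fields_def)

lemma vf_tangent: "X \<in> vector_fields M \<Longrightarrow> p \<in> mpoints M \<Longrightarrow> vf_at X p \<in> tangent_space M p"
  by (simp add: vector_fields_def)

lemma vf_nonsmooth: "X \<in> vector_fields M \<Longrightarrow> f \<notin> C_infinity M \<Longrightarrow> X f = (\<lambda>p. 0)"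
  by (simp add: vector_fields_def)

lemma vf_linear:
  assumes X: "X \<in> vector_fields M" and f: "f \<in> C_infinity M" and g: "g \<in> C_infinity M"
  shows "X (\<lambda>q. a * f q + b * g q) = (\<lambda>p. a * X f p + b * X g p)"
proof
  fix p show "X (\<lambda>q. a * f q + b * g q) p = a * X f p + b * X g p"
    using tangent_linear[OF vf_tangent[OF X] f g, of p a b]
      C_infinity_outside[OF vf_smooth[OF X f], of p] C_infinity_outside[OF vf_smooth[OF X g], of p]
      C_infinity_outside[OF vf_smooth[OF X C_infinity_lin[OF f g]], of p a b]
    by (cases "p \<in> mpoints M") (auto simp: vf_at_def)
qed

lemma vf_leibniz:
  assumes X: "X \<in> vector_fields M" and f: "f \<in> C_infinity M" and g: "g \<in> C_infinity M"
  shows "X (\<lambda>q. f q * g q) = (\<lambda>p. X f p * g p + f p * X g p)"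
proof
  fix p show "X (\<lambda>q. f q * g q) p = X f p * g p + f p * X g p"
    using tangent_leibniz[OF vf_tangent[OF X] f g, of p]
      C_infinity_outside[OF vf_smooth[OF X f], of p] C_infinity_outside[OF vf_smooth[OF X g], of p]
      C_infinity_outside[OF vf_smooth[OF X C_infinity_mult[OF f g]], of p]
    by (cases "p \<in> mpoints M") (auto simp: vf_at_def)
qed

lemma vf_add: "X \<in> vector_fields M \<Longrightarrow> f \<in> C_infinity M \<Longrightarrow> g \<in> C_infinity M \<Longrightarrow>
    X (\<lambda>q. f q + g q) = (\<lambda>p. X f p + X g p)"
  using vf_linear[of X f g 1 1] by simp

lemma vf_diff: "X \<in> vector_fields M \<Longrightarrow> f \<in> C_infinity M \<Longrightarrow> g \<in> C_infinity M \<Longrightarrow>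
    X (\<lambda>q. f q - g q) = (\<lambda>p. X f p - X g p)"
  using vf_linear[of X f g 1 "-1"] by simp

lemma vf_scale: "X \<in> vector_fields M \<Longrightarrow> f \<in> C_infinity M \<Longrightarrow> X (\<lambda>q. c * f q) = (\<lambda>p. c * X f p)"
  using vf_linear[of X f f c 0] by simp

lemma vf_0: "X \<in> vector_fields M \<Longrightarrow> X (\<lambda>q. 0) = (\<lambda>p. 0)"
  using vf_linear[OF _ C_infinity_0 C_infinity_0, of X 0 0] by simp

lemma vector_fieldsI:
  assumes "\<And>f. f \<in> C_infinity M \<Longrightarrow> X f \<in> C_infinity M" "\<And>f. f \<notin> C_infinity M \<Longrightarrow> X f = (\<lambda>p. 0)"
    "\<And>f g a b p. f \<in> C_infinity M \<Longrightarrow> g \<in> C_infinity M \<Longrightarrow> X (\<lambda>q. a * f q + b * g q) p = a * X f p + b * X g p"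
    "\<And>f g p. f \<in> C_infinity M \<Longrightarrow> g \<in> C_infinity M \<Longrightarrow> X (\<lambda>q. f q * g q) p = X f p * g p + f p * X g p"
  shows "X \<in> vector_fields M"
  unfolding vector_fields_def vf_at_def tangent_space_def linear_functionals_def
  using assms by auto

definition vmul :: "('a \<Rightarrow> real) \<Rightarrow> 'a vfield \<Rightarrow> 'a vfield" where
  "vmul g X = (\<lambda>f p. g p * X f p)"

lemma vf_vmul: "g \<in> C_infinity M \<Longrightarrow> X \<in> vector_fields M \<Longrightarrow> vmul g X \<in> vector_fields M"
  unfolding vmul_def
  by (rule vector_fieldsI)
     (simp_all add: C_infinity_mult vf_smooth vf_nonsmooth vf_linear vf_leibniz algebra_simps)

lemma vf_subspace: "subspace (vector_fields M)"
  unfolding subspace_def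
proof (intro conjI ballI allI)
  show "0 \<in> vector_fields M"
    by (rule vector_fieldsI) (simp_all add: C_infinity_0 zero_fun_def)
next
  fix X Y assume "X \<in> vector_fields M" "Y \<in> vector_fields M"
  moreover have "X + Y = (\<lambda>f p. X f p + Y f p)" by (simp add: fun_eq_iff)
  ultimately show "X + Y \<in> vector_fields M"
    by (simp only:) (rule vector_fieldsI; simp add: C_infinity_add vf_smooth vf_nonsmooth vf_linear vf_leibniz algebra_simps)
next
  fix c X assume "X \<in> vector_fields M"
  moreover have "c *\<^sub>R X = (\<lambda>f p. c * X f p)" by (simp add: fun_eq_iff)
  ultimately show "c *\<^sub>R X \<in> vector_fields M"
    by (simp only:) (rule vector_fieldsI; simp add: C_infinity_scale vf_smooth vf_nonsmooth vf_linear vf_leibniz algebra_simps)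
qed

lemma vf_bracket_closed:
  assumes "X \<in> vector_fields M" "Y \<in> vector_fields M"
  shows "vf_bracket X Y \<in> vector_fields M"
proof (rule vector_fieldsI)
  fix f g a b p assume fg: "f \<in> C_infinity M" "g \<in> C_infinity M"
  note sm = vf_smooth[OF assms(1)] vf_smooth[OF assms(2)]
  have dl: "W (\<lambda>q. a * h q + b * k q) = (\<lambda>p. a * W h p + b * W k p)"
    "W (\<lambda>q. h q * k q) = (\<lambda>p. W h p * k p + h p * W k p)"
    if "W = X \<or> W = Y" "h \<in> C_infinity M" "k \<in> C_infinity M" for W h k
    using that assms vf_linear vf_leibniz by auto
  have da: "W (\<lambda>q. h q * k q + h' q * k' q) = (\<lambda>p. W h p * k p + h p * W k p + (W h' p * k' p + h' p * W k' p))"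
    if "W = X \<or> W = Y" "h \<in> C_infinity M" "k \<in> C_infinity M" "h' \<in> C_infinity M" "k' \<in> C_infinity M" for W h k h' k'
  proof -
    have "W (\<lambda>q. h q * k q + h' q * k' q) = (\<lambda>p. W (\<lambda>q. h q * k q) p + W (\<lambda>q. h' q * k' q) p)"
      using that assms by (intro vf_add C_infinity_mult) auto
    then show ?thesis by (simp only: dl(2)[OF that(1,2,3)] dl(2)[OF that(1,4,5)])
  qed
  show "vf_bracket X Y f \<in> C_infinity M"
    unfolding vf_bracket_def
    by (rule C_infinity_diff[OF sm(1)[OF sm(2)[OF fg(1)]] sm(2)[OF sm(1)[OF fg(1)]]])
  show "vf_bracket X Y (\<lambda>q. a * f q + b * g q) p = a * vf_bracket X Y f p + b * vf_bracket X Y g p"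
    unfolding vf_bracket_def dl(1)[OF disjI1[OF refl] fg] dl(1)[OF disjI2[OF refl] fg]
      dl(1)[OF disjI1[OF refl] sm(2)[OF fg(1)] sm(2)[OF fg(2)]] dl(1)[OF disjI2[OF refl] sm(1)[OF fg(1)] sm(1)[OF fg(2)]]
    by (simp add: algebra_simps)
  show "vf_bracket X Y (\<lambda>q. f q * g q) p = vf_bracket X Y f p * g p + f p * vf_bracket X Y g p"
    unfolding vf_bracket_def dl(2)[OF disjI1[OF refl] fg] dl(2)[OF disjI2[OF refl] fg]
      da[OF disjI1[OF refl] sm(2)[OF fg(1)] fg(2) fg(1) sm(2)[OF fg(2)]]
      da[OF disjI2[OF refl] sm(1)[OF fg(1)] fg(2) fg(1) sm(1)[OF fg(2)]]
    by (simp add: algebra_simps)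
qed (simp add: vf_bracket_def vf_nonsmooth vf_0 assms)

lemma vf_bracket_antisym: "vf_bracket X Y = - vf_bracket Y X"
  by (simp add: vf_bracket_def fun_eq_iff)

lemma vf_bracket_add_right:
  assumes "X \<in> vector_fields M" "Y \<in> vector_fields M" "Z \<in> vector_fields M"
  shows "vf_bracket X (Y + Z) = vf_bracket X Y + vf_bracket X Z"
proof (intro ext)
  fix f p
  show "vf_bracket X (Y + Z) f p = (vf_bracket X Y + vf_bracket X Z) f p"
  proof (cases "f \<in> C_infinity M")
    case True
    have "(Y + Z) f = (\<lambda>q. Y f q + Z f q)" by (simp add: fun_eq_iff)
    then show ?thesis using True by (simp add: vf_bracket_def vf_add assms vf_smooth)
  next
    case False
    then show ?thesis
      by (simp add: vf_nonsmooth[OF vf_bracket_closed] assms subspace_add[OF vf_subspace] del: plus_fun_apply)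
         (simp add: vf_nonsmooth[OF vf_bracket_closed] assms)
  qed
qed

lemma vf_bracket_vmul_right:
  assumes "X \<in> vector_fields M" "Z \<in> vector_fields M" "g \<in> C_infinity M"
  shows "vf_bracket X (vmul g Z) = vmul g (vf_bracket X Z) + vmul (X g) Z"
proof (intro ext)
  fix f p
  show "vf_bracket X (vmul g Z) f p = (vmul g (vf_bracket X Z) + vmul (X g) Z) f p"
  proof (cases "f \<in> C_infinity M")
    case True
    then show ?thesis by (simp add: vf_bracket_def vmul_def vf_leibniz assms vf_smooth algebra_simps)
  next
    case False
    then show ?thesis
      by (simp add: vf_nonsmooth[OF vf_bracket_closed] assms vf_vmul) (simp add: vmul_def vf_nonsmooth[OF vf_bracket_closed] vf_nonsmooth assms)
  qed
qed

lemma vf_bracket_scale_right: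
  assumes "X \<in> vector_fields M" "Z \<in> vector_fields M"
  shows "vf_bracket X (c *\<^sub>R Z) = c *\<^sub>R vf_bracket X Z"
proof (intro ext)
  fix f p
  have cZ: "(c *\<^sub>R Z) f = (\<lambda>q. c * Z f q)" for f by (simp add: fun_eq_iff)
  show "vf_bracket X (c *\<^sub>R Z) f p = (c *\<^sub>R vf_bracket X Z) f p"
  proof (cases "f \<in> C_infinity M")
    case True
    have "vf_bracket X (c *\<^sub>R Z) f p = X (\<lambda>q. c * Z f q) p - c * Z (X f) p"
      by (simp only: vf_bracket_def cZ)
    also have "X (\<lambda>q. c * Z f q) = (\<lambda>q. c * X (Z f) q)"
      using True by (simp add: vf_scale assms vf_smooth)
    finally have "vf_bracket X (c *\<^sub>R Z) f p = c * X (Z f) p - c * Z (X f) p" .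
    moreover have "(c *\<^sub>R vf_bracket X Z) f p = c * (X (Z f) p - Z (X f) p)"
      by (simp add: vf_bracket_def)
    ultimately show ?thesis by (simp only: right_diff_distrib)
  next
    case False
    show ?thesis
      unfolding scaleR_apply vf_nonsmooth[OF vf_bracket_closed[OF assms(1) subspace_scale[OF vf_subspace assms(2)]] False]
        vf_nonsmooth[OF vf_bracket_closed[OF assms] False] by simp
  qed
qed

lemma vf_bracket_0_right: "X \<in> vector_fields M \<Longrightarrow> vf_bracket X 0 = 0"
  using vf_bracket_scale_right[of X 0 0] subspace_0[OF vf_subspace] by simp

lemma vf_bracket_sum_right:
  assumes X: "X \<in> vector_fields M"
  shows "(\<And>i. i \<in> I \<Longrightarrow> Z i \<in> vector_fields M) \<Longrightarrow> vf_bracket X (\<Sum>i\<in>I. Z i) = (\<Sum>i\<in>I. vf_bracket X (Z i))"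
proof (induction I rule: infinite_finite_induct)
  case (insert i I)
  have "sum Z I \<in> vector_fields M" using insert by (intro subspace_sum[OF vf_subspace]) auto
  then have "vf_bracket X (Z i + sum Z I) = vf_bracket X (Z i) + vf_bracket X (sum Z I)"
    using insert by (intro vf_bracket_add_right X) auto
  moreover have "vf_bracket X (sum Z I) = (\<Sum>i\<in>I. vf_bracket X (Z i))"
    using insert by auto
  ultimately show ?case unfolding sum.insert[OF insert(1,2)] by (simp only:)
qed (simp_all add: vf_bracket_0_right X)

lemma vf_jacobi:
  assumes "X \<in> vector_fields M" "Y \<in> vector_fields M" "Z \<in> vector_fields M"
  shows "vf_bracket X (vf_bracket Y Z) = vf_bracket (vf_bracket X Y) Z + vf_bracket Y (vf_bracket X Z)"
proof (intro ext)
  fix f p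
  show "vf_bracket X (vf_bracket Y Z) f p = (vf_bracket (vf_bracket X Y) Z + vf_bracket Y (vf_bracket X Z)) f p"
  proof (cases "f \<in> C_infinity M")
    case True
    then show ?thesis by (simp add: vf_bracket_def vf_diff assms vf_smooth)
  next
    case False
    then show ?thesis by (simp add: vf_nonsmooth[OF vf_bracket_closed] assms vf_bracket_closed)
  qed
qed

section \<open>Finitely generated modules of vector fields\<close>

lemma finitely_generated:
  assumes "finitely_generated_module M E"
  obtains B where "finite B" "B \<subseteq> vector_fields M"
    "E = {\<Sum>Z\<in>B. vmul (g Z) Z | g. \<forall>Z\<in>B. g Z \<in> C_infinity M}"
proof -
  obtain B where B: "finite B" "B \<subseteq> vector_fields M"
    "E = {(\<lambda>f p. \<Sum>Z\<in>B. g Z p * Z f p) | g. \<forall>Z\<in>B. g Z \<in> C_infinity M}"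
    using assms unfolding finitely_generated_module_def by blast
  have "(\<lambda>f p. \<Sum>Z\<in>B. g Z p * Z f p) = (\<Sum>Z\<in>B. vmul (g Z) Z)" for g
    by (simp add: fun_eq_iff sum_fun_apply vmul_def)
  then show thesis using that B by simp
qed

lemma fg_module:
  assumes E: "finitely_generated_module M E"
  shows "E \<subseteq> vector_fields M" "subspace E" "\<And>g X. g \<in> C_infinity M \<Longrightarrow> X \<in> E \<Longrightarrow> vmul g X \<in> E"
proof -
  obtain B where B: "finite B" "B \<subseteq> vector_fields M"
    "E = {\<Sum>Z\<in>B. vmul (g Z) Z | g. \<forall>Z\<in>B. g Z \<in> C_infinity M}"
    using finitely_generated[OF E] by blast
  show "E \<subseteq> vector_fields M"
    unfolding B(3) using B(2) by (auto intro!: subspace_sum[OF vf_subspace] vf_vmul)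
  show mul: "vmul g X \<in> E" if gX: "g \<in> C_infinity M" "X \<in> E" for g X
  proof -
    obtain h where h: "X = (\<Sum>Z\<in>B. vmul (h Z) Z)" "\<forall>Z\<in>B. h Z \<in> C_infinity M" using gX(2) B(3) by blast
    have "vmul g X = (\<Sum>Z\<in>B. vmul (\<lambda>q. g q * h Z q) Z)"
      unfolding h(1) by (simp add: vmul_def fun_eq_iff sum_fun_apply sum_distrib_left mult.assoc)
    moreover have "\<forall>Z\<in>B. (\<lambda>q. g q * h Z q) \<in> C_infinity M" using h(2) gX(1) by (simp add: C_infinity_mult)
    ultimately show ?thesis unfolding B(3) by (intro CollectI exI[of _ "\<lambda>Z q. g q * h Z q"]) simp
  qed
  have "X + Y \<in> E" if XY: "X \<in> E" "Y \<in> E" for X Y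
  proof -
    obtain h where h: "X = (\<Sum>Z\<in>B. vmul (h Z) Z)" "\<forall>Z\<in>B. h Z \<in> C_infinity M" using XY(1) B(3) by blast
    obtain g where g: "Y = (\<Sum>Z\<in>B. vmul (g Z) Z)" "\<forall>Z\<in>B. g Z \<in> C_infinity M" using XY(2) B(3) by blast
    have "X + Y = (\<Sum>Z\<in>B. vmul (\<lambda>q. h Z q + g Z q) Z)"
      unfolding h(1) g(1) by (simp add: vmul_def fun_eq_iff sum_fun_apply sum.distrib algebra_simps)
    moreover have "\<forall>Z\<in>B. (\<lambda>q. h Z q + g Z q) \<in> C_infinity M" using h(2) g(2) by (simp add: C_infinity_add)
    ultimately show ?thesis unfolding B(3) by (intro CollectI exI[of _ "\<lambda>Z q. h Z q + g Z q"]) simp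
  qed
  moreover have "0 \<in> E"
  proof -
    have "0 = (\<Sum>Z\<in>B. vmul (\<lambda>q. 0) Z)" by (simp add: vmul_def fun_eq_iff sum_fun_apply)
    then show ?thesis unfolding B(3) using C_infinity_0 by (intro CollectI exI[of _ "\<lambda>Z q. 0"]) simp
  qed
  moreover have "c *\<^sub>R X \<in> E" if "X \<in> E" for c X
  proof -
    have "X \<in> vector_fields M" using that \<open>E \<subseteq> vector_fields M\<close> by blast
    then have "X f p = 0" if "p \<notin> mpoints M" for f p
      using C_infinity_outside[OF vf_smooth that] vf_nonsmooth[of X f] by (cases "f \<in> C_infinity M") auto
    \<comment> \<open>\<open>const_fun c\<close> is zero off \<open>M\<close>; the two sides agree
      there because \<open>X f\<close> is zero off \<open>M\<close> as well.\<close>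
    then have "c *\<^sub>R X = vmul (const_fun c) X"
      by (auto simp: vmul_def const_fun_def fun_eq_iff)
    then show ?thesis using mul[OF C_infinity_const that] by simp
  qed
  ultimately show "subspace E" unfolding subspace_def by blast
qed

end

section \<open>The associated graded Lie algebra\<close>

lemmas fun_ops = plus_fun_apply minus_fun_apply' uminus_fun_apply' zero_fun_apply' scaleR_apply

declare fun_ops [simp del]

text \<open>Members already in the span of \<open>D\<close> and their predecessors are discarded.
  The last clause says that discarding leaves the span before each kept vector unchanged, so order
  properties of \<open>ss\<close> pass to \<open>es\<close>.\<close>

lemma greedy_basis:
  fixes D :: "'v::real_vector set"
  shows "\<exists>es. (\<forall>a<length es. es ! a \<notin> span (D \<union> set (take a es))) \<and> span (D \<union> set es) = span (D \<union> set ss) \<and>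
    (\<forall>a<length es. \<exists>j<length ss. es ! a = ss ! j \<and> span (D \<union> set (take a es)) = span (D \<union> set (take j ss)))"
proof (induction ss rule: rev_induct)
  case Nil
  show ?case by (rule exI[of _ "[]"]) simp
next
  case (snoc s ss)
  then obtain es where es: "\<And>a. a < length es \<Longrightarrow> es ! a \<notin> span (D \<union> set (take a es))"
    "span (D \<union> set es) = span (D \<union> set ss)"
    "\<And>a. a < length es \<Longrightarrow> \<exists>j<length ss. es ! a = ss ! j \<and> span (D \<union> set (take a es)) = span (D \<union> set (take j ss))"
    by blast
  have 3: "\<exists>j<length (ss @ [s]). es ! a = (ss @ [s]) ! j \<and> span (D \<union> set (take a es)) = span (D \<union> set (take j (ss @ [s])))"
    if al: "a < length es" for a
  proof -
    obtain j where "j < length ss" "es ! a = ss ! j" "span (D \<union> set (take a es)) = span (D \<union> set (take j ss))"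
      using es(3)[OF al] by blast
    then show ?thesis by (intro exI[of _ j]) (simp add: nth_append)
  qed
  show ?case
  proof (cases "s \<in> span (D \<union> set ss)")
    case True
    then have "span (D \<union> set (ss @ [s])) = span (D \<union> set ss)" by (simp add: span_redundant)
    then show ?thesis using es 3 by (intro exI[of _ es]) auto
  next
    case False
    show ?thesis
    proof (intro exI[of _ "es @ [s]"] conjI allI impI)
      fix a assume "a < length (es @ [s])"
      then consider "a < length es" | "a = length es" by fastforce
      then show "(es @ [s]) ! a \<notin> span (D \<union> set (take a (es @ [s])))"
        by cases (use es False in \<open>auto simp: nth_append\<close>)
      show "\<exists>j<length (ss @ [s]). (es @ [s]) ! a = (ss @ [s]) ! j \<and>
          span (D \<union> set (take a (es @ [s]))) = span (D \<union> set (take j (ss @ [s])))"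
      proof (cases "a < length es")
        case True
        then show ?thesis using 3[OF True] by (simp add: nth_append)
      next
        case False
        then have "a = length es" using \<open>a < length (es @ [s])\<close> by simp
        then show ?thesis using es(2) by (intro exI[of _ "length ss"]) simp
      qed
    next
      have "span (insert s (D \<union> set es)) = span (insert s (D \<union> set ss))"
        using es(2) by (metis span_insert)
      then show "span (D \<union> set (es @ [s])) = span (D \<union> set (ss @ [s]))" by simp
    qed
  qed
qed

text \<open>Coordinates modulo a subspace that may be infinite-dimensional: a basis of
  \<open>D\<close> together with \<open>es\<close> is independent, so values may be prescribed on
  it.\<close>

lemma dual_coordinates:
  fixes D :: "'v::real_vector set" and es :: "'v list"
  assumes D: "subspace D" and es: "\<And>a. a < length es \<Longrightarrow> es ! a \<notin> span (D \<union> set (take a es))"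
  obtains \<kappa> :: "'v \<Rightarrow> nat \<Rightarrow> real" where "linear \<kappa>" "\<And>v. v \<in> D \<Longrightarrow> \<kappa> v = 0"
    "\<And>a b. a < length es \<Longrightarrow> \<kappa> (es ! a) b = (if a = b then 1 else 0)"
proof -
  obtain A where A: "A \<subseteq> D" "independent A" "D \<subseteq> span A" using maximal_independent_subset[of D] by blast
  have nin: "es ! a \<notin> span (A \<union> set (take a es))" if "a < length es" for a
  proof -
    have "span (A \<union> set (take a es)) \<subseteq> span (D \<union> set (take a es))"
      using A(1) by (intro span_mono) blast
    then show ?thesis using es[OF that] by blast
  qed
  have ind: "independent (A \<union> set (take a es))" if "a \<le> length es" for a
    using that
  proof (induction a)
    case (Suc a)
    then have "A \<union> set (take (Suc a) es) = insert (es ! a) (A \<union> set (take a es))"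
      by (simp add: take_Suc_conv_app_nth)
    then show ?case using Suc nin[of a] by (simp add: independent_insertI)
  qed (simp add: A(2))
  have inA: "es ! a \<notin> A" if "a < length es" for a using nin[OF that] by (auto intro: span_base)
  have dist: "es ! a \<noteq> es ! b" if ab: "a < length es" "b < length es" "a \<noteq> b" for a b
  proof -
    have "es ! b \<noteq> es ! a" if "a < b" "b < length es" for a b
    proof -
      have "es ! a \<in> set (take b es)" using that by (auto simp: in_set_conv_nth intro!: exI[of _ a])
      then show ?thesis using nin[of b] that by (metis UnI2 span_base)
    qed
    then show ?thesis using ab by (metis nat_neq_iff)
  qed
  define f :: "'v \<Rightarrow> nat \<Rightarrow> real" where
    "f v = (if v \<in> A then 0 else (\<lambda>b. if b < length es \<and> es ! b = v then 1 else 0))" for v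
  obtain \<kappa> where \<kappa>: "linear \<kappa>" "\<And>v. v \<in> A \<union> set es \<Longrightarrow> \<kappa> v = f v"
    using linear_independent_extend[OF ind[of "length es"], of f] by auto
  show thesis
  proof (rule that[OF \<kappa>(1)])
    fix v assume "v \<in> D"
    then have "v \<in> span A" using A(3) by blast
    then show "\<kappa> v = 0"
    proof (induction rule: span_induct_alt)
      case base
      then show ?case by (rule linear_0[OF \<kappa>(1)])
    next
      case (step c v y)
      then show ?case using \<kappa>(2)[of v] by (simp add: linear_add[OF \<kappa>(1)] linear_scale[OF \<kappa>(1)] f_def)
    qed
  next
    fix a b assume a: "a < length es"
    have "\<kappa> (es ! a) b = f (es ! a) b" using \<kappa>(2)[of "es ! a"] a by simp
    then show "\<kappa> (es ! a) b = (if a = b then 1 else 0)"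
      using inA[OF a] dist[OF a, of b] a by (cases "a = b"; cases "b < length es") (auto simp: f_def)
  qed
qed

locale filtered_mfd = smooth_mfd M for M :: "'a manifold" +
  fixes N :: nat and F :: "nat \<Rightarrow> 'a vfield set" and x :: 'a
  assumes filt: "filtration M N F" and x: "x \<in> mpoints M"
begin

lemma vf_ops [simp]: "vf_zero = 0" "vf_add X Y = X + Y" "vf_diff X Y = X - Y" "vf_scale c X = c *\<^sub>R X"
  by (simp_all add: vf_zero_def vf_add_def vf_diff_def vf_scale_def fun_eq_iff fun_ops)

lemma N: "1 \<le> N" and F_0: "F 0 = {0}" and F_N: "F N = vector_fields M"
  using filt by (auto simp: filtration_def)

lemma F_fg: "i \<in> {1..N} \<Longrightarrow> finitely_generated_module M (F i)"
  using filt by (auto simp: filtration_def)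

lemma F_sub: "i \<le> N \<Longrightarrow> subspace (F i)"
  using fg_module(2)[OF F_fg, of i] F_0 by (cases "i = 0") (auto simp: subspace_single_0)

lemma F_vf: "i \<le> N \<Longrightarrow> F i \<subseteq> vector_fields M"
  using fg_module(1)[OF F_fg, of i] F_0 subspace_0[OF vf_subspace] by (cases "i = 0") auto

lemma F_vmul: "i \<le> N \<Longrightarrow> g \<in> C_infinity M \<Longrightarrow> X \<in> F i \<Longrightarrow> vmul g X \<in> F i"
  using fg_module(3)[OF F_fg, of i] F_0 by (cases "i = 0") (auto simp: vmul_def fun_eq_iff fun_ops)

lemma F_mono: "i \<le> j \<Longrightarrow> j \<le> N \<Longrightarrow> F i \<subseteq> F j"
proof (induction j rule: dec_induct)
  case (step j)
  then have "F j \<subseteq> F (Suc j)" using filt unfolding filtration_def by auto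
  then show ?case using step by auto
qed simp

lemma F_bracket: "1 \<le> i \<Longrightarrow> 1 \<le> j \<Longrightarrow> i + j \<le> N \<Longrightarrow> X \<in> F i \<Longrightarrow> Y \<in> F j \<Longrightarrow> vf_bracket X Y \<in> F (i + j)"
  using filt unfolding filtration_def by blast

text \<open>The ideal absorbs real scalars, so the finite sums of products form exactly a real span,
  and the subspace laws come for free.\<close>

definition IF :: "nat \<Rightarrow> 'a vfield set" where
  "IF i = span {vmul g Z | g Z. g \<in> vanishing_ideal M x \<and> Z \<in> F i}"

lemma ideal_times_module_span: "ideal_times_module (vanishing_ideal M x) (F i) = IF i"
proof -
  let ?I = "vanishing_ideal M x"
  let ?S = "{vmul g Z | g Z. g \<in> ?I \<and> Z \<in> F i}"
  have eq: "(\<lambda>f p. \<Sum>k<m. g k p * Z k f p) = (\<Sum>k<m. vmul (g k) (Z k))" for m and g :: "nat \<Rightarrow> 'a \<Rightarrow> real" and Z :: "nat \<Rightarrow> 'a vfield"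
    by (simp add: fun_eq_iff sum_fun_apply vmul_def fun_ops)
  have T: "ideal_times_module ?I (F i) = {\<Sum>k<m. vmul (g k) (Z k) | (m::nat) g Z. \<forall>k<m. g k \<in> ?I \<and> Z k \<in> F i}"
    unfolding ideal_times_module_def eq ..
  show ?thesis
  proof
    show "ideal_times_module ?I (F i) \<subseteq> IF i"
    proof
      fix X assume "X \<in> ideal_times_module ?I (F i)"
      then obtain m :: nat and g Z where X: "X = (\<Sum>k<m. vmul (g k) (Z k))" "\<forall>k<m. g k \<in> ?I \<and> Z k \<in> F i"
        unfolding T by blast
      show "X \<in> IF i" unfolding X(1) IF_def
        by (intro span_sum span_base) (use X(2) in blast)
    qed
    show "IF i \<subseteq> ideal_times_module ?I (F i)"
    proof
      fix X assume "X \<in> IF i"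
      then show "X \<in> ideal_times_module ?I (F i)" unfolding IF_def
      proof (induction rule: span_induct_alt)
        case base
        show ?case unfolding T by (rule CollectI, rule exI[of _ 0]) simp
      next
        case (step c v y)
        obtain g Z where gZ: "v = vmul g Z" "g \<in> ?I" "Z \<in> F i" using step(1) by blast
        obtain m :: nat and h Y where y: "y = (\<Sum>k<m. vmul (h k) (Y k))" "\<forall>k<m. h k \<in> ?I \<and> Y k \<in> F i"
          using step(2) unfolding T by blast
        have "(\<lambda>q. c * g q) \<in> ?I" using gZ(2) C_infinity_scale unfolding vanishing_ideal_def by auto
        moreover have "c *\<^sub>R v = vmul (\<lambda>q. c * g q) Z" by (simp add: gZ(1) vmul_def fun_eq_iff fun_ops)
        moreover have "(\<Sum>k<m. vmul ((h(m := \<lambda>q. c * g q)) k) ((Y(m := Z)) k)) = y"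
          unfolding y(1) by (intro sum.cong) auto
        ultimately have "c *\<^sub>R v + y = (\<Sum>k<Suc m. vmul ((h(m := \<lambda>q. c * g q)) k) ((Y(m := Z)) k))"
          by (simp add: add.commute)
        moreover have "\<forall>k<Suc m. (h(m := \<lambda>q. c * g q)) k \<in> ?I \<and> (Y(m := Z)) k \<in> F i"
          using y(2) \<open>(\<lambda>q. c * g q) \<in> ?I\<close> gZ(3) by (simp add: less_Suc_eq)
        ultimately show ?case unfolding T by blast
      qed
    qed
  qed
qed

definition D :: "nat \<Rightarrow> 'a vfield set" where
  "D i = {Y + Z | Y Z. Y \<in> F (i - 1) \<and> Z \<in> IF i}"

lemma gr_denominator_eq: "gr_denominator M F x i = D i"
  by (simp add: gr_denominator_def D_def ideal_times_module_span)

lemma IF_sub: "subspace (IF i)" by (simp add: IF_def)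

lemma D_sub: "i \<in> {1..N} \<Longrightarrow> subspace (D i)"
  unfolding D_def using subspace_sums[OF F_sub[of "i - 1"] IF_sub[of i]] by auto

lemma IF_F: "i \<le> N \<Longrightarrow> IF i \<subseteq> F i"
  unfolding IF_def by (rule span_minimal) (auto simp: vanishing_ideal_def F_vmul F_sub)

lemma D_F: "i \<in> {1..N} \<Longrightarrow> D i \<subseteq> F i"
  unfolding D_def using subspace_add[OF F_sub[of i]] F_mono[of "i - 1" i] IF_F[of i] by auto

lemma F_D: "i \<in> {1..N} \<Longrightarrow> F (i - 1) \<subseteq> D i"
proof
  fix Y assume "i \<in> {1..N}" "Y \<in> F (i - 1)"
  then have "Y + 0 \<in> D i" unfolding D_def using subspace_0[OF IF_sub[of i]] by (intro CollectI exI conjI refl) auto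
  then show "Y \<in> D i" by (simp only: add_0_right)
qed

lemma IF_D: "i \<in> {1..N} \<Longrightarrow> IF i \<subseteq> D i"
proof
  fix Z assume "i \<in> {1..N}" "Z \<in> IF i"
  then have "0 + Z \<in> D i" unfolding D_def using subspace_0[OF F_sub[of "i - 1"]] by (intro CollectI exI conjI refl) auto
  then show "Z \<in> D i" by (simp only: add_0)
qed

text \<open>The critical case is [X, gV] = g [X, V] + X(g) V: the first term is in the ideal times
  \<open>F (i + j)\<close>, the second in \<open>F j\<close>, which lies in
  \<open>F (i + j - 1)\<close> because \<open>i \<ge> 1\<close>. For \<open>j = 1\<close> the part
  from \<open>F (j - 1)\<close> is zero.\<close>

lemma bracket_D_right:
  assumes ij: "1 \<le> i" "1 \<le> j" "i + j \<le> N" and X: "X \<in> F i" and Z: "Z \<in> D j"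
  shows "vf_bracket X Z \<in> D (i + j)"
proof -
  have k: "i + j \<in> {1..N}" using ij by auto
  have Xv: "X \<in> vector_fields M" using F_vf[of i] ij X by auto
  have Fv: "F j \<subseteq> vector_fields M" "F (j - 1) \<subseteq> vector_fields M" using F_vf[of j] F_vf[of "j - 1"] ij by auto
  obtain Y W where YW: "Z = Y + W" "Y \<in> F (j - 1)" "W \<in> IF j" using Z unfolding D_def by blast
  have Wv: "W \<in> vector_fields M" using YW(3) IF_F[of j] ij Fv by auto
  have "vf_bracket X Y \<in> D (i + j)"
  proof (cases "j = 1")
    case True
    then have "Y = 0" using YW(2) F_0 by simp
    then show ?thesis using vf_bracket_0_right[OF Xv] subspace_0[OF D_sub[OF k]] by simp
  next
    case False
    then have "vf_bracket X Y \<in> F (i + (j - 1))" using ij YW(2) X by (intro F_bracket) auto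
    then show ?thesis using F_D[OF k] ij by auto
  qed
  moreover have "W \<in> vector_fields M \<and> vf_bracket X W \<in> D (i + j)"
    using YW(3) unfolding IF_def
  proof (induction rule: span_induct_alt)
    case base
    then show ?case
      using vf_bracket_0_right[OF Xv] subspace_0[OF D_sub[OF k]] subspace_0[OF vf_subspace] by simp
  next
    case (step c v y)
    obtain g V where v: "v = vmul g V" "g \<in> vanishing_ideal M x" "V \<in> F j" using step(1) by blast
    have g: "g \<in> C_infinity M" using v(2) by (simp add: vanishing_ideal_def)
    have Vv: "V \<in> vector_fields M" using v(3) Fv by auto
    have vv: "v \<in> vector_fields M" unfolding v(1) by (rule vf_vmul[OF g Vv])
    have "vmul g (vf_bracket X V) \<in> IF (i + j)"
      unfolding IF_def using F_bracket[OF ij X v(3)] v(2) by (intro span_base) blast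
    moreover have "vmul (X g) V \<in> F (i + j - 1)"
    proof -
      have "F j \<subseteq> F (i + j - 1)" by (rule F_mono) (use ij in auto)
      then have "V \<in> F (i + j - 1)" using v(3) by blast
      then show ?thesis using F_vmul[of "i + j - 1" "X g" V] vf_smooth[OF Xv g] ij by auto
    qed
    ultimately have "vf_bracket X v \<in> D (i + j)"
      unfolding v(1) vf_bracket_vmul_right[OF Xv Vv g]
      by (intro subspace_add[OF D_sub[OF k]]) (use IF_D[OF k] F_D[OF k] in blast)+
    moreover have cv: "c *\<^sub>R v \<in> vector_fields M" by (rule subspace_scale[OF vf_subspace vv])
    ultimately have "vf_bracket X (c *\<^sub>R v) + vf_bracket X y \<in> D (i + j)"
      unfolding vf_bracket_scale_right[OF Xv vv] using step(2)
      by (intro subspace_add[OF D_sub[OF k]] subspace_scale[OF D_sub[OF k]]) auto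
    then show ?case
      using step(2) vf_bracket_add_right[OF Xv cv, of y] subspace_add[OF vf_subspace cv, of y] by (simp only:)
  qed
  ultimately show ?thesis
    unfolding YW(1) vf_bracket_add_right[OF Xv subsetD[OF Fv(2) YW(2)] Wv]
    by (intro subspace_add[OF D_sub[OF k]]) auto
qed

lemma bracket_D_left:
  assumes ij: "1 \<le> i" "1 \<le> j" "i + j \<le> N" and Z: "Z \<in> D i" and X: "X \<in> F j"
  shows "vf_bracket Z X \<in> D (i + j)"
  using bracket_D_right[of j i X Z] assms subspace_neg[OF D_sub[of "i + j"]]
    vf_bracket_antisym[of Z X] by (simp add: add.commute)

section \<open>Families of vector fields representing graded vectors\<close>

lemma fam_ops:
  fixes X Y :: "nat \<Rightarrow> 'a vfield"
  shows "(X + Y) k = X k + Y k" "(X - Y) k = X k - Y k" "(- X) k = - X k" "(0 :: nat \<Rightarrow> 'a vfield) k = 0"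
    "(c *\<^sub>R X) k = c *\<^sub>R X k"
  by (simp_all add: fun_ops)

definition FF :: "(nat \<Rightarrow> 'a vfield) set" where
  "FF = {X. (\<forall>i\<in>{1..N}. X i \<in> F i) \<and> (\<forall>i. i \<notin> {1..N} \<longrightarrow> X i = 0)}"

text \<open>Elements of the graded algebra are represented by families of vector fields; \<open>DD (Suc N)\<close> is the
  kernel of the class map, and the larger \<open>DD l\<close> filter the families by vanishing class in low degree.\<close>

definition DD :: "nat \<Rightarrow> (nat \<Rightarrow> 'a vfield) set" where
  "DD l = {X \<in> FF. \<forall>i\<in>{1..N}. i < l \<longrightarrow> X i \<in> D i}"

abbreviation "DF \<equiv> DD (Suc N)"

lemma FF_sub: "subspace FF"
  unfolding subspace_def FF_def
  by (auto simp: fam_ops subspace_0[OF F_sub] subspace_add[OF F_sub] subspace_scale[OF F_sub])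

lemma DD_sub: "subspace (DD l)"
  unfolding subspace_def DD_def
  by (auto simp: fam_ops subspace_0[OF D_sub] subspace_add[OF D_sub] subspace_scale[OF D_sub]
     subspace_0[OF FF_sub] subspace_add[OF FF_sub] subspace_scale[OF FF_sub])

lemma DD_FF: "DD l \<subseteq> FF"
  by (auto simp: DD_def)

lemma FF_F: "X \<in> FF \<Longrightarrow> i \<in> {1..N} \<Longrightarrow> X i \<in> F i"
  by (simp add: FF_def)

lemma FF_vf: "X \<in> FF \<Longrightarrow> X i \<in> vector_fields M"
  using F_vf[of i] subspace_0[OF vf_subspace] by (cases "i \<in> {1..N}") (auto simp: FF_def)

lemma gr_coset_eq: "gr_coset M F x i X = {Y \<in> F i. Y - X \<in> D i}"
  by (simp add: gr_coset_def gr_denominator_eq)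

lemma coset_eq:
  assumes i: "i \<in> {1..N}" and X: "X \<in> F i" and Y: "Y \<in> F i"
  shows "gr_coset M F x i X = gr_coset M F x i Y \<longleftrightarrow> X - Y \<in> D i"
proof
  assume "gr_coset M F x i X = gr_coset M F x i Y"
  moreover have "X \<in> gr_coset M F x i X" using X subspace_0[OF D_sub[OF i]] by (simp add: gr_coset_eq)
  ultimately show "X - Y \<in> D i" by (simp add: gr_coset_eq)
next
  assume d: "X - Y \<in> D i"
  have "Z - X \<in> D i \<longleftrightarrow> Z - Y \<in> D i" for Z
    using subspace_add[OF D_sub[OF i] _ d, of "Z - X"] subspace_diff[OF D_sub[OF i] _ d, of "Z - Y"]
    by auto
  then show "gr_coset M F x i X = gr_coset M F x i Y" by (simp add: gr_coset_eq)
qed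

lemma coset_mem: "i \<in> {1..N} \<Longrightarrow> X \<in> F i \<Longrightarrow> X \<in> gr_coset M F x i X"
  using subspace_0[OF D_sub] by (simp add: gr_coset_eq)

definition cls :: "(nat \<Rightarrow> 'a vfield) \<Rightarrow> 'a gr_vector" where
  "cls X = (\<lambda>i\<in>{1..N}. gr_coset M F x i (X i))"

abbreviation "L \<equiv> gr_lie M N F x"

lemma carrier_L: "carrier L = cls ` FF"
proof
  show "cls ` FF \<subseteq> carrier L" by (auto simp: gr_lie_def cls_def FF_def)
  show "carrier L \<subseteq> cls ` FF"
  proof
    fix u assume "u \<in> carrier L"
    then have u: "u \<in> PiE {1..N} (\<lambda>i. gr_coset M F x i ` F i)" by (simp add: gr_lie_def)
    then have "\<forall>i\<in>{1..N}. \<exists>X. X \<in> F i \<and> u i = gr_coset M F x i X" by (auto simp: PiE_iff image_iff)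
    then obtain X where X: "\<And>i. i \<in> {1..N} \<Longrightarrow> X i \<in> F i \<and> u i = gr_coset M F x i (X i)"
      unfolding bchoice_iff by blast
    define X' where "X' = (\<lambda>i. if i \<in> {1..N} then X i else 0)"
    have "X' \<in> FF" using X by (auto simp: FF_def X'_def)
    moreover have "u = cls X'"
      unfolding cls_def by (rule PiE_ext[OF u]) (use X in \<open>auto simp: X'_def\<close>)
    ultimately show "u \<in> cls ` FF" by blast
  qed
qed

lemma cls_eq_iff:
  assumes "X \<in> FF" "Y \<in> FF"
  shows "cls X = cls Y \<longleftrightarrow> X - Y \<in> DF"
proof -
  have "cls X = cls Y \<longleftrightarrow> (\<forall>i\<in>{1..N}. gr_coset M F x i (X i) = gr_coset M F x i (Y i))"
    unfolding cls_def restrict_def by (auto simp: fun_eq_iff)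
  also have "\<dots> \<longleftrightarrow> (\<forall>i\<in>{1..N}. X i - Y i \<in> D i)"
    using coset_eq FF_F assms by blast
  finally show ?thesis
    using subspace_diff[OF FF_sub assms] by (auto simp: DD_def fam_ops)
qed

lemma coset_Union:
  assumes "\<And>z. z \<in> A \<Longrightarrow> f z = c" "A \<noteq> {}"
  shows "(\<Union>z\<in>A. f z) = c"
  using assms by auto

lemma cls_nth: "i \<in> {1..N} \<Longrightarrow> cls X i = gr_coset M F x i (X i)"
  by (simp add: cls_def)

lemma lzero_cls: "lzero L = cls 0"
  by (simp add: gr_lie_def cls_def fam_ops)

lemma lscale_cls:
  assumes X: "X \<in> FF"
  shows "lscale L c (cls X) = cls (c *\<^sub>R X)"
proof -
  have "(\<Union>Y\<in>cls X i. gr_coset M F x i (c *\<^sub>R Y)) = gr_coset M F x i ((c *\<^sub>R X) i)" if i: "i \<in> {1..N}" for i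
  proof (rule coset_Union)
    show "cls X i \<noteq> {}" using coset_mem[OF i FF_F[OF X i]] by (auto simp: cls_nth[OF i])
    fix Y assume "Y \<in> cls X i"
    then have Y: "Y \<in> F i" "Y - X i \<in> D i" by (auto simp: cls_nth[OF i] gr_coset_eq)
    have s: "c *\<^sub>R Y - c *\<^sub>R X i \<in> D i"
      using subspace_scale[OF D_sub[OF i] Y(2), of c] by (simp add: scaleR_diff_right)
    have iN: "i \<le> N" using i by simp
    show "gr_coset M F x i (c *\<^sub>R Y) = gr_coset M F x i ((c *\<^sub>R X) i)"
      using s by (subst coset_eq[OF i]) (auto simp: fam_ops subspace_scale[OF F_sub[OF iN]] Y FF_F[OF X i])
  qed
  then show ?thesis unfolding gr_lie_def cls_def[of "c *\<^sub>R X"] lie_algebra.simps vf_ops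
    by (intro restrict_ext) simp
qed

lemma ladd_cls:
  assumes X: "X \<in> FF" and Y: "Y \<in> FF"
  shows "ladd L (cls X) (cls Y) = cls (X + Y)"
proof -
  have "(\<Union>X'\<in>cls X i. \<Union>Y'\<in>cls Y i. gr_coset M F x i (X' + Y')) = gr_coset M F x i ((X + Y) i)"
    if i: "i \<in> {1..N}" for i
  proof (rule coset_Union[OF coset_Union])
    show "cls X i \<noteq> {}" using coset_mem[OF i FF_F[OF X i]] by (auto simp: cls_nth[OF i])
    show "cls Y i \<noteq> {}" using coset_mem[OF i FF_F[OF Y i]] by (auto simp: cls_nth[OF i])
    fix X' Y' assume "X' \<in> cls X i" "Y' \<in> cls Y i"
    then have X': "X' \<in> F i" "X' - X i \<in> D i" and Y': "Y' \<in> F i" "Y' - Y i \<in> D i"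
      by (auto simp: cls_nth[OF i] gr_coset_eq)
    have s: "X' + Y' - (X i + Y i) \<in> D i"
      using subspace_add[OF D_sub[OF i] X'(2) Y'(2)] by (simp add: algebra_simps)
    have iN: "i \<le> N" using i by simp
    show "gr_coset M F x i (X' + Y') = gr_coset M F x i ((X + Y) i)"
      using s by (subst coset_eq[OF i]) (auto simp: fam_ops subspace_add[OF F_sub[OF iN]] X' Y' FF_F[OF X i] FF_F[OF Y i])
  qed
  then show ?thesis unfolding gr_lie_def cls_def[of "X + Y"] lie_algebra.simps vf_ops
    by (intro restrict_ext) simp
qed

definition br :: "(nat \<Rightarrow> 'a vfield) \<Rightarrow> (nat \<Rightarrow> 'a vfield) \<Rightarrow> nat \<Rightarrow> 'a vfield" where
  "br X Y = (\<lambda>k. if k \<in> {1..N} then \<Sum>i\<in>{1..<k}. vf_bracket (X i) (Y (k - i)) else 0)"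

lemma br_closed: "X \<in> FF \<Longrightarrow> Y \<in> FF \<Longrightarrow> br X Y \<in> FF"
proof -
  assume X: "X \<in> FF" and Y: "Y \<in> FF"
  have "vf_bracket (X i) (Y (k - i)) \<in> F k" if "k \<in> {1..N}" "i \<in> {1..<k}" for i k
    using F_bracket[of i "k - i" "X i" "Y (k - i)"] FF_F[OF X, of i] FF_F[OF Y, of "k - i"] that by auto
  then show ?thesis by (auto simp: FF_def br_def intro!: subspace_sum[OF F_sub])
qed

text \<open>All components of \<open>X\<close> have degree at least 1, so a bracket pushes vanishing
  classes one degree further. This is the source of nilpotency.\<close>

lemma br_DD_right: "X \<in> FF \<Longrightarrow> Y \<in> DD l \<Longrightarrow> br X Y \<in> DD (Suc l)"
proof -
  assume X: "X \<in> FF" and Y: "Y \<in> DD l"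
  have YF: "Y \<in> FF" using Y DD_FF by blast
  have "vf_bracket (X i) (Y (k - i)) \<in> D k" if "k \<in> {1..N}" "k < Suc l" "i \<in> {1..<k}" for i k
  proof -
    have "k - i \<in> {1..N}" "k - i < l" using that by auto
    then have "Y (k - i) \<in> D (k - i)" using Y unfolding DD_def by blast
    then show ?thesis using bracket_D_right[of i "k - i" "X i" "Y (k - i)"] FF_F[OF X, of i] that by auto
  qed
  then show ?thesis using br_closed[OF X YF] by (auto simp: DD_def br_def intro!: subspace_sum[OF D_sub])
qed

lemma br_add_right: "X \<in> FF \<Longrightarrow> Y \<in> FF \<Longrightarrow> Z \<in> FF \<Longrightarrow> br X (Y + Z) = br X Y + br X Z"
proof
  fix k assume "X \<in> FF" "Y \<in> FF" "Z \<in> FF"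
  then show "br X (Y + Z) k = (br X Y + br X Z) k"
    by (simp add: br_def fam_ops vf_bracket_add_right FF_vf sum.distrib)
qed

lemma br_scale_right: "X \<in> FF \<Longrightarrow> Y \<in> FF \<Longrightarrow> br X (c *\<^sub>R Y) = c *\<^sub>R br X Y"
proof
  fix k assume "X \<in> FF" "Y \<in> FF"
  then show "br X (c *\<^sub>R Y) k = (c *\<^sub>R br X Y) k"
    by (simp add: br_def fam_ops vf_bracket_scale_right FF_vf scaleR_sum_right)
qed

lemma br_antisym: "br X Y = - br Y X"
proof
  fix k
  have "(\<Sum>i\<in>{1..<k}. vf_bracket (X i) (Y (k - i))) = (\<Sum>i\<in>{1..<k}. - vf_bracket (Y i) (X (k - i)))"
    by (rule sum.reindex_bij_witness[of _ "\<lambda>i. k - i" "\<lambda>i. k - i"])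
       (auto intro: vf_bracket_antisym[symmetric])
  then show "br X Y k = (- br Y X) k"
    by (simp add: br_def fam_ops sum_negf)
qed

lemma br_0_right: "X \<in> FF \<Longrightarrow> br X 0 = 0"
  using br_scale_right[of X 0 0] subspace_0[OF FF_sub] by simp

lemma br_sum_right:
  "X \<in> FF \<Longrightarrow> (\<And>a. a \<in> A \<Longrightarrow> Y a \<in> FF) \<Longrightarrow> br X (\<Sum>a\<in>A. Y a) = (\<Sum>a\<in>A. br X (Y a))"
proof (induction A rule: infinite_finite_induct)
  case (insert a A)
  then show ?case using br_add_right[of X "Y a" "sum Y A"] subspace_sum[OF FF_sub, of A Y] by auto
qed (simp_all add: br_0_right)

lemma br_diff_right: "X \<in> FF \<Longrightarrow> Y \<in> FF \<Longrightarrow> Z \<in> FF \<Longrightarrow> br X (Y - Z) = br X Y - br X Z"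
  using br_add_right[of X Y "(-1) *\<^sub>R Z"] br_scale_right[of X Z "-1"] subspace_scale[OF FF_sub, of Z "-1"] by simp

lemma br_add_left: "X \<in> FF \<Longrightarrow> Y \<in> FF \<Longrightarrow> Z \<in> FF \<Longrightarrow> br (Y + Z) X = br Y X + br Z X"
  using br_add_right[of X Y Z] br_antisym[of "Y + Z" X] br_antisym[of Y X] br_antisym[of Z X] by simp

lemma br_scale_left: "X \<in> FF \<Longrightarrow> Y \<in> FF \<Longrightarrow> br (c *\<^sub>R Y) X = c *\<^sub>R br Y X"
  using br_scale_right[of X Y c] br_antisym[of "c *\<^sub>R Y" X] br_antisym[of Y X] by simp

lemma br_DD_left: "X \<in> FF \<Longrightarrow> Y \<in> DD l \<Longrightarrow> br Y X \<in> DD (Suc l)"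
  using br_DD_right[of X Y l] br_antisym[of Y X] subspace_neg[OF DD_sub] by simp

lemma DD_antimono: "l \<le> l' \<Longrightarrow> DD l' \<subseteq> DD l"
  by (auto simp: DD_def)

lemma br_DF_right: "X \<in> FF \<Longrightarrow> Y \<in> DF \<Longrightarrow> br X Y \<in> DF"
  using br_DD_right[of X Y "Suc N"] DD_antimono[of "Suc N" "Suc (Suc N)"] by auto

lemma br_DF_left: "X \<in> FF \<Longrightarrow> Y \<in> DF \<Longrightarrow> br Y X \<in> DF"
  using br_DD_left[of X Y "Suc N"] DD_antimono[of "Suc N" "Suc (Suc N)"] by auto

text \<open>The identity holds for the families themselves, before passing to classes: in degree k
  it is the sum of the Jacobi identities for fields over all triples of positive degrees with sum
  k.\<close>

lemma br_jacobi:
  assumes X: "X \<in> FF" and Y: "Y \<in> FF" and Z: "Z \<in> FF"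
  shows "br X (br Y Z) = br (br X Y) Z + br Y (br X Z)"
proof
  fix k
  show "br X (br Y Z) k = (br (br X Y) Z + br Y (br X Z)) k"
  proof (cases "k \<in> {1..N}")
    case True
    let ?T = "{(i, j). 1 \<le> i \<and> 1 \<le> j \<and> i + j < k}"
    have fin: "finite ?T" by (rule finite_subset[of _ "{..k} \<times> {..k}"]) auto
    have sg: "(\<Sum>i\<in>{1..<k}. \<Sum>j\<in>{1..<k - i}. h i j) = (\<Sum>(i, j)\<in>?T. h i j)" for h :: "nat \<Rightarrow> nat \<Rightarrow> 'a vfield"
      by (subst sum.Sigma) (auto intro!: sum.cong)
    have sw: "(\<Sum>(i, j)\<in>?T. h i j) = (\<Sum>(i, j)\<in>?T. h j i)" for h :: "nat \<Rightarrow> nat \<Rightarrow> 'a vfield"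
      by (rule sum.reindex_bij_witness[of _ "\<lambda>(i, j). (j, i)" "\<lambda>(i, j). (j, i)"]) auto
    have nest_right: "br A (br B C) k = (\<Sum>(i, j)\<in>?T. vf_bracket (A i) (vf_bracket (B j) (C (k - i - j))))"
      if "A \<in> FF" "B \<in> FF" "C \<in> FF" for A B C
    proof -
      have "br A (br B C) k = (\<Sum>i\<in>{1..<k}. vf_bracket (A i) (\<Sum>j\<in>{1..<k - i}. vf_bracket (B j) (C (k - i - j))))"
        using True by (auto simp: br_def intro!: sum.cong)
      also have "\<dots> = (\<Sum>i\<in>{1..<k}. \<Sum>j\<in>{1..<k - i}. vf_bracket (A i) (vf_bracket (B j) (C (k - i - j))))"
        using that by (intro sum.cong refl vf_bracket_sum_right) (auto simp: FF_vf vf_bracket_closed)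
      finally show ?thesis unfolding sg .
    qed
    \<comment> \<open>Antisymmetry turns the left-nested bracket into a right-nested one, at the
      price of relabelling the triples of degrees.\<close>
    have left: "br (br X Y) Z k = (\<Sum>(i, j)\<in>?T. vf_bracket (vf_bracket (X i) (Y j)) (Z (k - i - j)))"
    proof -
      have "br (br X Y) Z k = - br Z (br X Y) k"
        using fun_cong[OF br_antisym[of "br X Y" Z], of k] by (simp add: fam_ops)
      also have "br Z (br X Y) k = (\<Sum>(l, i)\<in>?T. vf_bracket (Z l) (vf_bracket (X i) (Y (k - l - i))))"
        by (rule nest_right[OF Z X Y])
      also have "\<dots> = (\<Sum>(i, j)\<in>?T. vf_bracket (Z (k - i - j)) (vf_bracket (X i) (Y j)))"
        by (rule sum.reindex_bij_witness[of _ "\<lambda>(i, j). (k - i - j, i)" "\<lambda>(l, i). (i, k - l - i)"]) auto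
      also have "- \<dots> = (\<Sum>(i, j)\<in>?T. vf_bracket (vf_bracket (X i) (Y j)) (Z (k - i - j)))"
        unfolding sum_negf[symmetric]
        by (intro sum.cong refl) (auto intro: vf_bracket_antisym[symmetric])
      finally show ?thesis .
    qed
    have right: "br Y (br X Z) k = (\<Sum>(i, j)\<in>?T. vf_bracket (Y j) (vf_bracket (X i) (Z (k - i - j))))"
      unfolding nest_right[OF Y X Z] by (subst sw) (simp add: add.commute)
    show ?thesis
      unfolding fam_ops left right nest_right[OF X Y Z] sum.distrib[symmetric]
    proof (intro sum.cong refl, clarify)
      fix i j
      show "vf_bracket (X i) (vf_bracket (Y j) (Z (k - i - j)))
         = vf_bracket (vf_bracket (X i) (Y j)) (Z (k - i - j)) + vf_bracket (Y j) (vf_bracket (X i) (Z (k - i - j)))"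
        by (intro vf_jacobi FF_vf X Y Z)
    qed
  next
    case False
    then have "br A B k = 0" for A B by (simp only: br_def if_False)
    then show ?thesis by (simp add: fam_ops)
  qed
qed

definition delta :: "(nat \<Rightarrow> 'a vfield) \<Rightarrow> nat \<Rightarrow> 'a vfield" where
  "delta X = (\<lambda>i. real i *\<^sub>R X i)"

lemma linear_delta: "linear delta"
  by (rule linearI; rule ext; simp add: delta_def fam_ops scaleR_add_right mult.commute)

lemma delta_closed: "X \<in> FF \<Longrightarrow> delta X \<in> FF"
  by (auto simp: FF_def delta_def subspace_scale[OF F_sub])

text \<open>The degrees are at least 1, so multiplying by them is invertible. The faithfulness of
  the representation below comes from this.\<close>

lemma delta_DF: "X \<in> FF \<Longrightarrow> delta X \<in> DF \<longleftrightarrow> X \<in> DF"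
proof -
  assume X: "X \<in> FF"
  have "real i *\<^sub>R X i \<in> D i \<longleftrightarrow> X i \<in> D i" if i: "i \<in> {1..N}" for i
  proof
    assume "real i *\<^sub>R X i \<in> D i"
    then have "(1 / real i) *\<^sub>R (real i *\<^sub>R X i) \<in> D i" by (rule subspace_scale[OF D_sub[OF i]])
    then show "X i \<in> D i" using i by simp
  qed (rule subspace_scale[OF D_sub[OF i]])
  then show ?thesis using X delta_closed[OF X] by (auto simp: DD_def delta_def)
qed

lemma delta_br:
  assumes X: "X \<in> FF" and Y: "Y \<in> FF"
  shows "delta (br X Y) = br (delta X) Y + br X (delta Y)"
proof
  fix k
  have "real k *\<^sub>R vf_bracket (X i) (Y (k - i)) = vf_bracket (real i *\<^sub>R X i) (Y (k - i)) + vf_bracket (X i) (real (k - i) *\<^sub>R Y (k - i))"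
    if "i \<in> {1..<k}" for i
  proof -
    have "vf_bracket (real i *\<^sub>R X i) (Y (k - i)) = real i *\<^sub>R vf_bracket (X i) (Y (k - i))"
      using vf_bracket_antisym[of "real i *\<^sub>R X i"] vf_bracket_antisym[of "X i"]
        vf_bracket_scale_right[of "Y (k - i)" "X i" "real i"] FF_vf X Y by simp
    moreover have "vf_bracket (X i) (real (k - i) *\<^sub>R Y (k - i)) = real (k - i) *\<^sub>R vf_bracket (X i) (Y (k - i))"
      using vf_bracket_scale_right FF_vf X Y by blast
    moreover have "real k = real i + real (k - i)" using that by simp
    ultimately show ?thesis by (simp only: scaleR_add_left)
  qed
  then show "delta (br X Y) k = (br (delta X) Y + br X (delta Y)) k"
    by (auto simp: delta_def br_def fam_ops scaleR_sum_right sum.distrib[symmetric] intro!: sum.cong)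
qed

lemma bracket_cong:
  assumes ij: "1 \<le> i" "1 \<le> j" "i + j \<le> N" and X: "X \<in> F i" "X' \<in> F i" "X' - X \<in> D i"
    and Y: "Y \<in> F j" "Y' \<in> F j" "Y' - Y \<in> D j"
  shows "vf_bracket X' Y' - vf_bracket X Y \<in> D (i + j)"
proof -
  have v: "X \<in> vector_fields M" "X' \<in> vector_fields M" "Y \<in> vector_fields M" "Y' \<in> vector_fields M"
    using X Y F_vf[of i] F_vf[of j] ij by auto
  note vd = subspace_diff[OF vf_subspace]
  have "vf_bracket X' (Y + (Y' - Y)) = vf_bracket X' Y + vf_bracket X' (Y' - Y)"
    by (intro vf_bracket_add_right v vd)
  moreover have "vf_bracket Y (X + (X' - X)) = vf_bracket Y X + vf_bracket Y (X' - X)"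
    by (intro vf_bracket_add_right v vd)
  ultimately have "vf_bracket X' Y' - vf_bracket X Y = vf_bracket X' (Y' - Y) + vf_bracket (X' - X) Y"
    using vf_bracket_antisym[of X' Y] vf_bracket_antisym[of X Y] vf_bracket_antisym[of "X' - X" Y] by simp
  moreover have "i + j \<in> {1..N}" using ij by auto
  ultimately show ?thesis
    using bracket_D_right[OF ij X(2) Y(3)] bracket_D_left[OF ij X(3) Y(1)] subspace_add[OF D_sub] by simp
qed

lemma lbracket_cls:
  assumes X: "X \<in> FF" and Y: "Y \<in> FF"
  shows "lbracket L (cls X) (cls Y) = cls (br X Y)"
proof -
  have "(\<Union>X'\<in>Pi {1..N} (cls X). \<Union>Y'\<in>Pi {1..N} (cls Y).
      gr_coset M F x k (\<lambda>f p. \<Sum>i\<in>{1..<k}. vf_bracket (X' i) (Y' (k - i)) f p)) = gr_coset M F x k (br X Y k)"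
    if k: "k \<in> {1..N}" for k
  proof (rule coset_Union[OF coset_Union])
    show "Pi {1..N} (cls X) \<noteq> {}" proof -
      have "X \<in> Pi {1..N} (cls X)"
        by (rule Pi_I) (simp only: cls_nth coset_mem FF_F[OF X])
      then show ?thesis by blast
    qed
    show "Pi {1..N} (cls Y) \<noteq> {}" proof -
      have "Y \<in> Pi {1..N} (cls Y)"
        by (rule Pi_I) (simp only: cls_nth coset_mem FF_F[OF Y])
      then show ?thesis by blast
    qed
    fix X' Y' assume "X' \<in> Pi {1..N} (cls X)" "Y' \<in> Pi {1..N} (cls Y)"
    then have X': "\<And>i. i \<in> {1..N} \<Longrightarrow> X' i \<in> F i \<and> X' i - X i \<in> D i"
      and Y': "\<And>i. i \<in> {1..N} \<Longrightarrow> Y' i \<in> F i \<and> Y' i - Y i \<in> D i"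
      by (auto simp: cls_nth gr_coset_eq Pi_iff)
    let ?s = "\<Sum>i\<in>{1..<k}. vf_bracket (X' i) (Y' (k - i))"
    have eq: "(\<lambda>f p. \<Sum>i\<in>{1..<k}. vf_bracket (X' i) (Y' (k - i)) f p) = ?s"
      by (simp add: fun_eq_iff sum_fun_apply)
    have idx: "1 \<le> i" "1 \<le> k - i" "i + (k - i) = k" "i \<in> {1..N}" "k - i \<in> {1..N}" if "i \<in> {1..<k}" for i
      using that k by auto
    have kN: "k \<le> N" using k by simp
    have sF: "?s \<in> F k"
    proof (rule subspace_sum[OF F_sub[OF kN]])
      fix i assume i: "i \<in> {1..<k}"
      then show "vf_bracket (X' i) (Y' (k - i)) \<in> F k"
        using F_bracket[of i "k - i" "X' i" "Y' (k - i)"] idx[OF i] X' Y' kN by auto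
    qed
    have "?s - br X Y k = (\<Sum>i\<in>{1..<k}. vf_bracket (X' i) (Y' (k - i)) - vf_bracket (X i) (Y (k - i)))"
      using k by (simp add: br_def sum_subtractf)
    also have "\<dots> \<in> D k"
    proof (rule subspace_sum[OF D_sub[OF k]])
      fix i assume i: "i \<in> {1..<k}"
      show "vf_bracket (X' i) (Y' (k - i)) - vf_bracket (X i) (Y (k - i)) \<in> D k"
        using bracket_cong[of i "k - i" "X i" "X' i" "Y (k - i)" "Y' (k - i)"] idx[OF i] X' Y' FF_F[OF X] FF_F[OF Y] kN by simp
    qed
    finally show "gr_coset M F x k (\<lambda>f p. \<Sum>i\<in>{1..<k}. vf_bracket (X' i) (Y' (k - i)) f p) = gr_coset M F x k (br X Y k)"
      unfolding eq using coset_eq[OF k sF FF_F[OF br_closed[OF X Y] k]] by blast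
  qed
  then show ?thesis unfolding gr_lie_def cls_def[of "br X Y"] lie_algebra.simps
    by (intro restrict_ext) simp
qed

section \<open>Finite-dimensionality and a basis adapted to the grading\<close>

lemma vmul_const: "X \<in> vector_fields M \<Longrightarrow> vmul (const_fun c) X = c *\<^sub>R X"
proof (intro ext)
  fix f p assume X: "X \<in> vector_fields M"
  have "X f p = 0" if "p \<notin> mpoints M"
    using C_infinity_outside[OF vf_smooth[OF X] that] vf_nonsmooth[OF X, of f] by (cases "f \<in> C_infinity M") auto
  then show "vmul (const_fun c) X f p = (c *\<^sub>R X) f p"
    by (auto simp: vmul_def const_fun_def fun_ops)
qed

text \<open>Each coefficient function is split into its value at \<open>x\<close> and a remainder in
  the vanishing ideal, so modulo \<open>IF i\<close> only real combinations of the generators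
  remain.\<close>

lemma F_span:
  assumes i: "i \<in> {1..N}"
  shows "\<exists>B. finite B \<and> B \<subseteq> F i \<and> F i \<subseteq> span (B \<union> IF i)"
proof -
  obtain B where B: "finite B" "B \<subseteq> vector_fields M"
    "F i = {\<Sum>Z\<in>B. vmul (g Z) Z | g. \<forall>Z\<in>B. g Z \<in> C_infinity M}"
    using finitely_generated[OF F_fg[OF i]] by blast
  have BF: "B \<subseteq> F i"
  proof
    fix Z0 assume Z0: "Z0 \<in> B"
    define g where "g = (\<lambda>Z. if Z = Z0 then const_fun 1 else const_fun 0)"
    have "(\<Sum>Z\<in>B. vmul (g Z) Z) = (\<Sum>Z\<in>B. if Z = Z0 then Z0 else 0)"
      using B(2) by (intro sum.cong) (auto simp: g_def vmul_const)
    also have "\<dots> = Z0" using B(1) Z0 by simp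
    finally have "Z0 = (\<Sum>Z\<in>B. vmul (g Z) Z)" by (rule sym)
    moreover have "\<forall>Z\<in>B. g Z \<in> C_infinity M" by (simp add: g_def C_infinity_const)
    ultimately show "Z0 \<in> F i" unfolding B(3) by blast
  qed
  have "F i \<subseteq> span (B \<union> IF i)"
  proof
    fix X assume "X \<in> F i"
    then obtain g where g: "X = (\<Sum>Z\<in>B. vmul (g Z) Z)" "\<forall>Z\<in>B. g Z \<in> C_infinity M" unfolding B(3) by blast
    show "X \<in> span (B \<union> IF i)" unfolding g(1)
    proof (rule span_sum)
      fix Z assume Z: "Z \<in> B"
      define h where "h = (\<lambda>q. g Z q - const_fun (g Z x) q)"
      have "h \<in> C_infinity M"
        unfolding h_def using g(2) Z by (intro C_infinity_diff C_infinity_const) auto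
      moreover have "h x = 0" using x by (simp add: h_def const_fun_def)
      ultimately have "h \<in> vanishing_ideal M x" by (simp add: vanishing_ideal_def)
      then have "vmul h Z \<in> IF i" unfolding IF_def using Z BF by (intro span_base) blast
      moreover have "vmul (g Z) Z = vmul (const_fun (g Z x)) Z + vmul h Z"
        by (intro ext) (simp add: vmul_def h_def fun_ops algebra_simps)
      then have "vmul (g Z) Z = g Z x *\<^sub>R Z + vmul h Z"
        using vmul_const[of Z "g Z x"] B(2) Z by auto
      moreover have "Z \<in> span (B \<union> IF i)" using Z by (simp add: span_base)
      moreover have "vmul h Z \<in> span (B \<union> IF i)" using calculation(1) by (simp add: span_base)
      ultimately show "vmul (g Z) Z \<in> span (B \<union> IF i)" by (simp add: span_add span_scale)
    qed
  qed
  then show ?thesis using B(1) BF by blast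
qed

definition single :: "nat \<Rightarrow> 'a vfield \<Rightarrow> nat \<Rightarrow> 'a vfield" where
  "single i Z = (\<lambda>k. if k = i then Z else 0)"

lemma single_FF: "i \<in> {1..N} \<Longrightarrow> Z \<in> F i \<Longrightarrow> single i Z \<in> FF"
  using subspace_0[OF F_sub] by (auto simp: FF_def single_def)

lemma single_DF: "i \<in> {1..N} \<Longrightarrow> Z \<in> D i \<Longrightarrow> single i Z \<in> DF"
  using single_FF[of i Z] D_F[of i] subspace_0[OF D_sub] by (auto simp: DD_def single_def)

text \<open>Applied with \<open>i = 0\<close> this gives spanning; applied to a bracket with a
  homogeneous family of degree \<open>i\<close> it says that only vectors of higher degree are
  used.\<close>

lemma FF_span:
  assumes W: "W \<in> FF" and low: "\<And>k. k \<le> i \<Longrightarrow> W k = 0"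
    and B: "\<And>k. k \<in> {1..N} \<Longrightarrow> F k \<subseteq> span (B k \<union> IF k)"
    and T: "\<And>k Z. k \<in> {1..N} \<Longrightarrow> i < k \<Longrightarrow> Z \<in> B k \<Longrightarrow> single k Z \<in> T"
  shows "W \<in> span (DF \<union> T)"
proof -
  have "W = (\<Sum>k\<in>{1..N}. single k (W k))"
  proof
    fix l
    have "(\<Sum>k\<in>{1..N}. single k (W k)) l = (\<Sum>k\<in>{1..N}. single k (W k) l)" by (rule sum_fun_apply)
    also have "\<dots> = (\<Sum>k\<in>{1..N}. if k = l then W l else 0)"
      by (intro sum.cong) (auto simp: single_def)
    also have "\<dots> = W l" using W by (auto simp: FF_def)
    finally show "W l = (\<Sum>k\<in>{1..N}. single k (W k)) l" by simp
  qed
  moreover have "single k (W k) \<in> span (DF \<union> T)" if k: "k \<in> {1..N}" for k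
  proof (cases "k \<le> i")
    case True
    then have "single k (W k) = 0" by (auto simp: low single_def fam_ops)
    then show ?thesis by (simp add: span_zero)
  next
    case False
    have "W k \<in> span (B k \<union> IF k)" using B[OF k] FF_F[OF W k] by blast
    then show ?thesis
    proof (induction rule: span_induct_alt)
      case base
      have "single k 0 = 0" by (auto simp: single_def fam_ops)
      then show ?case by (simp add: span_zero)
    next
      case (step c v y)
      have "single k v \<in> span (DF \<union> T)"
        using step(1) T[OF k, of v] False single_DF[OF k, of v] IF_D[OF k] by (auto intro!: span_base)
      moreover have "single k (c *\<^sub>R v + y) = c *\<^sub>R single k v + single k y"
        by (auto simp: single_def fam_ops)
      ultimately show ?case using step(2) by (simp add: span_add span_scale)
    qed
  qed
  ultimately show ?thesis by (metis (no_types, lifting) span_sum)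
qed

lemma br_single_low: "X \<in> FF \<Longrightarrow> k \<le> i \<Longrightarrow> br X (single i Z) k = 0"
  by (auto simp: br_def single_def vf_bracket_0_right[OF FF_vf] intro!: sum.neutral)

text \<open>Generators of higher degree are listed first. A bracket with a vector of degree i has
  components only in degrees above i, which are spanned by earlier vectors, so every adjoint
  operator is strictly triangular.\<close>

lemma graded_basis:
  obtains es and \<kappa> :: "(nat \<Rightarrow> 'a vfield) \<Rightarrow> nat \<Rightarrow> real" where
    "set es \<subseteq> FF" "linear \<kappa>" "\<And>v. v \<in> DF \<Longrightarrow> \<kappa> v = 0"
    "\<And>a b. a < length es \<Longrightarrow> \<kappa> (es ! a) b = (if a = b then 1 else 0)"
    "FF \<subseteq> span (DF \<union> set es)"
    "\<And>X a. X \<in> FF \<Longrightarrow> a < length es \<Longrightarrow> br X (es ! a) \<in> span (DF \<union> set (take a es))"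
proof -
  have "\<forall>i\<in>{1..N}. \<exists>B. finite B \<and> B \<subseteq> F i \<and> F i \<subseteq> span (B \<union> IF i)" using F_span by blast
  then obtain B where B: "\<And>i. i \<in> {1..N} \<Longrightarrow> finite (B i) \<and> B i \<subseteq> F i \<and> F i \<subseteq> span (B i \<union> IF i)"
    unfolding bchoice_iff by blast
  have "finite (Sigma {1..N} B)" using B by auto
  then obtain xs where xs: "set xs = Sigma {1..N} B" using finite_list by blast
  \<comment> \<open>The key \<open>N - fst p\<close> sorts by decreasing degree.\<close>
  define ps where "ps = sort_key (\<lambda>p. N - fst p) xs"
  have ps: "set ps = Sigma {1..N} B" by (simp add: ps_def xs)
  have srt: "sorted (map (\<lambda>p. N - fst p) ps)" by (simp add: ps_def)
  define ss where "ss = map (\<lambda>p. single (fst p) (snd p)) ps"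
  have len: "length ss = length ps" by (simp add: ss_def)
  have B': "F k \<subseteq> span (B k \<union> IF k)" if "k \<in> {1..N}" for k using B[OF that] by blast
  obtain es where es: "\<And>a. a < length es \<Longrightarrow> es ! a \<notin> span (DF \<union> set (take a es))"
    "span (DF \<union> set es) = span (DF \<union> set ss)"
    "\<And>a. a < length es \<Longrightarrow> \<exists>j<length ss. es ! a = ss ! j \<and> span (DF \<union> set (take a es)) = span (DF \<union> set (take j ss))"
    using greedy_basis[of DF ss] by blast
  obtain \<kappa> :: "(nat \<Rightarrow> 'a vfield) \<Rightarrow> nat \<Rightarrow> real" where \<kappa>: "linear \<kappa>" "\<And>v. v \<in> DF \<Longrightarrow> \<kappa> v = 0"
    "\<And>a b. a < length es \<Longrightarrow> \<kappa> (es ! a) b = (if a = b then 1 else 0)"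
    using dual_coordinates[OF DD_sub es(1)] by blast
  have mem: "fst (ps ! j) \<in> {1..N}" "snd (ps ! j) \<in> F (fst (ps ! j))" if "j < length ps" for j
  proof -
    have "ps ! j \<in> Sigma {1..N} B" using that ps nth_mem by blast
    then have 1: "fst (ps ! j) \<in> {1..N}" "snd (ps ! j) \<in> B (fst (ps ! j))" by (auto simp: mem_Sigma_iff split: prod.splits)
    then show "fst (ps ! j) \<in> {1..N}" "snd (ps ! j) \<in> F (fst (ps ! j))" using B[OF 1(1)] by blast+
  qed
  show thesis
  proof (rule that[OF _ \<kappa>])
    show "set es \<subseteq> FF"
    proof
      fix e assume "e \<in> set es"
      then obtain a where "a < length es" "e = es ! a" by (auto simp: in_set_conv_nth)
      then obtain j where "j < length ps" "e = ss ! j" using es(3) len by auto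
      then show "e \<in> FF" using single_FF mem by (simp add: ss_def)
    qed
    show "FF \<subseteq> span (DF \<union> set es)"
    proof
      fix W assume W: "W \<in> FF"
      show "W \<in> span (DF \<union> set es)" unfolding es(2)
      proof (rule FF_span[OF W _ B', of 0])
        show "W k = 0" if "k \<le> 0" for k using W that by (simp add: FF_def)
        fix k Z assume "k \<in> {1..N}" "Z \<in> B k"
        then have "(k, Z) \<in> set ps" by (simp add: ps)
        then show "single k Z \<in> set ss" by (force simp: ss_def)
      qed
    qed
    fix X a assume X: "X \<in> FF" and a: "a < length es"
    obtain j where j: "j < length ps" "es ! a = ss ! j" "span (DF \<union> set (take a es)) = span (DF \<union> set (take j ss))"
      using es(3)[OF a] len by auto
    define i where "i = fst (ps ! j)"
    have eq: "es ! a = single i (snd (ps ! j))" using j by (simp add: ss_def i_def)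
    have sF: "single i (snd (ps ! j)) \<in> FF" using single_FF mem j(1) by (simp add: i_def)
    show "br X (es ! a) \<in> span (DF \<union> set (take a es))"
      unfolding j(3) eq
    proof (rule FF_span[OF br_closed[OF X sF] _ B', of i])
      show "br X (single i (snd (ps ! j))) k = 0" if "k \<le> i" for k by (rule br_single_low[OF X that])
      fix k Z assume k: "k \<in> {1..N}" "i < k" "Z \<in> B k"
      then have "(k, Z) \<in> set ps" by (simp add: ps)
      then obtain l where l: "l < length ps" "ps ! l = (k, Z)" by (auto simp: in_set_conv_nth)
      have "l < j"
      proof (rule ccontr)
        assume "\<not> l < j"
        then have "N - fst (ps ! j) \<le> N - fst (ps ! l)"
          using sorted_nth_mono[OF srt, of j l] l(1) j(1) by simp
        then show False using k l(2) by (simp add: i_def)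
      qed
      then have "ss ! l \<in> set (take j ss)"
        using l(1) len by (auto simp: in_set_conv_nth intro!: exI[of _ l])
      then show "single k Z \<in> set (take j ss)" using l by (simp add: ss_def)
    qed
  qed
qed

end

section \<open>A faithful nilpotent representation\<close>

declare minus_apply [simp del] uminus_apply [simp del]

lemma vec_ops:
  fixes f g :: "nat \<Rightarrow> real"
  shows "(f + g) b = f b + g b" "(f - g) b = f b - g b" "(- f) b = - f b" "(0 :: nat \<Rightarrow> real) b = 0"
    "(c *\<^sub>R f) b = c * f b" "(\<Sum>i\<in>I. h i) b = (\<Sum>i\<in>I. h i b :: real)"
  by (simp_all add: fun_ops sum_fun_apply)

locale filtered_basis = filtered_mfd M N F x
  for M :: "'a manifold" and N F x +
  fixes es :: "(nat \<Rightarrow> 'a vfield) list" and \<kappa> :: "(nat \<Rightarrow> 'a vfield) \<Rightarrow> nat \<Rightarrow> real"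
  assumes es_FF: "set es \<subseteq> FF" and linear_kappa: "linear \<kappa>" and kappa_DF: "\<And>v. v \<in> DF \<Longrightarrow> \<kappa> v = 0"
    and kappa_es: "\<And>a b. a < length es \<Longrightarrow> \<kappa> (es ! a) b = (if a = b then 1 else 0)"
    and FF_spanned: "FF \<subseteq> span (DF \<union> set es)"
    and flag: "\<And>X a. X \<in> FF \<Longrightarrow> a < length es \<Longrightarrow> br X (es ! a) \<in> span (DF \<union> set (take a es))"
begin

abbreviation "n \<equiv> length es"

lemmas kappa_add = linear_add[OF linear_kappa]
lemmas kappa_scale = linear_scale[OF linear_kappa]
lemmas kappa_diff = linear_diff[OF linear_kappa]
lemmas kappa_0 = linear_0[OF linear_kappa]

lemma kappa_sum: "\<kappa> (\<Sum>i\<in>I. f i) = (\<Sum>i\<in>I. \<kappa> (f i))"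
  by (rule linear_sum[OF linear_kappa])

lemma es_mem: "a < n \<Longrightarrow> es ! a \<in> FF"
  using es_FF by auto

definition lift :: "(nat \<Rightarrow> real) \<Rightarrow> nat \<Rightarrow> 'a vfield" where
  "lift f = (\<Sum>a<n. f a *\<^sub>R es ! a)"

lemma lift_FF: "lift f \<in> FF"
  unfolding lift_def by (intro subspace_sum[OF FF_sub] subspace_scale[OF FF_sub] es_mem) simp

lemma linear_lift: "linear lift"
  by (rule linearI) (simp_all add: lift_def vec_ops scaleR_add_left sum.distrib scaleR_sum_right)

lemma lift_kappa_span: "W \<in> span (DF \<union> set es) \<Longrightarrow> W - lift (\<kappa> W) \<in> DF"
proof (induction rule: span_induct_alt)
  case base
  then show ?case using subspace_0[OF DD_sub] by (simp add: kappa_0 linear_0[OF linear_lift])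
next
  case (step c v y)
  have "v - lift (\<kappa> v) \<in> DF"
  proof (cases "v \<in> DF")
    case True
    then show ?thesis by (simp add: kappa_DF linear_0[OF linear_lift])
  next
    case False
    then obtain a where a: "a < n" "v = es ! a" using step(1) by (auto simp: in_set_conv_nth)
    have "lift (\<kappa> v) = (\<Sum>b<n. if b = a then es ! a else 0)"
      unfolding lift_def by (intro sum.cong) (auto simp: a kappa_es)
    then have "lift (\<kappa> v) = v" using a by simp
    then show ?thesis using subspace_0[OF DD_sub] by simp
  qed
  then have "c *\<^sub>R (v - lift (\<kappa> v)) + (y - lift (\<kappa> y)) \<in> DF"
    using step(2) by (intro subspace_add[OF DD_sub] subspace_scale[OF DD_sub])
  then show ?case
    by (simp add: kappa_add kappa_scale linear_add[OF linear_lift] linear_scale[OF linear_lift] algebra_simps)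
qed

lemma lift_kappa: "W \<in> FF \<Longrightarrow> W - lift (\<kappa> W) \<in> DF"
  using lift_kappa_span FF_spanned by blast

lemma kappa_flag: "W \<in> span (DF \<union> set (take a es)) \<Longrightarrow> a \<le> b \<Longrightarrow> \<kappa> W b = 0"
proof (induction rule: span_induct_alt)
  case base
  then show ?case by (simp add: kappa_0 vec_ops)
next
  case (step c v y)
  have "\<kappa> v b = 0"
  proof (cases "v \<in> DF")
    case True
    then show ?thesis by (simp add: kappa_DF vec_ops)
  next
    case False
    then obtain i where "i < a" "i < n" "v = es ! i" using step(1) by (auto simp: in_set_conv_nth)
    then show ?thesis using step.prems by (simp add: kappa_es)
  qed
  then show ?case using step by (simp add: kappa_add kappa_scale vec_ops)
qed

lemma kappa_outside: "W \<in> FF \<Longrightarrow> n \<le> b \<Longrightarrow> \<kappa> W b = 0"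
  using kappa_flag[of W n b] FF_spanned by auto

lemma kappa_eq_0: "W \<in> FF \<Longrightarrow> \<kappa> W = 0 \<longleftrightarrow> W \<in> DF"
  using lift_kappa[of W] kappa_DF by (auto simp: linear_0[OF linear_lift])

text \<open>This extends \<open>flag\<close> from basis vectors to all families supported on an
  initial segment of coordinates, so that it can be iterated.\<close>

lemma kappa_br_flag:
  assumes X: "X \<in> FF" and W: "W \<in> FF" and z: "\<And>b. a \<le> b \<Longrightarrow> \<kappa> W b = 0" and b: "a \<le> b"
  shows "\<kappa> (br X W) b = 0"
proof -
  have "br X W = br X (lift (\<kappa> W) + (W - lift (\<kappa> W)))" by simp
  also have "\<dots> = br X (lift (\<kappa> W)) + br X (W - lift (\<kappa> W))"
    by (intro br_add_right X lift_FF subspace_diff[OF FF_sub] W)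
  finally have "\<kappa> (br X W) = \<kappa> (br X (lift (\<kappa> W)))"
    using kappa_DF[OF br_DF_right[OF X lift_kappa[OF W]]] by (simp add: kappa_add)
  also have "br X (lift (\<kappa> W)) = (\<Sum>i<n. \<kappa> W i *\<^sub>R br X (es ! i))"
    unfolding lift_def using X es_mem
    by (subst br_sum_right) (auto simp: br_scale_right intro: subspace_scale[OF FF_sub])
  finally have "\<kappa> (br X W) b = (\<Sum>i<n. \<kappa> W i * \<kappa> (br X (es ! i)) b)"
    by (simp add: kappa_sum kappa_scale vec_ops)
  also have "\<dots> = 0"
  proof (rule sum.neutral, rule ballI)
    fix i assume i: "i \<in> {..<n}"
    show "\<kappa> W i * \<kappa> (br X (es ! i)) b = 0"
    proof (cases "a \<le> i")
      case True
      then show ?thesis by (simp add: z)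
    next
      case False
      then show ?thesis using kappa_flag[OF flag[OF X], of i b] i b by simp
    qed
  qed
  finally show ?thesis .
qed

text \<open>The adjoint representation of \<open>gr \<rtimes> \<real>\<delta>\<close> restricted to \<open>gr\<close>; coordinate \<open>n\<close> is that of the
  degree derivation \<open>\<delta>\<close>, which makes the representation faithful on the centre of \<open>gr\<close>.\<close>

definition rep :: "(nat \<Rightarrow> 'a vfield) \<Rightarrow> (nat \<Rightarrow> real) endo" where
  "rep X = Endo (\<lambda>f. \<kappa> (br X (lift f)) - f n *\<^sub>R \<kappa> (delta X))"

lemma app_rep: "X \<in> FF \<Longrightarrow> app (rep X) f = \<kappa> (br X (lift f)) - f n *\<^sub>R \<kappa> (delta X)"
proof -
  assume X: "X \<in> FF"
  have "linear (\<lambda>f. \<kappa> (br X (lift f)) - f n *\<^sub>R \<kappa> (delta X))"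
  proof (rule linearI)
    fix f g :: "nat \<Rightarrow> real"
    show "\<kappa> (br X (lift (f + g))) - (f + g) n *\<^sub>R \<kappa> (delta X)
       = \<kappa> (br X (lift f)) - f n *\<^sub>R \<kappa> (delta X) + (\<kappa> (br X (lift g)) - g n *\<^sub>R \<kappa> (delta X))"
      using br_add_right[OF X lift_FF lift_FF] plus_fun_apply[of f g n]
      by (simp add: linear_add[OF linear_lift] kappa_add scaleR_add_left)
  next
    fix c :: real and f :: "nat \<Rightarrow> real"
    show "\<kappa> (br X (lift (c *\<^sub>R f))) - (c *\<^sub>R f) n *\<^sub>R \<kappa> (delta X)
       = c *\<^sub>R (\<kappa> (br X (lift f)) - f n *\<^sub>R \<kappa> (delta X))"
      using br_scale_right[OF X lift_FF] scaleR_apply[of c f n]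
      by (simp add: linear_scale[OF linear_lift] kappa_scale scaleR_diff_right)
  qed
  then show ?thesis unfolding rep_def by (rule app_Endo)
qed

text \<open>Coordinates of families vanish at index \<open>n\<close>, so the \<delta>-term drops out
  and the plain adjoint action remains.\<close>

lemma app_rep_kappa:
  assumes X: "X \<in> FF" and W: "W \<in> FF"
  shows "app (rep X) (\<kappa> W) = \<kappa> (br X W)"
proof -
  have "br X W = br X (lift (\<kappa> W) + (W - lift (\<kappa> W)))" by simp
  also have "\<dots> = br X (lift (\<kappa> W)) + br X (W - lift (\<kappa> W))"
    by (intro br_add_right X lift_FF subspace_diff[OF FF_sub] W)
  finally have "\<kappa> (br X W) = \<kappa> (br X (lift (\<kappa> W)))"
    using kappa_DF[OF br_DF_right[OF X lift_kappa[OF W]]] by (simp add: kappa_add)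
  then show ?thesis using kappa_outside[OF W, of n] by (simp add: app_rep X)
qed

lemma rep_eq:
  assumes X: "X \<in> FF"
  shows "app (rep X) f = \<kappa> (br X (lift f) - f n *\<^sub>R delta X)"
    "br X (lift f) - f n *\<^sub>R delta X \<in> FF"
  using br_closed[OF X lift_FF] delta_closed[OF X]
  by (simp_all add: app_rep X kappa_diff kappa_scale subspace_diff[OF FF_sub] subspace_scale[OF FF_sub])

lemma rep_add: "X \<in> FF \<Longrightarrow> Y \<in> FF \<Longrightarrow> rep (X + Y) = rep X + rep Y"
  by (rule endo_eqI) (simp add: app_rep subspace_add[OF FF_sub] br_add_left lift_FF kappa_add
     linear_add[OF linear_delta] scaleR_add_right)

lemma rep_scale: "X \<in> FF \<Longrightarrow> rep (c *\<^sub>R X) = c *\<^sub>R rep X"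
  by (rule endo_eqI) (simp add: app_rep subspace_scale[OF FF_sub] br_scale_left lift_FF kappa_scale
     linear_scale[OF linear_delta] scaleR_diff_right mult.commute)

lemma rep_DF: "X \<in> DF \<Longrightarrow> rep X = 0"
proof (rule endo_eqI)
  fix f assume X: "X \<in> DF"
  then have XF: "X \<in> FF" using DD_FF by blast
  show "app (rep X) f = app 0 f"
    using kappa_DF[OF br_DF_left[OF lift_FF X]] kappa_DF[of "delta X"] delta_DF[OF XF] X
    by (simp add: app_rep XF)
qed

lemma rep_diff: "X \<in> FF \<Longrightarrow> Y \<in> FF \<Longrightarrow> rep (X - Y) = rep X - rep Y"
  using rep_add[of X "(-1) *\<^sub>R Y"] rep_scale[of Y "-1"] subspace_scale[OF FF_sub, of Y "-1"] by simp

text \<open>Evaluation at the basis vector \<open>u\<close> belonging to \<delta> returns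
  \<open>delta X\<close> up to sign, and \<open>delta\<close> is injective modulo
  \<open>DF\<close>.\<close>

lemma rep_faithful:
  assumes X: "X \<in> FF" and 0: "rep X = 0"
  shows "X \<in> DF"
proof -
  define u where "u = (\<lambda>b. if b = n then 1 else 0 :: real)"
  have "lift u = 0" unfolding lift_def by (rule sum.neutral) (simp add: u_def)
  then have "app (rep X) u = - \<kappa> (delta X)"
    by (simp add: app_rep X br_0_right kappa_0 u_def)
  then have "\<kappa> (delta X) = 0" using 0 by simp
  then show ?thesis using kappa_eq_0[OF delta_closed[OF X]] delta_DF[OF X] by simp
qed

text \<open>The Jacobi identity gives the part on the families; the coefficient of
  \<open>f n\<close> is the derivation rule for \<open>delta\<close>.\<close>

lemma rep_br:
  assumes X: "X \<in> FF" and Y: "Y \<in> FF"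
  shows "rep (br X Y) = comm (rep X) (rep Y)"
proof (rule endo_eqI)
  fix f
  have m: "app (rep A) (app (rep B) f) = \<kappa> (br A (br B (lift f))) - f n *\<^sub>R \<kappa> (br A (delta B))"
    if A: "A \<in> FF" and B: "B \<in> FF" for A B
  proof -
    have "app (rep A) (app (rep B) f) = \<kappa> (br A (br B (lift f) - f n *\<^sub>R delta B))"
      unfolding rep_eq(1)[OF B] by (rule app_rep_kappa[OF A rep_eq(2)[OF B]])
    also have "br A (br B (lift f) - f n *\<^sub>R delta B) = br A (br B (lift f)) - f n *\<^sub>R br A (delta B)"
      using br_diff_right[OF A br_closed[OF B lift_FF] subspace_scale[OF FF_sub delta_closed[OF B]]]
        br_scale_right[OF A delta_closed[OF B]] by simp
    finally show ?thesis by (simp add: kappa_diff kappa_scale)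
  qed
  have j: "\<kappa> (br X (br Y (lift f))) - \<kappa> (br Y (br X (lift f))) = \<kappa> (br (br X Y) (lift f))"
    using br_jacobi[OF X Y lift_FF, of f] by (simp add: kappa_add)
  have "delta (br X Y) = br X (delta Y) - br Y (delta X)"
    using delta_br[OF X Y] br_antisym[of "delta X" Y] by simp
  then have k: "\<kappa> (br X (delta Y)) - \<kappa> (br Y (delta X)) = \<kappa> (delta (br X Y))"
    by (simp add: kappa_diff)
  have "app (comm (rep X) (rep Y)) f = \<kappa> (br X (br Y (lift f))) - \<kappa> (br Y (br X (lift f)))
       - f n *\<^sub>R (\<kappa> (br X (delta Y)) - \<kappa> (br Y (delta X)))"
    by (simp add: comm_def m X Y scaleR_diff_right)
  then show "app (rep (br X Y)) f = app (comm (rep X) (rep Y)) f"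
    unfolding j k by (simp add: app_rep br_closed X Y)
qed

text \<open>The innermost operator may use the \<delta>-term and lands only in \<open>DD 1\<close>,
  which is \<open>FF\<close>; each further one is a bracket and raises the index. A word longer than
  \<open>N\<close> therefore ends in \<open>DF\<close>.\<close>

lemma rep_word:
  assumes "set ws \<subseteq> FF" "ws \<noteq> []"
  shows "\<exists>W\<in>DD (length ws). app (prod_list (map rep ws)) f = \<kappa> W"
  using assms
proof (induction ws rule: induct_list012)
  case (2 X)
  have "br X (lift f) - f n *\<^sub>R delta X \<in> DD 1"
    using rep_eq(2)[of X f] 2 by (auto simp: DD_def)
  then show ?case using rep_eq(1)[of X f] 2 by auto
next
  case (3 X Y ws)
  then obtain W where W: "W \<in> DD (length (Y # ws))" "app (prod_list (map rep (Y # ws))) f = \<kappa> W" by auto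
  have X: "X \<in> FF" using 3 by simp
  have "app (prod_list (map rep (X # Y # ws))) f = app (rep X) (\<kappa> W)" using W(2) by simp
  also have "\<dots> = \<kappa> (br X W)" using app_rep_kappa[OF X] W(1) DD_FF by blast
  finally show ?case using br_DD_right[OF X W(1)] by auto
qed simp

lemma rep_nilpotent:
  assumes "set ws \<subseteq> FF" "N < length ws"
  shows "prod_list (map rep ws) = 0"
proof (rule endo_eqI)
  fix f
  obtain W where "W \<in> DD (length ws)" "app (prod_list (map rep ws)) f = \<kappa> W"
    using rep_word[OF assms(1), of f] assms(2) by fastforce
  moreover have "DD (length ws) \<subseteq> DF" using assms(2) by (intro DD_antimono) simp
  ultimately show "app (prod_list (map rep ws)) f = app 0 f" using kappa_DF by auto
qed

definition rp :: "'a gr_vector \<Rightarrow> (nat \<Rightarrow> 'a vfield)" where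
  "rp u = (SOME X. X \<in> FF \<and> cls X = u)"

lemma rp: "u \<in> carrier L \<Longrightarrow> rp u \<in> FF \<and> cls (rp u) = u"
  unfolding rp_def using someI_ex[of "\<lambda>X. X \<in> FF \<and> cls X = u"] by (auto simp: carrier_L)

lemma rp_cls: "X \<in> FF \<Longrightarrow> rp (cls X) - X \<in> DF"
  using rp[of "cls X"] cls_eq_iff[of "rp (cls X)" X] by (auto simp: carrier_L)

lemma kappa_rp_cls: "X \<in> FF \<Longrightarrow> \<kappa> (rp (cls X)) = \<kappa> X"
  using kappa_DF[OF rp_cls] by (simp add: kappa_diff)

lemma rep_rp_cls: "X \<in> FF \<Longrightarrow> rep (rp (cls X)) = rep X"
  using rep_DF[OF rp_cls] rep_diff[of "rp (cls X)" X] rp[of "cls X"] by (auto simp: carrier_L)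

text \<open>Elements of the graded algebra act through chosen representatives; the choice is
  immaterial because \<open>rep\<close> vanishes on \<open>DF\<close>.\<close>

sublocale lie_rep L N "\<lambda>u. rep (rp u)"
proof
  show "lzero L \<in> carrier L" unfolding lzero_cls carrier_L using subspace_0[OF FF_sub] by blast
  show "rep (rp (lzero L)) = 0"
    unfolding lzero_cls using rep_rp_cls[OF subspace_0[OF FF_sub]] rep_DF[OF subspace_0[OF DD_sub]] by simp
next
  fix u v assume "u \<in> carrier L" "v \<in> carrier L"
  then obtain X Y where XY: "X \<in> FF" "Y \<in> FF" "u = cls X" "v = cls Y" unfolding carrier_L by blast
  show "ladd L u v \<in> carrier L" unfolding XY ladd_cls[OF XY(1,2)] carrier_L
    using subspace_add[OF FF_sub XY(1,2)] by blast
  show "rep (rp (ladd L u v)) = rep (rp u) + rep (rp v)"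
    unfolding XY ladd_cls[OF XY(1,2)] by (simp add: rep_rp_cls XY subspace_add[OF FF_sub] rep_add)
  show "lbracket L u v \<in> carrier L" unfolding XY lbracket_cls[OF XY(1,2)] carrier_L
    using br_closed[OF XY(1,2)] by blast
  show "rep (rp (lbracket L u v)) = comm (rep (rp u)) (rep (rp v))"
    unfolding XY lbracket_cls[OF XY(1,2)] by (simp add: rep_rp_cls XY br_closed rep_br)
next
  fix c u assume "u \<in> carrier L"
  then obtain X where X: "X \<in> FF" "u = cls X" unfolding carrier_L by blast
  show "lscale L c u \<in> carrier L" unfolding X lscale_cls[OF X(1)] carrier_L
    using subspace_scale[OF FF_sub X(1)] by blast
  show "rep (rp (lscale L c u)) = c *\<^sub>R rep (rp u)"
    unfolding X lscale_cls[OF X(1)] by (simp add: rep_rp_cls X subspace_scale[OF FF_sub] rep_scale)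
next
  show "inj_on (\<lambda>u. rep (rp u)) (carrier L)"
  proof (rule inj_onI)
    fix u v assume uv: "u \<in> carrier L" "v \<in> carrier L" "rep (rp u) = rep (rp v)"
    then have "rp u - rp v \<in> DF"
      using rp[OF uv(1)] rp[OF uv(2)] by (intro rep_faithful) (auto simp: rep_diff subspace_diff[OF FF_sub])
    then show "u = v" using cls_eq_iff[of "rp u" "rp v"] rp[OF uv(1)] rp[OF uv(2)] by simp
  qed
  fix w assume w: "set w \<subseteq> (\<lambda>u. rep (rp u)) ` carrier L" "N < length w"
  have "\<exists>ws. w = map rep ws \<and> set ws \<subseteq> FF" using w(1)
  proof (induction w)
    case (Cons a w)
    then obtain ws where "w = map rep ws" "set ws \<subseteq> FF" by auto
    moreover obtain u where "u \<in> carrier L" "a = rep (rp u)" using Cons by auto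
    ultimately show ?case using rp by (intro exI[of _ "rp u # ws"]) auto
  qed simp
  then show "prod_list w = 0" using rep_nilpotent w(2) by auto
qed

end

section \<open>The rank of the bracket form\<close>

lemma homogeneous_system:
  fixes r :: "'l \<Rightarrow> nat \<Rightarrow> real"
  assumes fin: "finite I" and card: "card I < m"
  shows "\<exists>c. (\<exists>a<m. c a \<noteq> 0) \<and> (\<forall>l\<in>I. (\<Sum>a<m. c a * r l a) = 0)"
proof -
  define v where "v = (\<lambda>a l. if l \<in> I then r l a else 0)"
  have v_sum: "(\<Sum>a<m. c a *\<^sub>R v a) l = (\<Sum>a<m. c a * r l a)" if "l \<in> I" for c l
    unfolding sum_fun_apply using that by (simp add: v_def fun_ops)
  \<comment> \<open>Linear dependence is a property of sets of vectors, so two equal columns have to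
    be treated separately.\<close>
  show ?thesis
  proof (cases "inj_on v {..<m}")
    case False
    then obtain a b where ab: "a < m" "b < m" "a \<noteq> b" "v a = v b" unfolding inj_on_def by auto
    define c where "c = (\<lambda>i. if i = a then 1 else if i = b then -1 else 0 :: real)"
    have "(\<Sum>i<m. c i * r l i) = 0" if "l \<in> I" for l
    proof -
      have "(\<Sum>i<m. c i * r l i) = (\<Sum>i\<in>{a, b}. c i * r l i)"
        using ab by (intro sum.mono_neutral_right) (auto simp: c_def)
      also have "\<dots> = r l a - r l b" using ab(3) by (simp add: c_def)
      also have "\<dots> = 0" using fun_cong[OF ab(4), of l] that by (simp add: v_def)
      finally show ?thesis .
    qed
    moreover have "c a \<noteq> 0" by (simp add: c_def)
    ultimately show ?thesis using ab(1) by blast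
  next
    case True
    define e :: "'l \<Rightarrow> 'l \<Rightarrow> real" where "e = (\<lambda>l l'. if l' = l then 1 else 0)"
    have vs: "v a \<in> span (e ` I)" for a
    proof -
      have "v a = (\<Sum>l\<in>I. r l a *\<^sub>R e l)"
      proof
        fix l
        have "(\<Sum>l\<in>I. r l a *\<^sub>R e l) l = (\<Sum>l'\<in>I. if l' = l then r l a else 0)"
          unfolding sum_fun_apply by (intro sum.cong) (auto simp: e_def fun_ops)
        then show "v a l = (\<Sum>l\<in>I. r l a *\<^sub>R e l) l" using fin by (simp add: v_def)
      qed
      moreover have "(\<Sum>l\<in>I. r l a *\<^sub>R e l) \<in> span (e ` I)"
        by (intro span_sum span_scale span_base) auto
      ultimately show ?thesis by (simp only:)
    qed
    have "dependent (v ` {..<m})"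
    proof (rule ccontr)
      assume "\<not> dependent (v ` {..<m})"
      then have "card (v ` {..<m}) \<le> card (e ` I)"
        using independent_span_bound[of "e ` I" "v ` {..<m}"] fin vs by auto
      also have "\<dots> \<le> card I" by (rule card_image_le[OF fin])
      finally show False using card_image[OF True] card by simp
    qed
    then obtain u where u: "\<exists>w\<in>v ` {..<m}. u w \<noteq> 0" "(\<Sum>w\<in>v ` {..<m}. u w *\<^sub>R w) = 0"
      using dependent_finite[of "v ` {..<m}"] by auto
    have "(\<Sum>a<m. u (v a) *\<^sub>R v a) = 0" using u(2) sum.reindex[OF True, of "\<lambda>w. u w *\<^sub>R w"] by simp
    then have "(\<Sum>a<m. u (v a) * r l a) = 0" if "l \<in> I" for l
      using v_sum[OF that, of "\<lambda>a. u (v a)"] by (simp add: fun_ops)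
    then show ?thesis using u(1) by (intro exI[of _ "\<lambda>a. u (v a)"]) auto
  qed
qed

text \<open>Biorthogonal vectors turn the pairing matrix of the limiting form into the identity,
  whose nonsingularity survives approximation. They are built by adding one functional at a
  time.\<close>

lemma dual_family:
  fixes f :: "nat \<Rightarrow> 'v::real_vector \<Rightarrow> real"
  assumes S: "subspace S"
    and lin: "\<And>a X Y s t. a < m \<Longrightarrow> X \<in> S \<Longrightarrow> Y \<in> S \<Longrightarrow> f a (s *\<^sub>R X + t *\<^sub>R Y) = s * f a X + t * f a Y"
    and ind: "\<And>c. (\<And>X. X \<in> S \<Longrightarrow> (\<Sum>a<m. c a * f a X) = 0) \<Longrightarrow> (\<forall>a<m. c a = 0)"
  shows "\<exists>Y. \<forall>b<m. Y b \<in> S \<and> (\<forall>a<m. f a (Y b) = (if a = b then 1 else 0))"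
  using lin ind
proof (induction m)
  case (Suc m)
  have lin: "f a (s *\<^sub>R X + t *\<^sub>R Y) = s * f a X + t * f a Y" if "a < Suc m" "X \<in> S" "Y \<in> S" for a X Y s t
    using Suc.prems(1) that by blast
  have f0: "f a 0 = 0" if "a < Suc m" for a
    using lin[OF that subspace_0[OF S] subspace_0[OF S], of 0 0] by simp
  have fsum: "f a (\<Sum>b\<in>B. s b *\<^sub>R Z b) = (\<Sum>b\<in>B. s b * f a (Z b))"
    if a: "a < Suc m" and Z: "\<And>b. b \<in> B \<Longrightarrow> Z b \<in> S" for a B s and Z :: "nat \<Rightarrow> 'v"
    using Z
  proof (induction B rule: infinite_finite_induct)
    case (insert b B)
    have "(\<Sum>b\<in>B. s b *\<^sub>R Z b) \<in> S" using insert by (intro subspace_sum[OF S] subspace_scale[OF S]) auto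
    then have "f a (s b *\<^sub>R Z b + 1 *\<^sub>R (\<Sum>b\<in>B. s b *\<^sub>R Z b)) = s b * f a (Z b) + 1 * f a (\<Sum>b\<in>B. s b *\<^sub>R Z b)"
      using insert by (intro lin[OF a]) auto
    then show ?case using insert by simp
  qed (simp_all add: f0[OF a])
  have "\<exists>Y. \<forall>b<m. Y b \<in> S \<and> (\<forall>a<m. f a (Y b) = (if a = b then 1 else 0))"
  proof (rule Suc.IH)
    show "f a (s *\<^sub>R X + t *\<^sub>R Y) = s * f a X + t * f a Y" if "a < m" "X \<in> S" "Y \<in> S" for a X Y s t
      using lin that by simp
    fix c :: "nat \<Rightarrow> real" assume c: "\<And>X. X \<in> S \<Longrightarrow> (\<Sum>a<m. c a * f a X) = 0"
    have "\<forall>a<Suc m. (c(m := 0)) a = 0"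
      by (rule Suc.prems(2)) (use c in simp)
    then show "\<forall>a<m. c a = 0" by (metis fun_upd_other less_SucI less_irrefl)
  qed
  then obtain Y where Y: "\<And>b. b < m \<Longrightarrow> Y b \<in> S" "\<And>a b. a < m \<Longrightarrow> b < m \<Longrightarrow> f a (Y b) = (if a = b then 1 else 0)"
    by blast
  \<comment> \<open>These are the coefficients of \<open>f m\<close> minus its part along the
    previous functionals. The coefficient 1 at \<open>m\<close> and independence give an
    \<open>X\<close> on which the combination is non-zero; its value is \<open>f m\<close> at
    \<open>X - P\<close>.\<close>
  define c where "c = (\<lambda>a. if a < m then - f m (Y a) else 1)"
  have "\<exists>X\<in>S. (\<Sum>a<Suc m. c a * f a X) \<noteq> 0"
  proof (rule ccontr)
    assume "\<not> (\<exists>X\<in>S. (\<Sum>a<Suc m. c a * f a X) \<noteq> 0)"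
    then have "\<forall>a<Suc m. c a = 0" by (intro Suc.prems(2)) blast
    then show False by (auto simp: c_def dest: spec[of _ m])
  qed
  then obtain X where X: "X \<in> S" "(\<Sum>a<Suc m. c a * f a X) \<noteq> 0" by blast
  define g where "g = (\<Sum>a<Suc m. c a * f a X)"
  define P where "P = (\<Sum>b<m. f b X *\<^sub>R Y b)"
  have PS: "P \<in> S" unfolding P_def by (intro subspace_sum[OF S] subspace_scale[OF S] Y) simp
  define Ym where "Ym = (1 / g) *\<^sub>R X + (- 1 / g) *\<^sub>R P"
  have YmS: "Ym \<in> S" unfolding Ym_def by (intro subspace_add[OF S] subspace_scale[OF S] X PS)
  have fP: "f a P = (\<Sum>b<m. f b X * f a (Y b))" if "a < Suc m" for a
    unfolding P_def by (rule fsum[OF that]) (simp add: Y)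
  have Ym: "f a Ym = (if a = m then 1 else 0)" if a: "a < Suc m" for a
  proof -
    have e: "f a Ym = (1 / g) * f a X + (- 1 / g) * f a P"
      unfolding Ym_def by (rule lin[OF a X(1) PS])
    show ?thesis
    proof (cases "a = m")
      case True
      have "(\<Sum>a<m. c a * f a X) = (\<Sum>a<m. - (f a X * f m (Y a)))"
        by (intro sum.cong) (auto simp: c_def)
      then have "g = f m X - f m P" unfolding g_def fP[of m, simplified] by (simp add: c_def sum_negf)
      moreover have "f m Ym = (f m X - f m P) / g" using e True by (simp add: diff_divide_distrib)
      moreover have "g \<noteq> 0" using X(2) by (simp only: g_def) simp
      ultimately show ?thesis using True by simp
    next
      case False
      then have "a < m" using a by simp
      then have "f a P = (\<Sum>b<m. if b = a then f a X else 0)"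
        unfolding fP[OF a] by (intro sum.cong) (auto simp: Y)
      then show ?thesis using e False \<open>a < m\<close> by simp
    qed
  qed
  \<comment> \<open>Subtracting multiples of \<open>Ym\<close>, on which the old functionals vanish,
    makes the old vectors orthogonal to \<open>f m\<close> and changes nothing else.\<close>
  define Y' where "Y' = (\<lambda>b. if b < m then 1 *\<^sub>R Y b + (- f m (Y b)) *\<^sub>R Ym else Ym)"
  show ?case
  proof (intro exI[of _ Y'] allI impI conjI)
    fix b assume b: "b < Suc m"
    show "Y' b \<in> S" unfolding Y'_def
      by (auto intro!: subspace_add[OF S] subspace_diff[OF S] subspace_scale[OF S] Y YmS)
    fix a assume a: "a < Suc m"
    show "f a (Y' b) = (if a = b then 1 else 0)"
    proof (cases "b < m")
      case True
      have "f a (Y' b) = 1 * f a (Y b) + (- f m (Y b)) * f a Ym"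
        unfolding Y'_def using True by (simp only: if_True) (rule lin[OF a Y(1)[OF True] YmS])
      then show ?thesis using True a Ym[OF a] Y(2)[of a b] by (cases "a = m") auto
    next
      case False
      then have "b = m" using b by simp
      then show ?thesis using Ym[OF a] by (simp add: Y'_def)
    qed
  qed
qed simp

text \<open>In a relation between the rows, the column of the coefficient of largest modulus is
  violated: the total error is at most that modulus times
  \<open>real m * \<epsilon>\<close>.\<close>

lemma near_identity_nonsingular:
  fixes W :: "nat \<Rightarrow> nat \<Rightarrow> real"
  assumes near: "\<And>a b. a < m \<Longrightarrow> b < m \<Longrightarrow> \<bar>W a b - (if a = b then 1 else 0)\<bar> \<le> \<epsilon>"
    and eps: "real m * \<epsilon> < 1" and c: "\<And>b. b < m \<Longrightarrow> (\<Sum>a<m. c a * W a b) = 0"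
  shows "\<forall>a<m. c a = 0"
proof (rule ccontr)
  assume "\<not> (\<forall>a<m. c a = 0)"
  then obtain a0 where a0: "a0 < m" "c a0 \<noteq> 0" by blast
  define C where "C = Max ((\<lambda>a. \<bar>c a\<bar>) ` {..<m})"
  have "C \<in> (\<lambda>a. \<bar>c a\<bar>) ` {..<m}" unfolding C_def using a0(1) by (intro Max_in) auto
  then obtain b where b: "b < m" "C = \<bar>c b\<bar>" by auto
  have le: "\<bar>c a\<bar> \<le> C" if "a < m" for a unfolding C_def using that by (intro Max_ge) auto
  have pos: "C > 0" using le[OF a0(1)] a0(2) by linarith
  have "(\<Sum>a<m. c a * ((if a = b then 1 else 0) - W a b)) = (\<Sum>a<m. if a = b then c b else 0) - (\<Sum>a<m. c a * W a b)"
    unfolding sum_subtractf[symmetric] by (intro sum.cong) (auto simp: algebra_simps)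
  also have "\<dots> = c b" using b(1) c[OF b(1)] by simp
  finally have "C = \<bar>\<Sum>a<m. c a * ((if a = b then 1 else 0) - W a b)\<bar>" using b(2) by simp
  also have "\<dots> \<le> (\<Sum>a<m. \<bar>c a * ((if a = b then 1 else 0) - W a b)\<bar>)" by (rule sum_abs)
  also have "\<dots> \<le> (\<Sum>a<m. C * \<epsilon>)"
  proof (rule sum_mono)
    fix a assume a: "a \<in> {..<m}"
    have "\<bar>(if a = b then 1 else 0) - W a b\<bar> \<le> \<epsilon>" using near[of a b] a b(1) by (simp add: abs_minus_commute)
    then show "\<bar>c a * ((if a = b then 1 else 0) - W a b)\<bar> \<le> C * \<epsilon>"
      unfolding abs_mult using le[of a] a pos by (intro mult_mono) auto
  qed
  also have "\<dots> = C * (real m * \<epsilon>)" by simp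
  also have "\<dots> < C * 1" using eps pos by (intro mult_strict_left_mono)
  finally show False by simp
qed

section \<open>The bracket form of a covector\<close>

context smooth_mfd
begin

lemma cotangent_linear:
  assumes p: "p \<in> mpoints M" and \<eta>: "\<eta> \<in> cotangent_space M p"
    and X: "X \<in> vector_fields M" and Y: "Y \<in> vector_fields M"
  shows "\<eta> (vf_at (a *\<^sub>R X + b *\<^sub>R Y) p) = a * \<eta> (vf_at X p) + b * \<eta> (vf_at Y p)"
proof -
  have "vf_at (a *\<^sub>R X + b *\<^sub>R Y) p = (\<lambda>f. a * vf_at X p f + b * vf_at Y p f)"
    by (simp add: vf_at_def fun_ops)
  then show ?thesis
    using \<eta> vf_tangent[OF X p] vf_tangent[OF Y p] unfolding cotangent_space_def linear_functionals_def by simp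
qed

lemma cotangent_sum:
  assumes p: "p \<in> mpoints M" and \<eta>: "\<eta> \<in> cotangent_space M p"
  shows "(\<And>i. i \<in> I \<Longrightarrow> X i \<in> vector_fields M) \<Longrightarrow>
    \<eta> (vf_at (\<Sum>i\<in>I. s i *\<^sub>R X i) p) = (\<Sum>i\<in>I. s i * \<eta> (vf_at (X i) p))"
proof (induction I rule: infinite_finite_induct)
  case (insert i I)
  have "(\<Sum>i\<in>I. s i *\<^sub>R X i) \<in> vector_fields M"
    using insert by (intro subspace_sum[OF vf_subspace] subspace_scale[OF vf_subspace]) auto
  then have "\<eta> (vf_at (s i *\<^sub>R X i + 1 *\<^sub>R (\<Sum>i\<in>I. s i *\<^sub>R X i)) p)
    = s i * \<eta> (vf_at (X i) p) + 1 * \<eta> (vf_at (\<Sum>i\<in>I. s i *\<^sub>R X i) p)"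
    using insert by (intro cotangent_linear[OF p \<eta>]) auto
  then show ?case using insert by simp
qed (use cotangent_linear[OF p \<eta> subspace_0[OF vf_subspace] subspace_0[OF vf_subspace], of 0 0] in simp_all)

text \<open>The fields vanishing at \<open>p\<close> form an isotropic subspace of codimension at most \<open>d\<close>, since the bracket
  of two of them vanishes at \<open>p\<close>.\<close>

lemma bracket_form_rank:
  assumes p: "p \<in> mpoints M" and \<eta>: "\<eta> \<in> cotangent_space M p"
    and A: "\<And>a. a < 2 * d + 1 \<Longrightarrow> A a \<in> vector_fields M" and B: "\<And>b. b < 2 * d + 1 \<Longrightarrow> B b \<in> vector_fields M"
  shows "\<exists>c. (\<exists>a<2 * d + 1. c a \<noteq> 0) \<and>
    (\<forall>b<2 * d + 1. (\<Sum>a<2 * d + 1. c a * \<eta> (vf_at (vf_bracket (A a) (B b)) p)) = 0)"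
proof -
  obtain y where y: "\<And>i. i < d \<Longrightarrow> y i \<in> C_infinity M"
    "\<And>v f. v \<in> tangent_space M p \<Longrightarrow> (\<And>i. i < d \<Longrightarrow> v (y i) = 0) \<Longrightarrow> f \<in> C_infinity M \<Longrightarrow> v f = 0"
    using tangent_coordinates[OF p] by blast
  let ?m = "2 * d + 1"
  have zero: "X f p = 0" if X: "X \<in> vector_fields M" and 0: "\<And>i. i < d \<Longrightarrow> X (y i) p = 0" for X f
    using y(2)[OF vf_tangent[OF X p], of f] 0 vf_nonsmooth[OF X, of f]
    by (cases "f \<in> C_infinity M") (auto simp: vf_at_def)
  \<comment> \<open>The value of the field \<open>B b\<close> at \<open>p\<close>, recorded as a
    vector in a space of dimension at most \<open>d\<close>.\<close>
  define \<beta> where "\<beta> = (\<lambda>b i. if i < d then B b (y i) p else 0)"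
  define e where "e = (\<lambda>l i::nat. if i = l then 1 else 0 :: real)"
  have \<beta>e: "\<beta> b \<in> span (e ` {..<d})" for b
  proof -
    have "\<beta> b = (\<Sum>l<d. \<beta> b l *\<^sub>R e l)"
    proof
      fix i
      have "(\<Sum>l<d. \<beta> b l *\<^sub>R e l) i = (\<Sum>l<d. if l = i then \<beta> b i else 0)"
        unfolding vec_ops by (intro sum.cong) (auto simp: e_def)
      then show "\<beta> b i = (\<Sum>l<d. \<beta> b l *\<^sub>R e l) i" by (simp add: \<beta>_def)
    qed
    moreover have "(\<Sum>l<d. \<beta> b l *\<^sub>R e l) \<in> span (e ` {..<d})"
      by (intro span_sum span_scale span_base) auto
    ultimately show ?thesis by metis
  qed
  \<comment> \<open>At most \<open>d\<close> of the fields \<open>B b\<close> have values at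
    \<open>p\<close> that span the values of all of them.\<close>
  obtain B0 where B0: "B0 \<subseteq> \<beta> ` {..<?m}" "independent B0" "\<beta> ` {..<?m} \<subseteq> span B0"
    using maximal_independent_subset by blast
  have "B0 \<subseteq> span (e ` {..<d})" using B0(1) \<beta>e by blast
  then have fB0: "finite B0" and cB0: "card B0 \<le> d"
    using independent_span_bound[of "e ` {..<d}" B0] B0(2) card_image_le[of "{..<d}" e] by auto
  have "\<forall>w\<in>B0. \<exists>b. b < ?m \<and> \<beta> b = w" using B0(1) by auto
  then obtain idx where idx: "\<And>w. w \<in> B0 \<Longrightarrow> idx w < ?m \<and> \<beta> (idx w) = w" unfolding bchoice_iff by blast
  define \<omega> where "\<omega> = (\<lambda>a b. \<eta> (vf_at (vf_bracket (A a) (B b)) p))"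
  \<comment> \<open>Two groups of at most \<open>d\<close> equations each: the combination of the
    \<open>A a\<close> vanishes at \<open>p\<close>, and it pairs to zero with the selected fields.
    With \<open>2 * d + 1\<close> unknowns there is a non-trivial solution.\<close>
  define r where "r = case_sum (\<lambda>i a. A a (y i) p) (\<lambda>w a. \<omega> a (idx w))"
  have "card (Inl ` {..<d} \<union> Inr ` B0) \<le> card (Inl ` {..<d} :: (nat + (nat \<Rightarrow> real)) set) + card (Inr ` B0 :: (nat + (nat \<Rightarrow> real)) set)"
    by (rule card_Un_le)
  also have "\<dots> \<le> d + d"
    using cB0 by (simp add: card_image)
  finally have cI: "card (Inl ` {..<d} \<union> Inr ` B0) < ?m" by simp
  obtain c where c: "\<exists>a<?m. c a \<noteq> 0" "\<And>l. l \<in> Inl ` {..<d} \<union> Inr ` B0 \<Longrightarrow> (\<Sum>a<?m. c a * r l a) = 0"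
    using homogeneous_system[OF _ cI, of r] fB0 by auto
  define X where "X = (\<Sum>a<?m. c a *\<^sub>R A a)"
  have XV: "X \<in> vector_fields M"
    unfolding X_def using A by (intro subspace_sum[OF vf_subspace] subspace_scale[OF vf_subspace]) auto
  have X0: "X f p = 0" for f
  proof (rule zero[OF XV])
    fix i assume i: "i < d"
    have "X (y i) p = (\<Sum>a<?m. c a * A a (y i) p)"
      unfolding X_def sum_fun_apply by (simp add: fun_ops)
    then show "X (y i) p = 0" using c(2)[of "Inl i"] i by (simp add: r_def)
  qed
  have lin: "(\<Sum>a<?m. c a * \<eta> (vf_at (vf_bracket (A a) Y) p)) = \<eta> (vf_at (vf_bracket X Y) p)"
    if Y: "Y \<in> vector_fields M" for Y
  proof -
    have "vf_bracket Y X = (\<Sum>a<?m. c a *\<^sub>R vf_bracket Y (A a))"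
      unfolding X_def using A Y
      by (subst vf_bracket_sum_right) (auto simp: vf_bracket_scale_right intro: subspace_scale[OF vf_subspace])
    then have "vf_bracket X Y = (\<Sum>a<?m. c a *\<^sub>R vf_bracket (A a) Y)"
      using vf_bracket_antisym[of X Y] vf_bracket_antisym[of "A _" Y] by (simp add: sum_negf)
    then show ?thesis using cotangent_sum[OF p \<eta>, of "{..<?m}" "\<lambda>a. vf_bracket (A a) Y" c] A Y
      by (simp add: vf_bracket_closed)
  qed
  have "(\<Sum>a<?m. c a * \<omega> a b) = 0" if b: "b < ?m" for b
  proof -
    have "\<beta> b \<in> span B0" using B0(3) b by auto
    then obtain u where u: "\<beta> b = (\<Sum>w\<in>B0. u w *\<^sub>R w)" unfolding span_finite[OF fB0] by auto
    define S where "S = (\<Sum>w\<in>B0. u w *\<^sub>R B (idx w))"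
    have SV: "S \<in> vector_fields M"
      unfolding S_def using B idx by (intro subspace_sum[OF vf_subspace] subspace_scale[OF vf_subspace]) auto
    \<comment> \<open>Correcting \<open>B b\<close> by selected fields makes it vanish at
      \<open>p\<close>. Its bracket with \<open>X\<close>, which also vanishes at \<open>p\<close>,
      is then zero at \<open>p\<close>, and the correction pairs to zero by the second group of
      equations.\<close>
    define B' where "B' = B b - S"
    have BV: "B b \<in> vector_fields M" using B b by blast
    have B'V: "B' \<in> vector_fields M" unfolding B'_def by (rule subspace_diff[OF vf_subspace BV SV])
    have B'0: "B' f p = 0" for f
    proof (rule zero[OF B'V])
      fix i assume i: "i < d"
      have "B b (y i) p = \<beta> b i" using i by (simp add: \<beta>_def)
      also have "\<dots> = (\<Sum>w\<in>B0. u w * w i)" unfolding u vec_ops ..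
      also have "\<dots> = (\<Sum>w\<in>B0. u w * \<beta> (idx w) i)" using idx by (intro sum.cong) auto
      also have "\<dots> = (\<Sum>w\<in>B0. u w * B (idx w) (y i) p)" using i by (simp add: \<beta>_def)
      also have "\<dots> = S (y i) p" unfolding S_def sum_fun_apply by (simp add: fun_ops)
      finally show "B' (y i) p = 0" unfolding B'_def by (simp add: fun_ops)
    qed
    have "vf_at (vf_bracket X B') p = vf_at 0 p"
      by (simp add: vf_at_def vf_bracket_def X0 B'0 fun_ops)
    then have 0: "\<eta> (vf_at (vf_bracket X B') p) = 0"
      using cotangent_sum[OF p \<eta>, of "{}" "\<lambda>_. 0" "\<lambda>_. 0"] by simp
    have "vf_bracket X S = (\<Sum>w\<in>B0. u w *\<^sub>R vf_bracket X (B (idx w)))"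
      unfolding S_def using B idx XV
      by (subst vf_bracket_sum_right) (auto simp: vf_bracket_scale_right intro: subspace_scale[OF vf_subspace])
    then have "\<eta> (vf_at (vf_bracket X S) p) = (\<Sum>w\<in>B0. u w * \<eta> (vf_at (vf_bracket X (B (idx w))) p))"
      using cotangent_sum[OF p \<eta>, of B0 "\<lambda>w. vf_bracket X (B (idx w))" u] B idx XV
      by (simp add: vf_bracket_closed)
    also have "\<dots> = (\<Sum>w\<in>B0. u w * (\<Sum>a<?m. c a * \<omega> a (idx w)))"
    proof (intro sum.cong refl)
      fix w assume "w \<in> B0"
      then have "B (idx w) \<in> vector_fields M" using idx B by blast
      from lin[OF this] show "u w * \<eta> (vf_at (vf_bracket X (B (idx w))) p) = u w * (\<Sum>a<?m. c a * \<omega> a (idx w))"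
        unfolding \<omega>_def by (simp only:)
    qed
    also have "\<dots> = 0"
    proof (rule sum.neutral, rule ballI)
      fix w assume "w \<in> B0"
      then show "u w * (\<Sum>a<?m. c a * \<omega> a (idx w)) = 0" using c(2)[of "Inr w"] by (simp add: r_def)
    qed
    finally have "\<eta> (vf_at (vf_bracket X S) p) = 0" .
    moreover have "vf_bracket X (B b) = 1 *\<^sub>R vf_bracket X B' + 1 *\<^sub>R vf_bracket X S"
      using vf_bracket_add_right[OF XV B'V SV] by (simp add: B'_def)
    ultimately have "\<eta> (vf_at (vf_bracket X (B b)) p) = 0"
      using cotangent_linear[OF p \<eta> vf_bracket_closed[OF XV B'V] vf_bracket_closed[OF XV SV], of 1 1] 0 by simp
    then show ?thesis unfolding \<omega>_def lin[OF BV] .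
  qed
  then show ?thesis using c(1) unfolding \<omega>_def by blast
qed

end

section \<open>Characteristic covectors as limits\<close>

context filtered_mfd
begin

lemma dual_linear:
  assumes \<xi>: "\<xi> \<in> lie_dual L" and X: "X \<in> FF" and Y: "Y \<in> FF"
  shows "\<xi> (cls (a *\<^sub>R X + b *\<^sub>R Y)) = a * \<xi> (cls X) + b * \<xi> (cls Y)"
proof -
  have "cls (a *\<^sub>R X + b *\<^sub>R Y) = ladd L (lscale L a (cls X)) (lscale L b (cls Y))"
    using X Y by (simp add: lscale_cls ladd_cls subspace_scale[OF FF_sub])
  moreover have "cls X \<in> carrier L" "cls Y \<in> carrier L" using X Y by (auto simp: carrier_L)
  ultimately show ?thesis using \<xi> unfolding lie_dual_def by simp
qed

lemma dual_0: "\<xi> \<in> lie_dual L \<Longrightarrow> \<xi> (cls 0) = 0"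
  using dual_linear[of \<xi> 0 0 0 0] subspace_0[OF FF_sub] by simp

lemma dual_sum:
  assumes \<xi>: "\<xi> \<in> lie_dual L"
  shows "(\<And>i. i \<in> I \<Longrightarrow> X i \<in> FF) \<Longrightarrow> \<xi> (cls (\<Sum>i\<in>I. c i *\<^sub>R X i)) = (\<Sum>i\<in>I. c i * \<xi> (cls (X i)))"
proof (induction I rule: infinite_finite_induct)
  case (insert i I)
  have "(\<Sum>i\<in>I. c i *\<^sub>R X i) \<in> FF"
    using insert by (intro subspace_sum[OF FF_sub] subspace_scale[OF FF_sub]) auto
  from dual_linear[OF \<xi> insert.prems[of i] this, of "c i" 1] show ?case using insert by simp
qed (simp_all add: dual_0[OF \<xi>])

text \<open>A basic neighbourhood in the weak topology controls finitely many evaluations and the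
  parameter at once, so a single covector serves the whole finite set \<open>J\<close>.\<close>

lemma approximation:
  assumes \<xi>: "\<xi> \<in> characteristic_set M N F x" and J: "finite J"
    and JF: "\<And>i X. (i, X) \<in> J \<Longrightarrow> i \<in> {1..N} \<and> X \<in> F i" and \<epsilon>: "0 < \<epsilon>"
  obtains p \<eta> t where "p \<in> mpoints M" "\<eta> \<in> cotangent_space M p" "0 < t" "t \<le> 1" "t < \<epsilon>"
    "\<And>i X. (i, X) \<in> J \<Longrightarrow> \<bar>t ^ i * \<eta> (vf_at X p) - \<xi> (cls (single i X))\<bar> < \<epsilon>"
proof -
  define A where "A = cotangent_part M \<union> graded_part M N F"
  define T where "T = adiabatic_topology M N F"
  have T: "openin T {z \<in> A. base_projection z \<in> W}"
    if "openin (prod_topology (mtop M) (top_of_set {0..1})) W" for W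
    unfolding T_def adiabatic_topology_def Let_def A_def[symmetric]
    by (rule topology_generated_by_Basis) (use that in blast)
  have T': "openin T {z \<in> A. evaluation M N F i X z \<in> W}" if "i \<in> {1..N}" "X \<in> F i" "open W" for i X W
    unfolding T_def adiabatic_topology_def Let_def A_def[symmetric]
    by (rule topology_generated_by_Basis) (use that in blast)
  define U0 where "U0 = {z \<in> A. base_projection z \<in> mpoints M \<times> ({0..1} \<inter> {..<\<epsilon>})}"
  define U where "U = (\<lambda>(i, X). {z \<in> A. evaluation M N F i X z \<in> ball (\<xi> (cls (single i X))) \<epsilon>})"
  have cl: "Graded x \<xi> \<in> T closure_of cotangent_part M" and \<xi>': "\<xi> \<in> lie_dual L"
    using \<xi> by (auto simp: characteristic_set_def T_def)
  have "openin (prod_topology (mtop M) (top_of_set {0..1})) (mpoints M \<times> ({0..1} \<inter> {..<\<epsilon>}))"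
    unfolding openin_prod_Times_iff by (auto intro!: openin_open_Int)
  then have "openin T U0" unfolding U0_def by (rule T)
  then have "openin T (U0 \<inter> \<Inter>(U ` J))"
  proof (intro openin_Int_Inter)
    fix S assume "S \<in> U ` J"
    then obtain i X where iX: "(i, X) \<in> J" "S = U (i, X)" by auto
    show "openin T S"
      unfolding iX(2) U_def prod.case using JF[OF iX(1)] by (intro T') auto
  qed (use J in auto)
  moreover have "gr_class M N F x i X = cls (single i X)" for i X
    by (simp add: gr_class_def cls_def single_def if_distrib fun_ops cong: if_cong)
  then have "Graded x \<xi> \<in> U0 \<inter> \<Inter>(U ` J)"
    using x \<epsilon> \<xi>' by (auto simp: U0_def U_def A_def graded_part_def)
  ultimately obtain z where z: "z \<in> cotangent_part M" "z \<in> U0 \<inter> \<Inter>(U ` J)"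
    using cl unfolding in_closure_of by blast
  then obtain p \<eta> t where p: "z = Cotangent p \<eta> t" "p \<in> mpoints M" "\<eta> \<in> cotangent_space M p" "t \<in> {0<..1}"
    by (auto simp: cotangent_part_def)
  have "\<bar>t ^ i * \<eta> (vf_at X p) - \<xi> (cls (single i X))\<bar> < \<epsilon>" if "(i, X) \<in> J" for i X
    using z(2) that by (force simp: U_def p(1) dist_real_def)
  moreover have "t < \<epsilon>" using z(2) by (auto simp: U0_def p(1))
  ultimately show thesis using that p by auto
qed

lemma fam_sum:
  fixes X :: "'i \<Rightarrow> nat \<Rightarrow> 'a vfield"
  shows "(\<Sum>i\<in>I. X i) k = (\<Sum>i\<in>I. X i k)"
  by (rule sum_fun_apply)

text \<open>The adiabatic topology controls \<xi> only on homogeneous classes, so the bracket is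
  split into its homogeneous pieces, each of degree \<open>i + j\<close>.\<close>

lemma br_single:
  "br X Y = (\<Sum>i\<in>{1..N}. \<Sum>j\<in>{1..N}. if i + j \<le> N then single (i + j) (vf_bracket (X i) (Y j)) else 0)"
proof
  fix k
  have "(\<Sum>i\<in>{1..N}. \<Sum>j\<in>{1..N}. if i + j \<le> N then single (i + j) (vf_bracket (X i) (Y j)) else 0) k
    = (\<Sum>i\<in>{1..N}. \<Sum>j\<in>{1..N}. if j = k - i \<and> i < k \<and> k \<le> N then vf_bracket (X i) (Y j) else 0)"
    unfolding fam_sum by (intro sum.cong refl) (auto simp: single_def fam_ops)
  also have "\<dots> = (\<Sum>i\<in>{1..N}. if i < k \<and> k \<le> N then vf_bracket (X i) (Y (k - i)) else 0)"
  proof (intro sum.cong refl)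
    fix i assume "i \<in> {1..N}"
    show "(\<Sum>j\<in>{1..N}. if j = k - i \<and> i < k \<and> k \<le> N then vf_bracket (X i) (Y j) else 0)
      = (if i < k \<and> k \<le> N then vf_bracket (X i) (Y (k - i)) else 0)"
    proof (cases "i < k \<and> k \<le> N")
      case True
      then have "(\<Sum>j\<in>{1..N}. if j = k - i \<and> i < k \<and> k \<le> N then vf_bracket (X i) (Y j) else 0)
        = (\<Sum>j\<in>{1..N}. if j = k - i then vf_bracket (X i) (Y (k - i)) else 0)"
        by (intro sum.cong) auto
      then show ?thesis using True \<open>i \<in> {1..N}\<close> by (simp only: sum.delta[OF finite_atLeastAtMost]) auto
    qed auto
  qed
  also have "\<dots> = br X Y k"
  proof (cases "k \<in> {1..N}")
    case True
    then have "(\<Sum>i\<in>{1..N}. if i < k \<and> k \<le> N then vf_bracket (X i) (Y (k - i)) else 0)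
      = (\<Sum>i\<in>{1..<k}. vf_bracket (X i) (Y (k - i)))"
      by (intro sum.mono_neutral_cong_right) auto
    then show ?thesis using True by (simp add: br_def)
  next
    case False
    then show ?thesis by (auto simp: br_def intro!: sum.neutral)
  qed
  finally show "br X Y k = (\<Sum>i\<in>{1..N}. \<Sum>j\<in>{1..N}.
    if i + j \<le> N then single (i + j) (vf_bracket (X i) (Y j)) else 0) k" ..
qed

definition dil :: "real \<Rightarrow> (nat \<Rightarrow> 'a vfield) \<Rightarrow> 'a vfield" where
  "dil t X = (\<Sum>i\<in>{1..N}. t ^ i *\<^sub>R X i)"

lemma dil_vf: "X \<in> FF \<Longrightarrow> dil t X \<in> vector_fields M"
  unfolding dil_def by (intro subspace_sum[OF vf_subspace] subspace_scale[OF vf_subspace] FF_vf)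

lemma bracket_dil:
  assumes X: "X \<in> FF" and Y: "Y \<in> FF"
  shows "vf_bracket (dil t X) (dil t Y) = (\<Sum>i\<in>{1..N}. \<Sum>j\<in>{1..N}. t ^ (i + j) *\<^sub>R vf_bracket (X i) (Y j))"
proof -
  have 1: "vf_bracket A (dil t Y) = (\<Sum>j\<in>{1..N}. t ^ j *\<^sub>R vf_bracket A (Y j))"
    if A: "A \<in> vector_fields M" and Y: "Y \<in> FF" for A Y
    unfolding dil_def using A FF_vf[OF Y]
    by (subst vf_bracket_sum_right) (auto simp: vf_bracket_scale_right intro: subspace_scale[OF vf_subspace])
  have "vf_bracket (dil t X) (Y j) = (\<Sum>i\<in>{1..N}. t ^ i *\<^sub>R vf_bracket (X i) (Y j))" for j
    using 1[OF FF_vf[OF Y] X, of j] vf_bracket_antisym[of "dil t X" "Y j"] vf_bracket_antisym[of "X _" "Y j"]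
    by (simp add: sum_negf)
  then have "vf_bracket (dil t X) (dil t Y)
    = (\<Sum>j\<in>{1..N}. \<Sum>i\<in>{1..N}. t ^ (i + j) *\<^sub>R vf_bracket (X i) (Y j))"
    by (simp add: 1[OF dil_vf[OF X] Y] scaleR_sum_right power_add mult.commute)
  then show ?thesis by (subst sum.swap)
qed

lemma characteristic_rank:
  assumes \<xi>: "\<xi> \<in> characteristic_set M N F x" and U: "\<And>a. a < 2 * d + 1 \<Longrightarrow> U a \<in> FF"
  shows "\<exists>c. (\<exists>a<2 * d + 1. c a \<noteq> 0) \<and> (\<forall>Y\<in>FF. (\<Sum>a<2 * d + 1. c a * \<xi> (cls (br (U a) Y))) = 0)"
proof (rule ccontr)
  assume no: "\<not> ?thesis"
  define m where "m = 2 * d + 1"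
  have \<xi>': "\<xi> \<in> lie_dual L" using \<xi> by (simp add: characteristic_set_def)
  have UF: "a < m \<Longrightarrow> U a \<in> FF" for a using U by (simp add: m_def)
  \<comment> \<open>Without a relation the functionals sending Y to
    \<open>\<xi> (cls (br (U a) Y))\<close> are independent, and a dual family normalises the matrix
    of the form to the identity.\<close>
  have "\<exists>Y. \<forall>b<m. Y b \<in> FF \<and> (\<forall>a<m. \<xi> (cls (br (U a) (Y b))) = (if a = b then 1 else 0))"
  proof (rule dual_family[OF FF_sub])
    fix a X Y and s t :: real assume "a < m" "X \<in> FF" "Y \<in> FF"
    then show "\<xi> (cls (br (U a) (s *\<^sub>R X + t *\<^sub>R Y))) = s * \<xi> (cls (br (U a) X)) + t * \<xi> (cls (br (U a) Y))"
      using UF by (simp add: br_add_right br_scale_right br_closed subspace_scale[OF FF_sub] dual_linear[OF \<xi>'])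
  next
    fix c :: "nat \<Rightarrow> real" assume "\<And>X. X \<in> FF \<Longrightarrow> (\<Sum>a<m. c a * \<xi> (cls (br (U a) X))) = 0"
    then show "\<forall>a<m. c a = 0" using no unfolding m_def by blast
  qed
  then obtain Y where Y: "\<And>b. b < m \<Longrightarrow> Y b \<in> FF"
    "\<And>a b. a < m \<Longrightarrow> b < m \<Longrightarrow> \<xi> (cls (br (U a) (Y b))) = (if a = b then 1 else 0)" by blast
  define I where "I = {1..N} \<times> {1..N}"
  define Q where "Q = {..<m} \<times> {..<m} \<times> {1..N} \<times> {1..N}"
  define Z where "Z = (\<lambda>(a, b, i, j). vf_bracket (U a i) (Y b j))"
  \<comment> \<open>A bracket with \<open>i + j > N\<close> is only known to lie in
    \<open>F N\<close>, the module of all fields, so its degree is capped at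
    \<open>N\<close>.\<close>
  define e where "e = (\<lambda>(a :: nat, b :: nat, i, j). min (i + j) N)"
  define \<zeta> where "\<zeta> = (\<lambda>q. \<xi> (cls (single (e q) (Z q))))"
  have finQ: "finite Q" by (simp add: Q_def)
  define C where "C = (\<Sum>q\<in>Q. \<bar>\<zeta> q\<bar>)"
  have C: "\<bar>\<zeta> q\<bar> \<le> C" if "q \<in> Q" for q
    unfolding C_def using finQ that by (intro member_le_sum) auto
  have C0: "0 \<le> C" unfolding C_def by (simp add: sum_nonneg)
  \<comment> \<open>A matrix entry is a sum of \<open>N * N\<close> terms, each off by at most
    \<open>\<epsilon> * (C + 1)\<close>, and \<open>m\<close> times the entry error has to stay
    below 1. The final summand 1 makes this strict and gives
    \<open>\<epsilon> \<le> 1\<close>.\<close>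
  define \<epsilon> where "\<epsilon> = 1 / (real m * (real N * (real N * (C + 1))) + 1)"
  have den: "0 < real m * (real N * (real N * (C + 1))) + 1" using C0 by (simp add: add_nonneg_pos)
  have \<epsilon>: "0 < \<epsilon>" "\<epsilon> \<le> 1" unfolding \<epsilon>_def using den C0 by auto
  have ZF: "e q \<in> {1..N}" "Z q \<in> F (e q)" if q: "q \<in> Q" for q
  proof -
    obtain a b i j where q': "q = (a, b, i, j)" by (metis prod_cases4)
    then have ab: "a < m" "b < m" "i \<in> {1..N}" "j \<in> {1..N}" using q by (auto simp: Q_def)
    show "e q \<in> {1..N}" using ab by (auto simp: e_def q')
    show "Z q \<in> F (e q)"
    proof (cases "i + j \<le> N")
      case True
      then show ?thesis using F_bracket[of i j "U a i" "Y b j"] ab FF_F[OF UF[OF ab(1)]] FF_F[OF Y(1)[OF ab(2)]]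
        by (simp add: e_def Z_def q')
    next
      case False
      then show ?thesis using FF_vf[OF UF[OF ab(1)]] FF_vf[OF Y(1)[OF ab(2)]]
        by (simp add: e_def Z_def q' F_N vf_bracket_closed)
    qed
  qed
  have JF: "\<And>i X. (i, X) \<in> (\<lambda>q. (e q, Z q)) ` Q \<Longrightarrow> i \<in> {1..N} \<and> X \<in> F i" using ZF by auto
  obtain p \<eta> t where p: "p \<in> mpoints M" "\<eta> \<in> cotangent_space M p" and t: "0 < t" "t \<le> 1" "t < \<epsilon>"
    and app: "\<And>i X. (i, X) \<in> (\<lambda>q. (e q, Z q)) ` Q \<Longrightarrow> \<bar>t ^ i * \<eta> (vf_at X p) - \<xi> (cls (single i X))\<bar> < \<epsilon>"
    using approximation[OF \<xi> finite_imageI[OF finQ] JF \<epsilon>(1)] by blast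
  have app: "\<bar>t ^ e q * \<eta> (vf_at (Z q) p) - \<zeta> q\<bar> < \<epsilon>" if "q \<in> Q" for q
    unfolding \<zeta>_def using that by (intro app) blast
  have near: "\<bar>t ^ (i + j) * \<eta> (vf_at (vf_bracket (U a i) (Y b j)) p)
      - (if i + j \<le> N then \<xi> (cls (single (i + j) (vf_bracket (U a i) (Y b j)))) else 0)\<bar> \<le> \<epsilon> * (C + 1)"
    if "a < m" "b < m" "i \<in> {1..N}" "j \<in> {1..N}" for a b i j
  proof -
    have q: "(a, b, i, j) \<in> Q" using that by (simp add: Q_def)
    show ?thesis
    proof (cases "i + j \<le> N")
      case True
      have "\<epsilon> * 1 \<le> \<epsilon> * (C + 1)" using \<epsilon> C0 by (intro mult_left_mono) auto
      then show ?thesis using app[OF q] True by (simp add: e_def Z_def \<zeta>_def)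
    next
      case False
      \<comment> \<open>Here the graded bracket contributes 0. The quantity \<open>h\<close> is
        close to a fixed value bounded by \<open>C\<close>, and at least one factor
        \<open>t < \<epsilon>\<close> is left over.\<close>
      define h where "h = t ^ N * \<eta> (vf_at (vf_bracket (U a i) (Y b j)) p)"
      have "\<bar>h\<bar> \<le> C + 1"
        using app[OF q] C[OF q] False \<epsilon>(2) unfolding h_def e_def Z_def by simp
      have "t ^ (i + j - N) \<le> t ^ 1" using t False by (intro power_decreasing) auto
      then have "t ^ (i + j - N) \<le> \<epsilon>" using t by simp
      then have "t ^ (i + j - N) * \<bar>h\<bar> \<le> \<epsilon> * (C + 1)"
        using \<open>\<bar>h\<bar> \<le> C + 1\<close> \<epsilon> by (intro mult_mono) auto
      moreover have "t ^ (i + j) = t ^ (i + j - N) * t ^ N" using False by (simp flip: power_add)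
      ultimately show ?thesis using False t by (simp add: h_def abs_mult mult.assoc)
    qed
  qed
  define W where "W = (\<lambda>a b. \<eta> (vf_at (vf_bracket (dil t (U a)) (dil t (Y b))) p))"
  have W: "W a b = (\<Sum>i\<in>{1..N}. \<Sum>j\<in>{1..N}. t ^ (i + j) * \<eta> (vf_at (vf_bracket (U a i) (Y b j)) p))"
    if ab: "a < m" "b < m" for a b
  proof -
    have V: "vf_bracket (U a i) (Y b j) \<in> vector_fields M" for i j
      by (intro vf_bracket_closed FF_vf UF Y ab)
    have "W a b = \<eta> (vf_at (\<Sum>i\<in>{1..N}. 1 *\<^sub>R (\<Sum>j\<in>{1..N}. t ^ (i + j) *\<^sub>R vf_bracket (U a i) (Y b j))) p)"
      unfolding W_def bracket_dil[OF UF[OF ab(1)] Y(1)[OF ab(2)]] by simp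
    also have "\<dots> = (\<Sum>i\<in>{1..N}. 1 * \<eta> (vf_at (\<Sum>j\<in>{1..N}. t ^ (i + j) *\<^sub>R vf_bracket (U a i) (Y b j)) p))"
      by (intro cotangent_sum[OF p] subspace_sum[OF vf_subspace] subspace_scale[OF vf_subspace] V)
    also have "\<dots> = (\<Sum>i\<in>{1..N}. \<Sum>j\<in>{1..N}. t ^ (i + j) * \<eta> (vf_at (vf_bracket (U a i) (Y b j)) p))"
      by (simp add: cotangent_sum[OF p] V)
    finally show ?thesis .
  qed
  have \<delta>: "(if a = b then 1 else 0) = (\<Sum>i\<in>{1..N}. \<Sum>j\<in>{1..N}.
      if i + j \<le> N then \<xi> (cls (single (i + j) (vf_bracket (U a i) (Y b j)))) else 0)"
    if ab: "a < m" "b < m" for a b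
  proof -
    let ?S = "\<lambda>i j. if i + j \<le> N then single (i + j) (vf_bracket (U a i) (Y b j)) else 0"
    have S: "?S i j \<in> FF" if "i \<in> {1..N}" "j \<in> {1..N}" for i j
    proof (cases "i + j \<le> N")
      case True
      have "vf_bracket (U a i) (Y b j) \<in> F (i + j)"
        using that True by (intro F_bracket FF_F UF Y ab) auto
      then show ?thesis using True that by (auto intro!: single_FF)
    qed (simp add: subspace_0[OF FF_sub])
    have S': "(\<Sum>j\<in>{1..N}. 1 *\<^sub>R ?S i j) \<in> FF" if "i \<in> {1..N}" for i
      using S that by (intro subspace_sum[OF FF_sub] subspace_scale[OF FF_sub]) auto
    have "(if a = b then 1 else 0) = \<xi> (cls (\<Sum>i\<in>{1..N}. 1 *\<^sub>R (\<Sum>j\<in>{1..N}. 1 *\<^sub>R ?S i j)))"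
      using Y(2)[OF ab] unfolding br_single by simp
    also have "\<dots> = (\<Sum>i\<in>{1..N}. 1 * \<xi> (cls (\<Sum>j\<in>{1..N}. 1 *\<^sub>R ?S i j)))"
      by (rule dual_sum[OF \<xi>' S'])
    also have "\<dots> = (\<Sum>i\<in>{1..N}. 1 * (\<Sum>j\<in>{1..N}. 1 * \<xi> (cls (?S i j))))"
    proof (intro sum.cong refl arg_cong2[where f = times])
      fix i assume "i \<in> {1..N}"
      then show "\<xi> (cls (\<Sum>j\<in>{1..N}. 1 *\<^sub>R ?S i j)) = (\<Sum>j\<in>{1..N}. 1 * \<xi> (cls (?S i j)))"
        by (intro dual_sum[OF \<xi>' S])
    qed
    also have "\<dots> = (\<Sum>i\<in>{1..N}. \<Sum>j\<in>{1..N}.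
      if i + j \<le> N then \<xi> (cls (single (i + j) (vf_bracket (U a i) (Y b j)))) else 0)"
      unfolding mult_1 by (intro sum.cong refl) (simp add: dual_0[OF \<xi>'])
    finally show ?thesis .
  qed
  have Wnear: "\<bar>W a b - (if a = b then 1 else 0)\<bar> \<le> real N * (real N * (\<epsilon> * (C + 1)))" if ab: "a < m" "b < m" for a b
  proof -
    let ?f = "\<lambda>i j. t ^ (i + j) * \<eta> (vf_at (vf_bracket (U a i) (Y b j)) p)
      - (if i + j \<le> N then \<xi> (cls (single (i + j) (vf_bracket (U a i) (Y b j)))) else 0)"
    have "W a b - (if a = b then 1 else 0) = (\<Sum>i\<in>{1..N}. \<Sum>j\<in>{1..N}. ?f i j)"
      unfolding W[OF ab] \<delta>[OF ab] by (simp only: sum_subtractf)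
    then have "\<bar>W a b - (if a = b then 1 else 0)\<bar> = \<bar>\<Sum>i\<in>{1..N}. \<Sum>j\<in>{1..N}. ?f i j\<bar>" by (rule arg_cong)
    also have "\<dots> \<le> (\<Sum>i\<in>{1..N}. \<Sum>j\<in>{1..N}. \<bar>?f i j\<bar>)"
      by (rule order_trans[OF sum_abs]) (intro sum_mono sum_abs)
    also have "\<dots> \<le> (\<Sum>i\<in>{1..N}. \<Sum>j\<in>{1..N}. \<epsilon> * (C + 1))"
      by (intro sum_mono near[OF ab])
    finally show ?thesis by simp
  qed
  obtain c where c: "\<exists>a<m. c a \<noteq> 0" "\<forall>b<m. (\<Sum>a<m. c a * W a b) = 0"
    using bracket_form_rank[OF p, of "\<lambda>a. dil t (U a)" "\<lambda>b. dil t (Y b)"] dil_vf[OF UF] dil_vf[OF Y(1)]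
    unfolding W_def m_def by auto
  have "real m * (real N * (real N * (\<epsilon> * (C + 1)))) = \<epsilon> * (real m * (real N * (real N * (C + 1))))"
    by (simp add: mult_ac)
  also have "\<dots> < 1" unfolding \<epsilon>_def using den by simp
  finally have "\<forall>a<m. c a = 0"
    using near_identity_nonsingular[of m W "real N * (real N * (\<epsilon> * (C + 1)))" c] Wnear c(2) by blast
  then show False using c(1) by blast
qed

end

section \<open>Coadjoint orbits\<close>

context lie_rep
begin

text \<open>\<open>Exp g\<close> is the operator of \<open>Ad g\<close> on coordinates, where
  \<open>Ad g\<close> conjugates by the inverse of \<open>g\<close>. It therefore reverses products;
  passing to the dual restores their order.\<close>

definition Exp :: "'g \<Rightarrow> 'v endo" where
  "Exp g = fexp K (- \<rho> g)"

lemma Exp_scale: "g \<in> carrier L \<Longrightarrow> Exp (lscale L s g) = fexp K ((- s) *\<^sub>R \<rho> g)"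
  by (simp only: Exp_def rep scaleR_minus_left)

lemma Exp_scale_add:
  assumes "g \<in> carrier L"
  shows "Exp (lscale L (s + t) g) = Exp (lscale L s g) * Exp (lscale L t g)"
  unfolding Exp_scale[OF assms] using fexp_scale_add[OF assms, of "- s" "- t"] by simp

lemma Exp_scale_1: "g \<in> carrier L \<Longrightarrow> Exp (lscale L 1 g) = Exp g"
  unfolding Exp_scale unfolding Exp_def by simp

lemma Exp_scale_0: "g \<in> carrier L \<Longrightarrow> Exp (lscale L 0 g) = 1"
  unfolding Exp_scale by (simp only: minus_zero scaleR_zero_left fexp_0)

lemma Exp_inverse:
  assumes "g \<in> carrier L"
  shows "Exp (lscale L (- 1) g) * Exp g = 1" "Exp g * Exp (lscale L (- 1) g) = 1"
  using Exp_scale_add[OF assms, of "- 1" 1] Exp_scale_add[OF assms, of 1 "- 1"]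
  by (simp_all add: Exp_scale_1[OF assms] Exp_scale_0[OF assms])

lemma Exp_bch:
  assumes g: "g \<in> carrier L" and h: "h \<in> carrier L"
  shows "Exp (bch L N g h) = Exp h * Exp g"
proof -
  define a b c where "a = fexp K (\<rho> g)" and "b = fexp K (\<rho> h)" and "c = Exp (bch L N g h)"
  have 1: "c * (a * b) = 1"
    unfolding a_def b_def c_def Exp_def bch_rep[OF g h, symmetric] by (rule fexp_neg(1)[OF bch_closed(1)[OF g h]])
  have 2: "a * Exp g = 1" "b * Exp h = 1"
    unfolding a_def b_def Exp_def by (rule fexp_neg(2)[OF g], rule fexp_neg(2)[OF h])
  have "c = c * (a * (b * Exp h) * Exp g)" by (simp only: 2 mult_1_right)
  also have "\<dots> = c * (a * b) * (Exp h * Exp g)" by (simp only: mult.assoc)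
  finally show ?thesis unfolding 1 mult_1_left unfolding c_def .
qed

end

context unitriangular_action
begin

lemma word_act_0:
  assumes "set gs \<subseteq> G" "\<And>j. j < length gs \<Longrightarrow> y (i + j) = 0"
  shows "agree n (word_act i gs y w) w"
  using assms
proof (induction gs arbitrary: i)
  case (Cons g gs)
  have "y (Suc i + j) = 0" if "j < length gs" for j using Cons.prems(2)[of "Suc j"] that by simp
  then have "agree n (word_act (Suc i) gs y w) w" using Cons by auto
  moreover have "y i = 0" using Cons.prems(2)[of 0] by simp
  ultimately show ?case using pw(4) Cons.prems(1) by (simp add: agree_def)
qed (simp add: agree_refl)

text \<open>Along a coordinate axis all other letters act trivially, so a partial derivative at the
  origin is the velocity of a single one-parameter subgroup.\<close>

lemma word_act_single:
  assumes "set gs \<subseteq> G" "l < length gs" "\<And>j. j < length gs \<Longrightarrow> j \<noteq> l \<Longrightarrow> y (i + j) = 0"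
  shows "agree n (word_act i gs y w) (act (pw (gs ! l) (y (i + l))) w)"
  using assms
proof (induction gs arbitrary: i l)
  case (Cons g gs)
  have g: "g \<in> G" using Cons.prems(1) by simp
  show ?case
  proof (cases l)
    case 0
    have "y (Suc i + j) = 0" if "j < length gs" for j using Cons.prems(3)[of "Suc j"] that 0 by simp
    then have "agree n (word_act (Suc i) gs y w) w" using Cons.prems(1) by (intro word_act_0) auto
    then show ?thesis using 0 act_agree[OF pw(1)[OF g] order_refl] by simp
  next
    case (Suc l')
    have "y (Suc i + j) = 0" if "j < length gs" "j \<noteq> l'" for j
      using Cons.prems(3)[of "Suc j"] that Suc by simp
    then have "agree n (word_act (Suc i) gs y w) (act (pw (gs ! l') (y (Suc i + l'))) w)"
      using Cons.prems Suc by (intro Cons.IH) auto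
    moreover have "y i = 0" using Cons.prems(3)[of 0] Suc by simp
    ultimately show ?thesis using pw(4)[OF g] Suc by (simp add: agree_def)
  qed
qed simp

end

section \<open>The coadjoint action in coordinates\<close>

context filtered_basis
begin

lemma br_funpow_FF: "X \<in> FF \<Longrightarrow> Y \<in> FF \<Longrightarrow> (br X ^^ k) Y \<in> FF"
  by (induction k) (auto intro: br_closed)

lemma rep_br_funpow: "X \<in> FF \<Longrightarrow> Y \<in> FF \<Longrightarrow> rep ((br X ^^ k) Y) = app (adE (rep X) ^ k) (rep Y)"
  by (induction k) (simp_all add: rep_br br_funpow_FF)

lemma kappa_br_funpow: "X \<in> FF \<Longrightarrow> Y \<in> FF \<Longrightarrow> \<kappa> ((br X ^^ k) Y) = app (rep X ^ k) (\<kappa> Y)"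
  by (induction k) (simp_all add: app_rep_kappa[symmetric] br_funpow_FF)

lemma rep_sum: "(\<And>i. i \<in> I \<Longrightarrow> X i \<in> FF) \<Longrightarrow> rep (\<Sum>i\<in>I. c i *\<^sub>R X i) = (\<Sum>i\<in>I. c i *\<^sub>R rep (X i))"
proof (induction I rule: infinite_finite_induct)
  case (insert i I)
  have "(\<Sum>i\<in>I. c i *\<^sub>R X i) \<in> FF"
    using insert by (intro subspace_sum[OF FF_sub] subspace_scale[OF FF_sub]) auto
  then show ?case using insert by (simp add: rep_add rep_scale subspace_scale[OF FF_sub])
qed (simp_all add: rep_DF subspace_0[OF DD_sub])

text \<open>Both sides are the alternating exponential series in iterated brackets with the
  representative of \<open>g\<close>. The family \<open>A\<close> is that series, and faithfulness
  identifies its class with \<open>Ad g Y\<close>.\<close>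

lemma kappa_Ad:
  assumes g: "g \<in> carrier L" and Y: "Y \<in> carrier L"
  shows "\<kappa> (rp (Ad g Y)) = app (Exp g) (\<kappa> (rp Y))"
proof -
  define X W where "X = rp g" and "W = rp Y"
  have XW: "X \<in> FF" "W \<in> FF" using rp g Y by (auto simp: X_def W_def)
  define A where "A = (\<Sum>k<K. ((-1) ^ k / fact k) *\<^sub>R (br X ^^ k) W)"
  have A: "A \<in> FF"
    unfolding A_def by (intro subspace_sum[OF FF_sub] subspace_scale[OF FF_sub] br_funpow_FF XW)
  have "rep (rp (cls A)) = (\<Sum>k<K. ((-1) ^ k / fact k) *\<^sub>R app (adE (rep X) ^ k) (rep W))"
    unfolding rep_rp_cls[OF A] unfolding A_def
    by (subst rep_sum) (auto simp only: br_funpow_FF[OF XW] rep_br_funpow[OF XW])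
  also have "\<dots> = rep (rp (Ad g Y))"
    unfolding Ad(2)[OF g Y] conj_eq[OF g] X_def W_def ..
  finally have "Ad g Y = cls A"
    using A Ad(1)[OF g Y] by (intro rho_eqI) (auto simp: carrier_L)
  then have "\<kappa> (rp (Ad g Y)) = (\<Sum>k<K. ((-1) ^ k / fact k) *\<^sub>R app (rep X ^ k) (\<kappa> W))"
    unfolding kappa_rp_cls[OF A, symmetric]
    by (simp only: kappa_rp_cls[OF A]) (simp only: A_def kappa_sum kappa_scale kappa_br_funpow[OF XW])
  also have "\<dots> = app (Exp g) (\<kappa> W)"
  proof -
    have "(- rep X) ^ k = (-1) ^ k *\<^sub>R rep X ^ k" for k
      using scaleR_power_eq[of "-1" "rep X" k] by simp
    then show ?thesis unfolding Exp_def fexp_def' app_sum X_def[symmetric]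
      by (simp only: app_simps scaleR_scaleR) (simp add: mult.commute)
  qed
  finally show ?thesis unfolding W_def .
qed

definition unit_coord :: "nat \<Rightarrow> nat \<Rightarrow> real" where
  "unit_coord b = \<kappa> (es ! b)"

lemma rp_es: "b < n \<Longrightarrow> \<kappa> (rp (cls (es ! b))) = unit_coord b"
  by (simp add: kappa_rp_cls es_mem unit_coord_def)

lemma es_cls: "b < n \<Longrightarrow> cls (es ! b) \<in> carrier L"
  by (simp add: carrier_L es_mem)

definition pairing :: "(nat \<Rightarrow> real) \<Rightarrow> (nat \<Rightarrow> real) \<Rightarrow> real" where
  "pairing w f = (\<Sum>a<n. f a * w a)"

lemma pairing_linear: "pairing w (f + g) = pairing w f + pairing w g" "pairing w (c *\<^sub>R f) = c * pairing w f"
  "pairing w (\<Sum>i\<in>I. h i) = (\<Sum>i\<in>I. pairing w (h i))"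
proof -
  show 1: "pairing w (f + g) = pairing w f + pairing w g" for f g
    by (simp add: pairing_def vec_ops sum.distrib algebra_simps)
  show "pairing w (c *\<^sub>R f) = c * pairing w f"
    by (simp add: pairing_def scaleR_apply sum_distrib_left mult.assoc)
  have "pairing w 0 = 0" by (simp add: pairing_def vec_ops)
  then show "pairing w (\<Sum>i\<in>I. h i) = (\<Sum>i\<in>I. pairing w (h i))"
    by (induction I rule: infinite_finite_induct) (simp_all add: 1)
qed

lemma Exp_supported: "g \<in> carrier L \<Longrightarrow> W \<in> FF \<Longrightarrow> \<exists>V\<in>FF. app (Exp g) (\<kappa> W) = \<kappa> V"
  using kappa_Ad[of g "cls W"] rp[OF Ad(1)[of g "cls W"]] kappa_rp_cls[of W] unfolding carrier_L
  by (metis imageI)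

lemma unit_expansion:
  assumes "V \<in> FF" shows "\<kappa> V = (\<Sum>b<n. \<kappa> V b *\<^sub>R unit_coord b)"
proof -
  have "\<kappa> (V - lift (\<kappa> V)) = 0" using kappa_DF[OF lift_kappa[OF assms]] .
  then have "\<kappa> V = \<kappa> (lift (\<kappa> V))" by (simp add: kappa_diff)
  also have "\<dots> = (\<Sum>b<n. \<kappa> V b *\<^sub>R unit_coord b)"
    by (simp add: lift_def kappa_sum kappa_scale unit_coord_def)
  finally show ?thesis .
qed

text \<open>The transpose of \<open>Exp g\<close>: the coadjoint action on functionals given by
  their values \<open>w\<close> on the basis \<open>es\<close>.\<close>

definition act :: "'a gr_vector \<Rightarrow> (nat \<Rightarrow> real) \<Rightarrow> nat \<Rightarrow> real" where
  "act g w b = pairing w (app (Exp g) (unit_coord b))"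

lemma pairing_act:
  assumes g: "g \<in> carrier L" and V: "V \<in> FF"
  shows "pairing (act g w) (\<kappa> V) = pairing w (app (Exp g) (\<kappa> V))"
proof -
  have "app (Exp g) (\<kappa> V) = (\<Sum>b<n. \<kappa> V b *\<^sub>R app (Exp g) (unit_coord b))"
    by (subst unit_expansion[OF V]) (simp add: linear_sum[OF linear_app])
  then have "pairing w (app (Exp g) (\<kappa> V)) = (\<Sum>b<n. \<kappa> V b * act g w b)"
    by (simp add: pairing_linear act_def)
  then show ?thesis by (simp add: pairing_def)
qed

lemma act_act:
  assumes g: "g \<in> carrier L" and h: "h \<in> carrier L" and b: "b < n"
  shows "act g (act h w) b = pairing w (app (Exp h * Exp g) (unit_coord b))"
proof -
  obtain V where V: "V \<in> FF" "app (Exp g) (unit_coord b) = \<kappa> V"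
    using Exp_supported[OF g es_mem[OF b]] unfolding unit_coord_def by blast
  show ?thesis unfolding act_def[of g] V(2) pairing_act[OF h V(1)] by (simp add: V(2))
qed

lemma pairing_unit: "b < n \<Longrightarrow> pairing w (unit_coord b) = w b"
proof -
  assume b: "b < n"
  have "pairing w (unit_coord b) = (\<Sum>a<n. if a = b then w b else 0)"
    unfolding pairing_def unit_coord_def using b by (intro sum.cong) (auto simp: kappa_es)
  then show ?thesis using b by simp
qed

text \<open>By the flag property every bracket with a basis vector lowers the index strictly, so
  from index \<open>b\<close> upwards only the constant term of the exponential is seen.\<close>

lemma Exp_unit_coord:
  assumes g: "g \<in> carrier L" and b: "b < n" and a: "b \<le> a"
  shows "app (Exp g) (unit_coord b) a = (if a = b then 1 else 0)"
proof -
  define X where "X = rp g"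
  have X: "X \<in> FF" using rp g by (simp add: X_def)
  have z: "\<kappa> ((br X ^^ Suc k) (es ! b)) c = 0" if "b \<le> c" for k c
    using that
  proof (induction k arbitrary: c)
    case 0
    then show ?case using kappa_flag[OF flag[OF X b]] by simp
  next
    case (Suc k)
    have "(br X ^^ Suc k) (es ! b) \<in> FF" by (rule br_funpow_FF[OF X es_mem[OF b]])
    from kappa_br_flag[OF X this Suc.IH Suc.prems] show ?case by simp
  qed
  have "app (Exp g) (unit_coord b) a = (\<Sum>k<K. (1 / fact k) *\<^sub>R app ((- rep X) ^ k) (unit_coord b)) a"
    unfolding Exp_def fexp_def' app_sum X_def[symmetric] by (simp only: app_simps)
  also have "\<dots> = (\<Sum>k<K. (1 / fact k * (-1) ^ k) * \<kappa> ((br X ^^ k) (es ! b)) a)"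
    unfolding sum_fun_apply
  proof (intro sum.cong refl)
    fix k
    have "(- rep X) ^ k = (-1) ^ k *\<^sub>R rep X ^ k"
      using scaleR_power_eq[of "-1" "rep X" k] by simp
    then show "((1 / fact k) *\<^sub>R app ((- rep X) ^ k) (unit_coord b)) a
      = (1 / fact k * (-1) ^ k) * \<kappa> ((br X ^^ k) (es ! b)) a"
      by (simp only: app_simps scaleR_apply kappa_br_funpow[OF X es_mem[OF b]] unit_coord_def) simp
  qed
  also have "\<dots> = (\<Sum>k<K. if k = 0 then \<kappa> (es ! b) a else 0)"
  proof (intro sum.cong refl)
    fix k show "(1 / fact k * (-1) ^ k) * \<kappa> ((br X ^^ k) (es ! b)) a = (if k = 0 then \<kappa> (es ! b) a else 0)"
      using z[OF a] by (cases k) auto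
  qed
  also have "\<dots> = (if a = b then 1 else 0)" using b by (simp add: kappa_es)
  finally show ?thesis .
qed

lemma act_pw_poly:
  assumes g: "g \<in> carrier L"
  shows "app (Exp (lscale L s g)) f a
    = poly (\<Sum>k<K. monom ((-1) ^ k / fact k * app (rep (rp g) ^ k) f a) k) s"
proof -
  have "app (Exp (lscale L s g)) f a = (\<Sum>k<K. (1 / fact k) *\<^sub>R app (((- s) *\<^sub>R rep (rp g)) ^ k) f) a"
    unfolding Exp_scale[OF g] fexp_def' app_sum by (simp only: app_simps)
  also have "\<dots> = (\<Sum>k<K. (-1) ^ k / fact k * app (rep (rp g) ^ k) f a * s ^ k)"
    unfolding sum_fun_apply
  proof (intro sum.cong refl)
    fix k
    show "((1 / fact k) *\<^sub>R app (((- s) *\<^sub>R rep (rp g)) ^ k) f) a = (-1) ^ k / fact k * app (rep (rp g) ^ k) f a * s ^ k"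
      unfolding scaleR_power_eq app_simps scaleR_apply power_minus[of s] by simp
  qed
  finally show ?thesis by (simp only: poly_sum poly_monom)
qed

sublocale coad: unitriangular_action "carrier L" n act "\<lambda>g s. lscale L s g" "\<lambda>g b a. app (Exp g) (unit_coord b) a"
proof
  fix g w b assume g: "g \<in> carrier L" and b: "b < n"
  have "act g w b = (\<Sum>a<Suc b. app (Exp g) (unit_coord b) a * w a)"
    unfolding act_def pairing_def using b Exp_unit_coord[OF g b] by (intro sum.mono_neutral_right) auto
  then show "act g w b = w b + (\<Sum>a<b. app (Exp g) (unit_coord b) a * w a)"
    using Exp_unit_coord[OF g b] by simp
  show "act (lscale L (s + t) g) w b = act (lscale L s g) (act (lscale L t g) w) b" for s t
    by (simp only: act_act[OF closed(3)[OF g] closed(3)[OF g] b])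
      (simp only: act_def Exp_scale_add[OF g, symmetric] add.commute)
  show "act (lscale L 1 g) w b = act g w b" unfolding act_def Exp_scale_1[OF g] ..
  show "act (lscale L 0 g) w b = w b" unfolding act_def Exp_scale_0[OF g] by (simp add: pairing_unit[OF b])
next
  fix g b a assume "g \<in> carrier L"
  from act_pw_poly[OF this]
  show "\<exists>p. \<forall>s. app (Exp (lscale L s g)) (unit_coord b) a = poly p s" by blast
next
  fix g h assume gh: "g \<in> carrier L" "h \<in> carrier L"
  show "\<exists>k\<in>carrier L. \<forall>w. \<forall>b<n. act k w b = act g (act h w) b"
    using bch_closed(1)[OF gh(1) gh(2)] bch_closed(1)[OF gh(2) gh(1)]
    by (intro bexI[of _ "bch L N g h"]) (simp_all add: act_act gh, simp add: act_def Exp_bch gh)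
next
  fix g assume g: "g \<in> carrier L"
  show "\<exists>h\<in>carrier L. \<forall>w. \<forall>b<n. act h (act g w) b = w b \<and> act g (act h w) b = w b"
    by (intro bexI[of _ "lscale L (-1) g"] allI impI conjI)
      (simp_all only: act_act[OF g closed(3)[OF g]] act_act[OF closed(3)[OF g] g] Exp_inverse[OF g]
        app_simps pairing_unit closed(3)[OF g])
qed (rule closed(3))

end

section \<open>Manifolds with a single global chart\<close>

lemma second_countable_euclidean: "second_countable (euclidean :: 'b::second_countable_topology topology)"
proof -
  obtain \<B> :: "'b set set" where B: "countable \<B>" "topological_basis \<B>" using ex_countable_basis by blast
  then show ?thesis unfolding second_countable_def topological_basis_def
    by (intro exI[of _ \<B>]) (metis B(2) open_openin topological_basisE topological_basis_open)
qed

text \<open>The orbit is given as a mere set of functionals; its topology is the one that makes the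
  parametrisation a homeomorphism.\<close>

definition chart_manifold :: "'b set \<Rightarrow> nat \<Rightarrow> ('b \<Rightarrow> nat \<Rightarrow> real) \<Rightarrow> 'b manifold" where
  "chart_manifold S k \<phi> =
    \<lparr>mtop = pullback_topology S \<phi> (Euclidean_space k), mdim = k, matlas = {(S, \<phi>)}\<rparr>"

lemma smooth_chart_manifold:
  assumes \<phi>: "bij_betw \<phi> S (ESp k)"
  shows "smooth_manifold (chart_manifold S k \<phi>)" "mpoints (chart_manifold S k \<phi>) = S"
proof -
  let ?E = "Euclidean_space k" and ?P = "pullback_topology S \<phi> (Euclidean_space k)"
  have im: "\<phi> ` S = topspace ?E" and inj: "inj_on \<phi> S" using \<phi> by (auto simp: bij_betw_def Euclidean_space_top)
  have top: "topspace ?P = S" unfolding topspace_pullback_topology using im by auto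
  then show "mpoints (chart_manifold S k \<phi>) = S" by (simp add: chart_manifold_def)
  have open_img: "openin ?E (\<phi> ` V)" if V: "openin ?P V" for V
  proof -
    obtain U where U: "openin ?E U" "V = \<phi> -` U \<inter> S" using V unfolding openin_pullback_topology by blast
    then have "\<phi> ` V = U \<inter> topspace ?E" unfolding im[symmetric] by auto
    then show ?thesis using U(1) by (simp add: openin_Int)
  qed
  have hom: "homeomorphic_map ?P ?E \<phi>"
  proof (rule bijective_open_imp_homeomorphic_map)
    show "continuous_map ?P ?E \<phi>"
      unfolding continuous_map_def top using im by (auto simp: openin_pullback_topology)
    show "open_map ?P ?E \<phi>" unfolding open_map_def using open_img by blast
  qed (use top im inj in auto)
  then have sp: "?P homeomorphic_space ?E" by (rule homeomorphic_map_imp_homeomorphic_space)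
  have "Hausdorff_space ?E" "second_countable ?E"
    unfolding Euclidean_space_top
    by (auto intro: Hausdorff_space_subtopology second_countable_subtopology second_countable_euclidean)
  then have "Hausdorff_space ?P" "second_countable ?P"
    using homeomorphic_Hausdorff_space[OF sp] homeomorphic_space_second_countability[OF sp] by simp_all
  moreover have "homeomorphic_map (subtopology ?P S) (subtopology ?E (\<phi> ` S)) \<phi>"
    using hom im top by (metis subtopology_topspace)
  moreover have "smooth_on k (\<phi> ` S) (\<lambda>y. \<phi> (inv_into S \<phi> y) i)" for i
  proof -
    have E: "openin ?E (\<phi> ` S)" unfolding im by simp
    then show ?thesis unfolding smooth_on_iff_ck
      using ck_cong[OF E ck_coord[OF E]] by (auto simp: f_inv_into_f)
  qed
  moreover have "openin ?P S" "openin ?E (\<phi> ` S)"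
    using openin_topspace[of ?P] openin_topspace[of ?E] unfolding top im .
  ultimately show "smooth_manifold (chart_manifold S k \<phi>)"
    unfolding smooth_manifold_def chart_manifold_def by (simp add: top)
qed

section \<open>The orbit as an immersed submanifold and its dimension\<close>

context filtered_basis
begin

lemma dual_pairing:
  assumes \<xi>: "\<xi> \<in> lie_dual L" and W: "W \<in> FF"
  shows "\<xi> (cls W) = pairing (\<lambda>b. \<xi> (cls (es ! b))) (\<kappa> W)"
proof -
  have "cls W = cls (lift (\<kappa> W))" using cls_eq_iff[OF W lift_FF] lift_kappa[OF W] by simp
  then show ?thesis
    unfolding lift_def pairing_def using dual_sum[OF \<xi>, of "{..<n}" "\<lambda>a. es ! a"] es_mem by simp
qed

definition functional :: "(nat \<Rightarrow> real) \<Rightarrow> 'a gr_vector \<Rightarrow> real" where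
  "functional w Y = (if Y \<in> carrier L then pairing w (\<kappa> (rp Y)) else 0)"

lemma functional_dual: "functional w \<in> lie_dual L"
proof -
  have "functional w (ladd L (lscale L a u) (lscale L b v)) = a * functional w u + b * functional w v"
    if uv: "u \<in> carrier L" "v \<in> carrier L" for a b u v
  proof -
    obtain X Y where XY: "X \<in> FF" "Y \<in> FF" "u = cls X" "v = cls Y" using uv unfolding carrier_L by blast
    have Z: "a *\<^sub>R X + b *\<^sub>R Y \<in> FF" using XY by (intro subspace_add[OF FF_sub] subspace_scale[OF FF_sub])
    have eq: "ladd L (lscale L a u) (lscale L b v) = cls (a *\<^sub>R X + b *\<^sub>R Y)"
      using XY by (simp add: lscale_cls ladd_cls subspace_scale[OF FF_sub])
    have "cls (a *\<^sub>R X + b *\<^sub>R Y) \<in> carrier L" using Z by (simp add: carrier_L)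
    then show ?thesis unfolding eq unfolding XY(3,4)
      using XY by (simp add: functional_def kappa_rp_cls Z kappa_add kappa_scale pairing_linear carrier_L)
  qed
  then show ?thesis by (auto simp: lie_dual_def functional_def)
qed

lemma functional_es: "b < n \<Longrightarrow> functional w (cls (es ! b)) = w b"
  by (simp add: functional_def es_cls rp_es pairing_unit)

lemma functional_agree: "functional w = functional w' \<longleftrightarrow> coad.agree n w w'"
proof
  assume "functional w = functional w'"
  then show "coad.agree n w w'" unfolding coad.agree_def by (metis functional_es)
next
  assume "coad.agree n w w'"
  then have "pairing w = pairing w'" by (auto simp: coad.agree_def pairing_def fun_eq_iff intro!: sum.cong)
  then show "functional w = functional w'" by (simp add: functional_def fun_eq_iff)
qed

lemma coadjoint_functional:
  assumes \<xi>: "\<xi> \<in> lie_dual L" and g: "g \<in> carrier L"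
  shows "coadjoint L N g \<xi> = functional (act g (\<lambda>b. \<xi> (cls (es ! b))))"
proof
  fix Y
  show "coadjoint L N g \<xi> Y = functional (act g (\<lambda>b. \<xi> (cls (es ! b)))) Y"
  proof (cases "Y \<in> carrier L")
    case True
    have "rp (Ad g Y) \<in> FF" "cls (rp (Ad g Y)) = Ad g Y" using rp[OF Ad(1)[OF g True]] by auto
    then have "\<xi> (Ad g Y) = pairing (\<lambda>b. \<xi> (cls (es ! b))) (app (Exp g) (\<kappa> (rp Y)))"
      using dual_pairing[OF \<xi>, of "rp (Ad g Y)"] kappa_Ad[OF g True] by simp
    also have "\<dots> = pairing (act g (\<lambda>b. \<xi> (cls (es ! b)))) (\<kappa> (rp Y))"
      using rp[OF True] pairing_act[OF g] by simp
    finally show ?thesis using True by (simp add: coadjoint_Ad[OF \<xi> g] functional_def)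
  qed (simp add: coadjoint_Ad[OF \<xi> g] functional_def)
qed

text \<open>The infinitesimal coadjoint action: along a one-parameter subgroup the action is
  polynomial, and its linear coefficient is read off. The sign comes from the inverse in
  \<open>Exp\<close>.\<close>

lemma act_derivative:
  assumes \<xi>: "\<xi> \<in> lie_dual L" and g: "g \<in> carrier L" and b: "b < n"
  shows "deriv (\<lambda>t. act (lscale L t g) (\<lambda>b. \<xi> (cls (es ! b))) b) 0 = - \<xi> (cls (br (rp g) (es ! b)))"
proof -
  define v where "v = (\<lambda>b. \<xi> (cls (es ! b)))"
  define X where "X = rp g"
  have X: "X \<in> FF" using rp[OF g] by (simp add: X_def)
  define p where "p = (\<Sum>a<n. smult (v a) (\<Sum>k<K. monom ((-1) ^ k / fact k * app (rep X ^ k) (unit_coord b) a) k))"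
  have "(\<lambda>t. act (lscale L t g) v b) = poly p"
    by (rule ext) (simp only: p_def act_def pairing_def act_pw_poly[OF g] X_def poly_sum poly_smult mult.commute)
  then have "deriv (\<lambda>t. act (lscale L t g) v b) 0 = poly (pderiv p) 0"
    by (simp only: DERIV_imp_deriv[OF poly_DERIV])
  also have "\<dots> = coeff p 1" by (simp add: poly_0_coeff_0 coeff_pderiv)
  also have "\<dots> = (\<Sum>a<n. v a * (\<Sum>k<K. if k = 1 then (-1) ^ k / fact k * app (rep X ^ k) (unit_coord b) a else 0))"
    unfolding p_def coeff_sum coeff_smult coeff_monom ..
  also have "\<dots> = (\<Sum>a<n. v a * (- app (rep X) (unit_coord b) a))"
    by (simp only: sum.delta[OF finite_lessThan]) simp
  also have "\<dots> = - pairing v (app (rep X) (unit_coord b))"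
    by (simp add: pairing_def sum_negf mult.commute)
  also have "app (rep X) (unit_coord b) = \<kappa> (br X (es ! b))"
    unfolding unit_coord_def by (rule app_rep_kappa[OF X es_mem[OF b]])
  also have "pairing v (\<kappa> (br X (es ! b))) = \<xi> (cls (br X (es ! b)))"
    unfolding v_def by (rule dual_pairing[OF \<xi> br_closed[OF X es_mem[OF b]], symmetric])
  finally show ?thesis unfolding v_def X_def .
qed

text \<open>At the origin the columns of the Jacobian are the functionals \<open>\<xi>\<close> of
  the bracket with a letter of the word, up to sign. Among \<open>2 * d + 1\<close> letters
  \<open>characteristic_rank\<close> provides a linear relation, contradicting immersivity.\<close>

lemma orbit_dimension:
  assumes \<xi>: "\<xi> \<in> characteristic_set M N F x"
    and gs: "coad.orbit_chart (\<lambda>b. \<xi> (cls (es ! b))) n gs"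
  shows "length gs \<le> 2 * d"
proof (rule ccontr)
  define v where "v = (\<lambda>b. \<xi> (cls (es ! b)))"
  have \<xi>': "\<xi> \<in> lie_dual L" using \<xi> by (simp add: characteristic_set_def)
  have gsL: "set gs \<subseteq> carrier L"
    and imm: "\<And>y c. (\<And>b. b < n \<Longrightarrow>
      (\<Sum>i<length gs. c i * partial_deriv i (\<lambda>y. coad.word_act 0 gs y v b) y) = 0) \<Longrightarrow> \<forall>i<length gs. c i = 0"
    using gs unfolding coad.orbit_chart_def v_def[symmetric] by blast+
  assume "\<not> length gs \<le> 2 * d"
  then have le: "2 * d + 1 \<le> length gs" by simp
  have gL: "gs ! i \<in> carrier L" if "i < length gs" for i using gsL that nth_mem by blast
  have "rp (gs ! a) \<in> FF" if "a < 2 * d + 1" for a using rp[OF gL] that le by simp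
  from characteristic_rank[OF \<xi>, of "\<lambda>a. rp (gs ! a)", OF this]
  obtain c where c: "\<exists>a<2 * d + 1. c a \<noteq> 0"
    "\<And>Y. Y \<in> FF \<Longrightarrow> (\<Sum>a<2 * d + 1. c a * \<xi> (cls (br (rp (gs ! a)) Y))) = 0" by blast
  define c' where "c' = (\<lambda>i. if i < 2 * d + 1 then c i else 0)"
  have pd: "partial_deriv i (\<lambda>y. coad.word_act 0 gs y v b) (\<lambda>_. 0) = - \<xi> (cls (br (rp (gs ! i)) (es ! b)))"
    if i: "i < length gs" and b: "b < n" for i b
  proof -
    have "coad.word_act 0 gs ((\<lambda>_. 0)(i := t)) v b = act (lscale L t (gs ! i)) v b" for t
      using coad.word_act_single[OF gsL i, of "(\<lambda>_. 0)(i := t)" 0 v] b by (simp add: coad.agree_def)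
    then show ?thesis
      unfolding partial_deriv_def by (simp only: v_def act_derivative[OF \<xi>' gL[OF i] b])
  qed
  have "(\<Sum>i<length gs. c' i * partial_deriv i (\<lambda>y. coad.word_act 0 gs y v b) (\<lambda>_. 0)) = 0" if b: "b < n" for b
  proof -
    have "(\<Sum>i<length gs. c' i * partial_deriv i (\<lambda>y. coad.word_act 0 gs y v b) (\<lambda>_. 0))
      = (\<Sum>i<length gs. c' i * - \<xi> (cls (br (rp (gs ! i)) (es ! b))))"
      by (intro sum.cong refl) (simp only: lessThan_iff pd[OF _ b])
    also have "\<dots> = (\<Sum>i<2 * d + 1. c' i * - \<xi> (cls (br (rp (gs ! i)) (es ! b))))"
      using le by (intro sum.mono_neutral_right) (auto simp: c'_def)
    also have "\<dots> = - (\<Sum>i<2 * d + 1. c i * \<xi> (cls (br (rp (gs ! i)) (es ! b))))"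
      unfolding sum_negf[symmetric] by (intro sum.cong) (auto simp: c'_def)
    finally show ?thesis unfolding c(2)[OF es_mem[OF b]] by simp
  qed
  from imm[OF this] have "\<forall>i<length gs. c' i = 0" .
  then have "c a = 0" if "a < 2 * d + 1" for a using that le by (metis c'_def less_le_trans)
  then show False using c(1) by blast
qed

text \<open>The polynomial map \<open>\<psi>\<close> is a bijection from Euclidean space onto the
  orbit, and its inverse is the chart. Immersivity is tested on the basis classes
  \<open>cls (es ! b)\<close>, where \<open>functional\<close> returns the coordinates
  themselves.\<close>

lemma orbit_immersed:
  assumes \<xi>: "\<xi> \<in> lie_dual L" and gs: "coad.orbit_chart (\<lambda>b. \<xi> (cls (es ! b))) n gs"
  shows "immersed_submanifold L (coadjoint_orbit L N \<xi>) (length gs)"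
proof -
  define v where "v = (\<lambda>b. \<xi> (cls (es ! b)))"
  define k where "k = length gs"
  define \<psi> where "\<psi> = (\<lambda>y. functional (coad.word_act 0 gs y v))"
  define S where "S = coadjoint_orbit L N \<xi>"
  have gsL: "set gs \<subseteq> carrier L"
    and ex: "\<And>h. h \<in> carrier L \<Longrightarrow> \<exists>y\<in>ESp k. coad.agree n (act h v) (coad.word_act 0 gs y v)"
    and un: "\<And>y y'. y \<in> ESp k \<Longrightarrow> y' \<in> ESp k \<Longrightarrow>
      coad.agree n (coad.word_act 0 gs y v) (coad.word_act 0 gs y' v) \<Longrightarrow> y = y'"
    and imm: "\<And>y c. (\<And>b. b < n \<Longrightarrow>
      (\<Sum>i<k. c i * partial_deriv i (\<lambda>y. coad.word_act 0 gs y v b) y) = 0) \<Longrightarrow> \<forall>i<k. c i = 0"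
    using gs unfolding coad.orbit_chart_def v_def[symmetric] k_def[symmetric] by blast+
  have S: "S = (\<lambda>g. functional (act g v)) ` carrier L"
    unfolding S_def coadjoint_orbit_def bch_group_def using coadjoint_functional[OF \<xi>] by (auto simp: v_def)
  have "\<psi> ` ESp k = S"
  proof (intro equalityI subsetI)
    fix f assume "f \<in> \<psi> ` ESp k"
    then obtain y where f: "f = functional (coad.word_act 0 gs y v)" by (auto simp: \<psi>_def)
    obtain u where "u \<in> carrier L" "coad.agree n (act u v) (coad.word_act 0 gs y v)"
      using coad.word_act_in[OF closed(1) gsL] by blast
    then show "f \<in> S" unfolding S f by (metis functional_agree image_eqI)
  next
    fix f assume "f \<in> S"
    then obtain h where h: "h \<in> carrier L" "f = functional (act h v)" by (auto simp: S)
    obtain y where y: "y \<in> ESp k" "coad.agree n (act h v) (coad.word_act 0 gs y v)" using ex[OF h(1)] ..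
    have "f = \<psi> y" unfolding h(2) \<psi>_def using y(2) by (rule functional_agree[THEN iffD2])
    then show "f \<in> \<psi> ` ESp k" using y(1) by (rule image_eqI)
  qed
  moreover have inj: "inj_on \<psi> (ESp k)"
    using un unfolding inj_on_def \<psi>_def functional_agree by blast
  ultimately have \<psi>: "bij_betw \<psi> (ESp k) S" by (simp add: bij_betw_def)
  define \<phi> where "\<phi> = inv_into (ESp k) \<psi>"
  have \<phi>: "bij_betw \<phi> S (ESp k)" unfolding \<phi>_def by (rule bij_betw_inv_into[OF \<psi>])
  have im: "\<phi> ` S = ESp k" using \<phi> by (simp add: bij_betw_def)
  have inv: "inv_into S \<phi> y = \<psi> y" if y: "y \<in> ESp k" for y
  proof (rule inv_into_f_eq[OF bij_betw_imp_inj_on[OF \<phi>]])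
    show "\<psi> y \<in> S" using \<psi> y by (auto simp: bij_betw_def)
    show "\<phi> (\<psi> y) = y" unfolding \<phi>_def by (rule inv_into_f_f[OF inj y])
  qed
  have E: "openin (Euclidean_space k) (ESp k)" unfolding Euclidean_space_top by simp
  have smooth: "smooth_on k (\<phi> ` S) (\<lambda>y. inv_into S \<phi> y Y)" if Y: "Y \<in> carrier L" for Y
    unfolding im smooth_on_iff_ck
  proof (intro conjI allI E)
    fix r
    have "ck k (ESp k) r (\<lambda>y. \<Sum>a<n. \<kappa> (rp Y) a * coad.word_act 0 gs y v a)"
      by (intro ck_sum[OF E] ck_mult[OF E] ck_const[OF E] coad.ck_word_act[OF E gsL]) simp
    then show "ck k (ESp k) r (\<lambda>y. inv_into S \<phi> y Y)"
      by (rule ck_cong[OF E]) (simp only: inv \<psi>_def functional_def Y if_True pairing_def)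
  qed
  have immersion: "\<forall>i<k. c i = 0"
    if y: "y \<in> ESp k" and c: "\<forall>Y\<in>carrier L. (\<Sum>i<k. c i * partial_deriv i (\<lambda>z. inv_into S \<phi> z Y) y) = 0" for y c
  proof (rule imm)
    fix b assume b: "b < n"
    have "partial_deriv i (\<lambda>z. inv_into S \<phi> z (cls (es ! b))) y
      = partial_deriv i (\<lambda>y. coad.word_act 0 gs y v b) y" if i: "i < k" for i
    proof -
      have "y(i := t) \<in> ESp k" for t using y i by simp
      then show ?thesis unfolding partial_deriv_def by (simp only: inv \<psi>_def functional_es[OF b])
    qed
    then show "(\<Sum>i<k. c i * partial_deriv i (\<lambda>y. coad.word_act 0 gs y v b) y) = 0"
      using c[rule_format, OF es_cls[OF b]] by simp
  qed
  have "S \<subseteq> lie_dual L" unfolding S using functional_dual by auto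
  moreover have "mdim (chart_manifold S k \<phi>) = k" "matlas (chart_manifold S k \<phi>) = {(S, \<phi>)}"
    by (simp_all add: chart_manifold_def)
  moreover have "\<forall>y\<in>\<phi> ` S. \<forall>c. (\<forall>Y\<in>carrier L. (\<Sum>i<k. c i * partial_deriv i (\<lambda>z. inv_into S \<phi> z Y) y) = 0)
      \<longrightarrow> (\<forall>i<k. c i = 0)"
    unfolding im using immersion by blast
  ultimately show ?thesis
    unfolding immersed_submanifold_def S_def[symmetric] k_def[symmetric]
    using smooth_chart_manifold[OF \<phi>] smooth
    by (intro conjI exI[of _ "chart_manifold S k \<phi>"]) simp_all
qed

end

theorem theoremB:
  fixes M :: "'a manifold" and N :: nat and F :: "nat \<Rightarrow> 'a vfield set"
    and x :: 'a and \<xi> :: "'a gr_vector \<Rightarrow> real"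
  assumes "closed_manifold M"
    and "filtration M N F"
    and "x \<in> mpoints M"
    and "\<xi> \<in> characteristic_set M N F x"
  shows "\<exists>k. immersed_submanifold (gr_lie M N F x) (coadjoint_orbit (gr_lie M N F x) N \<xi>) k
             \<and> k \<le> 2 * mdim M"
proof -
  interpret filtered_mfd M N F x
    using assms(1-3) by unfold_locales (simp_all add: closed_manifold_def)
  obtain es \<kappa> where basis: "filtered_basis M N F x es \<kappa>"
    by (rule graded_basis)
      (rule that, rule filtered_basis.intro[OF filtered_mfd_axioms filtered_basis_axioms.intro])
  then interpret filtered_basis M N F x es \<kappa> .
  have "\<xi> \<in> lie_dual L" using assms(4) by (simp add: characteristic_set_def)
  moreover obtain gs where "coad.orbit_chart (\<lambda>b. \<xi> (cls (es ! b))) n gs"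
    using coad.orbit_parametrization[OF closed(1) order_refl] by blast
  ultimately show ?thesis using orbit_immersed orbit_dimension[OF assms(4)] by blast
qed

end
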